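(* Let $G\curvearrowright \widetilde{X}$ be a virtually special action of a group $G$ on a CAT(0) cube complex $\widetilde{X}$, let $n\geq 1$, and let $K_1,K_2,\dots,K_n<G$ be convex-cocompact subgroups. Then the product $K_1K_2\cdots K_n=\{k_1k_2\cdots k_n\mid k_i\in K_i\}$ is separable in $G$.
   Context: Cube complexes are connected (not assumed finite-dimensional or locally finite), and actions on cube complexes are by cubical automorphisms. A CAT(0) cube complex is a simply connected non-positively curved cube complex. A local isometry $\phi:Y\to X$ of non-positively curved cube complexes is a combinatorial map such that each induced map on links of vertices $\mathrm{link}(y)\to\mathrm{link}(\phi(y))$ is an embedding with image a full subcomplex (a subcomplex $C$ of a simplicial complex $D$ is full if any simplex of $D$ whose vertices are in $C$ is contained in $C$). A subcomplex of a CAT(0) cube complex is convex if its inclusion is a local isometry (equivalently, it is connected and convex in the combinatorial or CAT(0) metric). For a simplicial graph $\Gamma$ (possibly infinite), $A_\Gamma=\langle V\Gamma\mid [u,v]: (u,v)\in E\Gamma\rangle$ is the right-angled Artin group, and the Salvetti complex $X_\Gamma$ is the non-positively curved cube complex with a single vertex, one oriented edge labelled $v$ for each $v\in V\Gamma$, and one $n$-cube (an $n$-torus after gluing) for each complete subgraph of $\Gamma$ on $n$ vertices $v_1,\dots,v_n$, whose parallelism classes of edges are labelled $v_1,\dots,v_n$. A non-positively curved cube complex is special if it admits a local isometry to some Salvetti complex $X_\Gamma$. An action $G\curvearrowright\widetilde{X}$ on a CAT(0) cube complex is virtually special if there is a finite-index subgroup $G'<G$ acting freely on $\widetilde{X}$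 such that the quotient $\widetilde{X}/G'$ is a special cube complex. A convex-cocompact subgroup of $G$ is a subgroup that stabilizes and acts cocompactly on a (non-empty) convex subcomplex of $\widetilde{X}$. A subset $S$ of a group $G$ is separable if for any $g\in G-S$ there is a homomorphism $\phi:G\to F$ to a finite group $F$ with $\phi(g)\notin\phi(S)$. *)

theory Defs
  imports "HOL-Analysis.Analysis" "HOL-Algebra.Group_Action"
begin

section \<open>Cube complexes\<close>

text \<open>
  A cube complex is a CW complex glued from unit cubes along faces by isometries.  It is recorded
  by its parametrised cubes: the characteristic maps of its cells, precomposed with arbitrary
  isometries of the cube, so that an unparametrised n-cube accounts for 2^n n! elements of
  \<open>cubes X n\<close> (a vertex for one, an edge for two: its two orientations).  Restricting a
  parametrised cube along an isometric embedding of a cube as a face of another one gives a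
  parametrised cube.

  Such an embedding of the m-cube in the n-cube is a list of length n, whose i-th entry is the i-th
  coordinate of the image of the point \<open>t\<close>: it is 0 or 1 (\<open>Fixed False\<close>, \<open>Fixed True\<close>),
  \<open>t j\<close> (\<open>Coord j False\<close>) or \<open>1 - t j\<close> (\<open>Coord j True\<close>), where every \<open>j < m\<close> occurs exactly once.
\<close>

datatype coord = Fixed bool | Coord nat bool

definition vars :: "coord list \<Rightarrow> nat list" where
  "vars f = concat (map (\<lambda>a. case a of Fixed _ \<Rightarrow> [] | Coord j _ \<Rightarrow> [j]) f)"

definition faces :: "nat \<Rightarrow> nat \<Rightarrow> coord list set" where
  "faces m n = {f. length f = n \<and> distinct (vars f) \<and> set (vars f) = {..<m}}"

definition id_face :: "nat \<Rightarrow> coord list" where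
  "id_face n = map (\<lambda>j. Coord j False) [0..<n]"

fun flip :: "bool \<Rightarrow> coord \<Rightarrow> coord" where
  "flip b (Fixed c) = Fixed (c \<noteq> b)"
| "flip b (Coord j c) = Coord j (c \<noteq> b)"

fun subst_coord :: "coord list \<Rightarrow> coord \<Rightarrow> coord" where
  "subst_coord g (Fixed b) = Fixed b"
| "subst_coord g (Coord j b) = flip b (g ! j)"

text \<open>The composite \<open>f \<circ> g\<close> of embeddings; see \<open>place_face_comp\<close> below.\<close>

definition face_comp :: "coord list \<Rightarrow> coord list \<Rightarrow> coord list" where
  "face_comp f g = map (subst_coord g) f"

definition cube_top :: "nat \<Rightarrow> (nat \<Rightarrow> real) topology" where
  "cube_top n = product_topology (\<lambda>_. top_of_set {0..1}) {..<n}"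

fun coord_val :: "coord \<Rightarrow> (nat \<Rightarrow> real) \<Rightarrow> real" where
  "coord_val (Fixed b) t = of_bool b"
| "coord_val (Coord j b) t = (if b then 1 - t j else t j)"

definition place :: "coord list \<Rightarrow> (nat \<Rightarrow> real) \<Rightarrow> nat \<Rightarrow> real" where
  "place f t = (\<lambda>i\<in>{..<length f}. coord_val (f ! i) t)"

lemma coord_val_flip: "coord_val (flip b a) t = (if b then 1 - coord_val a t else coord_val a t)"
  by (cases a) auto

lemma place_face_comp:
  assumes "f \<in> faces m n" "g \<in> faces l m"
  shows "place (face_comp f g) t = place f (place g t)"
proof -
  have "coord_val (subst_coord g (f ! i)) t = coord_val (f ! i) (place g t)"
    if "i < length f" for i
  proof (cases "f ! i")
    case (Coord j b)
    then have "j \<in> set (vars f)"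
      using nth_mem[OF that] by (force simp: vars_def)
    then have "j < length g"
      using assms by (auto simp: faces_def)
    then show ?thesis
      by (simp add: Coord coord_val_flip place_def)
  qed simp
  then show ?thesis
    unfolding place_def face_comp_def by (intro ext) (simp add: restrict_def)
qed

record 'a cube_complex =
  cubes :: "nat \<Rightarrow> 'a set"
  face :: "'a \<Rightarrow> coord list \<Rightarrow> 'a"

subsection \<open>Geometric realization\<close>

text \<open>
  The realization is the quotient of the disjoint union of one copy of the n-cube for every
  parametrised n-cube, with the quotient (weak) topology; a point is the set of all its
  representatives.
\<close>

definition glue :: "('a, 'b) cube_complex_scheme \<Rightarrow> 'a \<times> (nat \<Rightarrow> real) \<Rightarrow> 'a \<times> (nat \<Rightarrow> real) \<Rightarrow> bool" where
  "glue X p q \<longleftrightarrow> (\<exists>m n c f t. c \<in> cubes X n \<and> f \<in> faces m n \<and> t \<in> topspace (cube_top m) \<and>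
     p = (face X c f, t) \<and> q = (c, place f t))"

definition point :: "('a, 'b) cube_complex_scheme \<Rightarrow> 'a \<Rightarrow> (nat \<Rightarrow> real) \<Rightarrow> ('a \<times> (nat \<Rightarrow> real)) set" where
  "point X c t = {q. equivclp (glue X) (c, t) q}"

definition realization :: "('a, 'b) cube_complex_scheme \<Rightarrow> ('a \<times> (nat \<Rightarrow> real)) set topology" where
  "realization X = topology (\<lambda>U.
     U \<subseteq> {point X c t | c t n. c \<in> cubes X n \<and> t \<in> topspace (cube_top n)} \<and>
     (\<forall>n. \<forall>c\<in>cubes X n. openin (cube_top n) {t \<in> topspace (cube_top n). point X c t \<in> U}))"

lemma openin_realization:
  "openin (realization X) U \<longleftrightarrow>
     U \<subseteq> {point X c t | c t n. c \<in> cubes X n \<and> t \<in> topspace (cube_top n)} \<and>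
     (\<forall>n. \<forall>c\<in>cubes X n. openin (cube_top n) {t \<in> topspace (cube_top n). point X c t \<in> U})"
proof -
  let ?A = "\<lambda>n c U. {t \<in> topspace (cube_top n). point X c t \<in> U}"
  have "?A n c (S \<inter> T) = ?A n c S \<inter> ?A n c T" "?A n c (\<Union>K) = (\<Union>S\<in>K. ?A n c S)" for n c S T K
    by auto
  then show ?thesis
    unfolding realization_def
    by (subst topology_inverse') (auto simp: istopology_def)
qed

locale cube_complex =
  fixes X :: "('a, 'b) cube_complex_scheme"
  assumes cubes_disjoint: "m \<noteq> n \<Longrightarrow> cubes X m \<inter> cubes X n = {}"
    and face_closed: "\<lbrakk>c \<in> cubes X n; f \<in> faces m n\<rbrakk> \<Longrightarrow> face X c f \<in> cubes X m"
    and face_id: "c \<in> cubes X n \<Longrightarrow> face X c (id_face n) = c"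
    and face_face: "\<lbrakk>c \<in> cubes X n; f \<in> faces m n; g \<in> faces l m\<rbrakk>
      \<Longrightarrow> face X (face X c f) g = face X c (face_comp f g)"
    \<comment> \<open>characteristic maps are injective on open cubes\<close>
    and face_free: "\<lbrakk>c \<in> cubes X n; f \<in> faces n n; face X c f = c\<rbrakk> \<Longrightarrow> f = id_face n"
    and connected: "connected_space (realization X)"

definition combinatorial_map ::
  "('a \<Rightarrow> 'c) \<Rightarrow> ('a, 'b) cube_complex_scheme \<Rightarrow> ('c, 'd) cube_complex_scheme \<Rightarrow> bool" where
  "combinatorial_map \<phi> Y X \<longleftrightarrow>
     (\<forall>n. \<forall>c\<in>cubes Y n. \<phi> c \<in> cubes X n) \<and>
     (\<forall>m n. \<forall>c\<in>cubes Y n. \<forall>f\<in>faces m n. \<phi> (face Y c f) = face X (\<phi> c) f)"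

section \<open>Links and non-positive curvature\<close>

text \<open>
  The vertices of the link of \<open>v\<close> are the oriented edges starting at \<open>v\<close>, and an n-cube whose
  corner \<open>(0,...,0)\<close> is at \<open>v\<close> spans a simplex on the n edges along its coordinate axes.
\<close>

definition corner :: "('a, 'b) cube_complex_scheme \<Rightarrow> nat \<Rightarrow> 'a \<Rightarrow> 'a" where
  "corner X n c = face X c (replicate n (Fixed False))"

definition axis_edge :: "('a, 'b) cube_complex_scheme \<Rightarrow> nat \<Rightarrow> 'a \<Rightarrow> nat \<Rightarrow> 'a" where
  "axis_edge X n c i = face X c ((replicate n (Fixed False))[i := Coord 0 False])"

definition link :: "('a, 'b) cube_complex_scheme \<Rightarrow> 'a \<Rightarrow> 'a set set" where
  "link X v = {axis_edge X n c ` {..<n} | n c. n \<ge> 1 \<and> c \<in> cubes X n \<and> corner X n c = v}"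

text \<open>
  A priori the link is only a union of simplices glued along faces.  It is a simplicial complex iff
  the vertices of each simplex are distinct and a simplex is determined by its set of vertices, i.e.
  two cubes with the same edges at \<open>v\<close> differ by a permutation of the coordinates.
\<close>

definition simplicial_link :: "('a, 'b) cube_complex_scheme \<Rightarrow> 'a \<Rightarrow> bool" where
  "simplicial_link X v \<longleftrightarrow>
     (\<forall>n. \<forall>c\<in>cubes X n. corner X n c = v \<longrightarrow> inj_on (axis_edge X n c) {..<n}) \<and>
     (\<forall>n. \<forall>c\<in>cubes X n. \<forall>c'\<in>cubes X n. n \<ge> 1 \<longrightarrow> corner X n c = v \<longrightarrow> corner X n c' = v \<longrightarrow>
        axis_edge X n c ` {..<n} = axis_edge X n c' ` {..<n} \<longrightarrow>
        (\<exists>\<sigma>. \<sigma> permutes {..<n} \<and> c' = face X c (map (\<lambda>i. Coord (\<sigma> i) False) [0..<n])))"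

definition flag :: "'a set set \<Rightarrow> bool" where
  "flag D \<longleftrightarrow> (\<forall>\<sigma>. finite \<sigma> \<and> \<sigma> \<noteq> {} \<and> (\<forall>a\<in>\<sigma>. \<forall>b\<in>\<sigma>. {a, b} \<in> D) \<longrightarrow> \<sigma> \<in> D)"

definition full_subcomplex :: "'a set set \<Rightarrow> 'a set set \<Rightarrow> bool" where
  "full_subcomplex C D \<longleftrightarrow> C \<subseteq> D \<and> (\<forall>\<sigma>\<in>D. \<sigma> \<subseteq> \<Union>C \<longrightarrow> \<sigma> \<in> C)"

definition non_positively_curved :: "('a, 'b) cube_complex_scheme \<Rightarrow> bool" where
  "non_positively_curved X \<longleftrightarrow>
     cube_complex X \<and> (\<forall>v\<in>cubes X 0. simplicial_link X v \<and> flag (link X v))"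

definition simply_connected_space :: "'p topology \<Rightarrow> bool" where
  "simply_connected_space T \<longleftrightarrow> path_connected_space T \<and>
     (\<forall>\<gamma>. pathin T \<gamma> \<and> \<gamma> 0 = \<gamma> 1 \<longrightarrow>
        homotopic_with (\<lambda>h. h 0 = \<gamma> 0 \<and> h 1 = \<gamma> 0) (top_of_set {0..1}) T \<gamma> (\<lambda>_. \<gamma> 0))"

definition CAT0_cube_complex :: "('a, 'b) cube_complex_scheme \<Rightarrow> bool" where
  "CAT0_cube_complex X \<longleftrightarrow>
     non_positively_curved X \<and> simply_connected_space (realization X)"

definition local_isometry ::
  "('a \<Rightarrow> 'c) \<Rightarrow> ('a, 'b) cube_complex_scheme \<Rightarrow> ('c, 'd) cube_complex_scheme \<Rightarrow> bool" where
  "local_isometry \<phi> Y X \<longleftrightarrow>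
     non_positively_curved Y \<and> non_positively_curved X \<and> combinatorial_map \<phi> Y X \<and>
     (\<forall>v\<in>cubes Y 0. inj_on \<phi> (\<Union>(link Y v)) \<and>
        full_subcomplex ((`) \<phi> ` link Y v) (link X (\<phi> v)))"

definition subcomplex :: "('a, 'b) cube_complex_scheme \<Rightarrow> ('a, 'd) cube_complex_scheme \<Rightarrow> bool" where
  "subcomplex Y X \<longleftrightarrow> cube_complex Y \<and> (\<forall>n. cubes Y n \<subseteq> cubes X n) \<and>
     (\<forall>m n. \<forall>c\<in>cubes Y n. \<forall>f\<in>faces m n. face Y c f = face X c f)"

definition convex_subcomplex ::
  "('a, 'b) cube_complex_scheme \<Rightarrow> ('a, 'd) cube_complex_scheme \<Rightarrow> bool" where
  "convex_subcomplex Y X \<longleftrightarrow> subcomplex Y X \<and> local_isometry (\<lambda>c. c) Y X"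

section \<open>Special cube complexes\<close>

definition simplicial_graph :: "'v set \<Rightarrow> 'v set set \<Rightarrow> bool" where
  "simplicial_graph V E \<longleftrightarrow> (\<forall>e\<in>E. e \<subseteq> V \<and> card e = 2)"

definition coord_pos :: "coord list \<Rightarrow> nat \<Rightarrow> nat" where
  "coord_pos f j = (THE i. i < length f \<and> (\<exists>b. f ! i = Coord j b))"

text \<open>
  A parametrised n-cube of the Salvetti complex is a complete subgraph on n vertices, listed in the
  order of the coordinates, together with the direction of each edge: \<open>(v, True)\<close> stands for the edge
  labelled \<open>v\<close>, traversed along its orientation, and \<open>(v, False)\<close> for its reverse.
\<close>

definition salvetti :: "'v set \<Rightarrow> 'v set set \<Rightarrow> ('v \<times> bool) list cube_complex" where
  "salvetti V E =
     \<lparr>cubes = (\<lambda>n. {xs. length xs = n \<and> distinct (map fst xs) \<and> fst ` set xs \<subseteq> V \<and>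
                 (\<forall>u\<in>fst ` set xs. \<forall>v\<in>fst ` set xs. u \<noteq> v \<longrightarrow> {u, v} \<in> E)}),
      face = (\<lambda>xs f. map (\<lambda>j. let (v, d) = xs ! coord_pos f j in
                 (v, d \<noteq> (f ! coord_pos f j = Coord j True))) [0..<length (vars f)])\<rparr>"

text \<open>
  The type argument is the type of the vertices of the graph \<open>\<Gamma>\<close>, over which one cannot quantify
  inside a definition.
\<close>

definition special :: "'v itself \<Rightarrow> ('a, 'b) cube_complex_scheme \<Rightarrow> bool" where
  "special (_ :: 'v itself) X \<longleftrightarrow> non_positively_curved X \<and>
     (\<exists>(V :: 'v set) E \<phi>. simplicial_graph V E \<and> local_isometry \<phi> X (salvetti V E))"

section \<open>Group actions\<close>

definition cubical_action ::
  "('g, 'm) monoid_scheme \<Rightarrow> ('a, 'b) cube_complex_scheme \<Rightarrow> ('g \<Rightarrow> 'a \<Rightarrow> 'a) \<Rightarrow> bool" where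
  "cubical_action G X \<rho> \<longleftrightarrow> group_action G (\<Union>n. cubes X n) \<rho> \<and>
     (\<forall>g\<in>carrier G. combinatorial_map (\<rho> g) X X)"

definition point_map :: "('a \<Rightarrow> 'a) \<Rightarrow> ('a \<times> (nat \<Rightarrow> real)) set \<Rightarrow> ('a \<times> (nat \<Rightarrow> real)) set" where
  "point_map \<phi> p = (\<lambda>(c, t). (\<phi> c, t)) ` p"

definition free_action ::
  "('g, 'm) monoid_scheme \<Rightarrow> ('a, 'b) cube_complex_scheme \<Rightarrow> ('g \<Rightarrow> 'a \<Rightarrow> 'a) \<Rightarrow> bool" where
  "free_action G X \<rho> \<longleftrightarrow>
     (\<forall>g\<in>carrier G. \<forall>p\<in>topspace (realization X). point_map (\<rho> g) p = p \<longrightarrow> g = \<one>\<^bsub>G\<^esub>)"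

definition cocompact_action ::
  "('g, 'm) monoid_scheme \<Rightarrow> ('a, 'b) cube_complex_scheme \<Rightarrow> ('g \<Rightarrow> 'a \<Rightarrow> 'a) \<Rightarrow> bool" where
  "cocompact_action G X \<rho> \<longleftrightarrow> (\<exists>C. compactin (realization X) C \<and>
     topspace (realization X) = (\<Union>g\<in>carrier G. point_map (\<rho> g) ` C))"

definition quotient_complex ::
  "('g, 'm) monoid_scheme \<Rightarrow> ('a, 'b) cube_complex_scheme \<Rightarrow> ('g \<Rightarrow> 'a \<Rightarrow> 'a) \<Rightarrow> 'a set cube_complex" where
  "quotient_complex G X \<rho> =
     \<lparr>cubes = (\<lambda>n. {orbit G \<rho> c | c. c \<in> cubes X n}),
      face = (\<lambda>S f. (\<lambda>c. face X c f) ` S)\<rparr>"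

definition virtually_special ::
  "'v itself \<Rightarrow> ('g, 'm) monoid_scheme \<Rightarrow> ('a, 'b) cube_complex_scheme \<Rightarrow> ('g \<Rightarrow> 'a \<Rightarrow> 'a) \<Rightarrow> bool" where
  "virtually_special T G X \<rho> \<longleftrightarrow>
     (\<exists>H. subgroup H G \<and> finite (rcosets\<^bsub>G\<^esub> H) \<and> free_action (G\<lparr>carrier := H\<rparr>) X \<rho> \<and>
        special T (quotient_complex (G\<lparr>carrier := H\<rparr>) X \<rho>))"

definition convex_cocompact ::
  "('g, 'm) monoid_scheme \<Rightarrow> ('a, 'b) cube_complex_scheme \<Rightarrow> ('g \<Rightarrow> 'a \<Rightarrow> 'a) \<Rightarrow> 'g set \<Rightarrow> bool" where
  "convex_cocompact G X \<rho> K \<longleftrightarrow> subgroup K G \<and>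
     (\<exists>Y :: 'a cube_complex. convex_subcomplex Y X \<and> (\<exists>n. cubes Y n \<noteq> {}) \<and>
        (\<forall>k\<in>K. \<forall>n. \<rho> k ` cubes Y n = cubes Y n) \<and>
        cocompact_action (G\<lparr>carrier := K\<rparr>) Y \<rho>)"

text \<open>Every finite group is isomorphic to one whose carrier consists of natural numbers.\<close>

definition separable :: "('g, 'm) monoid_scheme \<Rightarrow> 'g set \<Rightarrow> bool" where
  "separable G S \<longleftrightarrow> S \<subseteq> carrier G \<and>
     (\<forall>g\<in>carrier G - S. \<exists>(F :: nat monoid) \<phi>.
        group F \<and> finite (carrier F) \<and> \<phi> \<in> hom G F \<and> \<phi> g \<notin> \<phi> ` S)"

end

theory Submission
  imports Defs "HOL-Algebra.Weak_Morphisms"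
begin

text \<open>
  Separability of the product means that for every \<open>g\<close> outside of it there is a coset \<open>g N\<close>, \<open>N\<close>
  of finite index, that is disjoint from it. So suppose that \<open>g = k\<^sub>1 \<dots> k\<^sub>n \<nu>\<close> with \<open>\<nu>\<close> deep in a
  finite-index subgroup; the point is to replace the \<open>k\<^sub>i\<close> by other elements of the \<open>K\<^sub>i\<close> such
  that the error term disappears. Geometrically, the equation is a polygon in \<open>X\<close> that almost
  closes up: its sides run through translates of the convex subcomplexes \<open>Y\<^sub>i\<close> and, in between,
  along translates of fixed edge paths, and its last vertex is the image of the first one under a
  conjugate of \<open>\<nu>\<close>. The polygon has to be bent, by moving its vertices within the orbits of the
  stabilizers of its sides, until it closes up.

  This bending takes place in a right-angled Coxeter group \<open>W\<close>. A special subgroup \<open>H\<close> labels the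
  edges of \<open>X\<close> by the vertices of a graph, edges at a vertex of \<open>X\<close> span a square iff their labels
  are adjacent (\<open>edge_unique\<close>, \<open>ex_square\<close>), and each label \<open>v\<close> has a height function on the
  vertices of \<open>X\<close>. The letter of an edge is its label together with the parity of its lower
  height; its reverse has the same letter, so that edge paths are words in involutions. This gives
  a map \<open>wt\<close> from the vertices of \<open>X\<close> to \<open>W\<close> that is equivariant under a subgroup of finite index
  of \<open>H\<close>. Only finitely many labels occur on the sides, and edges with other labels are mapped to
  points. Heights and \<open>wt\<close> are potentials, which exist because \<open>X\<close> is simply connected;
  \<open>ex_potential\<close> proves this by lifting paths and homotopies in the realization.

  A convex subcomplex becomes a family of sets of directions in \<open>W\<close> that is locally convex and
  invariant under a normal subgroup \<open>M\<close> of finite index (\<open>piece_rel_rels\<close>); here \<open>M\<close> is chosen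
  such that it moves the vertices of the subcomplex only within orbits of its stabilizer, which is
  possible because there are finitely many orbits (\<open>ex_good\<close>). The combinatorial heart is
  \<open>polygons_close\<close>: for a given number of sides there is a normal subgroup \<open>N\<close> of finite index
  such that every polygon with \<open>M\<close>-invariant locally convex sides that closes up modulo \<open>N\<close> can be
  replaced by one that closes up, with vertices in the same \<open>M\<close>-cosets. Reading the new polygon in
  \<open>X\<close> gives the new \<open>k\<^sub>i\<close>; that it closes up in \<open>X\<close> and not only in \<open>W\<close> follows as \<open>W\<close> acts on the
  vertices of \<open>X\<close> and \<open>H\<close> acts freely.

  The proof of \<open>polygons_close\<close> sends a walker around the polygon, with an imitator who may only
  use the directions of the closing side and who copies a step if the hyperplane that he would
  cross has the same colour, that is, the same image in a finite quotient, as the one that the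
  walker crosses. Such a pair is a \<open>W\<close>-action with finitely many classes, so the imitator returns
  if \<open>N\<close> is small enough, and his final position closes the polygon. To join it to the given
  sides, one pushes the sides along with the imitator. This works as long as his steps commute
  with the letters of all earlier sides and then leaves a polygon with fewer sides; a step that
  does not commute cuts the polygon along a hyperplane, after which a projection to the hyperplane
  removes letters from a side.
\<close>

section \<open>Right-angled Coxeter groups\<close>

text \<open>
  The generators are the letters, and a letter carries the set of vertices that its vertex is
  adjacent to. Thus commutation is a relation between letters, and the type of the group does not
  depend on a graph. The parity distinguishes the two letters over a vertex \<open>v\<close>; they generate an
  infinite dihedral group, in which the powers of the generator \<open>v\<close> of a right-angled Artin group
  can be recorded.
\<close>

datatype 'v letter = Letter (vertex: 'v) (parity: bool) (nbrs: "'v set")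

definition comm :: "'v letter \<Rightarrow> 'v letter \<Rightarrow> bool" where
  "comm c d \<longleftrightarrow> vertex c \<noteq> vertex d \<and> vertex c \<in> nbrs d \<and> vertex d \<in> nbrs c"

lemma comm_sym: "comm c d \<Longrightarrow> comm d c" and comm_irrefl: "\<not> comm c c"
  by (auto simp: comm_def)

inductive weq :: "'v letter list \<Rightarrow> 'v letter list \<Rightarrow> bool" where
  weq_refl: "weq u u"
| weq_sym: "weq u v \<Longrightarrow> weq v u"
| weq_trans: "weq u v \<Longrightarrow> weq v w \<Longrightarrow> weq u w"
| weq_cancel: "weq (u @ [c, c] @ v) (u @ v)"
| weq_swap: "comm c d \<Longrightarrow> weq (u @ [c, d] @ v) (u @ [d, c] @ v)"

lemma weq_append_left: "weq u v \<Longrightarrow> weq (w @ u) (w @ v)"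
proof (induction rule: weq.induct)
  case (weq_cancel u c v)
  then show ?case using weq.weq_cancel[of "w @ u" c v] by simp
next
  case (weq_swap c d u v)
  then show ?case using weq.weq_swap[of c d "w @ u" v] by simp
qed (auto intro: weq.weq_refl weq.weq_sym weq.weq_trans)

lemma weq_append_right: "weq u v \<Longrightarrow> weq (u @ w) (v @ w)"
proof (induction rule: weq.induct)
  case (weq_cancel u c v)
  then show ?case using weq.weq_cancel[of u c "v @ w"] by simp
next
  case (weq_swap c d u v)
  then show ?case using weq.weq_swap[of c d u "v @ w"] by simp
qed (auto intro: weq.weq_refl weq.weq_sym weq.weq_trans)

lemma weq_append: "weq u u' \<Longrightarrow> weq v v' \<Longrightarrow> weq (u @ v) (u' @ v')"
  by (meson weq_append_left weq_append_right weq_trans)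

lemma weq_rev: "weq u v \<Longrightarrow> weq (rev u) (rev v)"
proof (induction rule: weq.induct)
  case (weq_cancel u c v)
  then show ?case using weq.weq_cancel[of "rev v" c "rev u"] by simp
next
  case (weq_swap c d u v)
  then show ?case using weq.weq_swap[OF comm_sym[OF weq_swap(1)], of "rev v" "rev u"] by simp
qed (auto intro: weq.weq_refl weq.weq_sym weq.weq_trans)

lemma weq_rev_cancel: "weq (rev u @ u) []"
proof (induction u)
  case (Cons c u)
  then show ?case
    using weq_cancel[of "rev u" c u] weq_trans by fastforce
qed (simp add: weq_refl)

quotient_type 'v racg = "'v letter list" / weq
  by (intro equivpI reflpI sympI transpI) (auto intro: weq.intros)

instantiation racg :: (type) group_add
begin

lift_definition zero_racg :: "'a racg" is "[]" .
lift_definition plus_racg :: "'a racg \<Rightarrow> 'a racg \<Rightarrow> 'a racg" is append by (rule weq_append)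
lift_definition uminus_racg :: "'a racg \<Rightarrow> 'a racg" is rev by (rule weq_rev)
definition minus_racg :: "'a racg \<Rightarrow> 'a racg \<Rightarrow> 'a racg" where "minus_racg x y = x + - y"

instance
proof
  fix a b c :: "'a racg"
  show "a + b + c = a + (b + c)" by transfer (simp add: weq_refl)
  show "0 + a = a" "a + 0 = a" by (transfer; simp add: weq_refl)+
  show "- a + a = 0" by transfer (rule weq_rev_cancel)
  show "a + - b = a - b" by (simp add: minus_racg_def)
qed

end

lift_definition word :: "'v letter list \<Rightarrow> 'v racg" is "\<lambda>u. u" .

definition gen :: "'v letter \<Rightarrow> 'v racg" where "gen c = word [c]"

lemma word_single [simp]: "word [c] = gen c"
  by (simp add: gen_def)

lemma word_Nil [simp]: "word [] = 0"
  by transfer (rule weq_refl)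

lemma word_append: "word (u @ v) = word u + word v"
  by transfer (rule weq_refl)

lemma word_Cons: "word (c # u) = gen c + word u"
  using word_append[of "[c]" u] by simp

lemma word_snoc: "x + word (u @ [c]) = x + word u + gen c"
  by (simp add: word_append add.assoc)

lemma word_rev: "word (rev u) = - word u"
  by transfer (rule weq_refl)

lemma ex_word: "\<exists>u. x = word u"
  by (metis Quotient3_abs_rep Quotient3_racg word.abs_eq)

lemma gen_gen [simp]: "gen c + gen c = 0" "gen c + (gen c + x) = x" "x + gen c + gen c = x"
proof -
  show 1: "gen c + gen c = 0"
    unfolding gen_def using weq_cancel[of "[]" c "[]"] by transfer simp
  show "gen c + (gen c + x) = x" "x + gen c + gen c = x"
    by (simp_all add: add.assoc 1 flip: add.assoc[of "gen c" "gen c"])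
qed

lemma uminus_gen [simp]: "- gen c = gen c"
  by (simp add: minus_unique)

lemma gen_comm: "comm c d \<Longrightarrow> gen c + gen d = gen d + gen c"
  unfolding gen_def using weq_swap[of c d "[]" "[]"] by transfer simp

lemma minus_plus [simp]: "- x + (x + y) = y" "x + (- x + y) = (y :: 'a::group_add)"
  by (simp_all flip: add.assoc)

lemma uminus_plus: "- (x + y) = - y + - (x :: 'a::group_add)"
  by (simp add: minus_add)

text \<open>
  The universal property: to let the group act on a type, on the right, it suffices to give
  commuting involutions. All constructions below are such actions: imitators, counting of
  hyperplanes, pairs of a walker and an imitator, and the moves of vertices in a cube complex.
\<close>

definition commuting_involutions :: "('v letter \<Rightarrow> 'w \<Rightarrow> 'w) \<Rightarrow> bool" where
  "commuting_involutions f \<longleftrightarrow>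
     (\<forall>c p. f c (f c p) = p) \<and> (\<forall>c d p. comm c d \<longrightarrow> f c (f d p) = f d (f c p))"

definition act :: "('v letter \<Rightarrow> 'w \<Rightarrow> 'w) \<Rightarrow> 'w \<Rightarrow> 'v racg \<Rightarrow> 'w" where
  "act f p x = fold f (SOME u. x = word u) p"

lemma fold_weq:
  assumes "commuting_involutions f" "weq u v"
  shows "fold f u p = fold f v p"
  using assms(2)
proof (induction arbitrary: p rule: weq.induct)
  case (weq_swap c d u v)
  then have "f c (f d q) = f d (f c q)" for q
    using assms(1) unfolding commuting_involutions_def by blast
  then show ?case by simp
qed (use assms(1) in \<open>auto simp: commuting_involutions_def\<close>)

lemma act_word:
  assumes "commuting_involutions f"
  shows "act f p (word u) = fold f u p"
proof -
  have "word u = word (SOME v. word u = word v)"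
    by (rule someI) simp
  then have "weq u (SOME v. word u = word v)"
    by transfer
  then show ?thesis
    unfolding act_def using fold_weq[OF assms] by metis
qed

lemma act_0 [simp]: "commuting_involutions f \<Longrightarrow> act f p 0 = p"
  using act_word[of f p "[]"] by simp

lemma act_gen: "commuting_involutions f \<Longrightarrow> act f p (gen c) = f c p"
  using act_word[of f p "[c]"] by simp

lemma act_plus: "commuting_involutions f \<Longrightarrow> act f p (x + y) = act f (act f p x) y"
  using ex_word[of x] ex_word[of y] by (auto simp: act_word simp flip: word_append)

section \<open>Convex sets\<close>

text \<open>
  A family of disjoint, locally convex subgraphs of the Cayley graph: \<open>E x\<close> is the set of
  directions in which the subgraph through \<open>x\<close> continues, and the classes of the equivalence
  relation \<open>rel E\<close> are the vertex sets of the connected subgraphs. Single cosets of parabolic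
  subgroups, and the translates of a subgraph under a group, are handled alike.
\<close>

definition convex_rel :: "('v racg \<Rightarrow> 'v letter set) \<Rightarrow> bool" where
  "convex_rel E \<longleftrightarrow> (\<forall>x. \<forall>c\<in>E x. c \<in> E (x + gen c)) \<and>
     (\<forall>x. \<forall>c\<in>E x. \<forall>d\<in>E x. comm c d \<longrightarrow> d \<in> E (x + gen c))"

lemma convex_relD:
  assumes "convex_rel E" "c \<in> E x"
  shows "c \<in> E (x + gen c)" "d \<in> E x \<Longrightarrow> comm c d \<Longrightarrow> d \<in> E (x + gen c)"
  using assms unfolding convex_rel_def by blast+

inductive rel :: "('v racg \<Rightarrow> 'v letter set) \<Rightarrow> 'v racg \<Rightarrow> 'v racg \<Rightarrow> bool" for E where
  rel_refl [simp]: "rel E x x"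
| rel_step: "rel E x y \<Longrightarrow> c \<in> E y \<Longrightarrow> rel E x (y + gen c)"

fun walk :: "('v racg \<Rightarrow> 'v letter set) \<Rightarrow> 'v racg \<Rightarrow> 'v letter list \<Rightarrow> bool" where
  "walk E x [] = True"
| "walk E x (c # u) = (c \<in> E x \<and> walk E (x + gen c) u)"

lemma rel_trans: "rel E y z \<Longrightarrow> rel E x y \<Longrightarrow> rel E x z"
  by (induction rule: rel.induct) (auto intro: rel.intros)

lemma rel_gen: "c \<in> E x \<Longrightarrow> rel E x (x + gen c)"
  by (intro rel_step rel_refl)

lemma rel_sym:
  assumes "convex_rel E" shows "rel E x y \<Longrightarrow> rel E y x"
proof (induction rule: rel.induct)
  case (rel_step x y c)
  then have "rel E (y + gen c) y"
    using convex_relD(1)[OF assms, of c y] rel_gen[of c E "y + gen c"] by simp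
  then show ?case using rel_step rel_trans by blast
qed simp

lemma walk_append: "walk E x (u @ v) \<longleftrightarrow> walk E x u \<and> walk E (x + word u) v"
  by (induction u arbitrary: x) (auto simp: word_Cons add.assoc)

lemma walk_rel: "walk E x u \<Longrightarrow> rel E x (x + word u)"
proof (induction u arbitrary: x)
  case (Cons c u)
  then show ?case
    using rel_trans[of E "x + gen c" "x + gen c + word u" x] rel_gen[of c E x] Cons.IH[of "x + gen c"]
    by (simp add: word_Cons add.assoc)
qed simp

lemma rel_walk: "rel E x y \<Longrightarrow> \<exists>u. walk E x u \<and> y = x + word u"
proof (induction rule: rel.induct)
  case (rel_refl x)
  then show ?case by (intro exI[of _ "[]"]) simp
next
  case (rel_step x y c)
  then obtain u where "walk E x u" "y = x + word u" by blast
  then show ?case using rel_step(2)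
    by (intro exI[of _ "u @ [c]"]) (simp add: walk_append word_append add.assoc)
qed

lemma rel_mono: "rel E x y \<Longrightarrow> (\<And>z. E z \<subseteq> E' z) \<Longrightarrow> rel E' x y"
  by (induction rule: rel.induct) (auto intro: rel.intros)

lemma rel_translate: "(\<And>z. E (m + z) = E z) \<Longrightarrow> rel E (m + x) (m + y) \<longleftrightarrow> rel E x y"
proof -
  have *: "rel E x y \<Longrightarrow> rel E (m + x) (m + y)" if "\<And>z. E (m + z) = E z" for m x y
  proof (induction rule: rel.induct)
    case (rel_step x y c)
    then show ?case using rel.rel_step[of E "m + x" "m + y" c] that by (simp add: add.assoc)
  qed simp
  assume inv: "\<And>z. E (m + z) = E z"
  then have "\<And>z. E (- m + z) = E z"
    by (metis minus_plus(2))
  then show ?thesis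
    using *[OF inv, of x y] *[of "- m" "m + x" "m + y"] by auto
qed

definition parab :: "'v letter set \<Rightarrow> 'v racg set" where
  "parab J = {word u | u. set u \<subseteq> J}"

lemma parab_0 [simp]: "0 \<in> parab J"
  unfolding parab_def by (rule CollectI, rule exI[of _ "[]"]) simp

lemma parab_gen: "c \<in> J \<Longrightarrow> gen c \<in> parab J"
  unfolding parab_def by (rule CollectI, rule exI[of _ "[c]"]) simp

lemma parab_add: "x \<in> parab J \<Longrightarrow> y \<in> parab J \<Longrightarrow> x + y \<in> parab J"
  unfolding parab_def by (auto simp flip: word_append) (metis set_append Un_least)

lemma parab_uminus: "x \<in> parab J \<Longrightarrow> - x \<in> parab J"
  unfolding parab_def by (auto simp flip: word_rev) (metis set_rev)

lemma parab_uminus_iff [simp]: "- x \<in> parab J \<longleftrightarrow> x \<in> parab J"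
  using parab_uminus[of x J] parab_uminus[of "- x" J] by auto

lemma parab_mono: "J \<subseteq> K \<Longrightarrow> parab J \<subseteq> parab K"
  unfolding parab_def by auto

lemma parab_add_cancel:
  assumes x: "x \<in> parab J"
  shows "x + y \<in> parab J \<longleftrightarrow> y \<in> parab J" "y + x \<in> parab J \<longleftrightarrow> y \<in> parab J"
proof -
  have "y \<in> parab J" if "x + y \<in> parab J"
    using parab_add[OF parab_uminus[OF x] that] by (simp only: minus_plus)
  then show "x + y \<in> parab J \<longleftrightarrow> y \<in> parab J" using parab_add[OF x] by blast
  have "y \<in> parab J" if "y + x \<in> parab J"
    using parab_add[OF that parab_uminus[OF x]] by (simp only: add.assoc right_minus add_0_right)
  then show "y + x \<in> parab J \<longleftrightarrow> y \<in> parab J" using parab_add[OF _ x] by blast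
qed

lemma parab_sym: "- x + y \<in> parab J \<longleftrightarrow> - y + x \<in> parab J"
  using parab_uminus_iff[of "- x + y" J] by (simp only: uminus_plus minus_minus)

lemma walk_const: "walk (\<lambda>_. J) x u \<longleftrightarrow> set u \<subseteq> J"
  by (induction u arbitrary: x) auto

lemma rel_const: "rel (\<lambda>_. J) x y \<longleftrightarrow> - x + y \<in> parab J"
proof
  assume "rel (\<lambda>_. J) x y"
  then show "- x + y \<in> parab J"
    using rel_walk[of "\<lambda>_. J" x y] by (auto simp: walk_const parab_def)
next
  assume "- x + y \<in> parab J"
  then obtain u where u: "- x + y = word u" "set u \<subseteq> J" by (auto simp: parab_def)
  then have "y = x + word u" by (metis minus_plus(2))
  then show "rel (\<lambda>_. J) x y"
    using walk_rel[of "\<lambda>_. J" x u] u by (simp add: walk_const)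
qed

lemma convex_const: "convex_rel (\<lambda>_. J)"
  by (simp add: convex_rel_def)

definition perp :: "'v letter \<Rightarrow> 'v letter set" where "perp d = {e. comm d e}"

abbreviation star :: "'v letter \<Rightarrow> 'v letter set" where "star d \<equiv> insert d (perp d)"

lemma parab_commute:
  assumes "x \<in> parab J" "\<And>e. e \<in> J \<Longrightarrow> gen e + y = y + gen e"
  shows "x + y = y + x"
proof -
  obtain u where "x = word u" "set u \<subseteq> J" using assms(1) by (auto simp: parab_def)
  moreover have "set u \<subseteq> J \<Longrightarrow> word u + y = y + word u" for u
  proof (induction u)
    case (Cons c u)
    have "word (c # u) + y = gen c + (word u + y)" by (simp add: word_Cons add.assoc)
    also have "\<dots> = (gen c + y) + word u" using Cons by (simp add: add.assoc)
    also have "\<dots> = y + word (c # u)" using Cons assms(2)[of c] by (simp add: word_Cons add.assoc)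
    finally show ?case .
  qed simp
  ultimately show ?thesis by blast
qed

lemma parab_perp_commute: "x \<in> parab (perp d) \<Longrightarrow> x + gen d = gen d + x"
  by (rule parab_commute) (auto simp: perp_def gen_comm comm_sym)

text \<open>
  The letters of \<open>perp d\<close> commute with \<open>d\<close>, which can be moved to the end and cancels in pairs.
\<close>

lemma parab_star:
  assumes "x \<in> parab (star d)"
  shows "x \<in> parab (perp d) \<or> x + gen d \<in> parab (perp d)"
proof -
  obtain u where "x = word u" "set u \<subseteq> star d" using assms by (auto simp: parab_def)
  moreover have "set u \<subseteq> star d \<Longrightarrow> word u \<in> parab (perp d) \<or> word u + gen d \<in> parab (perp d)" for u
  proof (induction u)
    case (Cons c u)
    then consider "word u \<in> parab (perp d)" | "word u + gen d \<in> parab (perp d)" by auto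
    then show ?case
    proof cases
      case 1
      then show ?thesis
        using Cons.prems parab_add[OF parab_gen[of c "perp d"] 1] parab_perp_commute[OF 1]
        by (auto simp: word_Cons add.assoc)
    next
      case 2
      then show ?thesis
        using Cons.prems parab_add[OF parab_gen[of c "perp d"] 2] parab_perp_commute[OF 2]
        by (auto simp: word_Cons add.assoc) (metis add.assoc gen_gen(2,3))
    qed
  qed simp
  ultimately show ?thesis by blast
qed

text \<open>
  An imitator copies the steps of a walker, except those that would lead him out of his class of
  \<open>E\<close>. Local convexity is exactly what is needed for these moves to be commuting involutions, so
  that the position of the imitator depends only on the displacement of the walker and not on his
  path.
\<close>

definition imit :: "('v racg \<Rightarrow> 'v letter set) \<Rightarrow> 'v letter \<Rightarrow> 'v racg \<Rightarrow> 'v racg" where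
  "imit E c u = (if c \<in> E u then u + gen c else u)"

lemma imit_simps [simp]:
  "c \<in> E u \<Longrightarrow> imit E c u = u + gen c" "c \<notin> E u \<Longrightarrow> imit E c u = u"
  by (simp_all add: imit_def)

lemma commuting_imit:
  assumes "convex_rel E" shows "commuting_involutions (imit E)"
proof -
  have inv: "c \<in> E (x + gen c) \<longleftrightarrow> c \<in> E x" for c x
    using convex_relD(1)[OF assms, of c x] convex_relD(1)[OF assms, of c "x + gen c"] by auto
  have sq: "d \<in> E (x + gen c) \<longleftrightarrow> d \<in> E x" if "c \<in> E x" "comm c d" for c d x
    using convex_relD(2)[OF assms that(1), of d] convex_relD(2)[OF assms, of c "x + gen c" d] that inv
    by auto
  have "imit E c (imit E d p) = imit E d (imit E c p)" if "comm c d" for c d p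
  proof -
    have "p + gen c + gen d = p + gen d + gen c"
      using gen_comm[OF that] by (simp add: add.assoc)
    then show ?thesis
      using sq[of c p d] sq[of d p c] that comm_sym[OF that]
      by (cases "c \<in> E p"; cases "d \<in> E p") (simp_all add: imit_def)
  qed
  moreover have "imit E c (imit E c p) = p" for c p
    by (simp add: imit_def inv)
  ultimately show ?thesis
    unfolding commuting_involutions_def by blast
qed

lemma act_imit_walk:
  assumes "convex_rel E" "walk E x u" shows "act (imit E) x (word u) = x + word u"
proof -
  have "walk E x u \<Longrightarrow> fold (imit E) u x = x + word u" for x
    by (induction u arbitrary: x) (auto simp: imit_def word_Cons add.assoc)
  then show ?thesis using assms by (simp add: act_word commuting_imit)
qed

lemma act_imit_rel:
  assumes "convex_rel E" "rel E x y" shows "act (imit E) x (- x + y) = y"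
proof -
  obtain u where "walk E x u" "y = x + word u" using rel_walk[OF assms(2)] by blast
  then show ?thesis using act_imit_walk[OF assms(1)] by simp
qed

definition len :: "'v racg \<Rightarrow> nat" where
  "len x = (LEAST n. \<exists>u. length u = n \<and> x = word u)"

lemma len_le: "len (word u) \<le> length u"
  unfolding len_def by (rule Least_le) auto

lemma ex_geodesic: "\<exists>u. x = word u \<and> length u = len x"
proof -
  have "\<exists>u. length u = len x \<and> x = word u"
    unfolding len_def by (rule LeastI_ex) (use ex_word in auto)
  then show ?thesis by blast
qed

text \<open>
  An imitator that ends up at the same place as a walker on a geodesic cannot have skipped a step.
  Hence locally convex sets are convex.
\<close>

lemma geodesic_in_class:
  assumes "convex_rel E" "rel E x (x + word u)" "length u = len (word u)"
  shows "walk E x u"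
proof -
  have "\<exists>v. length v \<le> length u \<and> fold (imit E) u x = x + word v \<and> (length v = length u \<longrightarrow> walk E x u)"
    for x
  proof (induction u arbitrary: x)
    case (Cons c u)
    show ?case
    proof (cases "c \<in> E x")
      case True
      obtain v where "length v \<le> length u" "fold (imit E) u (x + gen c) = x + gen c + word v"
        "length v = length u \<longrightarrow> walk E (x + gen c) u" using Cons by blast
      then show ?thesis
        using True by (intro exI[of _ "c # v"]) (auto simp: word_Cons add.assoc)
    next
      case False
      obtain v where "length v \<le> length u" "fold (imit E) u x = x + word v" using Cons by blast
      then show ?thesis
        using False by (intro exI[of _ v]) auto
    qed
  qed auto
  then obtain v where v: "length v \<le> length u" "act (imit E) x (word u) = x + word v"
    "length v = length u \<longrightarrow> walk E x u"
    using act_word[OF commuting_imit[OF assms(1)], of x u] by metis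
  have "act (imit E) x (word u) = x + word u"
    using act_imit_rel[OF assms(1,2)] by simp
  then have "word v = word u" using v by simp
  then have "length u \<le> length v" using assms(3) len_le[of v] by simp
  then show ?thesis using v by simp
qed

section \<open>Hyperplanes and gates\<close>

text \<open>
  The hyperplane dual to the edge from \<open>w\<close> to \<open>w + gen d\<close>, represented by its letter and the
  vertices of its carrier, a coset of the parabolic subgroup of the letters equal to or commuting
  with \<open>d\<close>.
\<close>

definition hyp :: "'v racg \<Rightarrow> 'v letter \<Rightarrow> 'v letter \<times> 'v racg set" where
  "hyp w d = (d, {z. - w + z \<in> parab (star d)})"

lemma hyp_eq: "hyp w d = hyp w' d' \<longleftrightarrow> d = d' \<and> - w + w' \<in> parab (star d)"
proof
  assume "hyp w d = hyp w' d'"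
  then have "d = d' \<and> {z. - w + z \<in> parab (star d)} = {z. - w' + z \<in> parab (star d')}"
    unfolding hyp_def prod.inject .
  then have d: "d = d'" and eq: "{z. - w + z \<in> parab (star d)} = {z. - w' + z \<in> parab (star d')}"
    by blast+
  have "w' \<in> {z. - w' + z \<in> parab (star d')}" by simp
  then have "w' \<in> {z. - w + z \<in> parab (star d)}" by (simp only: eq)
  then show "d = d' \<and> - w + w' \<in> parab (star d)" using d by blast
next
  assume *: "d = d' \<and> - w + w' \<in> parab (star d)"
  then have w: "- w + w' \<in> parab (star d)" and d: "d' = d" by auto
  have "- w + z \<in> parab (star d) \<longleftrightarrow> - w' + z \<in> parab (star d)" for z
  proof -
    have "- w + z = (- w + w') + (- w' + z)" by (simp add: add.assoc)
    then show ?thesis using parab_add_cancel(1)[OF w, of "- w' + z"] by (simp only:)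
  qed
  then show "hyp w d = hyp w' d'" by (simp add: hyp_def d)
qed

lemma hyp_gen [simp]: "hyp (w + gen d) d = hyp w d"
  using parab_gen[of d "star d"] by (simp add: hyp_eq uminus_plus)

lemma hyp_comm: "comm d e \<Longrightarrow> hyp (w + gen e) d = hyp w d"
  using parab_gen[of e "star d"] by (simp add: hyp_eq uminus_plus perp_def)

text \<open>
  A walker who notes, modulo 2, the hyperplanes that he crosses. The symmetric difference makes
  this an action of the group, so that the result depends only on the end points of the path.
\<close>

definition cross_step where
  "cross_step d p = (fst p + gen d, sym_diff (snd p) {hyp (fst p) d})"

lemma cross_step: "cross_step d (x, T) = (x + gen d, sym_diff T {hyp x d})"
  by (simp add: cross_step_def)

lemma commuting_cross: "commuting_involutions cross_step"
proof -
  have gc: "x + gen c + gen d = x + gen d + gen c" if "comm c d" for x and c d :: "'a letter"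
    using gen_comm[OF that] by (simp add: add.assoc)
  show ?thesis
    unfolding commuting_involutions_def cross_step_def
    by (auto simp: hyp_comm comm_sym gc)
qed

definition separating :: "'v racg \<Rightarrow> 'v racg \<Rightarrow> ('v letter \<times> 'v racg set) set" where
  "separating x y = snd (act cross_step (x, {}) (- x + y))"

lemma act_cross: "act cross_step (x, T) u = (x + u, sym_diff T (separating x (x + u)))"
proof -
  have *: "\<exists>R. \<forall>T. act cross_step (x, T) (word v) = (x + word v, sym_diff T R)" for v
  proof (induction v rule: rev_induct)
    case Nil
    show ?case by (intro exI[of _ "{}"]) (simp add: act_word commuting_cross)
  next
    case (snoc d v)
    then obtain R where R: "\<And>T. act cross_step (x, T) (word v) = (x + word v, sym_diff T R)" by blast
    show ?case
      by (intro exI[of _ "sym_diff R {hyp (x + word v) d}"])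
        (auto simp: word_append act_plus commuting_cross R act_gen cross_step add.assoc)
  qed
  obtain v where "u = word v" using ex_word by blast
  then obtain R where R: "\<And>T. act cross_step (x, T) u = (x + u, sym_diff T R)" using * by blast
  then have "separating x (x + u) = R" by (simp add: separating_def)
  with R show ?thesis by simp
qed

lemma separating_refl [simp]: "separating x x = {}"
  by (simp add: separating_def commuting_cross)

lemma separating_gen [simp]: "separating x (x + gen d) = {hyp x d}"
  by (simp add: separating_def act_gen commuting_cross cross_step)

lemma separating_trans: "separating x z = sym_diff (separating x y) (separating y z)"
proof -
  have "act cross_step (x, {}) (- x + y + (- y + z)) = act cross_step (act cross_step (x, {}) (- x + y)) (- y + z)"
    by (rule act_plus[OF commuting_cross])
  then show ?thesis
    using act_cross[of x "{}" "- x + z"] act_cross[of x "{}" "- x + y"] act_cross[of y _ "- y + z"]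
    by (simp add: add.assoc)
qed

lemma separating_step: "separating x (y + gen d) = sym_diff (separating x y) {hyp y d}"
  using separating_trans[of x "y + gen d" y] by simp

lemma separating_sym: "separating x y = separating y x"
  using separating_trans[of x x y] by auto

lemma separating_word: "separating x (x + word u) \<subseteq> {hyp (x + word v) d | v d w. u = v @ d # w}"
proof (induction u rule: rev_induct)
  case (snoc d u)
  define A where "A = {hyp (x + word v) d | v d w. u = v @ d # w}"
  define B where "B = {hyp (x + word v) e | v e w. u @ [d] = v @ e # w}"
  have "hyp (x + word v) e \<in> B" if "u = v @ e # w" for v e w
  proof -
    have "u @ [d] = v @ e # (w @ [d])" using that by simp
    then show ?thesis unfolding B_def by blast
  qed
  then have "A \<subseteq> B" unfolding A_def by blast
  moreover have "hyp (x + word u) d \<in> B" unfolding B_def by blast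
  moreover have "separating x (x + word u) \<subseteq> A" using snoc by (simp only: A_def)
  moreover have "separating x (x + word (u @ [d])) \<subseteq> separating x (x + word u) \<union> {hyp (x + word u) d}"
    by (auto simp: word_snoc separating_step)
  ultimately have "separating x (x + word (u @ [d])) \<subseteq> B" by blast
  then show ?case by (simp only: B_def)
qed simp

text \<open>
  After the last crossing, the path does not meet the hyperplane again, which the cancellation in
  \<open>card_separating_geodesic\<close> needs.
\<close>

lemma last_crossing:
  assumes "H \<in> {hyp (x + word v) d | v d w. u = v @ d # w}"
  shows "\<exists>v d w. u = v @ d # w \<and> hyp (x + word v) d = H \<and>
    (\<forall>a e b. w = a @ e # b \<longrightarrow> hyp (x + word v + gen d + word a) e \<noteq> H)"
  using assms
proof (induction u rule: rev_induct)
  case (snoc c u)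
  show ?case
  proof (cases "hyp (x + word u) c = H")
    case True
    then show ?thesis by (intro exI[of _ u] exI[of _ c] exI[of _ "[]"]) auto
  next
    case False
    obtain v d w where vdw: "u @ [c] = v @ d # w" "hyp (x + word v) d = H" using snoc.prems by auto
    with False have "w \<noteq> []" by auto
    then obtain w' where "w = w' @ [c]" "u = v @ d # w'"
      using vdw(1) by (metis append.assoc append_Cons append_butlast_last_id butlast_snoc last_snoc
        last_appendR last_ConsR list.distinct(1) butlast_append butlast.simps(2))
    then have "H \<in> {hyp (x + word v) d | v d w. u = v @ d # w}" using vdw(2) by blast
    then obtain v d w where *: "u = v @ d # w" "hyp (x + word v) d = H"
      "\<And>a e b. w = a @ e # b \<Longrightarrow> hyp (x + word v + gen d + word a) e \<noteq> H"
      using snoc.IH by blast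
    have "hyp (x + word v + gen d + word a) e \<noteq> H" if "w @ [c] = a @ e # b" for a e b
    proof (cases b rule: rev_cases)
      case Nil
      then have "a = w" "e = c" using that by auto
      then show ?thesis using False *(1) by (simp add: word_append word_Cons add.assoc)
    next
      case (snoc b' c')
      then show ?thesis using *(3)[of a e b'] that by simp
    qed
    then show ?thesis using *(1,2)
      by (intro exI[of _ v] exI[of _ d] exI[of _ "w @ [c]"]) simp
  qed
qed simp

lemma finite_separating: "finite (separating x y)"
proof -
  obtain u where u: "- x + y = word u" using ex_word by blast
  have "finite (separating x (x + word u))" for u
  proof (induction u rule: rev_induct)
    case (snoc d u)
    then show ?case
      by (simp add: word_snoc separating_step)
  qed simp
  from this[of u] show ?thesis unfolding u[symmetric] by simp
qed

lemma geodesic_prefix: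
  assumes "length (u @ v) = len (word (u @ v))" shows "length u = len (word u)"
proof -
  obtain u' where u': "word u = word u'" "length u' = len (word u)" using ex_geodesic by metis
  have "len (word (u @ v)) \<le> length (u' @ v)"
    using len_le[of "u' @ v"] u' by (simp add: word_append)
  then show ?thesis using assms u' len_le[of u] by simp
qed

text \<open>
  A geodesic crosses each hyperplane at most once: if the last step from \<open>w\<close> crosses a hyperplane
  that was crossed before, then the part in between represents a product of letters that commute
  with the crossing letter, which can thus be cancelled, contradicting minimality of the length.
\<close>

lemma card_separating_geodesic:
  assumes "length u = len (word u)"
  shows "card (separating x (x + word u)) = length u"
  using assms
proof (induction u rule: rev_induct)
  case (snoc d u)
  define y where "y = x + word u"
  have IH: "card (separating x y) = length u"
    using snoc geodesic_prefix[of u "[d]"] by (simp add: y_def)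
  have S: "separating x (x + word (u @ [d])) = sym_diff (separating x y) {hyp y d}"
    by (simp add: word_snoc y_def separating_step)
  show ?case
  proof (cases "hyp y d \<in> separating x y")
    case False
    then have "sym_diff (separating x y) {hyp y d} = insert (hyp y d) (separating x y)" by auto
    with False IH show ?thesis by (simp add: S finite_separating)
  next
    case True
    obtain v d' w where "u = v @ d' # w" "hyp (x + word v) d' = hyp y d"
      and nocross: "\<And>a e b. w = a @ e # b \<Longrightarrow> hyp (x + word v + gen d' + word a) e \<noteq> hyp y d"
      using last_crossing[of "hyp y d" x u] True separating_word[of x u] unfolding y_def by blast
    then have [simp]: "d' = d" and u: "u = v @ [d] @ w" and hv: "hyp (x + word v) d = hyp y d"
      by (auto simp: hyp_eq)
    define z where "z = x + word v + gen d"
    have y: "y = z + word w"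
      by (simp add: y_def z_def u word_append word_Cons add.assoc)
    have hz: "hyp z d = hyp y d" using hv by (simp add: z_def)
    then have "- z + y \<in> parab (star d)" by (simp add: hyp_eq)
    then have "word w \<in> parab (star d)" by (simp add: y)
    moreover have "\<not> word w + gen d \<in> parab (perp d)"
    proof
      assume "word w + gen d \<in> parab (perp d)"
      then obtain b where b: "word w + gen d = word b" "set b \<subseteq> perp d" by (auto simp: parab_def)
      have "hyp z d \<notin> separating z (z + word b)"
      proof
        assume "hyp z d \<in> separating z (z + word b)"
        then obtain v' e w' where "hyp z d = hyp (z + word v') e" "b = v' @ e # w'"
          using separating_word[of z b] by auto
        then show False using b(2) by (auto simp: hyp_eq perp_def comm_irrefl)
      qed
      moreover have "z + word b = y + gen d"
        by (simp add: y add.assoc flip: b(1))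
      then have "separating z (z + word b) = sym_diff (separating z y) {hyp y d}"
        by (simp only: separating_step)
      ultimately have "hyp y d \<in> separating z (z + word w)" using hz y by auto
      then obtain v' e w' where "hyp y d = hyp (z + word v') e" "w = v' @ e # w'"
        using separating_word[of z w] by auto
      then show False using nocross[of v' e w'] by (simp add: z_def)
    qed
    ultimately have "word w \<in> parab (perp d)" using parab_star by blast
    then have "word (u @ [d]) = word (v @ w)"
      using parab_perp_commute[of "word w" d] by (simp add: u word_append word_Cons add.assoc)
    then have "len (word (u @ [d])) \<le> length (v @ w)" by (metis len_le)
    then show ?thesis using snoc.prems u by simp
  qed
qed simp

lemma card_separating: "card (separating x y) = len (- x + y)"
  using ex_geodesic[of "- x + y"] card_separating_geodesic[of _ x] by (metis minus_plus(2))

lemma separating_eq_empty: "separating x y = {} \<longleftrightarrow> x = y"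
proof
  assume "separating x y = {}"
  then have "len (- x + y) = 0" by (simp flip: card_separating)
  then have "- x + y = 0" using ex_geodesic[of "- x + y"] by auto
  then show "x = y" by (metis add.right_neutral minus_plus(2))
qed simp

text \<open>
  Two geodesics that cross no common hyperplane can be composed, since the number of hyperplanes
  that separate the end points is the sum of the lengths.
\<close>

lemma geodesic_concat:
  assumes "separating x y \<inter> separating y z = {}"
    and "- x + y = word u" "length u = len (word u)" "- y + z = word v" "length v = len (word v)"
  shows "length (u @ v) = len (word (u @ v))"
proof -
  have "separating x z = separating x y \<union> separating y z"
    using separating_trans[of x z y] assms(1) by auto
  then have "card (separating x z) = card (separating x y) + card (separating y z)"
    using assms(1) by (simp add: card_Un_disjoint finite_separating)
  moreover have "word (u @ v) = - x + z"
    by (simp add: word_append add.assoc flip: assms(2,4))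
  ultimately show ?thesis using assms by (simp add: card_separating)
qed

definition crossing :: "('v racg \<Rightarrow> 'v letter set) \<Rightarrow> 'v racg \<Rightarrow> ('v letter \<times> 'v racg set) set" where
  "crossing E q = {hyp h d | h d. rel E q h \<and> d \<in> E h}"

lemma separating_crossing: "rel E q h \<Longrightarrow> separating q h \<subseteq> crossing E q"
proof (induction rule: rel.induct)
  case (rel_step x y c)
  then show ?case
    by (auto simp: crossing_def separating_step)
qed simp

lemma crossing_rel: "convex_rel E \<Longrightarrow> rel E x y \<Longrightarrow> crossing E x = crossing E y"
  unfolding crossing_def using rel_trans rel_sym by blast

text \<open>
  If a hyperplane is adjacent to \<open>w\<close> and crosses the class of \<open>q\<close>, and \<open>q\<close> is the point of its
  class next to \<open>w\<close>, then the hyperplane is adjacent to \<open>q\<close> as well: a geodesic from \<open>w\<close> via \<open>q\<close>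
  to a point of the class at the hyperplane lies in the carrier of the hyperplane, hence uses
  letters commuting with \<open>d\<close>, and the direction \<open>d\<close> can be transported back along it to \<open>q\<close>.
\<close>

lemma adjacent_hyperplane:
  assumes E: "convex_rel E"
    and disj: "separating w q \<inter> crossing E q = {}"
    and H: "hyp w d \<in> crossing E q"
  shows "- w + q \<in> parab (perp d)" "d \<in> E q"
proof -
  obtain h0 where h0: "hyp w d = hyp h0 d" "rel E q h0" "d \<in> E h0"
    using H unfolding crossing_def by (auto simp: hyp_eq)
  then have "- w + h0 \<in> parab (star d)" by (simp add: hyp_eq)
  then have "- w + h0 \<in> parab (perp d) \<or> - w + h0 + gen d \<in> parab (perp d)" by (rule parab_star)
  then obtain h where h: "- w + h \<in> parab (perp d)" "rel E q h" "d \<in> E h"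
  proof (elim disjE)
    assume "- w + h0 \<in> parab (perp d)"
    then show ?thesis using that h0 by blast
  next
    assume "- w + h0 + gen d \<in> parab (perp d)"
    then show ?thesis
      using that[of "h0 + gen d"] h0 rel_step[of E q h0 d] convex_relD(1)[OF E] by (simp add: add.assoc)
  qed
  obtain u v where u: "- w + q = word u" "length u = len (word u)"
    and v: "- q + h = word v" "length v = len (word v)"
    using ex_geodesic by metis
  have geo: "length (u @ v) = len (word (u @ v))"
    using geodesic_concat[of w q h u v] separating_crossing[OF h(2)] disj u v by blast
  have q: "q = w + word u" and hq: "h = q + word v" by (simp_all flip: u v)
  have "rel (\<lambda>_. perp d) w h" using h(1) by (simp add: rel_const)
  then have "walk (\<lambda>_. perp d) w (u @ v)"
    using geodesic_in_class[OF convex_const _ geo, of "perp d" w] by (simp add: hq q word_append add.assoc)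
  then have uv: "set u \<subseteq> perp d" "set v \<subseteq> perp d" by (auto simp: walk_const)
  then show "- w + q \<in> parab (perp d)" using u by (auto simp: parab_def)
  have "walk E q v" using geodesic_in_class[OF E _ v(2), of q] h(2) hq by simp
  moreover have "walk E q v \<Longrightarrow> set v \<subseteq> perp d \<Longrightarrow> d \<in> E (q + word v) \<Longrightarrow> d \<in> E q" for q
  proof (induction v arbitrary: q)
    case (Cons e v)
    then have "d \<in> E (q + gen e)" by (auto simp: word_Cons add.assoc)
    moreover have "e \<in> E (q + gen e)" using Cons convex_relD(1)[OF E] by auto
    ultimately have "d \<in> E (q + gen e + gen e)"
      using Cons.prems convex_relD(2)[OF E, of e "q + gen e" d] by (auto simp: perp_def comm_sym)
    then show ?case by simp
  qed simp
  ultimately show "d \<in> E q" using uv h(3) hq by blast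
qed

text \<open>
  Walk from \<open>p\<close> to \<open>x\<close> and let the gate follow whenever the hyperplane that is crossed also
  crosses the class; \<open>adjacent_hyperplane\<close> says that the gate can follow.
\<close>

lemma ex_gate:
  assumes E: "convex_rel E"
  shows "\<exists>g. rel E p g \<and> separating g x \<inter> crossing E p = {}"
proof -
  have "\<exists>g. rel E p g \<and> separating g (p + word u) \<inter> crossing E p = {}" for u
  proof (induction u rule: rev_induct)
    case Nil
    show ?case by (intro exI[of _ p]) simp
  next
    case (snoc d u)
    define x where "x = p + word u"
    then obtain g where g: "rel E p g" "separating g x \<inter> crossing E p = {}" using snoc by blast
    note cr = crossing_rel[OF E g(1)]
    have x': "p + word (u @ [d]) = x + gen d" by (simp add: x_def word_snoc)
    show ?case
    proof (cases "hyp x d \<in> crossing E p")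
      case True
      have *: "- x + g \<in> parab (perp d)" "d \<in> E g"
        using adjacent_hyperplane[OF E, of x g d] g True cr separating_sym[of x g] by auto
      have "- g + x \<in> parab (star d)" using *(1) parab_sym parab_mono[of "perp d" "star d"] by blast
      then have "hyp g d = hyp x d" by (simp add: hyp_eq)
      then have "separating (g + gen d) (x + gen d) = separating g x"
        using separating_trans[of "g + gen d" "x + gen d" g] separating_trans[of g "x + gen d" x]
          separating_sym[of "g + gen d" g] by auto
      then show ?thesis
        using g * rel_step[of E p g d] by (intro exI[of _ "g + gen d"]) (simp add: x')
    next
      case False
      then show ?thesis
        using g by (intro exI[of _ g]) (auto simp: x' separating_step)
    qed
  qed
  moreover obtain u where "- p + x = word u" using ex_word by blast
  then have "x = p + word u" by (metis minus_plus(2))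
  ultimately show ?thesis by blast
qed

text \<open>
  The nearest point to \<open>x\<close> in the class of \<open>p\<close>: no hyperplane that separates them crosses the
  class.
\<close>

definition gate :: "('v racg \<Rightarrow> 'v letter set) \<Rightarrow> 'v racg \<Rightarrow> 'v racg \<Rightarrow> 'v racg" where
  "gate E p x = (SOME g. rel E p g \<and> separating g x \<inter> crossing E p = {})"

lemma gate:
  assumes "convex_rel E"
  shows "rel E p (gate E p x)" "separating (gate E p x) x \<inter> crossing E p = {}"
  using someI_ex[OF ex_gate[OF assms, of p x]] unfolding gate_def by auto

lemma gate_eq:
  assumes E: "convex_rel E" and g: "rel E p g" "separating g x \<inter> crossing E p = {}"
  shows "gate E p x = g"
proof -
  let ?g = "gate E p x"
  have "rel E g ?g" using gate(1)[OF E] g(1) rel_sym[OF E] rel_trans by blast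
  then have "separating g ?g \<subseteq> crossing E p"
    using separating_crossing[of E g] crossing_rel[OF E g(1)] by simp
  moreover have "separating g ?g \<inter> crossing E p = {}"
    using separating_trans[of g ?g x] g(2) gate(2)[OF E, of p x] separating_sym[of x ?g] by auto
  ultimately show ?thesis using separating_eq_empty[of g ?g] by auto
qed

lemma gate_self: "convex_rel E \<Longrightarrow> rel E p x \<Longrightarrow> gate E p x = x"
  by (rule gate_eq) auto

lemma len_gate:
  assumes E: "convex_rel E" and g: "rel E p g"
  shows "len (- g + x) = len (- g + gate E p x) + len (- gate E p x + x)"
proof -
  let ?g = "gate E p x"
  have "rel E g ?g" using gate(1)[OF E] g(1) rel_sym[OF E] rel_trans by blast
  then have "separating g ?g \<subseteq> crossing E p"
    using separating_crossing[of E g] crossing_rel[OF E g(1)] by simp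
  then have *: "separating g ?g \<inter> separating ?g x = {}" using gate(2)[OF E, of p x] by blast
  then have "separating g x = separating g ?g \<union> separating ?g x"
    using separating_trans[of g x ?g] by auto
  then have "card (separating g x) = card (separating g ?g) + card (separating ?g x)"
    using * by (simp add: card_Un_disjoint finite_separating)
  then show ?thesis by (simp add: card_separating)
qed

text \<open>
  The gates in a coset of the parabolic subgroup of \<open>J\<close> of all points of a class of \<open>E\<close>. Take a
  point \<open>q0\<close> of the class at minimal distance from the coset and its displacement \<open>s\<close> from its
  gate. No hyperplane that separates \<open>q0\<close> from its gate crosses the coset or the class. Going
  along geodesics between gates, each hyperplane that is crossed also crosses the class, hence
  commutes with \<open>s\<close>. So the gates form a parallel copy of a subset of the class, displaced by \<open>s\<close>.
\<close>

lemma bridge: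
  assumes E: "convex_rel E"
  shows "\<exists>s. (\<forall>x. rel E q x \<longrightarrow> rel E x (gate (\<lambda>_. J) p x + s)) \<and>
     (\<forall>x y. rel E q x \<longrightarrow> rel E q y \<longrightarrow>
        rel (\<lambda>z. {d \<in> J. gen d + s = s + gen d \<and> d \<in> E (z + s)}) (gate (\<lambda>_. J) p x) (gate (\<lambda>_. J) p y)) \<and>
     ((\<exists>x. rel E q x \<and> - p + x \<in> parab J) \<longrightarrow> s = 0)"
proof -
  define C :: "'a racg \<Rightarrow> 'a letter set" where "C = (\<lambda>_. J)"
  have C: "convex_rel C" by (simp add: C_def convex_const)
  define \<pi> where "\<pi> = gate C p"
  obtain q0 where q0: "rel E q q0" and min: "\<And>x. rel E q x \<Longrightarrow> len (- \<pi> q0 + q0) \<le> len (- \<pi> x + x)"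
    using ex_has_least_nat[of "rel E q" q "\<lambda>x. len (- \<pi> x + x)"] by auto
  define g0 where "g0 = \<pi> q0"
  define s where "s = - g0 + q0"
  define E' where "E' = (\<lambda>z. {d \<in> J. gen d + s = s + gen d \<and> d \<in> E (z + s)})"
  have "convex_rel E'"
  proof -
    have "z + gen d + s = z + s + gen d" if "gen d + s = s + gen d" for z d
      using that by (simp add: add.assoc)
    then show ?thesis
      using convex_relD[OF E] unfolding convex_rel_def E'_def by auto
  qed
  have CJ: "crossing C x = crossing C p" if "rel C p x" for x
    using crossing_rel[OF C that] by simp
  have Eq: "crossing E x = crossing E q" if "rel E q x" for x
    using crossing_rel[OF E that] by simp
  have A1: "separating g0 q0 \<inter> crossing C p = {}"
    using gate(2)[OF C] by (simp add: g0_def \<pi>_def)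
  \<comment> \<open>otherwise the gate of \<open>g0\<close> in the class and its gate in the coset would be closer to each other\<close>
  have A2: "separating g0 q0 \<inter> crossing E q = {}"
  proof -
    define q' where "q' = gate E q g0"
    have q': "rel E q q'" "separating q' g0 \<inter> crossing E q = {}"
      using gate[OF E] by (auto simp: q'_def)
    have inv: "len (- a + b) = len (- b + a)" for a b :: "'a racg"
      using card_separating[of a b] card_separating[of b a] separating_sym[of a b] by simp
    have "len (- q0 + g0) = len (- q0 + q') + len (- q' + g0)"
      using len_gate[OF E q0, of g0] by (simp add: q'_def)
    moreover have "len (- g0 + q') = len (- g0 + \<pi> q') + len (- \<pi> q' + q')"
      using len_gate[OF C, of p g0 q'] gate(1)[OF C, of p q0] by (simp add: \<pi>_def g0_def)
    ultimately have "len (- q0 + q') = 0"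
      using min[OF q'(1)] inv[of q0 g0] inv[of q' g0] by (simp flip: g0_def)
    then have "q0 = q'" using card_separating[of q0 q'] finite_separating[of q0 q'] separating_eq_empty[of q0 q'] by simp
    then show ?thesis using q' separating_sym[of q' g0] by simp
  qed
  have key: "rel E' g0 (\<pi> x) \<and> rel E q (\<pi> x + s)" if x: "rel E q x" for x
  proof -
    define g where "g = \<pi> x"
    have gx: "separating g x \<inter> crossing C p = {}" "rel C p g" "rel C p g0"
      using gate[OF C] by (auto simp: g_def g0_def \<pi>_def)
    obtain u where u: "- g0 + g = word u" "length u = len (word u)" using ex_geodesic by metis
    have "rel E' g0 (g0 + word v) \<and> rel E q (g0 + word v + s) \<and>
      separating (g0 + word v) (g0 + word v + s) = separating g0 q0" if "u = v @ w" for v w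
      using that
    proof (induction v arbitrary: w rule: rev_induct)
      case Nil
      then show ?case using q0 by (simp add: s_def)
    next
      case (snoc d v)
      define h where "h = g0 + word v"
      have IH: "rel E' g0 h" "rel E q (h + s)" "separating h (h + s) = separating g0 q0"
        using snoc by (auto simp: h_def)
      have "walk C g0 u"
        using geodesic_in_class[OF C _ u(2), of g0] gx rel_sym[OF C] rel_trans u(1)
        by (metis minus_plus(2))
      then have "d \<in> J" "walk C g0 v" using snoc.prems by (auto simp: C_def walk_const)
      then have h: "rel C p h" using walk_rel[of C g0 v] gx rel_trans by (auto simp: h_def)
      have g: "g = h + word (d # w)"
      proof -
        have "g = g0 + (- g0 + g)" by (simp only: minus_plus)
        then have "g = g0 + word u" by (simp only: u(1))
        then show ?thesis using snoc.prems by (simp add: h_def add.assoc word_append)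
      qed
      have geo: "length (d # w) = len (word (d # w))"
      proof -
        obtain t where t: "word (d # w) = word t" "length t = len (word (d # w))" using ex_geodesic by metis
        have "word u = word (v @ t)" using snoc.prems t by (simp add: word_append)
        then have "length u \<le> length (v @ t)" using u(2) len_le by metis
        then show ?thesis using snoc.prems t len_le[of "d # w"] by simp
      qed
      have "hyp h d \<in> separating h g"
      proof (rule ccontr)
        assume *: "hyp h d \<notin> separating h g"
        have "separating (h + gen d) g = insert (hyp h d) (separating h g)"
          using * separating_trans[of "h + gen d" g h] separating_sym[of "h + gen d" h] by auto
        then have "card (separating (h + gen d) g) = Suc (length (d # w))"
          using * geo g finite_separating[of h g] card_separating[of h g] by simp
        moreover have "g = h + gen d + word w" by (simp add: g word_Cons add.assoc)
        then have "- (h + gen d) + g = word w" by (simp only: minus_plus)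
        then have "card (separating (h + gen d) g) \<le> length w"
          using card_separating[of "h + gen d" g] len_le[of w] by (simp only:)
        ultimately show False by simp
      qed
      moreover have "separating h g \<subseteq> crossing C p"
        using separating_crossing[of C h g] CJ[OF h] gx(2) h rel_sym[OF C] rel_trans by metis
      ultimately have H: "hyp h d \<in> separating h g" "hyp h d \<in> crossing C p" by auto
      have "hyp h d \<in> separating (h + s) x"
        using separating_trans[of "h + s" x h] separating_trans[of h x g] H A1 gx(1)
          separating_sym[of h "h + s"] IH(3) by auto
      then have "hyp h d \<in> crossing E (h + s)"
        using separating_crossing[of E "h + s" x] x IH(2) rel_sym[OF E] rel_trans by blast
      then have adj: "s \<in> parab (perp d)" "d \<in> E (h + s)"
        using adjacent_hyperplane[OF E, of h "h + s" d] IH(3) A2 Eq[OF IH(2)] by auto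
      have sd: "s + gen d = gen d + s" by (rule parab_perp_commute[OF adj(1)])
      then have hd: "h + gen d + s = h + s + gen d" by (simp add: add.assoc)
      have "hyp (h + s) d = hyp h d"
        using adj(1) parab_mono[of "perp d" "star d"] by (auto simp: hyp_eq uminus_plus add.assoc)
      then have "separating (h + gen d) (h + s + gen d) = separating h (h + s)"
        using separating_trans[of "h + gen d" "h + s + gen d" h] separating_trans[of h "h + s + gen d" "h + s"]
          separating_sym[of "h + gen d" h] by auto
      moreover have "rel E' g0 (h + gen d)"
        using rel_step[OF IH(1), of d] adj \<open>d \<in> J\<close> sd by (simp add: E'_def)
      moreover have "rel E q (h + s + gen d)" using rel_step[OF IH(2) adj(2)] .
      ultimately show ?case
        using IH(3) hd by (simp add: h_def word_append add.assoc)
    qed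
    from this[of u "[]"] show ?thesis by (simp flip: u(1) g_def)
  qed
  have "rel E x (\<pi> x + s)" if "rel E q x" for x
    using key[OF that] that rel_sym[OF E] rel_trans by blast
  moreover have "rel E' (\<pi> x) (\<pi> y)" if "rel E q x" "rel E q y" for x y
    using key[OF that(1)] key[OF that(2)] rel_sym[OF \<open>convex_rel E'\<close>] rel_trans by blast
  moreover have "s = 0" if "rel E q x" "- p + x \<in> parab J" for x
  proof -
    have "\<pi> x = x" using gate_self[OF C, of p x] that by (simp add: \<pi>_def C_def rel_const)
    moreover have "len (0 :: 'a racg) = 0" using len_le[of "[] :: 'a letter list"] by simp
    ultimately have "len s = 0" using min[OF that(1)] by (simp add: s_def g0_def)
    then show ?thesis using ex_geodesic[of s] by auto
  qed
  ultimately show ?thesis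
    unfolding E'_def \<pi>_def C_def by blast
qed

section \<open>Normal subgroups of finite index\<close>

text \<open>
  Cosets are described by terms \<open>x + - y\<close> and \<open>- x + y\<close>. The group is not commutative, and most
  rewriting with differences is only available in commutative groups.
\<close>

declare add_uminus_conv_diff [simp del]

lemma plus_minus [simp]: "x + y + - y = x" "x + - y + y = (x :: 'a::group_add)"
  by (simp_all add: add.assoc)

text \<open>
  A normal subgroup of finite index; the last conjunct bounds the index by the number of
  representatives. The group is a type, so that its subgroups are plain sets.
\<close>

definition fin_normal :: "'v racg set \<Rightarrow> bool" where
  "fin_normal M \<longleftrightarrow> 0 \<in> M \<and> (\<forall>x\<in>M. \<forall>y\<in>M. x + y \<in> M) \<and> (\<forall>x\<in>M. - x \<in> M) \<and>
     (\<forall>x\<in>M. \<forall>g. g + x + - g \<in> M) \<and> (\<exists>R. finite R \<and> (\<forall>x. \<exists>r\<in>R. x + - r \<in> M))"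

lemma fin_normalD:
  assumes "fin_normal M"
  shows "0 \<in> M" "x \<in> M \<Longrightarrow> y \<in> M \<Longrightarrow> x + y \<in> M" "x \<in> M \<Longrightarrow> - x \<in> M"
    "x \<in> M \<Longrightarrow> g + x + - g \<in> M" "x \<in> M \<Longrightarrow> - g + x + g \<in> M"
proof -
  show *: "x \<in> M \<Longrightarrow> g + x + - g \<in> M" for g x using assms unfolding fin_normal_def by simp
  show "0 \<in> M" "x \<in> M \<Longrightarrow> y \<in> M \<Longrightarrow> x + y \<in> M" "x \<in> M \<Longrightarrow> - x \<in> M"
    using assms unfolding fin_normal_def by simp_all
  show "x \<in> M \<Longrightarrow> - g + x + g \<in> M" using *[of x "- g"] by simp
qed

definition cong :: "'v racg set \<Rightarrow> 'v racg \<Rightarrow> 'v racg \<Rightarrow> bool" where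
  "cong M x y \<longleftrightarrow> x + - y \<in> M"

lemma cong_iff: "cong M x y \<longleftrightarrow> (\<exists>m\<in>M. x = m + y)"
proof
  assume "cong M x y"
  moreover have "x = x + - y + y" by simp
  ultimately show "\<exists>m\<in>M. x = m + y" unfolding cong_def by blast
qed (auto simp: cong_def add.assoc)

lemma cong_refl: "fin_normal M \<Longrightarrow> cong M x x"
  by (simp add: cong_def fin_normalD)

lemma cong_sym: "fin_normal M \<Longrightarrow> cong M x y \<Longrightarrow> cong M y x"
  using fin_normalD(3)[of M "x + - y"] by (simp add: cong_def minus_add)

lemma cong_trans: "fin_normal M \<Longrightarrow> cong M x y \<Longrightarrow> cong M y z \<Longrightarrow> cong M x z"
  using fin_normalD(2)[of M "x + - y" "y + - z"] by (simp add: cong_def add.assoc)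

lemma cong_add_right: "cong M (x + z) (y + z) \<longleftrightarrow> cong M x y"
proof -
  have "x + z + - (y + z) = x + - y"
    by (simp add: minus_add add.assoc)
  then show ?thesis by (simp only: cong_def)
qed

lemma cong_add_left:
  assumes "fin_normal M" shows "cong M (z + x) (z + y) \<longleftrightarrow> cong M x y"
proof -
  have *: "z + x + - (z + y) = z + (x + - y) + - z" for z x y :: "'a racg"
    by (simp add: minus_add add.assoc)
  have "cong M (z + x) (z + y)" if "cong M x y" for z x y
    using fin_normalD(4)[OF assms, of "x + - y" z] that unfolding cong_def * .
  from this[of x y z] this[of "z + x" "z + y" "- z"] show ?thesis by auto
qed

lemma cong_mem: "fin_normal M \<Longrightarrow> m \<in> M \<Longrightarrow> cong M (m + x) x"
  by (auto simp: cong_iff)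

lemma cong_mono: "cong M x y \<Longrightarrow> M \<subseteq> N \<Longrightarrow> cong N x y"
  by (auto simp: cong_def)

lemma finite_range_reps:
  assumes "finite (range F)" "\<And>x y. F x = F y \<Longrightarrow> P x y"
  shows "\<exists>R. finite R \<and> (\<forall>x. \<exists>r\<in>R. P x r)"
proof (intro exI conjI allI)
  show "finite ((\<lambda>v. SOME y. F y = v) ` range F)" using assms(1) by simp
  fix x
  have "F (SOME y. F y = F x) = F x" by (rule someI) simp
  then have "P x (SOME y. F y = F x)" by (intro assms(2)) simp
  then show "\<exists>r\<in>(\<lambda>v. SOME y. F y = v) ` range F. P x r" by blast
qed

lemma fin_normal_reps:
  assumes "fin_normal M"
  shows "\<exists>rep. finite (range rep) \<and> (\<forall>x. cong M x (rep x))"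
proof -
  obtain R where R: "finite R" "\<And>x. \<exists>r\<in>R. cong M x r"
    using assms unfolding fin_normal_def cong_def by blast
  then obtain rep where rep: "\<And>x. rep x \<in> R \<and> cong M x (rep x)" by metis
  then have "finite (range rep)" using R(1) finite_subset[of "range rep" R] by blast
  then show ?thesis using rep by blast
qed

lemma fin_normal_Int:
  assumes M: "fin_normal M" and N: "fin_normal N" shows "fin_normal (M \<inter> N)"
proof -
  obtain rM where rM: "finite (range rM)" "\<And>x. cong M x (rM x)" using fin_normal_reps[OF M] by blast
  obtain rN where rN: "finite (range rN)" "\<And>x. cong N x (rN x)" using fin_normal_reps[OF N] by blast
  have "range (\<lambda>x. (rM x, rN x)) \<subseteq> range rM \<times> range rN" by auto
  then have "finite (range (\<lambda>x. (rM x, rN x)))"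
    using rM(1) rN(1) by (meson finite_SigmaI finite_subset)
  moreover have "x + - y \<in> M \<inter> N" if "(rM x, rN x) = (rM y, rN y)" for x y
  proof -
    have "cong M x y" using cong_trans[OF M rM(2)[of x]] cong_sym[OF M rM(2)[of y]] that by simp
    moreover have "cong N x y" using cong_trans[OF N rN(2)[of x]] cong_sym[OF N rN(2)[of y]] that by simp
    ultimately show ?thesis by (simp add: cong_def)
  qed
  ultimately have X: "\<exists>R. finite R \<and> (\<forall>x. \<exists>r\<in>R. x + - r \<in> M \<inter> N)"
    by (rule finite_range_reps)
  show ?thesis
    unfolding fin_normal_def by (intro conjI X) (auto simp: fin_normalD[OF M] fin_normalD[OF N])
qed

lemma fin_normal_UNIV: "fin_normal UNIV"
  unfolding fin_normal_def by (intro conjI exI[of _ "{0}"]) auto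

lemma fin_normal_INT: "finite I \<Longrightarrow> (\<And>i. i \<in> I \<Longrightarrow> fin_normal (M i)) \<Longrightarrow> fin_normal (\<Inter>i\<in>I. M i)"
  by (induction I rule: finite_induct) (auto simp: fin_normal_UNIV fin_normal_Int)

lemma act_fold: "commuting_involutions f \<Longrightarrow> \<exists>u. x = word u \<and> (\<forall>p. act f p x = fold f u p)"
  using ex_word[of x] act_word by metis

text \<open>
  The kernel of an action on finitely many classes. All finite quotients of the Coxeter group
  below arise in this way.
\<close>

lemma fin_normal_kernel:
  assumes f: "commuting_involutions f"
    and eqv: "\<And>p. eqv p p" "\<And>p q. eqv p q \<Longrightarrow> eqv q p" "\<And>p q r. eqv p q \<Longrightarrow> eqv q r \<Longrightarrow> eqv p r"
    and compat: "\<And>c p q. eqv p q \<Longrightarrow> eqv (f c p) (f c q)"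
    and fin: "finite R" "\<And>p. \<exists>r\<in>R. eqv p r"
  shows "fin_normal {x. \<forall>p. eqv (act f p x) p}"
proof -
  have act: "eqv (act f p x) (act f q x)" if "eqv p q" for p q x
  proof -
    obtain u where "\<And>p. act f p x = fold f u p" using act_fold[OF f] by blast
    moreover have "eqv p q \<Longrightarrow> eqv (fold f u p) (fold f u q)" for p q
      by (induction u arbitrary: p q) (auto intro: compat)
    ultimately show ?thesis using that by simp
  qed
  obtain \<rho> where \<rho>: "\<And>p. \<rho> p \<in> R \<and> eqv p (\<rho> p)" using fin(2) by metis
  define F where "F x = restrict (\<lambda>r. \<rho> (act f r x)) R" for x
  have "range F \<subseteq> (\<Pi>\<^sub>E r\<in>R. R)" using \<rho> unfolding F_def by auto
  then have "finite (range F)" using finite_PiE[OF fin(1)] fin(1) by (meson finite_subset)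
  moreover have "eqv (act f p (x + - y)) p" if "F x = F y" for x y p
  proof -
    have *: "eqv (act f q x) (act f q y)" for q
    proof -
      obtain r where r: "r \<in> R" "eqv q r" using fin(2) by blast
      have "\<rho> (act f r x) = \<rho> (act f r y)"
        using fun_cong[OF that, of r] r by (simp add: F_def)
      then have "eqv (act f r x) (act f r y)" using \<rho> eqv by metis
      then show ?thesis using act[OF r(2)] eqv by meson
    qed
    have "eqv (act f (act f p x) (- y)) (act f (act f p y) (- y))" by (rule act[OF *])
    then show ?thesis by (simp add: act_plus[OF f, symmetric] f)
  qed
  ultimately have "\<exists>R. finite R \<and> (\<forall>x. \<exists>r\<in>R. x + - r \<in> {x. \<forall>p. eqv (act f p x) p})"
    by (intro finite_range_reps[where F = F]) auto
  moreover have "eqv (act f p (- x)) p" if "\<forall>p. eqv (act f p x) p" for x p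
  proof -
    have "eqv (act f (act f p (- x)) x) (act f p (- x))" using that by blast
    moreover have "act f (act f p (- x)) x = p" by (simp add: act_plus[OF f, symmetric] f)
    ultimately show ?thesis using eqv(2) by simp
  qed
  moreover have "eqv (act f p (g + x + - g)) p" if "\<forall>p. eqv (act f p x) p" for x p g
  proof -
    have "eqv (act f (act f p g) x) (act f p g)" using that by blast
    then have "eqv (act f (act f (act f p g) x) (- g)) (act f (act f p g) (- g))" by (rule act)
    moreover have "act f (act f p g) (- g) = p" by (simp add: act_plus[OF f, symmetric] f)
    ultimately show ?thesis by (simp add: act_plus[OF f])
  qed
  moreover have "eqv (act f p (x + y)) p" if "\<forall>p. eqv (act f p x) p" "\<forall>p. eqv (act f p y) p" for x y p
    using that eqv(3) by (metis act_plus[OF f])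
  ultimately show ?thesis
    unfolding fin_normal_def using eqv(1) f by (simp)
qed

section \<open>Relations invariant under a subgroup of finite index\<close>

definition inv_rel :: "'v racg set \<Rightarrow> ('v racg \<Rightarrow> 'v letter set) \<Rightarrow> bool" where
  "inv_rel M E \<longleftrightarrow> (\<forall>m\<in>M. \<forall>x. E (m + x) = E x)"

lemma inv_relD: "inv_rel M E \<Longrightarrow> m \<in> M \<Longrightarrow> E (m + x) = E x"
  by (simp add: inv_rel_def)

lemma inv_rel_mono: "inv_rel M E \<Longrightarrow> N \<subseteq> M \<Longrightarrow> inv_rel N E"
  by (auto simp: inv_rel_def)

lemma rel_inv: "inv_rel M E \<Longrightarrow> m \<in> M \<Longrightarrow> rel E (m + x) (m + y) \<longleftrightarrow> rel E x y"
  by (rule rel_translate) (simp add: inv_rel_def)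

definition supp :: "('v racg \<Rightarrow> 'v letter set) \<Rightarrow> 'v letter set" where
  "supp E = (\<Union>x. E x)"

text \<open>
  The sides of polygons. There are finitely many of them for given \<open>M\<close> of finite index and finite
  \<open>C\<close>, and hence a single subgroup of finite index can be small enough for all.
\<close>

definition rels :: "'v racg set \<Rightarrow> 'v letter set \<Rightarrow> ('v racg \<Rightarrow> 'v letter set) set" where
  "rels M C = {E. convex_rel E \<and> inv_rel M E \<and> supp E \<subseteq> C}"

text \<open>
  The last side of a polygon may also be the family of the carriers of all hyperplanes of a
  letter: this side appears when a polygon is cut along a hyperplane.
\<close>

definition closing_rels :: "'v racg set \<Rightarrow> 'v letter set \<Rightarrow> ('v racg \<Rightarrow> 'v letter set) set" where
  "closing_rels M C = rels M C \<union> {\<lambda>_. star c | c. c \<in> C}"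

lemma relsD:
  assumes "E \<in> rels M C"
  shows "convex_rel E" "inv_rel M E" "supp E \<subseteq> C"
  using assms by (auto simp: rels_def)

lemma closing_relsD:
  assumes "E \<in> closing_rels M C"
  shows "convex_rel E" "inv_rel M E"
  using assms by (auto simp: closing_rels_def rels_def convex_const inv_rel_def)

lemma rels_mono: "N \<subseteq> M \<Longrightarrow> rels M C \<subseteq> rels N C" "N \<subseteq> M \<Longrightarrow> closing_rels M C \<subseteq> closing_rels N C"
  by (auto simp: rels_def closing_rels_def inv_rel_def)

lemma finite_closing_rels:
  assumes M: "fin_normal M" and C: "finite C"
  shows "finite (closing_rels M C)"
proof -
  obtain rep where rep: "finite (range rep)" "\<And>x. cong M x (rep x)" using fin_normal_reps[OF M] by blast
  have E: "E x = E (rep x)" if "E \<in> rels M C" for E x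
    using rep(2)[of x] inv_relD[OF relsD(2)[OF that]] unfolding cong_iff by metis
  define F where "F E = restrict E (range rep)" for E :: "'a racg \<Rightarrow> 'a letter set"
  have "E x \<subseteq> C" if "E \<in> rels M C" for E x
    using relsD(3)[OF that] by (auto simp: supp_def)
  then have "F ` rels M C \<subseteq> (\<Pi>\<^sub>E r\<in>range rep. Pow C)"
    unfolding F_def by (intro image_subsetI restrict_PiE_iff[THEN iffD2]) blast
  then have "finite (F ` rels M C)"
    using finite_PiE[OF rep(1), of "\<lambda>_. Pow C"] C by (meson finite_Pow_iff finite_subset)
  moreover have "inj_on F (rels M C)"
  proof (rule inj_onI, rule ext)
    fix E E' x assume "E \<in> rels M C" "E' \<in> rels M C" "F E = F E'"
    then have "F E (rep x) = F E' (rep x)" by simp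
    then show "E x = E' x"
      using E[OF \<open>E \<in> rels M C\<close>, of x] E[OF \<open>E' \<in> rels M C\<close>, of x] by (simp add: F_def)
  qed
  ultimately have "finite (rels M C)" by (rule finite_imageD)
  moreover have "finite {\<lambda>_ :: 'a racg. star c | c. c \<in> C}" using C by simp
  ultimately show ?thesis by (simp add: closing_rels_def)
qed

lemma imit_translate:
  assumes E: "convex_rel E" "inv_rel M E" and m: "m \<in> M"
  shows "act (imit E) (m + u) x = m + act (imit E) u x"
proof -
  obtain w where "\<And>p. act (imit E) p x = fold (imit E) w p" using act_fold[OF commuting_imit[OF E(1)]] by blast
  moreover have "fold (imit E) w (m + u) = m + fold (imit E) w u" for u
    by (induction w arbitrary: u) (auto simp: imit_def inv_relD[OF E(2) m] add.assoc)
  ultimately show ?thesis by simp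
qed

definition imit_kernel :: "'v racg set \<Rightarrow> ('v racg \<Rightarrow> 'v letter set) \<Rightarrow> 'v racg set" where
  "imit_kernel M E = {x. \<forall>u. cong M (act (imit E) u x) u}"

lemma fin_normal_imit_kernel:
  assumes M: "fin_normal M" and E: "convex_rel E" "inv_rel M E"
  shows "fin_normal (imit_kernel M E)"
proof -
  obtain rep where rep: "finite (range rep)" "\<And>x. cong M x (rep x)" using fin_normal_reps[OF M] by blast
  have "cong M (imit E c p) (imit E c q)" if "cong M p q" for c p q
    using that inv_relD[OF E(2)] unfolding cong_iff imit_def by (auto simp: add.assoc)
  then show ?thesis
    unfolding imit_kernel_def
    by (intro fin_normal_kernel[where R = "range rep"])
      (use rep cong_refl[OF M] cong_sym[OF M] cong_trans[OF M] commuting_imit[OF E(1)] in blast)+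
qed

text \<open>
  The colour of a hyperplane with letter \<open>c\<close> is its orbit under \<open>K\<close>, or equivalently its image in
  the quotient by \<open>K\<close>; the hyperplanes at \<open>w\<close> and at \<open>u\<close> have the same colour.
\<close>

definition colour :: "'v racg set \<Rightarrow> 'v letter \<Rightarrow> 'v racg \<Rightarrow> 'v racg \<Rightarrow> bool" where
  "colour K c w u \<longleftrightarrow> (\<exists>m\<in>K. \<exists>a\<in>parab (star c). - w + u = m + a)"

lemma colour_refl: "fin_normal K \<Longrightarrow> colour K c w w"
  unfolding colour_def using fin_normalD(1)[of K] by (intro bexI[of _ 0]) auto

lemma colour_right:
  assumes "a \<in> parab (star c)" shows "colour K c w (u + a) \<longleftrightarrow> colour K c w u"
proof -
  have "colour K c w (u + a)" if "colour K c w u" "a \<in> parab (star c)" for a u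
  proof -
    from that(1) obtain m b where mb: "m \<in> K" "b \<in> parab (star c)" "- w + u = m + b" unfolding colour_def by blast
    have "- w + (u + a) = m + (b + a)" using mb(3) by (simp add: add.assoc[symmetric])
    then show ?thesis unfolding colour_def using mb that parab_add by blast
  qed
  from this[of u a] this[of "u + a" "- a"] show ?thesis using assms by (auto simp: add.assoc)
qed

lemma colour_left:
  assumes K: "fin_normal K" and a: "a \<in> parab (star c)" shows "colour K c (w + a) u \<longleftrightarrow> colour K c w u"
proof -
  have "colour K c (w + a) u" if "colour K c w u" "a \<in> parab (star c)" for a w
  proof -
    from that(1) obtain m b where mb: "m \<in> K" "b \<in> parab (star c)" "- w + u = m + b" unfolding colour_def by blast
    have "- (w + a) + u = - a + (- w + u)" by (simp add: minus_add add.assoc)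
    also have "\<dots> = (- a + m + a) + (- a + b)" by (simp only: mb(3)) (simp add: add.assoc)
    finally have "- (w + a) + u = (- a + m + a) + (- a + b)" .
    moreover have "- a + m + a \<in> K" by (rule fin_normalD(5)[OF K mb(1)])
    moreover have "- a + b \<in> parab (star c)" using that mb by (simp add: parab_add)
    ultimately show ?thesis unfolding colour_def by blast
  qed
  from this[of w a] this[of "w + a" "- a"] show ?thesis using a by (auto simp: add.assoc)
qed

lemma colour_translate_right:
  assumes K: "fin_normal K" and m: "m \<in> K" shows "colour K c w (m + u) \<longleftrightarrow> colour K c w u"
proof -
  have "colour K c w (m + u)" if "colour K c w u" "m \<in> K" for m u
  proof -
    from that(1) obtain n b where mb: "n \<in> K" "b \<in> parab (star c)" "- w + u = n + b" unfolding colour_def by blast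
    have "- w + (m + u) = (- w + m + w) + (- w + u)" by (simp add: add.assoc)
    also have "\<dots> = (- w + m + w + n) + b" by (simp only: mb(3)) (simp add: add.assoc)
    finally have "- w + (m + u) = (- w + m + w + n) + b" .
    moreover have "- w + m + w + n \<in> K" by (intro fin_normalD(2)[OF K] fin_normalD(5)[OF K] mb that)
    ultimately show ?thesis unfolding colour_def using mb by blast
  qed
  from this[of u m] this[of "m + u" "- m"] show ?thesis using m fin_normalD(3)[OF K] by auto
qed

lemma colour_translate_left:
  assumes K: "fin_normal K" and m: "m \<in> K" shows "colour K c (m + w) u \<longleftrightarrow> colour K c w u"
proof -
  have "- (m + w) + u = - w + (- m + u)" by (simp add: minus_add add.assoc)
  then have "colour K c (m + w) u = colour K c w (- m + u)" by (simp only: colour_def)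
  then show ?thesis using colour_translate_right[OF K fin_normalD(3)[OF K m]] by simp
qed

lemma gen_star: "gen c \<in> parab (star c)" "comm c d \<Longrightarrow> gen d \<in> parab (star c)"
  by (auto intro!: parab_gen simp: perp_def)

lemma parab_perp_star: "x \<in> parab (perp c) \<Longrightarrow> x \<in> parab (star c)"
  using parab_mono[of "perp c" "star c"] by blast

text \<open>
  A hyperplane adjacent to a class that has the colour of a hyperplane crossing this class crosses
  it, too. An imitator in \<open>E\<close> of a walker from \<open>p\<close> to \<open>v\<close> ends up at \<open>v\<close>. The displacement of the
  walker is the sum of an element of \<open>K\<close>, which does not change the position modulo \<open>M\<close>, and of
  letters equal to or commuting with \<open>c\<close>, which preserve the direction \<open>c\<close>.
\<close>

lemma colour_crosses:
  assumes E: "convex_rel E" "inv_rel M E" and K: "K \<subseteq> imit_kernel M E"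
    and "rel E v p" "c \<in> E p" "colour K c p v"
  shows "c \<in> E v"
proof -
  let ?f = "imit E"
  have f: "commuting_involutions ?f" by (rule commuting_imit[OF E(1)])
  obtain m a where ma: "m \<in> K" "a \<in> parab (star c)" "- p + v = m + a" using assms(6) by (auto simp: colour_def)
  obtain u where u: "a = word u" "set u \<subseteq> star c" using ma(2) by (auto simp: parab_def)
  have "set u \<subseteq> star c \<Longrightarrow> c \<in> E q \<Longrightarrow> c \<in> E (fold ?f u q)" for q
  proof (induction u arbitrary: q)
    case (Cons d u)
    have "c \<in> E (imit E d q)"
    proof (cases "d \<in> E q")
      case True
      have "c \<in> E (q + gen d)"
      proof (cases "d = c")
        case True
        then show ?thesis using convex_relD(1)[OF E(1)] Cons.prems by blast
      next
        case False
        then have "comm d c" using Cons.prems by (auto simp: perp_def comm_sym)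
        then show ?thesis using convex_relD(2)[OF E(1) True] Cons.prems by blast
      qed
      then show ?thesis using True by simp
    qed (use Cons.prems in simp)
    then show ?case using Cons by simp
  qed simp
  then have c: "c \<in> E (act ?f p a)" using u assms(5) f by (simp add: act_word)
  have "cong M (act ?f p m) p" using K ma(1) unfolding imit_kernel_def by blast
  then obtain n where n: "n \<in> M" "act ?f p m = n + p" unfolding cong_iff by blast
  have "v = act ?f p (- p + v)" using act_imit_rel[OF E(1)] rel_sym[OF E(1) assms(4)] by metis
  also have "\<dots> = act ?f (act ?f p m) a" by (simp only: ma(3) act_plus[OF f])
  also have "\<dots> = n + act ?f p a" by (simp only: n(2) imit_translate[OF E n(1)])
  finally show ?thesis using c inv_relD[OF E(2) n(1)] by simp
qed

section \<open>Imitators that look at colours\<close>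

text \<open>
  A walker without restrictions, and an imitator who stays in his class of \<open>E\<close> and copies a step
  only if the two hyperplanes have the same colour.
\<close>

definition pair_step where
  "pair_step E K c p = (fst p + gen c,
     if c \<in> E (snd p) \<and> colour K c (fst p) (snd p) then snd p + gen c else snd p)"

lemma commuting_pair:
  assumes E: "convex_rel E" and K: "fin_normal K"
  shows "commuting_involutions (pair_step E K)"
proof -
  have inv: "c \<in> E (x + gen c) \<longleftrightarrow> c \<in> E x" for c x
    using convex_relD(1)[OF E, of c x] convex_relD(1)[OF E, of c "x + gen c"] by auto
  have sq: "d \<in> E (x + gen c) \<longleftrightarrow> d \<in> E x" if "c \<in> E x" "comm c d" for c d x
    using convex_relD(2)[OF E that(1), of d] convex_relD(2)[OF E, of c "x + gen c" d] that inv
    by auto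
  have cl [simp]: "colour K c (w + gen c) u = colour K c w u" "colour K c w (u + gen c) = colour K c w u"
    for c w u by (rule colour_left[OF K gen_star(1)] colour_right[OF gen_star(1)])+
  have cm: "colour K c (w + gen d) u = colour K c w u" "colour K c w (u + gen d) = colour K c w u"
    if "comm c d" for c d w u
    by (rule colour_left[OF K gen_star(2)[OF that]] colour_right[OF gen_star(2)[OF that]])+
  have "pair_step E K c (pair_step E K c p) = p" for c p
    by (cases p) (auto simp: pair_step_def inv)
  moreover have "pair_step E K c (pair_step E K d (w, u)) = pair_step E K d (pair_step E K c (w, u))"
    if "comm c d" for c d w u
  proof -
    have gc: "x + gen c + gen d = x + gen d + gen c" for x
      using gen_comm[OF that] by (simp add: add.assoc)
    note simps = cm[OF that] cm[OF comm_sym[OF that]] gc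
    show ?thesis
      using sq[of c u d] sq[of d u c] that comm_sym[OF that]
      by (cases "c \<in> E u \<and> colour K c w u"; cases "d \<in> E u \<and> colour K d w u")
        (auto simp: pair_step_def simps)
  qed
  ultimately show ?thesis
    unfolding commuting_involutions_def by (metis prod.collapse)
qed

text \<open>The position of the imitator when the walker has gone from \<open>w\<close> to \<open>w'\<close>.\<close>

definition imitator where
  "imitator E K w u w' = snd (act (pair_step E K) (w, u) (- w + w'))"

context
  fixes E :: "'v racg \<Rightarrow> 'v letter set" and K :: "'v racg set"
  assumes E: "convex_rel E" and K: "fin_normal K" and EK: "inv_rel K E"
begin

lemma act_pair: "act (pair_step E K) (w, u) (- w + w') = (w', imitator E K w u w')"
proof -
  let ?f = "pair_step E K"
  obtain v where v: "- w + w' = word v" "\<And>p. act ?f p (- w + w') = fold ?f v p"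
    using act_fold[OF commuting_pair[OF E K]] by blast
  have "fst (fold ?f v p) = fst p + word v" for p
    by (induction v arbitrary: p) (auto simp: pair_step_def word_Cons add.assoc)
  then have "fst (act ?f (w, u) (- w + w')) = w + (- w + w')" using v by simp
  then show ?thesis unfolding imitator_def by (metis minus_plus(2) prod.collapse)
qed

lemma imitator_refl [simp]: "imitator E K w u w = u"
  by (simp add: imitator_def commuting_pair[OF E K])

lemma imitator_trans: "imitator E K w' (imitator E K w u w') w'' = imitator E K w u w''"
proof -
  have "act (pair_step E K) (w, u) (- w + w' + (- w' + w'')) = (w'', imitator E K w' (imitator E K w u w') w'')"
    by (simp only: act_plus[OF commuting_pair[OF E K], of _ "- w + w'"] act_pair)
  moreover have "- w + w' + (- w' + w'') = - w + w''" by (simp add: add.assoc)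
  ultimately show ?thesis using act_pair[of w u w''] by simp
qed

lemma imitator_gen:
  "imitator E K w u (w + gen c) = (if c \<in> E u \<and> colour K c w u then u + gen c else u)"
  by (simp add: imitator_def act_gen commuting_pair[OF E K] pair_step_def)

lemma imitator_step:
  "imitator E K w u (w' + gen c) =
    (let u' = imitator E K w u w' in if c \<in> E u' \<and> colour K c w' u' then u' + gen c else u')"
  using imitator_trans[of w' w u "w' + gen c"] by (simp add: imitator_gen Let_def)

lemma walker_induct [case_names refl step]:
  assumes "P w" "\<And>w' c. P w' \<Longrightarrow> P (w' + gen c)" shows "P w'"
proof -
  have "P (w + word u)" for u
    by (induction u rule: rev_induct) (use assms in \<open>auto simp: word_snoc\<close>)
  then show ?thesis using ex_word[of "- w + w'"] by (metis minus_plus(2))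
qed

lemma imitator_rel: "rel E u (imitator E K w u w')"
  by (induction w' rule: walker_induct[where w = w]) (auto simp: imitator_step Let_def intro: rel.rel_step)

text \<open>Walker and imitator stay together, so that both cross the same hyperplane each time.\<close>

lemma imitator_follows: "rel E w w' \<Longrightarrow> imitator E K w w w' = w'"
  by (induction rule: rel.induct) (auto simp: imitator_step Let_def colour_refl[OF K])

lemma imitator_translate:
  assumes "m \<in> K" shows "imitator E K w (m + u) w' = m + imitator E K w u w'"
  by (induction w' rule: walker_induct[where w = w])
    (auto simp: imitator_step Let_def colour_translate_right[OF K assms] inv_relD[OF EK assms] add.assoc)

definition pair_kernel :: "'v racg set" where
  "pair_kernel = {x. \<forall>w u. cong K (imitator E K w u (w + x)) u}"

lemma fin_normal_pair_kernel: "fin_normal (K \<inter> pair_kernel)"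
proof -
  let ?f = "pair_step E K"
  define eqv where "eqv p q \<longleftrightarrow> cong K (fst p) (fst q) \<and> cong K (snd p) (snd q)" for p q
  obtain rep where rep: "finite (range rep)" "\<And>x. cong K x (rep x)" using fin_normal_reps[OF K] by blast
  have compat: "eqv (?f c p) (?f c q)" if "eqv p q" for c p q
  proof -
    obtain m n where "m \<in> K" "fst p = m + fst q" "n \<in> K" "snd p = n + snd q"
      using \<open>eqv p q\<close> unfolding eqv_def cong_iff by blast
    then show ?thesis
      unfolding eqv_def cong_iff pair_step_def
      by (auto simp: colour_translate_left[OF K] colour_translate_right[OF K] inv_relD[OF EK] add.assoc)
  qed
  have "fin_normal {x. \<forall>p. eqv (act ?f p x) p}"
  proof (rule fin_normal_kernel[where R = "range rep \<times> range rep" and eqv = eqv and f = ?f])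
    show "commuting_involutions ?f" by (rule commuting_pair[OF E K])
    show "eqv (?f c p) (?f c q)" if "eqv p q" for c p q by (rule compat[OF that])
    show "eqv p p" for p using cong_refl[OF K] by (simp add: eqv_def)
    show "eqv q p" if "eqv p q" for p q using that cong_sym[OF K] by (auto simp: eqv_def)
    show "eqv p r" if "eqv p q" "eqv q r" for p q r using that cong_trans[OF K] unfolding eqv_def by blast
    show "\<exists>r\<in>range rep \<times> range rep. eqv p r" for p
      using rep(2) by (intro bexI[of _ "(rep (fst p), rep (snd p))"]) (auto simp: eqv_def)
  qed (use rep in auto)
  moreover have "K \<inter> {x. \<forall>p. eqv (act ?f p x) p} = K \<inter> pair_kernel"
  proof -
    have "eqv (act ?f (w, u) x) (w, u) \<longleftrightarrow> cong K (imitator E K w u (w + x)) u" if "x \<in> K" for x w u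
    proof -
      have "act ?f (w, u) x = (w + x, imitator E K w u (w + x))" using act_pair[of w u "w + x"] by simp
      moreover have "cong K (w + x) (w + 0)"
        using cong_add_left[OF K, of w x 0] cong_mem[OF K that, of 0] by (simp del: add_0_right) simp
      ultimately show ?thesis by (simp add: eqv_def)
    qed
    then have *: "(\<forall>p. eqv (act ?f p x) p) \<longleftrightarrow> x \<in> pair_kernel" if "x \<in> K" for x
      using that by (simp add: pair_kernel_def split_paired_All)
    show ?thesis
    proof (rule Set.set_eqI)
      fix x show "x \<in> K \<inter> {x. \<forall>p. eqv (act ?f p x) p} \<longleftrightarrow> x \<in> K \<inter> pair_kernel"
        using *[of x] by (simp only: Int_iff mem_Collect_eq) blast
    qed
  qed
  ultimately show ?thesis using fin_normal_Int[OF K, of "{x. \<forall>p. eqv (act ?f p x) p}"] by simp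
qed

end

text \<open>
  If walker and imitator start at \<open>K\<close>-equivalent points and the walker moves in a class of some
  other relation \<open>E\<close>, then so does the imitator, although his steps are restricted by \<open>E0\<close> only:
  he crosses hyperplanes of the same colours as the walker, and these cross the class of \<open>E\<close>, by
  \<open>colour_crosses\<close>.
\<close>

lemma imitator_stays:
  assumes E0: "convex_rel E0" and K: "fin_normal K" and E0K: "inv_rel K E0"
    and E: "convex_rel E" "inv_rel M E" and KM: "K \<subseteq> M" "K \<subseteq> imit_kernel M E"
    and "rel E w w'" "m \<in> K"
  shows "rel E (m + w) (imitator E0 K w (m + w) w')"
  using \<open>rel E w w'\<close>
proof (induction rule: rel.induct)
  case (rel_refl x)
  then show ?case by (simp add: imitator_refl[OF E0 K E0K])
next
  case (rel_step w w' c)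
  define u where "u = imitator E0 K w (m + w) w'"
  have u: "rel E (m + w) u" using rel_step by (simp add: u_def)
  have mM: "m \<in> M" using KM(1) \<open>m \<in> K\<close> by blast
  have "rel E (m + w) (m + w')" using rel_step(1) rel_inv[OF E(2) mM] by simp
  then have r: "rel E u (m + w')" using u rel_sym[OF E(1)] rel_trans by blast
  have "c \<in> E u" if "colour K c w' u"
    by (rule colour_crosses[OF E KM(2) r])
      (use rel_step(2) inv_relD[OF E(2) mM] colour_translate_left[OF K \<open>m \<in> K\<close>] that in auto)
  then show ?case
    using u rel.rel_step[OF u] by (simp add: imitator_step[OF E0 K E0K] Let_def flip: u_def)
qed

section \<open>Polygons that close up in a finite quotient\<close>

lemma supp_subset: "supp E \<subseteq> J \<Longrightarrow> rel E x y \<Longrightarrow> - x + y \<in> parab J"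
  using rel_mono[of E x y "\<lambda>_. J"] by (auto simp: rel_const supp_def)

lemma rel_displaced:
  assumes "rel E' x y" "\<And>z c. c \<in> E' z \<Longrightarrow> c \<in> E (z + s) \<and> gen c + s = s + gen c"
  shows "rel E (x + s) (y + s)"
  using assms(1)
proof (induction rule: rel.induct)
  case (rel_step x y c)
  have "y + gen c + s = y + s + gen c" using assms(2)[OF rel_step(2)] by (simp add: add.assoc)
  then show ?case using rel.rel_step[OF rel_step(3), of c] assms(2)[OF rel_step(2)] by simp
qed simp

lemma displaced_rels:
  assumes E: "E \<in> rels M C" and s: "\<And>c. c \<in> J \<Longrightarrow> gen c + s = s + gen c"
  shows "(\<lambda>z. {c \<in> J. c \<in> E (z + s)}) \<in> rels M C"
proof -
  have "z + gen c + s = z + s + gen c" if "c \<in> J" for z c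
    using s[OF that] by (simp add: add.assoc)
  then have "convex_rel (\<lambda>z. {c \<in> J. c \<in> E (z + s)})"
    using convex_relD[OF relsD(1)[OF E]] unfolding convex_rel_def by auto
  moreover have "inv_rel M (\<lambda>z. {c \<in> J. c \<in> E (z + s)})"
    using inv_relD[OF relsD(2)[OF E]] by (simp add: inv_rel_def add.assoc)
  moreover have "supp (\<lambda>z. {c \<in> J. c \<in> E (z + s)}) \<subseteq> C"
    using relsD(3)[OF E] by (auto simp: supp_def)
  ultimately show ?thesis by (simp add: rels_def)
qed

text \<open>
  The family \<open>E\<close> moved by a displacement \<open>b\<close> on the right that commutes with its letters:
  subgraphs parallel to the given ones.
\<close>

definition shift :: "'v racg \<Rightarrow> ('v racg \<Rightarrow> 'v letter set) \<Rightarrow> 'v racg \<Rightarrow> 'v letter set" where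
  "shift b E = (\<lambda>z. {c \<in> supp E. c \<in> E (z + - b)})"

lemma rel_shift:
  assumes "\<And>c. c \<in> supp E \<Longrightarrow> gen c + b = b + gen c"
  shows "rel (shift b E) x y \<longleftrightarrow> rel E (x + - b) (y + - b)"
proof
  have n: "gen c + - b = - b + gen c" if "c \<in> supp E" for c
  proof -
    have "- b + (gen c + b) + - b = - b + (b + gen c) + - b" by (simp only: assms[OF that])
    then show ?thesis by (simp add: add.assoc)
  qed
  show "rel (shift b E) x y \<Longrightarrow> rel E (x + - b) (y + - b)"
    by (erule rel_displaced) (auto simp: shift_def n)
  assume "rel E (x + - b) (y + - b)"
  then have "rel (shift b E) (x + - b + b) (y + - b + b)"
    by (rule rel_displaced) (use assms in \<open>auto simp: shift_def supp_def\<close>)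
  then show "rel (shift b E) x y" by simp
qed

lemma shift_rels:
  assumes "E \<in> rels M C" "\<And>c. c \<in> supp E \<Longrightarrow> gen c + b = b + gen c"
  shows "shift b E \<in> rels M C"
  unfolding shift_def
proof (rule displaced_rels[OF assms(1)])
  fix c assume "c \<in> supp E"
  then have "- b + (gen c + b) + - b = - b + (b + gen c) + - b" by (simp only: assms(2))
  then show "gen c + - b = - b + gen c" by (simp add: add.assoc)
qed

lemma supp_shift: "supp (shift b E) \<subseteq> supp E"
  by (auto simp: shift_def supp_def)

text \<open>
  The first \<open>i\<close> sides of the polygon \<open>x\<close> pushed to parallel sides of a polygon \<open>y\<close>. Side \<open>l\<close> is
  pushed by \<open>b l\<close>, which maps the class of \<open>x l\<close> and \<open>x (Suc l)\<close> to a parallel class containing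
  \<open>y l\<close> and \<open>y (Suc l)\<close>.
\<close>

definition displaced where
  "displaced E x i y b \<longleftrightarrow> (\<forall>l<i. rel (E l) (x l) (y l + - b l) \<and> rel (E l) (y l + - b l) (x (Suc l)) \<and>
     y (Suc l) = x (Suc l) + b l \<and> (\<forall>c\<in>supp (E l). gen c + b l = b l + gen c))"

text \<open>
  If the displaced polygon is bent, to vertices \<open>p\<close>, then the given polygon can be bent
  accordingly: each of its vertices is translated by the element of \<open>M\<close> that moves the displaced
  vertex.
\<close>

lemma displaced_transfer:
  assumes M: "fin_normal M" and E: "\<And>l. l \<le> i \<Longrightarrow> E l \<in> rels M C"
    and d: "displaced E x i y b" and yi: "rel (E i) (x i) (y i)"
    and p: "\<And>l. l \<le> i \<Longrightarrow> cong M (p l) (y l)" "p 0 = y 0"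
      "\<And>l. l < i \<Longrightarrow> rel (shift (b l) (E l)) (p l) (p (Suc l))"
  shows "\<exists>x'. x' 0 = x 0 \<and> (\<forall>l\<le>i. cong M (x' l) (x l)) \<and> (\<forall>l<i. rel (E l) (x' l) (x' (Suc l))) \<and>
    rel (E i) (x' i) (p i)"
proof (intro exI conjI allI impI)
  define m where "m l = p l + - y l" for l
  define x' where "x' l = m l + x l" for l
  have m: "m l \<in> M" "p l = m l + y l" if "l \<le> i" for l
    using p(1)[OF that] by (auto simp: m_def cong_def)
  show "m 0 + x 0 = x 0" using p(2) by (simp add: m_def)
  show "cong M (m l + x l) (x l)" if "l \<le> i" for l using m[OF that] cong_mem[OF M] by blast
  show "rel (E l) (m l + x l) (m (Suc l) + x (Suc l))" if "l < i" for l
  proof -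
    have l: "l \<le> i" "Suc l \<le> i" using that by auto
    have dl: "rel (E l) (x l) (y l + - b l)" "y (Suc l) = x (Suc l) + b l"
      "\<And>c. c \<in> supp (E l) \<Longrightarrow> gen c + b l = b l + gen c"
      using d that by (auto simp: displaced_def)
    have "rel (E l) (m l + x l) (m l + (y l + - b l))"
      using dl(1) rel_inv[OF relsD(2)[OF E[OF l(1)]] m(1)[OF l(1)]] by simp
    moreover have "rel (E l) (p l + - b l) (p (Suc l) + - b l)"
      using p(3)[OF that] rel_shift[OF dl(3)] by simp
    moreover have "p (Suc l) + - b l = m (Suc l) + x (Suc l)"
      by (simp add: m(2)[OF l(2)] dl(2) add.assoc)
    moreover have "m l + (y l + - b l) = p l + - b l" by (simp add: m(2)[OF l(1)] add.assoc)
    ultimately show ?thesis using rel_trans by metis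
  qed
  show "rel (E i) (m i + x i) (p i)"
    using yi rel_inv[OF relsD(2)[OF E[OF order_refl]] m(1)[OF order_refl]] m(2)[OF order_refl] by simp
qed

text \<open>
  A polygon with sides \<open>E 0, \<dots>, E (k - 1)\<close>, closing side \<open>F\<close> and at most \<open>s\<close> letters on its sides
  that closes up modulo \<open>N\<close> can be replaced by one that closes up, with the same first vertex and
  the other vertices in the same cosets of \<open>M\<close>.
\<close>

definition closes where
  "closes C k s M N \<longleftrightarrow> (\<forall>E x F \<nu>. (\<forall>i<k. E i \<in> rels M C) \<longrightarrow> (\<Sum>i<k. card (supp (E i))) \<le> s \<longrightarrow>
     F \<in> closing_rels M C \<longrightarrow> (\<forall>i<k. rel (E i) (x i) (x (Suc i))) \<longrightarrow> \<nu> \<in> N \<longrightarrow> rel F (x k) (\<nu> + x 0) \<longrightarrow>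
     (\<exists>y. y 0 = x 0 \<and> (\<forall>i\<le>k. cong M (y i) (x i)) \<and> (\<forall>i<k. rel (E i) (y i) (y (Suc i))) \<and> rel F (y k) (x 0)))"

lemma closesD:
  assumes "closes C k s M N" "\<And>i. i < k \<Longrightarrow> E i \<in> rels M C" "(\<Sum>i<k. card (supp (E i))) \<le> s"
    "F \<in> closing_rels M C" "\<And>i. i < k \<Longrightarrow> rel (E i) (x i) (x (Suc i))" "\<nu> \<in> N" "rel F (x k) (\<nu> + x 0)"
  obtains y where "y 0 = x 0" "\<And>i. i \<le> k \<Longrightarrow> cong M (y i) (x i)"
    "\<And>i. i < k \<Longrightarrow> rel (E i) (y i) (y (Suc i))" "rel F (y k) (x 0)"
proof -
  have "\<exists>y. y 0 = x 0 \<and> (\<forall>i\<le>k. cong M (y i) (x i)) \<and> (\<forall>i<k. rel (E i) (y i) (y (Suc i))) \<and> rel F (y k) (x 0)"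
    by (rule assms(1)[unfolded closes_def, rule_format, OF assms(2-7)])
  then obtain y where y: "y 0 = x 0 \<and> (\<forall>i\<le>k. cong M (y i) (x i)) \<and> (\<forall>i<k. rel (E i) (y i) (y (Suc i))) \<and> rel F (y k) (x 0)"
    by (rule exE)
  note y1 = conjunct2[OF y] and y2 = conjunct2[OF conjunct2[OF y]]
  show thesis
    by (rule that[OF conjunct1[OF y] conjunct1[OF y1, rule_format] conjunct1[OF y2, rule_format] conjunct2[OF y2]])
qed

lemma closes_mono:
  assumes "closes C k s M N" "s' \<le> s" "N' \<subseteq> N"
  shows "closes C k s' M N'"
  unfolding closes_def
proof (intro allI impI)
  fix E x F \<nu>
  assume *: "\<forall>i<k. E i \<in> rels M C" "(\<Sum>i<k. card (supp (E i))) \<le> s'" "F \<in> closing_rels M C"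
    "\<forall>i<k. rel (E i) (x i) (x (Suc i))" "\<nu> \<in> N'" "rel F (x k) (\<nu> + x 0)"
  have "(\<Sum>i<k. card (supp (E i))) \<le> s" "\<nu> \<in> N" using *(2,5) assms by auto
  then show "\<exists>y. y 0 = x 0 \<and> (\<forall>i\<le>k. cong M (y i) (x i)) \<and>
      (\<forall>i<k. rel (E i) (y i) (y (Suc i))) \<and> rel F (y k) (x 0)"
    using assms(1)[unfolded closes_def, rule_format, OF *(1)[rule_format] _ *(3) *(4)[rule_format] _ *(6)] by blast
qed

text \<open>
  The imitator at \<open>y 0\<close> is about to cross a hyperplane of the same colour as the hyperplane with
  letter \<open>c\<close> at the point \<open>w\<close> on side \<open>i\<close>, where \<open>c\<close> does not commute with all letters of an
  earlier side \<open>l0\<close>. The polygon \<open>y 0, \<dots>, y i, w\<close> closes up modulo \<open>K\<close> through the carrier of this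
  hyperplane and has fewer sides than the given one. So it can be bent to a polygon \<open>p\<close> that
  closes up; all its vertices are then projected to the coset of the letters commuting with \<open>c\<close> at
  \<open>y 0\<close>. By \<open>bridge\<close> the projected sides \<open>g 0, \<dots>, g i\<close> use no letters but those that commute with
  \<open>c\<close>; replacing the first \<open>i\<close> sides by them gives a polygon with fewer letters, which can be bent
  to \<open>r\<close>. Finally the bridges from the projected sides to the sides of \<open>p\<close> are put back.
\<close>

lemma polygon_cut:
  assumes C: "finite C" and M: "fin_normal M" and Na: "fin_normal Na" "Na \<subseteq> M" and K: "fin_normal K" "K \<subseteq> Na"
    and IHs: "s > 0 \<Longrightarrow> closes C k (s - 1) M Na"
    and IHk: "closes C (Suc i) (k * card C) Na K"
    and E: "\<And>l. l < k \<Longrightarrow> E l \<in> rels M C" and sum: "(\<Sum>l<k. card (supp (E l))) \<le> s"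
    and F: "F \<in> closing_rels M C"
    and x: "\<And>l. l < k \<Longrightarrow> rel (E l) (x l) (x (Suc l))" "\<nu> \<in> Na" "rel F (x k) (\<nu> + x 0)"
    and i: "Suc i < k" and d: "displaced E x i y b" and yi: "rel (E i) (x i) (y i)"
    and w: "rel (E i) (x i) w" "c \<in> E i w" "colour K c w (y 0)"
    and l0: "l0 < i" "\<not> supp (E l0) \<subseteq> perp c"
    and y0: "rel F (x 0) (y 0)"
  shows "\<exists>y. y 0 = x 0 \<and> (\<forall>i\<le>k. cong M (y i) (x i)) \<and> (\<forall>i<k. rel (E i) (y i) (y (Suc i))) \<and> rel F (y k) (x 0)"
proof -
  have KM: "K \<subseteq> M" using Na K by blast
  have ik: "i < k" using i by simp
  note Ei = relsD[OF E[OF ik]]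
  note Fc = closing_relsD[OF F]
  have supp_fin: "finite (supp (E l))" "card (supp (E l)) \<le> card C" if "l < k" for l
    using relsD(3)[OF E[OF that]] C by (auto intro: finite_subset card_mono)
  have "c \<in> C" using Ei(3) w(2) by (auto simp: supp_def)
  define u where "u = y 0"
  define J where "J = perp c"
  define D where "D l = (if l < i then shift (b l) (E l) else E i)" for l
  have comm_b: "gen e + b l = b l + gen e" if "l < i" "e \<in> supp (E l)" for l e
    using d that by (auto simp: displaced_def)
  have D: "D l \<in> rels M C" "supp (D l) \<subseteq> supp (E (min l i))" for l
    using shift_rels[OF E comm_b, of l l] E[OF ik] supp_shift[of "b l" "E l"] i
    by (auto simp: D_def min_def)
  note Dc = relsD[OF D(1)]
  have yl: "rel (D l) (y l) (y (Suc l))" if "l < i" for l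
    using d that rel_shift[OF comm_b[OF that]] by (simp add: displaced_def D_def)
  obtain m a where ma: "m \<in> K" "a \<in> parab (star c)" "- w + u = m + a"
    using w(3) unfolding colour_def u_def by blast
  define m' where "m' = w + m + - w"
  have m': "m' \<in> K" unfolding m'_def by (rule fin_normalD(4)[OF K(1) ma(1)])
  have "u = w + (- w + u)" by (simp only: minus_plus)
  then have "u = m' + (w + a)" by (simp only: ma(3)) (simp add: m'_def add.assoc)
  then have "- m' + u = w + a" by simp
  \<comment> \<open>equal colours: up to an element of \<open>K\<close>, both ends lie in the carrier of one hyperplane\<close>
  then have cl: "rel (\<lambda>_. star c) w (- m' + u)" using ma(2) by (simp add: rel_const)
  \<comment> \<open>the polygon that is cut off\<close>
  define X where "X l = (if l \<le> i then y l else w)" for l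
  have "(\<Sum>l<Suc i. card (supp (D l))) \<le> (\<Sum>l<Suc i. card C)"
  proof (rule sum_mono)
    fix l
    have "min l i < k" using ik by simp
    then show "card (supp (D l)) \<le> card C"
      using supp_fin[of "min l i"] D(2)[of l] by (meson card_mono le_trans)
  qed
  also have "\<dots> \<le> k * card C" using mult_le_mono1[of "Suc i" k "card C"] i by simp
  finally have sumD: "(\<Sum>l<Suc i. card (supp (D l))) \<le> k * card C" .
  obtain p where p: "p 0 = X 0" "\<And>l. l \<le> Suc i \<Longrightarrow> cong Na (p l) (X l)"
    "\<And>l. l < Suc i \<Longrightarrow> rel (D l) (p l) (p (Suc l))" "rel (\<lambda>_. star c) (p (Suc i)) (X 0)"
  proof (rule closesD[OF IHk _ sumD])
    show "D l \<in> rels Na C" for l using D(1) rels_mono(1)[OF Na(2)] by blast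
    show "(\<lambda>_. star c) \<in> closing_rels Na C" using \<open>c \<in> C\<close> by (auto simp: closing_rels_def)
    show "rel (D l) (X l) (X (Suc l))" if "l < Suc i" for l
    proof (cases "l < i")
      case False
      then have "l = i" using that by simp
      then show ?thesis using rel_trans[OF w(1) rel_sym[OF Ei(1) yi]] by (simp add: D_def X_def)
    qed (use yl in \<open>auto simp: X_def\<close>)
    show "- m' \<in> K" using m' fin_normalD(3)[OF K(1)] by blast
    show "rel (\<lambda>_. star c) (X (Suc i)) (- m' + X 0)" using cl by (simp add: X_def u_def)
  qed (assumption | rule that)+
  have p0: "p 0 = u" using p(1) by (simp add: X_def u_def)
  obtain n where n: "n \<in> Na" "p (Suc i) = n + w" using p(2)[of "Suc i"] by (auto simp: X_def cong_iff)
  have nM: "n \<in> M" using n(1) Na(2) by blast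
  have cp: "c \<in> E i (p (Suc i))" using w(2) inv_relD[OF Ei(2) nM] n(2) by simp
  have pS: "rel (E i) (p i) (p (Suc i))" using p(3)[of i] by (simp add: D_def)
  \<comment> \<open>the last side meets the hyperplane, so it contains a point on our side of it\<close>
  obtain q where q: "rel (E i) (p i) q" "- u + q \<in> parab J"
  proof -
    have "- p (Suc i) + u \<in> parab (star c)" using p(4) by (simp add: rel_const X_def u_def)
    then have "- u + p (Suc i) \<in> parab (star c)" using parab_sym by blast
    then have "- u + p (Suc i) \<in> parab J \<or> - u + p (Suc i) + gen c \<in> parab J"
      unfolding J_def by (rule parab_star)
    then show ?thesis
      using that[of "p (Suc i)"] that[of "p (Suc i) + gen c"] pS rel_step[OF pS cp] by (auto simp: add.assoc)
  qed
  \<comment> \<open>projection to the coset of the letters commuting with \<open>c\<close>, and the bridges \<open>t l\<close> to it\<close>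
  define \<pi> where "\<pi> = gate (\<lambda>_. J) u"
  define bridging where "bridging l s \<longleftrightarrow> (\<forall>z. rel (D l) (p l) z \<longrightarrow> rel (D l) z (\<pi> z + s)) \<and>
      (\<forall>z z'. rel (D l) (p l) z \<longrightarrow> rel (D l) (p l) z' \<longrightarrow>
        rel (\<lambda>z. {d \<in> J. gen d + s = s + gen d \<and> d \<in> D l (z + s)}) (\<pi> z) (\<pi> z')) \<and>
      ((\<exists>z. rel (D l) (p l) z \<and> - u + z \<in> parab J) \<longrightarrow> s = 0)" for l s
  have "\<exists>s. bridging l s" for l
    unfolding \<pi>_def bridging_def by (rule bridge[OF Dc(1)])
  then obtain t where t0: "\<And>l. bridging l (t l)" by metis
  have t: "\<And>l z. rel (D l) (p l) z \<Longrightarrow> rel (D l) z (\<pi> z + t l)"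
    "\<And>l z z'. rel (D l) (p l) z \<Longrightarrow> rel (D l) (p l) z' \<Longrightarrow>
        rel (\<lambda>z. {d \<in> J. gen d + t l = t l + gen d \<and> d \<in> D l (z + t l)}) (\<pi> z) (\<pi> z')"
    "\<And>l z. rel (D l) (p l) z \<Longrightarrow> - u + z \<in> parab J \<Longrightarrow> t l = 0"
    using t0 unfolding bridging_def by blast+
  have ti: "t i = 0" using t(3)[of i q] q by (simp add: D_def)
  define g where "g l = \<pi> (p l)" for l
  have g0: "g 0 = u" using gate_self[OF convex_const rel_refl] by (simp add: g_def \<pi>_def p0)
  define D' where "D' l = (\<lambda>z. {d \<in> {d \<in> J \<inter> supp (D l). gen d + t l = t l + gen d}. d \<in> D l (z + t l)})" for l
  have D': "D' l \<in> rels M C" "supp (D' l) \<subseteq> supp (D l) \<inter> J" for l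
    using displaced_rels[OF D(1), of "{d \<in> J \<inter> supp (D l). gen d + t l = t l + gen d}" "t l"]
    by (auto simp: D'_def supp_def)
  have D'_alt: "D' l = (\<lambda>z. {d \<in> J. gen d + t l = t l + gen d \<and> d \<in> D l (z + t l)})" for l
    by (auto simp: D'_def supp_def)
  have D'D: "rel (D' l) z z' \<Longrightarrow> rel (D l) (z + t l) (z' + t l)" for l z z'
    by (erule rel_displaced) (auto simp: D'_def)
  have gl: "rel (D' l) (g l) (g (Suc l))" if "l < i" for l
    using t(2)[of l "p l" "p (Suc l)"] p(3)[of l] that by (simp add: g_def D'_alt)
  have gi: "rel (E i) (p i) (g i)" using t(1)[of i "p i"] ti by (simp add: g_def D_def)
  \<comment> \<open>the polygon with projected sides; side \<open>l0\<close> has lost a letter\<close>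
  define E' where "E' l = (if l < i then D' l else E l)" for l
  define x' where "x' l = (if l \<le> i then g l else n + x l)" for l
  have E': "E' l \<in> rels M C" if "l < k" for l using E[OF that] D'(1) by (simp add: E'_def)
  have supp_E': "supp (E' l) \<subseteq> supp (E l)" if "l < k" for l
    using D'(2)[of l] D(2)[of l] by (auto simp: E'_def min_def split: if_splits)
  have "supp (E' l0) \<subset> supp (E l0)"
    using D'(2)[of l0] D(2)[of l0] l0 by (auto simp: E'_def min_def J_def)
  then have "card (supp (E' l0)) < card (supp (E l0))"
    using supp_fin(1)[of l0] l0(1) ik by (intro psubset_card_mono) auto
  moreover have "card (supp (E' l)) \<le> card (supp (E l))" if "l < k" for l
    using supp_fin(1)[OF that] supp_E'[OF that] by (rule card_mono)
  ultimately have "(\<Sum>l<k. card (supp (E' l))) < (\<Sum>l<k. card (supp (E l)))"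
    using l0(1) ik by (intro sum_strict_mono_ex1) auto
  then have s: "(\<Sum>l<k. card (supp (E' l))) \<le> s - 1" "s > 0" using sum by auto
  obtain r where r: "r 0 = x' 0" "\<And>l. l \<le> k \<Longrightarrow> cong M (r l) (x' l)"
    "\<And>l. l < k \<Longrightarrow> rel (E' l) (r l) (r (Suc l))" "rel F (r k) (x' 0)"
  proof (rule closesD[OF IHs[OF s(2)] E' s(1) F, of x' "n + \<nu>"])
    show "rel (E' l) (x' l) (x' (Suc l))" if "l < k" for l
    proof -
      consider "l < i" | "l = i" | "l > i" by linarith
      then show ?thesis
      proof cases
        case 1
        then show ?thesis using gl by (simp add: x'_def E'_def)
      next
        case 2
        have "rel (E i) (g i) (n + w)" using gi pS n(2) rel_sym[OF Ei(1)] rel_trans by metis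
        moreover have "rel (E i) (n + w) (n + x (Suc i))"
          using w(1) x(1)[OF ik] rel_sym[OF Ei(1)] rel_trans rel_inv[OF Ei(2) nM] by metis
        ultimately show ?thesis using 2 rel_trans by (auto simp: x'_def E'_def)
      next
        case 3
        then show ?thesis
          using x(1)[OF that] rel_inv[OF relsD(2)[OF E[OF that]] nM] by (simp add: x'_def E'_def)
      qed
    qed
    show "n + \<nu> \<in> Na" using n(1) x(2) fin_normalD(2)[OF Na(1)] by blast
    have nu: "n + \<nu> \<in> M" using nM x(2) Na(2) fin_normalD(2)[OF M] by blast
    have "rel F (n + x k) (n + (\<nu> + x 0))" using x(3) rel_inv[OF Fc(2) nM] by simp
    moreover have "rel F (n + \<nu> + x 0) (n + \<nu> + u)" using y0 rel_inv[OF Fc(2) nu] by (simp add: u_def)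
    ultimately show "rel F (x' k) (n + \<nu> + x' 0)"
      using ik rel_trans by (simp add: x'_def g0 add.assoc)
  qed (assumption | rule that)+
  \<comment> \<open>\<open>p\<close> moved along with its projection\<close>
  define p' where "p' l = r l + - g l + p l" for l
  have rg: "r l + - g l \<in> M" if "l \<le> i" for l
    using r(2)[of l] that ik by (simp add: x'_def cong_def)
  have pg: "rel (D l) (p' l) (r l + t l)" if "l < i" for l
  proof -
    have "rel (D l) (p l) (g l + t l)" using t(1)[of l "p l"] by (simp add: g_def)
    then have "rel (D l) (p' l) (r l + - g l + (g l + t l))"
      unfolding p'_def using rel_inv[OF Dc(2) rg[of l]] that by simp
    then show ?thesis by (simp add: add.assoc)
  qed
  have pg': "rel (D l) (p' (Suc l)) (r (Suc l) + t l)" if "l < i" for l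
  proof -
    have "rel (D l) (p (Suc l)) (g (Suc l) + t l)" using t(1)[of l "p (Suc l)"] p(3)[of l] that by (simp add: g_def)
    then have "rel (D l) (p' (Suc l)) (r (Suc l) + - g (Suc l) + (g (Suc l) + t l))"
      unfolding p'_def using rel_inv[OF Dc(2) rg[of "Suc l"]] that by simp
    then show ?thesis by (simp add: add.assoc)
  qed
  have "\<exists>x'. x' 0 = x 0 \<and> (\<forall>l\<le>i. cong M (x' l) (x l)) \<and> (\<forall>l<i. rel (E l) (x' l) (x' (Suc l))) \<and>
    rel (E i) (x' i) (p' i)"
  proof (rule displaced_transfer[OF M E d yi])
    show "cong M (p' l) (y l)" if "l \<le> i" for l
    proof -
      have "cong M (p' l) (p l)" unfolding p'_def using cong_mem[OF M rg[OF that]] .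
      moreover have "cong M (p l) (y l)" using p(2)[of l] that cong_mono[OF _ Na(2)] by (simp add: X_def)
      ultimately show ?thesis using cong_trans[OF M] by blast
    qed
    show "p' 0 = y 0" using r(1) by (simp add: p'_def x'_def p0 u_def)
    show "rel (shift (b l) (E l)) (p' l) (p' (Suc l))" if "l < i" for l
    proof -
      have "rel (D l) (r l + t l) (r (Suc l) + t l)"
        using D'D r(3)[of l] that ik by (simp add: E'_def)
      then have "rel (D l) (p' l) (p' (Suc l))"
        using pg[OF that] pg'[OF that] rel_sym[OF Dc(1)] rel_trans by metis
      then show ?thesis using that by (simp add: D_def)
    qed
  qed (use ik in auto)
  then obtain x2 where x2: "x2 0 = x 0" "\<And>l. l \<le> i \<Longrightarrow> cong M (x2 l) (x l)"
    "\<And>l. l < i \<Longrightarrow> rel (E l) (x2 l) (x2 (Suc l))" "rel (E i) (x2 i) (p' i)" by blast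
  have "rel (E i) (p' i) (r i + - g i + g i)"
    unfolding p'_def using rel_inv[OF Ei(2) rg[of i], of "p i" "g i"] gi by blast
  then have "rel (E i) (p' i) (r i)" by (simp only: plus_minus)
  moreover have "rel (E i) (r i) (r (Suc i))" using r(3)[OF ik] by (simp add: E'_def)
  ultimately have x2i: "rel (E i) (x2 i) (r (Suc i))"
    using x2(4) rel_trans by blast
  show ?thesis
  proof (intro exI[of _ "\<lambda>l. if l \<le> i then x2 l else r l"] conjI allI impI)
    show "(if 0 \<le> i then x2 0 else r 0) = x 0" using x2 by simp
    show "cong M (if l \<le> i then x2 l else r l) (x l)" if "l \<le> k" for l
    proof (cases "l \<le> i")
      case False
      then have "cong M (r l) (n + x l)" using r(2)[OF that] by (simp add: x'_def)
      then have "cong M (r l) (x l)" by (rule cong_trans[OF M _ cong_mem[OF M nM]])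
      then show ?thesis using False by simp
    qed (use x2 in simp)
    show "rel (E l) (if l \<le> i then x2 l else r l) (if Suc l \<le> i then x2 (Suc l) else r (Suc l))" if "l < k" for l
    proof -
      consider "l < i" | "l = i" | "l > i" by linarith
      then show ?thesis
      proof cases
        case 3
        then show ?thesis using r(3)[OF that] by (simp add: E'_def)
      qed (use x2 x2i in auto)
    qed
    show "rel F (if k \<le> i then x2 k else r k) (x 0)"
    proof -
      have "rel F (r k) (y 0)" using r(4) by (simp add: x'_def g0 u_def)
      then show ?thesis using ik rel_trans[OF rel_sym[OF Fc(1) y0]] by simp
    qed
  qed
qed

text \<open>
  The imitator starts with the walker at \<open>x 0\<close> and stays in the class of \<open>F\<close>; \<open>u w\<close> is his
  position when the walker is at \<open>w\<close>. As \<open>\<nu>\<close> lies in \<open>pair_kernel\<close>, his position \<open>z\<close> at the end of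
  the last side is a \<open>K\<close>-translate of \<open>x k\<close>, so that \<open>z\<close> can serve as the last vertex. The
  invariant \<open>Inv i w\<close> holds while the walker is at \<open>w\<close> on side \<open>i\<close>: a displaced copy of the first
  \<open>i\<close> sides starts at the imitator. It is violated only by a step that does not commute with the
  earlier sides, in which case \<open>polygon_cut\<close> applies. If it holds up to the last side, then the
  displaced polygon starts at \<open>t\<close>, has \<open>k - 1\<close> sides, and closes up modulo \<open>K\<close> through the last
  side of the given one.
\<close>

lemma polygon_step:
  assumes C: "finite C" and M: "fin_normal M" and Na: "fin_normal Na" "Na \<subseteq> M" and K: "fin_normal K" "K \<subseteq> Na"
    and ker: "\<And>E. E \<in> rels M C \<Longrightarrow> K \<subseteq> imit_kernel M E"
    and IHs: "s > 0 \<Longrightarrow> closes C k (s - 1) M Na"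
    and IHk: "\<And>j. j < k \<Longrightarrow> closes C j (k * card C) Na K"
    and E: "\<And>l. l < k \<Longrightarrow> E l \<in> rels M C" and sum: "(\<Sum>l<k. card (supp (E l))) \<le> s"
    and F: "F \<in> closing_rels M C"
    and x: "\<And>l. l < k \<Longrightarrow> rel (E l) (x l) (x (Suc l))" "rel F (x k) (\<nu> + x 0)"
    and \<nu>: "\<nu> \<in> K \<inter> pair_kernel F K" and k: "k > 0"
  shows "\<exists>y. y 0 = x 0 \<and> (\<forall>i\<le>k. cong M (y i) (x i)) \<and> (\<forall>i<k. rel (E i) (y i) (y (Suc i))) \<and> rel F (y k) (x 0)"
    (is ?G)
proof -
  have KM: "K \<subseteq> M" using Na K by blast
  note Fc = closing_relsD[OF F]
  have FK: "inv_rel K F" by (rule inv_rel_mono[OF Fc(2) KM])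
  note im = imitator_refl[OF Fc(1) K(1) FK] imitator_trans[OF Fc(1) K(1) FK] imitator_step[OF Fc(1) K(1) FK]
  define u where "u w = imitator F K (x 0) (x 0) w" for w
  have uF: "rel F (x 0) (u w)" for w
    unfolding u_def by (rule imitator_rel[OF Fc(1) K(1) FK])
  have u_trans: "imitator F K w (u w) w' = u w'" for w w' by (simp add: u_def im)
  have stay: "rel E (m + w) (imitator F K w (m + w) w')" if "E \<in> rels M C" "rel E w w'" "m \<in> K" for E w w' m
    by (rule imitator_stays[OF Fc(1) K(1) FK relsD(1,2)[OF that(1)] KM ker[OF that(1)] that(2,3)])
  \<comment> \<open>from \<open>x k\<close> to \<open>\<nu> + x 0\<close> the walker stays in a class of \<open>F\<close>, so the imitator follows him up to a
    translation\<close>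
  obtain mz where mz: "mz \<in> K" "u (x k) = mz + x k"
  proof -
    define e where "e = \<nu> + x 0"
    have "- x 0 + \<nu> + x 0 \<in> K \<inter> pair_kernel F K"
      by (rule fin_normalD(5)[OF fin_normal_pair_kernel[OF Fc(1) K(1) FK] \<nu>])
    then have "cong K (imitator F K (x 0) (x 0) (x 0 + (- x 0 + \<nu> + x 0))) (x 0)"
      unfolding pair_kernel_def[OF Fc(1) K(1) FK] by blast
    then have "cong K (u e) (x 0)" by (simp add: u_def e_def add.assoc)
    then obtain m1 where m1: "m1 \<in> K" "u e = m1 + x 0" unfolding cong_iff by blast
    have m: "m1 + - \<nu> \<in> K" using m1 \<nu> fin_normalD(2,3)[OF K(1)] by blast
    have "u (x k) = imitator F K e ((m1 + - \<nu>) + e) (x k)"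
      using u_trans[of e "x k"] m1 by (simp add: e_def add.assoc)
    also have "\<dots> = (m1 + - \<nu>) + imitator F K e e (x k)"
      by (rule imitator_translate[OF Fc(1) K(1) FK m])
    also have "imitator F K e e (x k) = x k"
      using imitator_follows[OF Fc(1) K(1) FK rel_sym[OF Fc(1) x(2)]] by (simp add: e_def)
    finally show ?thesis using that m by blast
  qed
  define z where "z = u (x k)"
  have zx: "cong M z (x k)" using mz KM by (auto simp: z_def cong_iff)
  have zF: "rel F z (x 0)" using uF rel_sym[OF Fc(1)] by (simp add: z_def)
  have v: "rel (E 0) (x 0) (u (x 1))"
    using stay[OF E[OF k] x(1)[OF k] fin_normalD(1)[OF K(1)]] by (simp add: u_def)
  show ?thesis
  proof (cases "k = 1")
    case True
    then show ?thesis
      using v zx zF cong_refl[OF M]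
      by (intro exI[of _ "\<lambda>i. if i = 0 then x 0 else z"]) (auto simp: z_def le_Suc_eq)
  next
    case False
    then obtain k' where k': "k = Suc (Suc k')" using k by (metis One_nat_def not0_implies_Suc less_irrefl)
    define t where "t = u (x (Suc k'))"
    have last: "Suc k' < k" "E (Suc k') \<in> rels M C" using E k' by auto
    note El = relsD[OF last(2)]
    have tz: "rel (E (Suc k')) z t"
      using stay[OF last(2) _ mz(1), of "x k" "x (Suc k')"] x(1)[OF last(1)] rel_sym[OF El(1)] mz(2)
        u_trans[of "x k" "x (Suc k')"] by (simp add: z_def t_def k')
    define Inv where "Inv i w \<longleftrightarrow> (\<exists>y b. y 0 = u w \<and> displaced E x i y b \<and> rel (E i) (x i) (y i))" for i w
    \<comment> \<open>the walker moves along side \<open>i\<close>\<close>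
    have side: "?G \<or> Inv i w" if "rel (E i) a w" "a = x i" "Suc i < k" "?G \<or> Inv i a" for i a w
      using that
    proof (induction rule: rel.induct)
      case (rel_step a w c)
      have ik: "i < k" "E i \<in> rels M C" using rel_step.prems E by auto
      note Ei = relsD[OF ik(2)]
      show ?case
      proof (cases "?G")
        case False
        then obtain y b where yb: "y 0 = u w" "displaced E x i y b" "rel (E i) (x i) (y i)"
          using rel_step.IH rel_step.prems unfolding Inv_def by blast
        have xw: "rel (E i) (x i) w" using rel_step.hyps(1) rel_step.prems by simp
        show ?thesis
        proof (cases "c \<in> F (u w) \<and> colour K c w (u w)")
          case False
          then have "u (w + gen c) = u w" by (auto simp: u_def im Let_def)
          then show ?thesis using yb unfolding Inv_def by auto
        next
          case True
          then have uc: "u (w + gen c) = u w + gen c" by (simp add: u_def im Let_def)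
          have "\<forall>l<i. supp (E l) \<subseteq> perp c"
          proof (rule ccontr)
            assume "\<not> (\<forall>l<i. supp (E l) \<subseteq> perp c)"
            then obtain l0 where l0: "l0 < i" "\<not> supp (E l0) \<subseteq> perp c" by blast
            have "\<nu> \<in> Na" using \<nu> K(2) by blast
            then have "?G"
              by (intro polygon_cut[OF C M Na K IHs IHk[OF rel_step.prems(2)] E sum F x(1) _ x(2)
                    rel_step.prems(2) yb(2,3) xw rel_step.hyps(2) _ l0])
                (use True uF yb(1) in auto)
            then show False using \<open>\<not> ?G\<close> by blast
          qed
          then have harmless: "supp (E l) \<subseteq> perp c" if "l < i" for l using that by blast
          have yu: "- y 0 + y l \<in> parab (perp c)" if "l \<le> i" for l
            using that
          proof (induction l)
            case (Suc l)
            have "rel (E l) (y l + - b l) (y (Suc l) + - b l)" and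
              com: "\<And>e. e \<in> supp (E l) \<Longrightarrow> gen e + b l = b l + gen e"
              using yb(2) Suc.prems by (auto simp: displaced_def)
            then have "rel (shift (b l) (E l)) (y l) (y (Suc l))" using rel_shift[OF com] by blast
            then have "- y l + y (Suc l) \<in> parab (perp c)"
              using supp_subset[of "shift (b l) (E l)" "perp c"] supp_shift[of "b l" "E l"] harmless[of l] Suc.prems
              by auto
            then have "- y 0 + y l + (- y l + y (Suc l)) \<in> parab (perp c)"
              using Suc by (intro parab_add[of "- y 0 + y l"]) auto
            then show ?case by (simp add: add.assoc)
          qed simp
          have "colour K c w (u w + (- y 0 + y i))"
            using True colour_right[OF parab_perp_star[OF yu[of i]], of K w "u w"] by simp
          then have "colour K c w (y i)" by (simp add: yb(1))
          then have ci: "c \<in> E i (y i)"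
            using colour_crosses[OF Ei(1,2) ker[OF ik(2)], of "y i" w c] xw yb(3) rel_step.hyps(2)
              rel_sym[OF Ei(1)] rel_trans by metis
          have "displaced E x i (\<lambda>l. y l + gen c) (\<lambda>l. b l + gen c)"
            unfolding displaced_def
          proof (intro allI impI)
            fix l assume l: "l < i"
            have "gen e + (b l + gen c) = b l + gen c + gen e" if "e \<in> supp (E l)" for e
            proof -
              have "gen e + b l = b l + gen e" using yb(2) l that by (auto simp: displaced_def)
              moreover have "gen c + gen e = gen e + gen c"
                using harmless[OF l] that gen_comm by (auto simp: perp_def)
              ultimately show ?thesis by (metis add.assoc)
            qed
            moreover have "y l + gen c + - (b l + gen c) = y l + - b l"
              by (simp add: minus_add add.assoc)
            ultimately show "rel (E l) (x l) (y l + gen c + - (b l + gen c)) \<and>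
              rel (E l) (y l + gen c + - (b l + gen c)) (x (Suc l)) \<and>
              y (Suc l) + gen c = x (Suc l) + (b l + gen c) \<and>
              (\<forall>e\<in>supp (E l). gen e + (b l + gen c) = b l + gen c + gen e)"
              using yb(2) l by (simp add: displaced_def add.assoc)
          qed
          moreover have "rel (E i) (x i) (y i + gen c)" using rel.rel_step[OF yb(3) ci] .
          ultimately have "Inv i (w + gen c)"
            unfolding Inv_def
            by (intro exI[of _ "\<lambda>l. y l + gen c"] exI[of _ "\<lambda>l. b l + gen c"]) (simp add: yb(1) uc)
          then show ?thesis by blast
        qed
      qed simp
    qed simp
    \<comment> \<open>the walker turns into the next side; its displacement starts with 0\<close>
    have switch: "Inv (Suc i) (x (Suc i))" if "Inv i (x (Suc i))" "i < k" for i
    proof -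
      from that(1) obtain y b where yb: "y 0 = u (x (Suc i))" "displaced E x i y b" "rel (E i) (x i) (y i)"
        unfolding Inv_def by blast
      have "rel (E i) (y i) (x (Suc i))"
        using yb(3) x(1)[OF that(2)] rel_sym[OF relsD(1)[OF E[OF that(2)]]] rel_trans by blast
      then show ?thesis
        unfolding Inv_def using yb
        by (intro exI[of _ "y(Suc i := x (Suc i))"] exI[of _ "b(i := 0)"])
          (auto simp: displaced_def less_Suc_eq)
    qed
    have "Inv 0 (x (Suc 0))"
      unfolding Inv_def using v by (intro exI[of _ "\<lambda>_. u (x 1)"] exI[of _ "\<lambda>_. 0"]) (simp add: displaced_def)
    then have first: "Inv 1 (x 1)" using switch[of 0] k by simp
    have "?G \<or> Inv i (x i)" if "1 \<le> i" "i < k" for i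
      using that
    proof (induction i rule: dec_induct)
      case (step i)
      then have i: "i < k" "Suc i < k" by auto
      have "?G \<or> Inv i (x (Suc i))" by (rule side[OF x(1)[OF i(1)] refl i(2)]) (use step i in auto)
      then show ?case using switch[of i] i by blast
    qed (use first in simp)
    then consider "?G" | "Inv (Suc k') (x (Suc k'))" using last(1) by auto
    then show ?thesis
    proof cases
      case 2
      then obtain y b where yb: "y 0 = t" "displaced E x (Suc k') y b" "rel (E (Suc k')) (x (Suc k')) (y (Suc k'))"
        unfolding Inv_def t_def by blast
      have comm_b: "gen e + b l = b l + gen e" if "l < Suc k'" "e \<in> supp (E l)" for l e
        using yb(2) that by (auto simp: displaced_def)
      have mzM: "- mz \<in> K" "- mz \<in> M" using mz(1) fin_normalD(3)[OF K(1)] KM by auto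
      have "rel (E (Suc k')) (- mz + z) (- mz + t)" using tz rel_inv[OF El(2) mzM(2)] by simp
      then have "rel (E (Suc k')) (x k) (- mz + t)" using mz(2) by (simp add: z_def)
      then have cl: "rel (E (Suc k')) (y (Suc k')) (- mz + y 0)"
        using yb(1,3) x(1)[OF last(1)] rel_sym[OF El(1)] rel_trans by (metis k')
      have l: "Suc k' < k" using last by simp
      have "(\<Sum>l<Suc k'. card (supp (shift (b l) (E l)))) \<le> (\<Sum>l<Suc k'. card C)"
      proof (rule sum_mono)
        fix l assume "l \<in> {..<Suc k'}"
        then have "supp (shift (b l) (E l)) \<subseteq> C"
          using supp_shift[of "b l" "E l"] relsD(3)[OF E[of l]] l by auto
        then show "card (supp (shift (b l) (E l))) \<le> card C" by (rule card_mono[OF C])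
      qed
      then have sm: "(\<Sum>l<Suc k'. card (supp (shift (b l) (E l)))) \<le> k * card C"
        by (simp add: k') 
      obtain p where p: "p 0 = y 0" "\<And>l. l \<le> Suc k' \<Longrightarrow> cong Na (p l) (y l)"
        "\<And>l. l < Suc k' \<Longrightarrow> rel (shift (b l) (E l)) (p l) (p (Suc l))" "rel (E (Suc k')) (p (Suc k')) (y 0)"
      proof (rule closesD[OF IHk[OF l] _ sm, of "E (Suc k')" y "- mz"])
        show "shift (b j) (E j) \<in> rels Na C" if "j < Suc k'" for j
          using shift_rels[OF E[of j] comm_b[OF that]] rels_mono(1)[OF Na(2)] that k' by auto
        show "E (Suc k') \<in> closing_rels Na C"
          using last(2) rels_mono(1)[OF Na(2)] by (auto simp: closing_rels_def)
        show "rel (shift (b j) (E j)) (y j) (y (Suc j))" if "j < Suc k'" for j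
          using yb(2) that rel_shift[OF comm_b[OF that]] by (simp add: displaced_def)
        show "- mz \<in> K" by (rule mzM)
        show "rel (E (Suc k')) (y (Suc k')) (- mz + y 0)" by (rule cl)
      qed (assumption | rule that)+
      have "\<exists>x'. x' 0 = x 0 \<and> (\<forall>l\<le>Suc k'. cong M (x' l) (x l)) \<and>
        (\<forall>l<Suc k'. rel (E l) (x' l) (x' (Suc l))) \<and> rel (E (Suc k')) (x' (Suc k')) (p (Suc k'))"
        by (rule displaced_transfer[OF M E yb(2,3)]) (use p cong_mono[OF p(2) Na(2)] k' in auto)
      then obtain x' where x': "x' 0 = x 0" "\<And>l. l \<le> Suc k' \<Longrightarrow> cong M (x' l) (x l)"
        "\<And>l. l < Suc k' \<Longrightarrow> rel (E l) (x' l) (x' (Suc l))" "rel (E (Suc k')) (x' (Suc k')) (p (Suc k'))" by blast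
      have "rel (E (Suc k')) (x' (Suc k')) z"
        using x'(4) p(4) yb(1) tz rel_sym[OF El(1)] rel_trans by metis
      then show ?thesis
        using x' zx zF by (intro exI[of _ "x'(k := z)"]) (auto simp: k' less_Suc_eq le_Suc_eq)
    qed
  qed
qed

text \<open>
  Induction on the number of sides and, for a fixed number of sides, on the number of letters on
  them. \<open>Na\<close> takes care of polygons with fewer letters and \<open>K\<close> of those with fewer sides; the
  latter is needed relative to \<open>Na\<close>, as \<open>polygon_cut\<close> uses both in this order. The bound
  \<open>k * card C\<close> suffices for all polygons with fewer than \<open>k\<close> sides.
\<close>

theorem polygons_close:
  fixes C :: "'v letter set"
  assumes C: "finite C" and "fin_normal M"
  shows "\<exists>N. fin_normal N \<and> N \<subseteq> M \<and> closes C k s M N"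
  using assms(2)
proof (induction k arbitrary: M s rule: less_induct)
  case (less k)
  note IHk = less.IH
  show ?case
    using less.prems
  proof (induction s arbitrary: M rule: less_induct)
    case (less s)
    note M = less.prems
    show ?case
    proof (cases "k = 0")
      case True
      have "closes C 0 s M M"
        unfolding closes_def using cong_refl[OF M] by (auto intro!: exI)
      then show ?thesis using True M by blast
    next
      case False
      have "\<exists>Na. fin_normal Na \<and> Na \<subseteq> M \<and> (s > 0 \<longrightarrow> closes C k (s - 1) M Na)"
        using less.IH[of "s - 1" M] M by (cases "s > 0") auto
      then obtain Na where Na: "fin_normal Na" "Na \<subseteq> M" "s > 0 \<Longrightarrow> closes C k (s - 1) M Na" by blast
      have "\<exists>N. fin_normal N \<and> N \<subseteq> Na \<and> closes C j (k * card C) Na N" if "j < k" for j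
        using IHk[OF that Na(1)] by blast
      then obtain N where N: "\<And>j. j < k \<Longrightarrow> fin_normal (N j) \<and> N j \<subseteq> Na \<and> closes C j (k * card C) Na (N j)"
        by metis
      define K where "K = Na \<inter> (\<Inter>j\<in>{..<k}. N j) \<inter> (\<Inter>E\<in>closing_rels M C. imit_kernel M E)"
      have fin: "finite (closing_rels M C)" by (rule finite_closing_rels[OF M C])
      have K: "fin_normal K"
        unfolding K_def using N Na(1) fin M closing_relsD
        by (intro fin_normal_Int fin_normal_INT fin_normal_imit_kernel) (auto; blast)+
      have KNa: "K \<subseteq> Na" by (auto simp: K_def)
      define P where "P = K \<inter> (\<Inter>F\<in>closing_rels M C. K \<inter> pair_kernel F K)"
      have FK: "inv_rel K F" if "F \<in> closing_rels M C" for F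
        using inv_rel_mono[OF closing_relsD(2)[OF that]] KNa Na(2) by blast
      have "fin_normal P"
        unfolding P_def using closing_relsD(1) FK
        by (intro fin_normal_Int[OF K] fin_normal_INT[OF fin] fin_normal_pair_kernel K) auto
      moreover have "P \<subseteq> M" using KNa Na(2) by (auto simp: P_def)
      moreover have "closes C k s M P"
        unfolding closes_def
      proof (intro allI impI)
        fix E :: "nat \<Rightarrow> 'v racg \<Rightarrow> 'v letter set" and x F \<nu>
        assume *: "\<forall>i<k. E i \<in> rels M C" "(\<Sum>i<k. card (supp (E i))) \<le> s" "F \<in> closing_rels M C"
          "\<forall>i<k. rel (E i) (x i) (x (Suc i))" "\<nu> \<in> P" "rel F (x k) (\<nu> + x 0)"
        have ker: "K \<subseteq> imit_kernel M E" if "E \<in> rels M C" for E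
          using that unfolding K_def closing_rels_def by blast
        have cl: "closes C j (k * card C) Na K" if "j < k" for j
          using closes_mono[of C j "k * card C" Na "N j" "k * card C" K] N[OF that] that by (auto simp: K_def)
        have "\<nu> \<in> K \<inter> pair_kernel F K" using *(3,5) unfolding P_def by blast
        then show "\<exists>y. y 0 = x 0 \<and> (\<forall>i\<le>k. cong M (y i) (x i)) \<and>
            (\<forall>i<k. rel (E i) (y i) (y (Suc i))) \<and> rel F (y k) (x 0)"
          using * False
          by (intro polygon_step[OF C M Na(1,2) K KNa ker Na(3) cl _ *(2,3) _ *(6)]) auto
      qed
      ultimately show ?thesis by blast
    qed
  qed
qed

declare add_uminus_conv_diff [simp]

section \<open>Faces of a cube\<close>

lemma vars_simps [simp]:
  "vars [] = []" "vars (Fixed b # f) = vars f" "vars (Coord j b # f) = j # vars f"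
  by (simp_all add: vars_def)

lemma in_vars: "j \<in> set (vars f) \<longleftrightarrow> (\<exists>i<length f. \<exists>b. f ! i = Coord j b)"
proof (induction f)
  case (Cons a f)
  have "(\<exists>i<length (a # f). \<exists>b. (a # f) ! i = Coord j b) \<longleftrightarrow> (\<exists>b. a = Coord j b) \<or> j \<in> set (vars f)"
    unfolding Cons by (auto simp: less_Suc_eq_0_disj)
  then show ?case by (cases a) auto
qed simp

lemma distinct_vars:
  "distinct (vars f) \<longleftrightarrow> (\<forall>i<length f. \<forall>i'<length f. \<forall>j b b'. f ! i = Coord j b \<longrightarrow> f ! i' = Coord j b' \<longrightarrow> i = i')"
proof (induction f)
  case (Cons a f)
  show ?case
  proof (cases a)
    case (Fixed x)
    then show ?thesis using Cons by (simp add: All_less_Suc2)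
  next
    case (Coord j b)
    have "distinct (vars (a # f)) \<longleftrightarrow> (\<forall>i<length f. \<forall>b. f ! i \<noteq> Coord j b) \<and> distinct (vars f)"
      using in_vars[of j f] by (simp add: Coord)
    then show ?thesis unfolding Cons by (simp add: All_less_Suc2 Coord) blast
  qed
qed simp

text \<open>
  The description of embeddings of cubes by indices, which replaces lists of variables from here
  on.
\<close>

lemma faces_iff:
  "f \<in> faces m n \<longleftrightarrow> length f = n \<and> (\<forall>i<n. \<forall>j b. f ! i = Coord j b \<longrightarrow> j < m) \<and>
     (\<forall>j<m. \<exists>i<n. \<exists>b. f ! i = Coord j b) \<and>
     (\<forall>i<n. \<forall>i'<n. \<forall>j b b'. f ! i = Coord j b \<longrightarrow> f ! i' = Coord j b' \<longrightarrow> i = i')"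
proof -
  have "set (vars f) = {..<m} \<longleftrightarrow> (\<forall>i<length f. \<forall>j b. f ! i = Coord j b \<longrightarrow> j < m) \<and>
     (\<forall>j<m. \<exists>i<length f. \<exists>b. f ! i = Coord j b)"
    by (auto simp: set_eq_iff in_vars)
  then show ?thesis unfolding faces_def mem_Collect_eq distinct_vars by auto
qed

lemma facesD:
  assumes "f \<in> faces m n"
  shows "length f = n" "i < n \<Longrightarrow> f ! i = Coord j b \<Longrightarrow> j < m"
    "j < m \<Longrightarrow> \<exists>i<n. \<exists>b. f ! i = Coord j b"
    "i < n \<Longrightarrow> i' < n \<Longrightarrow> f ! i = Coord j b \<Longrightarrow> f ! i' = Coord j b' \<Longrightarrow> i = i'"
  using assms unfolding faces_iff by blast+

lemma finite_faces: "finite (faces m n)"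
proof -
  have "faces m n \<subseteq> {f. set f \<subseteq> range Fixed \<union> (\<lambda>(j, b). Coord j b) ` ({..<m} \<times> UNIV) \<and> length f = n}"
  proof
    fix f assume f: "f \<in> faces m n"
    have "f ! i \<in> range Fixed \<union> (\<lambda>(j, b). Coord j b) ` ({..<m} \<times> UNIV)" if "i < n" for i
      using facesD(2)[OF f that] by (cases "f ! i") auto
    then have "set f \<subseteq> range Fixed \<union> (\<lambda>(j, b). Coord j b) ` ({..<m} \<times> UNIV)"
      using facesD(1)[OF f] by (metis in_set_conv_nth subsetI)
    then show "f \<in> {f. set f \<subseteq> range Fixed \<union> (\<lambda>(j, b). Coord j b) ` ({..<m} \<times> UNIV) \<and> length f = n}"
      using facesD(1)[OF f] by blast
  qed
  then show ?thesis by (rule finite_subset) (intro finite_lists_length_eq, auto)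
qed

lemma length_face_comp [simp]: "length (face_comp f g) = length f"
  by (simp add: face_comp_def)

lemma nth_face_comp [simp]: "i < length f \<Longrightarrow> face_comp f g ! i = subst_coord g (f ! i)"
  by (simp add: face_comp_def)

lemma flip_eq_Coord: "flip b a = Coord j c \<longleftrightarrow> a = Coord j (c \<noteq> b)"
  by (cases a) auto

lemma flip_flip [simp]: "flip b (flip b a) = a"
  by (cases a) auto

lemma face_comp_faces:
  assumes f: "f \<in> faces m n" and g: "g \<in> faces l m"
  shows "face_comp f g \<in> faces l n"
proof -
  have *: "(face_comp f g) ! i = Coord j b \<longleftrightarrow> (\<exists>k c. f ! i = Coord k c \<and> g ! k = Coord j (b \<noteq> c))" if "i < n" for i j b
    using facesD(1)[OF f] that by (cases "f ! i") (auto simp: flip_eq_Coord)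
  have "\<exists>i<n. \<exists>b. face_comp f g ! i = Coord j b" if "j < l" for j
  proof -
    obtain k b where k: "k < m" "g ! k = Coord j b" using facesD(3)[OF g \<open>j < l\<close>] by blast
    then obtain i c where "i < n" "f ! i = Coord k c" using facesD(3)[OF f k(1)] by blast
    then show ?thesis using k * by (intro exI[of _ i] conjI exI[of _ "b \<noteq> c"]) auto
  qed
  moreover have "j < l" if "i < n" "face_comp f g ! i = Coord j b" for i j b
    using that * facesD(2)[OF f that(1)] facesD(2)[OF g] by metis
  moreover have "i = i'" if "i < n" "i' < n" "face_comp f g ! i = Coord j b" "face_comp f g ! i' = Coord j b'" for i i' j b b'
  proof -
    have "\<exists>k c. f ! i = Coord k c \<and> g ! k = Coord j (b \<noteq> c)" "\<exists>k c. f ! i' = Coord k c \<and> g ! k = Coord j (b' \<noteq> c)"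
      using that(3) *[OF that(1)] that(4) *[OF that(2)] by blast+
    then obtain k c k' c' where k: "f ! i = Coord k c" "g ! k = Coord j (b \<noteq> c)"
      "f ! i' = Coord k' c'" "g ! k' = Coord j (b' \<noteq> c')"
      by blast
    then have "k = k'"
      using facesD(4)[OF g _ _ k(2) k(4)] facesD(2)[OF f that(1) k(1)] facesD(2)[OF f that(2) k(3)] by blast
    then show ?thesis using facesD(4)[OF f that(1,2)] k by blast
  qed
  ultimately show ?thesis
    unfolding faces_iff using facesD(1)[OF f] by auto
qed

lemma id_face_faces: "id_face n \<in> faces n n"
proof -
  have "\<exists>i<n. \<exists>b. id_face n ! i = Coord j b" if "j < n" for j
    using that by (intro exI[of _ j] conjI exI[of _ False]) (simp_all add: id_face_def)
  then show ?thesis unfolding faces_iff by (simp add: id_face_def)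
qed

lemma face_comp_id:
  assumes "f \<in> faces m n" shows "face_comp f (id_face m) = f"
proof (rule nth_equalityI)
  fix i assume "i < length (face_comp f (id_face m))"
  then show "face_comp f (id_face m) ! i = f ! i"
    using facesD(1,2)[OF assms] by (cases "f ! i") (auto simp: id_face_def)
qed simp

lemma in_cube: "t \<in> topspace (cube_top n) \<longleftrightarrow> t \<in> extensional {..<n} \<and> (\<forall>i<n. 0 \<le> t i \<and> t i \<le> 1)"
  by (auto simp: cube_top_def PiE_iff)

lemma place_nth: "i < length f \<Longrightarrow> place f t i = coord_val (f ! i) t"
  by (simp add: place_def)

lemma place_in_cube:
  assumes f: "f \<in> faces m n" and t: "t \<in> topspace (cube_top m)"
  shows "place f t \<in> topspace (cube_top n)"
proof -
  have "0 \<le> place f t i \<and> place f t i \<le> 1" if "i < n" for i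
    using that facesD(1,2)[OF f] t by (cases "f ! i") (auto simp: place_nth in_cube)
  then show ?thesis using facesD(1)[OF f] by (simp add: in_cube place_def)
qed

lemma place_id: "t \<in> topspace (cube_top n) \<Longrightarrow> place (id_face n) t = t"
  by (auto simp: place_def id_face_def in_cube extensional_def fun_eq_iff)

lemma place_surj:
  assumes g: "g \<in> faces m n" and t: "t \<in> topspace (cube_top n)"
    and fixed: "\<And>i b. i < n \<Longrightarrow> g ! i = Fixed b \<Longrightarrow> t i = of_bool b"
  shows "\<exists>t'\<in>topspace (cube_top m). place g t' = t"
proof -
  obtain p s where ps: "\<And>j. j < m \<Longrightarrow> p j < n \<and> g ! p j = Coord j (s j)"
    using facesD(3)[OF g] by metis
  define t' where "t' = (\<lambda>j\<in>{..<m}. if s j then 1 - t (p j) else t (p j))"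
  have "t' \<in> topspace (cube_top m)" using ps t by (auto simp: t'_def in_cube)
  moreover have "place g t' i = t i" for i
  proof (cases "i < n")
    case True
    show ?thesis
    proof (cases "g ! i")
      case (Fixed b)
      then show ?thesis using fixed[OF True Fixed] True facesD(1)[OF g] by (simp add: place_nth)
    next
      case (Coord j b)
      then have "j < m" "i = p j" "b = s j"
        using facesD(2,4)[OF g] True ps by (blast, metis, metis coord.inject(2) facesD(4)[OF g])
      then show ?thesis using True Coord facesD(1)[OF g] by (auto simp: place_nth t'_def)
    qed
  next
    case False
    then show ?thesis using t facesD(1)[OF g] by (auto simp: place_def in_cube extensional_def)
  qed
  ultimately show ?thesis by blast
qed

definition interior_point :: "nat \<Rightarrow> (nat \<Rightarrow> real) \<Rightarrow> bool" where
  "interior_point k s \<longleftrightarrow> s \<in> topspace (cube_top k) \<and> (\<forall>j<k. 0 < s j \<and> s j < 1)"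

lemma place_inj_interior:
  assumes f: "f \<in> faces k n" and s: "interior_point k s"
  shows "i < n \<Longrightarrow> place f s i = of_bool b \<longleftrightarrow> f ! i = Fixed b"
  using facesD(1)[OF f] facesD(2)[OF f, of i] s
  by (cases "f ! i") (force simp: place_nth interior_point_def split: if_splits)+

text \<open>
  If two faces of a cube share a point that is interior to the first one, then the first one is a
  face of the second one: coordinates that are fixed on the second face are 0 or 1 at that point,
  hence fixed on the first face.
\<close>

lemma factor_face:
  assumes f: "f \<in> faces k n" and g: "g \<in> faces m n" and s: "interior_point k s"
    and t: "t \<in> topspace (cube_top m)" and eq: "place f s = place g t"
  shows "\<exists>h\<in>faces k m. face_comp g h = f \<and> place h s = t"
proof -
  obtain p e where pe: "\<And>j. j < m \<Longrightarrow> p j < n \<and> g ! p j = Coord j (e j)"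
    using facesD(3)[OF g] by metis
  define h where "h = map (\<lambda>j. flip (e j) (f ! p j)) [0..<m]"
  have h: "length h = m" "\<And>j. j < m \<Longrightarrow> h ! j = flip (e j) (f ! p j)" by (simp_all add: h_def)
  have gi: "g ! i = Coord j b \<Longrightarrow> j < m \<and> i = p j \<and> b = e j" if "i < n" for i j b
    using facesD(2)[OF g that] facesD(4)[OF g that] pe by (metis coord.inject(2))
  have fixed: "f ! i = Fixed b" if "i < n" "g ! i = Fixed b" for i b
  proof -
    have "place f s i = of_bool b" using that facesD(1)[OF g] by (simp add: eq place_nth)
    then show ?thesis using place_inj_interior[OF f s that(1)] by blast
  qed
  have fg: "face_comp g h = f"
  proof (rule nth_equalityI)
    fix i assume "i < length (face_comp g h)"
    then have i: "i < n" using facesD(1)[OF g] by simp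
    then show "face_comp g h ! i = f ! i"
      using fixed[OF i] gi[OF i] facesD(1)[OF g] h(2) by (cases "g ! i") auto
  qed (use facesD(1)[OF f] facesD(1)[OF g] in simp)
  moreover have "h \<in> faces k m"
  proof -
    have "l < k" if "j < m" "h ! j = Coord l b" for j l b
    proof -
      have "f ! p j = Coord l (b \<noteq> e j)" using that h(2) by (simp add: flip_eq_Coord)
      then show ?thesis using facesD(2)[OF f] pe[OF that(1)] by blast
    qed
    moreover have "\<exists>j<m. \<exists>b. h ! j = Coord l b" if "l < k" for l
    proof -
      obtain i b where i: "i < n" "f ! i = Coord l b" using facesD(3)[OF f \<open>l < k\<close>] by blast
      then obtain j c where "g ! i = Coord j c" using fixed[OF i(1)] by (cases "g ! i") auto
      then show ?thesis using gi[OF i(1)] i h(2) by (intro exI[of _ j]) (auto simp: flip_eq_Coord)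
    qed
    moreover have "j = j'" if "j < m" "j' < m" "h ! j = Coord l b" "h ! j' = Coord l b'" for j j' l b b'
    proof -
      have fp: "f ! p j = Coord l (b \<noteq> e j)" "f ! p j' = Coord l (b' \<noteq> e j')"
        using that h(2) by (simp_all add: flip_eq_Coord)
      have "p j < n" "p j' < n" using pe[OF that(1)] pe[OF that(2)] by auto
      from facesD(4)[OF f this fp] have "g ! p j = g ! p j'" by (rule arg_cong)
      then have "Coord j (e j) = Coord j' (e j')" using pe[OF that(1)] pe[OF that(2)] by presburger
      then show ?thesis by blast
    qed
    ultimately show ?thesis unfolding faces_iff using h(1) by auto
  qed
  moreover have "place h s j = t j" for j
  proof (cases "j < m")
    case True
    have "coord_val (f ! p j) s = (if e j then 1 - t j else t j)"
      using fun_cong[OF eq, of "p j"] pe[OF True] facesD(1)[OF f] facesD(1)[OF g] by (simp add: place_nth)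
    then show ?thesis using True h by (simp add: place_nth coord_val_flip)
  qed (use t h(1) in \<open>auto simp: place_def in_cube extensional_def\<close>)
  ultimately show ?thesis by blast
qed

lemma ex_interior:
  assumes t: "t \<in> topspace (cube_top n)"
  shows "\<exists>k f s. f \<in> faces k n \<and> interior_point k s \<and> place f s = t"
proof -
  define A where "A = {i. i < n \<and> 0 < t i \<and> t i < 1}"
  define k where "k = card A"
  obtain p where p: "bij_betw p {0..<k} A"
    using ex_bij_betw_nat_finite[of A] by (auto simp: A_def k_def)
  define q where "q = inv_into {0..<k} p"
  have q: "q i < k" "p (q i) = i" if "i \<in> A" for i
    using p that bij_betw_inv_into_right[OF p that] bij_betw_imp_surj_on[OF bij_betw_inv_into[OF p]]
    by (auto simp: q_def)
  have p': "p j \<in> A" "q (p j) = j" if "j < k" for j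
    using p that bij_betwE[OF p] bij_betw_inv_into_left[OF p] by (auto simp: q_def)
  define f where "f = map (\<lambda>i. if i \<in> A then Coord (q i) False else Fixed (t i = 1)) [0..<n]"
  define s where "s = (\<lambda>j\<in>{..<k}. t (p j))"
  have f: "length f = n" "\<And>i. i < n \<Longrightarrow> f ! i = (if i \<in> A then Coord (q i) False else Fixed (t i = 1))"
    by (simp_all add: f_def)
  have "f \<in> faces k n"
    unfolding faces_iff
  proof (intro conjI allI impI f(1))
    show "j < k" if "i < n" "f ! i = Coord j b" for i j b using that f q by (auto split: if_splits)
    show "\<exists>i<n. \<exists>b. f ! i = Coord j b" if "j < k" for j
      using p'[OF that] f(2)[of "p j"] by (intro exI[of _ "p j"]) (auto simp: A_def)
    show "i = i'" if "i < n" "i' < n" "f ! i = Coord j b" "f ! i' = Coord j b'" for i i' j b b'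
      using that f q by (auto split: if_splits) metis
  qed
  moreover have "interior_point k s" using p' t by (auto simp: interior_point_def s_def in_cube A_def)
  moreover have "place f s i = t i" for i
  proof (cases "i < n")
    case True
    then have "t i = 0 \<or> t i = 1 \<or> i \<in> A" using t by (force simp: in_cube A_def)
    then show ?thesis using True f q[of i] by (auto simp: place_nth s_def A_def)
  qed (use t f(1) in \<open>auto simp: place_def in_cube extensional_def\<close>)
  ultimately show ?thesis by blast
qed

section \<open>Points of the realization\<close>

text \<open>
  The pair \<open>p\<close> of a cube and a point in it represents the point \<open>s\<close> of the cube \<open>a\<close> because \<open>a\<close> is
  a face of that cube.
\<close>

definition represents where
  "represents X k a s p \<longleftrightarrow> (\<exists>n f. fst p \<in> cubes X n \<and> f \<in> faces k n \<and> face X (fst p) f = a \<and> place f s = snd p)"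

context cube_complex
begin

lemma cube_dim: "c \<in> cubes X m \<Longrightarrow> c \<in> cubes X n \<Longrightarrow> m = n"
  using cubes_disjoint by blast

text \<open>
  Every point is interior to a cube, unique up to parametrisation, and its representatives in
  other cubes are given by the faces that are equal to this cube. This turns the equivalence
  relation that is generated by gluing into an explicit one.
\<close>

lemma glue_represents:
  assumes "glue X p q" and s: "interior_point k s"
  shows "represents X k a s p \<longleftrightarrow> represents X k a s q"
proof -
  obtain m n c g t where c: "c \<in> cubes X n" "g \<in> faces m n" "t \<in> topspace (cube_top m)"
    and p: "p = (face X c g, t)" and q: "q = (c, place g t)"
    using assms(1) unfolding glue_def by blast
  have cg: "face X c g \<in> cubes X m" using face_closed c by blast
  show ?thesis
  proof
    assume "represents X k a s p"
    then obtain m' f where f: "face X c g \<in> cubes X m'" "f \<in> faces k m'" "face X (face X c g) f = a" "place f s = t"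
      by (auto simp: represents_def p)
    then have "m' = m" using cube_dim cg by blast
    then have "face_comp g f \<in> faces k n" "face X c (face_comp g f) = a" "place (face_comp g f) s = place g t"
      using f c face_comp_faces face_face place_face_comp by metis+
    then show "represents X k a s q" using c(1) by (auto simp: represents_def q)
  next
    assume "represents X k a s q"
    then obtain n' f where f: "c \<in> cubes X n'" "f \<in> faces k n'" "face X c f = a" "place f s = place g t"
      by (auto simp: represents_def q)
    then have "n' = n" using cube_dim c by blast
    then obtain h where "h \<in> faces k m" "face_comp g h = f" "place h s = t"
      using factor_face[OF _ c(2) s c(3)] f by blast
    then show "represents X k a s p"
      using face_face[OF c(1,2)] cg f(3) by (auto simp: represents_def p)
  qed
qed

lemma point_eq_iff: "point X c t = point X c' t' \<longleftrightarrow> equivclp (glue X) (c, t) (c', t')"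
  unfolding point_def
  by (auto simp: set_eq_iff) (meson equivclp_refl equivclp_sym equivclp_trans)+

lemma glue_invariant:
  assumes "\<And>p q. glue X p q \<Longrightarrow> P p \<longleftrightarrow> P q" and "point X c t = point X c' t'"
  shows "P (c, t) \<longleftrightarrow> P (c', t')"
proof -
  have "equivclp (glue X) p q \<Longrightarrow> P p \<longleftrightarrow> P q" for p q
    by (induction rule: equivclp_induct) (use assms(1) in auto)
  then show ?thesis using assms(2) point_eq_iff by blast
qed

lemma point_face:
  "c \<in> cubes X n \<Longrightarrow> f \<in> faces m n \<Longrightarrow> t \<in> topspace (cube_top m) \<Longrightarrow> point X (face X c f) t = point X c (place f t)"
  unfolding point_eq_iff by (rule r_into_equivclp) (auto simp: glue_def)

lemma point_represents:
  assumes a: "a \<in> cubes X k" and s: "interior_point k s"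
  shows "point X c t = point X a s \<longleftrightarrow> represents X k a s (c, t)"
proof
  assume *: "point X c t = point X a s"
  have s': "s \<in> topspace (cube_top k)" using s by (simp add: interior_point_def)
  have "represents X k a s (a, s)"
    unfolding represents_def using a id_face_faces face_id[OF a] place_id[OF s']
    by (intro exI[of _ k] exI[of _ "id_face k"]) simp
  then show "represents X k a s (c, t)"
    using glue_invariant[of "represents X k a s", OF glue_represents[OF _ s] *] by simp
next
  assume "represents X k a s (c, t)"
  then show "point X c t = point X a s"
    using point_face s by (auto simp: represents_def interior_point_def)
qed

text \<open>Here \<open>face_free\<close> enters: an open cube is not folded by its characteristic map.\<close>

lemma face_unique:
  assumes a: "a \<in> cubes X k" and s: "interior_point k s" and c: "c \<in> cubes X n"
    and f: "f \<in> faces k n" "face X c f = a" and g: "g \<in> faces k n" "face X c g = a"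
    and eq: "place f s = place g s"
  shows "f = g"
proof -
  have s': "s \<in> topspace (cube_top k)" using s by (simp add: interior_point_def)
  obtain h where h: "h \<in> faces k k" "face_comp g h = f"
    using factor_face[OF f(1) g(1) s s' eq] by blast
  have "face X a h = a" using face_face[OF c g(1) h(1)] h(2) f(2) g(2) by simp
  then have "h = id_face k" using face_free[OF a h(1)] by blast
  then show ?thesis using h(2) face_comp_id[OF g(1)] by simp
qed

lemma ex_interior_point:
  assumes "c \<in> cubes X n" "t \<in> topspace (cube_top n)"
  shows "\<exists>k a s. a \<in> cubes X k \<and> interior_point k s \<and> point X c t = point X a s"
proof -
  obtain k f s where f: "f \<in> faces k n" "interior_point k s" "place f s = t" using ex_interior[OF assms(2)] by blast
  then have "point X (face X c f) s = point X c t"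
    using point_face[OF assms(1) f(1)] by (simp add: interior_point_def)
  then show ?thesis using f face_closed[OF assms(1) f(1)] by metis
qed

lemma topspace_realization:
  "topspace (realization X) = {point X c t | c t n. c \<in> cubes X n \<and> t \<in> topspace (cube_top n)}"
proof -
  have "openin (realization X) {point X c t | c t n. c \<in> cubes X n \<and> t \<in> topspace (cube_top n)}"
    unfolding openin_realization
  proof (intro conjI allI ballI)
    fix n c assume "c \<in> cubes X n"
    then have "{t \<in> topspace (cube_top n). point X c t \<in> {point X c t | c t n. c \<in> cubes X n \<and> t \<in> topspace (cube_top n)}} = topspace (cube_top n)"
      by blast
    then show "openin (cube_top n) {t \<in> topspace (cube_top n). point X c t \<in> {point X c t | c t n. c \<in> cubes X n \<and> t \<in> topspace (cube_top n)}}"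
      by simp
  qed simp
  then show ?thesis
    using openin_subset openin_realization[THEN iffD1, OF openin_topspace, THEN conjunct1] by (intro antisym)
qed

lemma point_in_topspace: "c \<in> cubes X n \<Longrightarrow> t \<in> topspace (cube_top n) \<Longrightarrow> point X c t \<in> topspace (realization X)"
  unfolding topspace_realization by blast

lemma continuous_point:
  assumes "c \<in> cubes X n" shows "continuous_map (cube_top n) (realization X) (point X c)"
  unfolding continuous_map
proof (intro conjI allI impI)
  show "point X c ` topspace (cube_top n) \<subseteq> topspace (realization X)"
    using point_in_topspace[OF assms] by blast
  show "openin (cube_top n) {t \<in> topspace (cube_top n). point X c t \<in> U}" if "openin (realization X) U" for U
    using that assms unfolding openin_realization by blast
qed

text \<open>
  A set of points described by a property of their representatives; it is well behaved if the
  property is invariant under gluing.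
\<close>

definition point_set where
  "point_set P = {point X c t | c t n. c \<in> cubes X n \<and> t \<in> topspace (cube_top n) \<and> P (c, t)}"

lemma point_set:
  assumes "\<And>p q. glue X p q \<Longrightarrow> P p \<longleftrightarrow> P q" "c \<in> cubes X n" "t \<in> topspace (cube_top n)"
  shows "point X c t \<in> point_set P \<longleftrightarrow> P (c, t)"
  using glue_invariant[of P, OF assms(1)] assms(2,3) unfolding point_set_def by blast

lemma openin_point_set:
  assumes "\<And>p q. glue X p q \<Longrightarrow> P p \<longleftrightarrow> P q"
    and "\<And>n c. c \<in> cubes X n \<Longrightarrow> openin (cube_top n) {t \<in> topspace (cube_top n). P (c, t)}"
  shows "openin (realization X) (point_set P)"
  unfolding openin_realization
proof (intro conjI allI ballI)
  show "point_set P \<subseteq> {point X c t |c t n. c \<in> cubes X n \<and> t \<in> topspace (cube_top n)}"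
    unfolding point_set_def by blast
  fix n c assume c: "c \<in> cubes X n"
  have "{t \<in> topspace (cube_top n). point X c t \<in> point_set P} = {t \<in> topspace (cube_top n). P (c, t)}"
    using point_set[of P, OF assms(1) c] by blast
  then show "openin (cube_top n) {t \<in> topspace (cube_top n). point X c t \<in> point_set P}" using assms(2)[OF c] by simp
qed

end

section \<open>Compact sets meet finitely many cells\<close>

definition center :: "nat \<Rightarrow> nat \<Rightarrow> real" where "center n = (\<lambda>i\<in>{..<n}. 1/2)"

lemma interior_center: "interior_point n (center n)"
  by (auto simp: interior_point_def center_def in_cube)

lemma Hausdorff_cube: "Hausdorff_space (cube_top n)"
  unfolding cube_top_def by (simp add: Hausdorff_space_product_topology Hausdorff_space_subtopology)

context cube_complex
begin

text \<open>
  The centers of n-cubes form a closed discrete set: each cube contains only finitely many points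
  that are that are such centers, at most one for each of its n-dimensional faces.
\<close>

lemma finite_centers_in_compact:
  assumes C: "compactin (realization X) C"
  shows "finite {p \<in> C. \<exists>e\<in>cubes X n. p = point X e (center n)}"
proof -
  define A where "A = {p \<in> C. \<exists>e\<in>cubes X n. p = point X e (center n)}"
  have closed: "openin (realization X) (topspace (realization X) - B)" if "B \<subseteq> A" for B
    unfolding openin_realization
  proof (intro conjI allI ballI)
    show "topspace (realization X) - B \<subseteq> {point X c t |c t n. c \<in> cubes X n \<and> t \<in> topspace (cube_top n)}"
      using topspace_realization by blast
    fix N c assume c: "c \<in> cubes X N"
    define Z where "Z = {t \<in> topspace (cube_top N). point X c t \<in> B}"
    have "Z \<subseteq> (\<lambda>f. place f (center n)) ` faces n N"
    proof
      fix t assume "t \<in> Z"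
      then obtain e where e: "e \<in> cubes X n" "point X c t = point X e (center n)"
        using \<open>B \<subseteq> A\<close> unfolding Z_def A_def by blast
      then have "represents X n e (center n) (c, t)" using point_represents[OF e(1) interior_center] by blast
      then obtain N' f where "c \<in> cubes X N'" "f \<in> faces n N'" "place f (center n) = t" by (auto simp: represents_def)
      then show "t \<in> (\<lambda>f. place f (center n)) ` faces n N" using cube_dim[OF c] by blast
    qed
    then have "finite Z" using finite_faces finite_subset by blast
    then have "closedin (cube_top N) Z"
      using Hausdorff_imp_t1_space[OF Hausdorff_cube] by (auto simp: t1_space_closedin_finite Z_def)
    then have "openin (cube_top N) (topspace (cube_top N) - Z)" by blast
    moreover have "{t \<in> topspace (cube_top N). point X c t \<in> topspace (realization X) - B} = topspace (cube_top N) - Z"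
      using point_in_topspace[OF c] by (auto simp: Z_def)
    ultimately show "openin (cube_top N) {t \<in> topspace (cube_top N). point X c t \<in> topspace (realization X) - B}" by simp
  qed
  have "finite A"
  proof (cases "A = {}")
    case False
    define \<U> where "\<U> = (\<lambda>p. topspace (realization X) - (A - {p})) ` A"
    have "C \<subseteq> \<Union>\<U>"
      using compactin_subset_topspace[OF C] False unfolding \<U>_def by blast
    moreover have "\<forall>U\<in>\<U>. openin (realization X) U" using closed unfolding \<U>_def by blast
    ultimately obtain \<F> where \<F>: "finite \<F>" "\<F> \<subseteq> \<U>" "C \<subseteq> \<Union>\<F>"
      using C unfolding compactin_def by meson
    obtain F where F: "finite F" "F \<subseteq> A" "\<F> = (\<lambda>p. topspace (realization X) - (A - {p})) ` F"
      using finite_subset_image[OF \<F>(1) \<F>(2)[unfolded \<U>_def]] by blast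
    have "A \<subseteq> F"
    proof
      fix p assume "p \<in> A"
      then have "p \<in> \<Union>\<F>" using \<F>(3) by (auto simp: A_def)
      then obtain q where "q \<in> F" "p \<in> topspace (realization X) - (A - {q})" unfolding F(3) by blast
      then show "p \<in> F" using \<open>p \<in> A\<close> by blast
    qed
    then show ?thesis using F(1) finite_subset by blast
  qed simp
  then show ?thesis by (simp add: A_def)
qed

lemma finite_same_center: "finite {e \<in> cubes X n. point X e (center n) = p}"
proof (cases "{e \<in> cubes X n. point X e (center n) = p} = {}")
  case False
  then obtain e0 where e0: "e0 \<in> cubes X n" "point X e0 (center n) = p" by blast
  have "{e \<in> cubes X n. point X e (center n) = p} \<subseteq> (\<lambda>f. face X e0 f) ` faces n n"
  proof
    fix e assume "e \<in> {e \<in> cubes X n. point X e (center n) = p}"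
    then have e: "e \<in> cubes X n" "point X e0 (center n) = point X e (center n)" using e0 by auto
    then have "represents X n e (center n) (e0, center n)" using point_represents[OF e(1) interior_center] by blast
    then obtain N f where "e0 \<in> cubes X N" "f \<in> faces n N" "face X e0 f = e" by (auto simp: represents_def)
    then show "e \<in> (\<lambda>f. face X e0 f) ` faces n n" using cube_dim[OF e0(1)] by blast
  qed
  then show ?thesis using finite_faces finite_subset by blast
next
  case True
  show ?thesis unfolding True by simp
qed

end

text \<open>
  A compact set whose translates cover contains the center of a translate of every n-cube, and it
  contains finitely many centers, each of finitely many parametrised cubes.
\<close>

lemma cocompact_finite_cells:
  assumes X: "cube_complex X" and \<rho>: "\<And>g. g \<in> carrier K \<Longrightarrow> \<rho> g ` cubes X n = cubes X n"
    "\<And>g. g \<in> carrier K \<Longrightarrow> combinatorial_map (\<rho> g) X X" and co: "cocompact_action K X \<rho>"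
  shows "\<exists>S. finite S \<and> S \<subseteq> cubes X n \<and> (\<forall>c\<in>cubes X n. \<exists>g\<in>carrier K. \<exists>s\<in>S. c = \<rho> g s)"
proof -
  interpret cube_complex X by (rule X)
  obtain C where C: "compactin (realization X) C" "topspace (realization X) = (\<Union>g\<in>carrier K. point_map (\<rho> g) ` C)"
    using co unfolding cocompact_action_def by blast
  define A where "A = {p \<in> C. \<exists>e\<in>cubes X n. p = point X e (center n)}"
  define S where "S = (\<Union>p\<in>A. {e \<in> cubes X n. point X e (center n) = p})"
  have "finite S" unfolding S_def A_def using finite_centers_in_compact[OF C(1)] finite_same_center by blast
  moreover have "\<exists>g\<in>carrier K. \<exists>s\<in>S. c = \<rho> g s" if c: "c \<in> cubes X n" for c
  proof -
    have cc: "center n \<in> topspace (cube_top n)" using interior_center by (simp add: interior_point_def)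
    obtain g p where g: "g \<in> carrier K" "p \<in> C" "point X c (center n) = point_map (\<rho> g) p"
      using point_in_topspace[OF c cc] C(2) by auto
    obtain b t N where b: "b \<in> cubes X N" "t \<in> topspace (cube_top N)" "p = point X b t"
      using compactin_subset_topspace[OF C(1)] g(2) topspace_realization by blast
    have "(b, t) \<in> p" using b(3) by (simp add: point_def)
    then have "(\<rho> g b, t) \<in> point X c (center n)" using g(3) by (force simp: point_map_def)
    then have "point X (\<rho> g b) t = point X c (center n)" using point_eq_iff by (metis point_def mem_Collect_eq)
    then have "represents X n c (center n) (\<rho> g b, t)" using point_represents[OF c interior_center] by blast
    then obtain N' f where f: "\<rho> g b \<in> cubes X N'" "f \<in> faces n N'" "face X (\<rho> g b) f = c" "place f (center n) = t"
      by (auto simp: represents_def)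
    have "\<rho> g b \<in> cubes X N" using \<rho>(2)[OF g(1)] b(1) unfolding combinatorial_map_def by blast
    then have [simp]: "N' = N" using cube_dim f(1) by blast
    define e where "e = face X b f"
    have e: "e \<in> cubes X n" using face_closed[OF b(1)] f(2) by (simp add: e_def)
    have "point X e (center n) = p" using point_face[OF b(1) _ cc, of f] f b(3) by (simp add: e_def)
    then have "e \<in> S" using g(2) e unfolding S_def A_def by blast
    moreover have "c = \<rho> g e" using \<rho>(2)[OF g(1)] b(1) f unfolding combinatorial_map_def e_def by simp
    ultimately show ?thesis using g(1) by blast
  qed
  moreover have "S \<subseteq> cubes X n" unfolding S_def by blast
  ultimately show ?thesis by blast
qed

section \<open>Edge paths\<close>

abbreviation src where "src X e \<equiv> face X e [Fixed False]"
abbreviation tgt where "tgt X e \<equiv> face X e [Fixed True]"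
abbreviation rev_edge where "rev_edge X e \<equiv> face X e [Coord 0 True]"

lemma edge_faces: "[Fixed b] \<in> faces 0 (Suc 0)" "[Coord 0 b] \<in> faces (Suc 0) (Suc 0)"
  by (auto simp: faces_iff)

definition edge_rel where "edge_rel X = {(src X e, tgt X e) | e. e \<in> cubes X 1}"

context cube_complex
begin

lemma edge_ends: "e \<in> cubes X 1 \<Longrightarrow> src X e \<in> cubes X 0" "e \<in> cubes X 1 \<Longrightarrow> tgt X e \<in> cubes X 0"
  using face_closed edge_faces by fastforce+

lemma rev_edge:
  assumes "e \<in> cubes X 1"
  shows "rev_edge X e \<in> cubes X 1" "src X (rev_edge X e) = tgt X e" "tgt X (rev_edge X e) = src X e"
proof -
  have e: "e \<in> cubes X (Suc 0)" using assms by simp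
  show "rev_edge X e \<in> cubes X 1" using face_closed[OF e edge_faces(2)] by simp
  show "src X (rev_edge X e) = tgt X e" "tgt X (rev_edge X e) = src X e"
    using face_face[OF e edge_faces(2) edge_faces(1)] by (simp_all add: face_comp_def)
qed

lemma sym_edge_rel: "sym (edge_rel X)"
  unfolding sym_def edge_rel_def using rev_edge by (simp; metis)

text \<open>
  Change the coordinates of a vertex one by one, each time moving along an edge of the cube.
\<close>

lemma vertices_of_cube:
  assumes c: "c \<in> cubes X n" and f: "f \<in> faces 0 n"
  shows "(corner X n c, face X c f) \<in> (edge_rel X)\<^sup>*"
proof -
  have fx: "\<exists>b. f ! i = Fixed b" if "i < n" for i
    using facesD(2)[OF f that] by (cases "f ! i") auto
  have "(corner X n c, face X c (take k f @ replicate (n - k) (Fixed False))) \<in> (edge_rel X)\<^sup>*" if "k \<le> n" for k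
    using that
  proof (induction k)
    case 0
    then show ?case by (simp add: corner_def)
  next
    case (Suc k)
    then have k: "k < n" by simp
    obtain b where b: "f ! k = Fixed b" using fx k by blast
    define h where "h a = take k f @ a # replicate (n - Suc k) (Fixed False)" for a
    have lf: "length f = n" using facesD(1)[OF f] .
    have hl: "length (h a) = n" for a using k lf by (simp add: h_def)
    have hn: "h a ! i = (if i < k then f ! i else if i = k then a else Fixed False)" if "i < n" for a i
      using that k lf by (auto simp: h_def nth_append nth_Cons')
    have h1: "h (Coord 0 False) \<in> faces 1 n"
    proof -
      have *: "h (Coord 0 False) ! i = Coord j b \<longleftrightarrow> i = k \<and> j = 0 \<and> \<not> b" if "i < n" for i j b
        using fx[OF that] by (auto simp: hn[OF that])
      have "\<exists>i<n. \<exists>b. h (Coord 0 False) ! i = Coord 0 b" using k *[OF k] by blast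
      then show ?thesis unfolding faces_iff using hl by (auto simp: *)
    qed
    have comp: "face_comp (h (Coord 0 False)) [Fixed d] = h (Fixed d)" for d
    proof (rule nth_equalityI)
      fix i assume "i < length (face_comp (h (Coord 0 False)) [Fixed d])"
      then have i: "i < n" using hl by simp
      then obtain b where "f ! i = Fixed b" using fx by blast
      then show "face_comp (h (Coord 0 False)) [Fixed d] ! i = h (Fixed d) ! i" using i hl by (simp add: hn)
    qed (simp add: hl)
    have e: "face X c (h (Coord 0 False)) \<in> cubes X 1" using face_closed[OF c h1] .
    have "(face X c (h (Fixed False)), face X c (h (Fixed True))) \<in> edge_rel X"
    proof -
      have "src X (face X c (h (Coord 0 False))) = face X c (h (Fixed False))"
        "tgt X (face X c (h (Coord 0 False))) = face X c (h (Fixed True))"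
        using face_face[OF c h1, of _ 0] edge_faces(1) comp by simp_all
      then show ?thesis using e unfolding edge_rel_def by force
    qed
    moreover have "take k f @ replicate (n - k) (Fixed False) = h (Fixed False)"
      using k by (simp add: h_def Suc_diff_Suc[symmetric] del: Suc_diff_Suc)
    moreover have "take (Suc k) f @ replicate (n - Suc k) (Fixed False) = h (Fixed b)"
      using k lf b by (simp add: h_def take_Suc_conv_app_nth)
    ultimately show ?case using Suc by (cases b) (auto intro: rtrancl_into_rtrancl)
  qed
  from this[of n] show ?thesis using facesD(1)[OF f] by simp
qed

lemma zeros_faces: "replicate n (Fixed b) \<in> faces 0 n"
  by (auto simp: faces_iff)

lemma corner_vertex: "c \<in> cubes X n \<Longrightarrow> corner X n c \<in> cubes X 0"
  unfolding corner_def using face_closed zeros_faces by blast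

lemma corner_face:
  assumes c: "c \<in> cubes X n" and g: "g \<in> faces m n"
  shows "\<exists>f\<in>faces 0 n. corner X m (face X c g) = face X c f"
  unfolding corner_def using face_face[OF c g zeros_faces] face_comp_faces[OF g zeros_faces] by blast

text \<open>
  The cubes whose corner can be reached along edges form an open set of points, and so do the
  others, as all vertices of a cube are connected by its edges.
\<close>

theorem edge_connected:
  assumes v: "v \<in> cubes X 0" and v': "v' \<in> cubes X 0"
  shows "(v, v') \<in> (edge_rel X)\<^sup>*"
proof -
  have sym: "sym ((edge_rel X)\<^sup>*)" by (rule sym_rtrancl[OF sym_edge_rel])
  define P where "P p \<longleftrightarrow> (\<exists>n. fst p \<in> cubes X n \<and> (v, corner X n (fst p)) \<in> (edge_rel X)\<^sup>*)" for p :: "'a \<times> (nat \<Rightarrow> real)"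
  have P_iff: "P (c, t) \<longleftrightarrow> (v, corner X n c) \<in> (edge_rel X)\<^sup>*" if "c \<in> cubes X n" for c t n
  proof
    assume "P (c, t)"
    then obtain n' where "c \<in> cubes X n'" "(v, corner X n' c) \<in> (edge_rel X)\<^sup>*" unfolding P_def fst_conv by blast
    then show "(v, corner X n c) \<in> (edge_rel X)\<^sup>*" using cube_dim[OF that] by blast
  next
    assume "(v, corner X n c) \<in> (edge_rel X)\<^sup>*"
    then show "P (c, t)" unfolding P_def fst_conv using that by blast
  qed
  have inv: "P p \<longleftrightarrow> P q" if "glue X p q" for p q
  proof -
    obtain m n c g t where c: "c \<in> cubes X n" "g \<in> faces m n" "p = (face X c g, t)" "q = (c, place g t)"
      using \<open>glue X p q\<close> unfolding glue_def by blast
    obtain f where f: "f \<in> faces 0 n" "corner X m (face X c g) = face X c f" using corner_face[OF c(1,2)] by blast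
    have r: "(corner X n c, corner X m (face X c g)) \<in> (edge_rel X)\<^sup>*" using vertices_of_cube[OF c(1) f(1)] f(2) by simp
    have cg: "face X c g \<in> cubes X m" using face_closed c by blast
    have "P p \<longleftrightarrow> (v, corner X m (face X c g)) \<in> (edge_rel X)\<^sup>*" by (simp only: c P_iff[OF cg])
    also have "\<dots> \<longleftrightarrow> (v, corner X n c) \<in> (edge_rel X)\<^sup>*"
      using r symD[OF sym r] by (meson rtrancl_trans)
    also have "\<dots> \<longleftrightarrow> P q" by (simp only: c P_iff[OF c(1)])
    finally show ?thesis .
  qed
  have 1: "openin (realization X) (point_set P)"
  proof (rule openin_point_set[OF inv])
    fix n c assume c: "c \<in> cubes X n"
    show "openin (cube_top n) {t \<in> topspace (cube_top n). P (c, t)}"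
      by (cases "(v, corner X n c) \<in> (edge_rel X)\<^sup>*") (simp_all add: P_iff[OF c])
  qed
  have 2: "openin (realization X) (point_set (\<lambda>p. \<not> P p))"
  proof (rule openin_point_set)
    show "(\<not> P p) = (\<not> P q)" if "glue X p q" for p q using inv[OF that] by simp
    fix n c assume c: "c \<in> cubes X n"
    show "openin (cube_top n) {t \<in> topspace (cube_top n). \<not> P (c, t)}"
      by (cases "(v, corner X n c) \<in> (edge_rel X)\<^sup>*") (simp_all add: P_iff[OF c])
  qed
  define t0 :: "nat \<Rightarrow> real" where "t0 = (\<lambda>_. undefined)"
  have t0: "t0 \<in> topspace (cube_top 0)" by (simp add: t0_def in_cube)
  have c0: "corner X 0 w = w" if "w \<in> cubes X 0" for w
    using face_id[OF that] by (simp add: corner_def id_face_def)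
  have "P (v, t0)" by (simp add: P_iff[OF v] c0[OF v])
  then have ne: "point X v t0 \<in> point_set P" using point_set[of P, OF inv v t0] by simp
  have "point_set P \<inter> point_set (\<lambda>p. \<not> P p) = {}"
    using glue_invariant[of P, OF inv] unfolding point_set_def by blast
  moreover have "topspace (realization X) \<subseteq> point_set P \<union> point_set (\<lambda>p. \<not> P p)"
    unfolding topspace_realization point_set_def by blast
  ultimately have "point_set (\<lambda>p. \<not> P p) = {}"
    using connected 1 2 ne unfolding connected_space_def by blast
  then have "point X v' t0 \<in> point_set P"
    using point_in_topspace[OF v' t0] \<open>topspace (realization X) \<subseteq> _\<close> by blast
  then have "P (v', t0)" using point_set[of P, OF inv v' t0] by simp
  then show ?thesis by (simp add: P_iff[OF v'] c0[OF v'])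
qed

end

section \<open>Labellings and transport\<close>

lemma sum_list_commute:
  fixes h :: "'b \<Rightarrow> 'w::monoid_add"
  shows "(\<And>y. y \<in> set ys \<Longrightarrow> z + h y = h y + z) \<Longrightarrow> z + sum_list (map h ys) = sum_list (map h ys) + z"
proof (induction ys)
  case (Cons y ys)
  have "z + (h y + sum_list (map h ys)) = h y + (z + sum_list (map h ys))"
    using Cons.prems[of y] by (simp flip: add.assoc)
  then show ?case using Cons by (simp add: add.assoc)
qed simp

lemma sum_list_perm:
  fixes h :: "'b \<Rightarrow> 'w::monoid_add"
  assumes "\<And>x y. x \<in> set xs \<Longrightarrow> y \<in> set xs \<Longrightarrow> h x + h y = h y + h x" "mset xs = mset ys"
  shows "sum_list (map h xs) = sum_list (map h ys)"
  using assms
proof (induction xs arbitrary: ys)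
  case (Cons x xs)
  have s: "set (x # xs) = set ys" using Cons.prems(2) by (rule mset_eq_setD)
  then obtain as bs where ys: "ys = as @ x # bs" using split_list[of x ys] by auto
  then have IH: "sum_list (map h xs) = sum_list (map h (as @ bs))"
    using Cons.prems by (intro Cons.IH) auto
  have "h x + sum_list (map h as) = sum_list (map h as) + h x"
    by (rule sum_list_commute) (use Cons.prems(1) s ys in auto)
  then have "sum_list (map h ys) = h x + sum_list (map h (as @ bs))" by (simp add: ys add.assoc[symmetric])
  then show ?case using IH by simp
qed simp

lemma sum_list_add:
  fixes u v :: "'b \<Rightarrow> 'w::monoid_add"
  assumes "\<And>i j. i \<in> set xs \<Longrightarrow> j \<in> set xs \<Longrightarrow> v i + u j = u j + v i"
  shows "sum_list (map (\<lambda>i. u i + v i) xs) = sum_list (map u xs) + sum_list (map v xs)"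
  using assms
proof (induction xs)
  case (Cons x xs)
  have "v x + sum_list (map u xs) = sum_list (map u xs) + v x"
    by (rule sum_list_commute) (use Cons.prems in auto)
  then have "u x + v x + (sum_list (map u xs) + sum_list (map v xs)) =
    u x + sum_list (map u xs) + (v x + sum_list (map v xs))"
    by (metis add.assoc)
  then show ?case using Cons by simp
qed simp

lemma commute_uminus:
  fixes x y :: "'w::group_add"
  assumes "x + y = y + x" shows "- x + y = y + - x" "x + - y = - y + x" "- x + - y = - y + - x"
proof -
  show 1: "- x + y = y + - x" using assms by (metis add.assoc add.left_neutral add.right_neutral left_minus right_minus)
  show 2: "x + - y = - y + x" using assms by (metis add.assoc add.left_neutral add.right_neutral left_minus right_minus)
  show "- x + - y = - y + - x" using assms by (metis minus_add)
qed

text \<open>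
  A cocycle on the cubes with values in a group: every coordinate direction of every cube has a
  value, which is inverted when the direction is reversed, is the same for parallel edges, and
  commutes with the values of the other directions of the cube.
\<close>

definition labelling :: "('a, 'b) cube_complex_scheme \<Rightarrow> ('a \<Rightarrow> nat \<Rightarrow> 'w::group_add) \<Rightarrow> bool" where
  "labelling X lam \<longleftrightarrow>
     (\<forall>m n c f i j b. c \<in> cubes X n \<longrightarrow> f \<in> faces m n \<longrightarrow> i < n \<longrightarrow> f ! i = Coord j b \<longrightarrow>
        lam (face X c f) j = (if b then - lam c i else lam c i)) \<and>
     (\<forall>n c i j. c \<in> cubes X n \<longrightarrow> i < n \<longrightarrow> j < n \<longrightarrow> lam c i + lam c j = lam c j + lam c i)"

text \<open>The coordinate of the image of the corner of a face.\<close>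

fun bit :: "coord \<Rightarrow> bool" where
  "bit (Fixed b) = b"
| "bit (Coord j b) = b"

lemma bit_flip [simp]: "bit (flip b a) \<longleftrightarrow> bit a \<noteq> b"
  by (cases a) auto

text \<open>
  The sum of the labels along an edge path from the corner of \<open>c\<close> to the corner of its face \<open>f\<close>;
  the order of the edges does not matter as the labels commute.
\<close>

definition transport :: "('a \<Rightarrow> nat \<Rightarrow> 'w::group_add) \<Rightarrow> 'a \<Rightarrow> coord list \<Rightarrow> 'w" where
  "transport lam c f = sum_list (map (\<lambda>i. if bit (f ! i) then lam c i else 0) [0..<length f])"

locale labelled_complex = cube_complex X for X :: "('a, 'b) cube_complex_scheme" +
  fixes lam :: "'a \<Rightarrow> nat \<Rightarrow> 'w::group_add"
  assumes labelling: "labelling X lam"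
begin

abbreviation "R \<equiv> realization X"

text \<open>
  The transports to the corner of a face \<open>f\<close> and further to the corner of a face \<open>g\<close> of it
  compose: the coordinates that \<open>f\<close> fixes contribute to the first summand only. A coordinate that
  \<open>f\<close> reverses contributes to the first summand as well and is subtracted again by \<open>g\<close> if its bit
  is set there.
\<close>

lemma transport_comp:
  assumes c: "c \<in> cubes X n" and f: "f \<in> faces m n" and g: "g \<in> faces l m"
  shows "transport lam c (face_comp f g) = transport lam c f + transport lam (face X c f) g"
proof -
  have com: "lam c i + lam c j = lam c j + lam c i" if "i < n" "j < n" for i j
    using labelling c that unfolding labelling_def by blast
  have face: "lam (face X c f) j = (if b then - lam c i else lam c i)" if "i < n" "f ! i = Coord j b" for i j b
    using labelling c f that unfolding labelling_def by blast
  define u where "u i = (if bit (f ! i) then lam c i else 0)" for i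
  define v where "v i = (case f ! i of Fixed _ \<Rightarrow> 0
    | Coord j b \<Rightarrow> if bit (g ! j) then (if b then - lam c i else lam c i) else 0)" for i
  have lf: "length f = n" "length g = m" using facesD(1)[OF f] facesD(1)[OF g] by auto
  have com_all: "a + b = b + a" if "a \<in> {0, lam c i, - lam c i}" "b \<in> {0, lam c j, - lam c j}" "i < n" "j < n" for a b i j
    using that com[of i j] commute_uminus[OF com[of i j]] by auto
  have u_in: "u i \<in> {0, lam c i, - lam c i}" and v_in: "v i \<in> {0, lam c i, - lam c i}" for i
    by (auto simp: u_def v_def split: coord.split)
  have "transport lam c (face_comp f g) = sum_list (map (\<lambda>i. u i + v i) [0..<n])"
    unfolding transport_def length_face_comp lf
  proof (intro arg_cong[where f = sum_list] map_cong refl)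
    fix i assume "i \<in> set [0..<n]"
    then show "(if bit (face_comp f g ! i) then lam c i else 0) = u i + v i"
      using lf by (cases "f ! i") (auto simp: u_def v_def)
  qed
  also have "\<dots> = sum_list (map u [0..<n]) + sum_list (map v [0..<n])"
    by (rule sum_list_add) (use com_all[OF v_in u_in] in auto)
  also have "sum_list (map u [0..<n]) = transport lam c f" by (simp add: transport_def u_def[abs_def] lf)
  also have "sum_list (map v [0..<n]) = transport lam (face X c f) g"
  proof -
    obtain p e where pe: "\<And>j. j < m \<Longrightarrow> p j < n \<and> f ! p j = Coord j (e j)"
      using facesD(3)[OF f] by metis
    define Q where "Q i \<longleftrightarrow> (\<exists>j b. f ! i = Coord j b)" for i
    have "sum_list (map v [0..<n]) = sum_list (map v (filter Q [0..<n]))"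
      by (rule sum_list_map_filter[symmetric]) (auto simp: v_def Q_def split: coord.split)
    also have "\<dots> = sum_list (map v (map p [0..<m]))"
    proof (rule sum_list_perm)
      show "v x + v y = v y + v x" if "x \<in> set (filter Q [0..<n])" "y \<in> set (filter Q [0..<n])" for x y
        using com_all[OF v_in v_in] that by auto
      have "inj_on p {..<m}" using pe by (intro inj_onI) (metis coord.inject(2) lessThan_iff)
      then have "distinct (map p [0..<m])" by (simp add: distinct_map atLeast0LessThan)
      moreover have "set (filter Q [0..<n]) = set (map p [0..<m])"
      proof
        show "set (filter Q [0..<n]) \<subseteq> set (map p [0..<m])"
        proof
          fix i assume "i \<in> set (filter Q [0..<n])"
          then obtain j b where i: "i < n" "f ! i = Coord j b" by (auto simp: Q_def)
          then have j: "j < m" using facesD(2)[OF f] by blast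
          then have "i = p j" using facesD(4)[OF f i(1) _ i(2)] pe[OF j] by blast
          then show "i \<in> set (map p [0..<m])" using j by auto
        qed
      qed (use pe in \<open>auto simp: Q_def\<close>)
      ultimately show "mset (filter Q [0..<n]) = mset (map p [0..<m])"
        by (subst set_eq_iff_mset_eq_distinct[symmetric]) auto
    qed
    also have "\<dots> = transport lam (face X c f) g"
      unfolding transport_def lf map_map
    proof (intro arg_cong[where f = sum_list] map_cong refl)
      fix j assume "j \<in> set [0..<m]"
      then show "(v \<circ> p) j = (if bit (g ! j) then lam (face X c f) j else 0)"
        using pe[of j] face[of "p j" j "e j"] by (simp add: v_def)
    qed
    finally show ?thesis .
  qed
  finally show ?thesis .
qed

section \<open>Local sections\<close>

text \<open>
  A section assigns a group element to each representative of a point, thought of as the value of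
  a potential at the corner of the cube of the representative. The values for different cubes
  differ by the transport between their corners.
\<close>

definition compatible where
  "compatible U \<phi> \<longleftrightarrow> (\<forall>m n c g t. c \<in> cubes X n \<longrightarrow> g \<in> faces m n \<longrightarrow> t \<in> topspace (cube_top m) \<longrightarrow>
     point X c (place g t) \<in> U \<longrightarrow> \<phi> (face X c g, t) = \<phi> (c, place g t) + transport lam c g)"

definition local_section where
  "local_section U \<phi> \<longleftrightarrow> openin R U \<and> compatible U \<phi> \<and>
     (\<forall>n c t. c \<in> cubes X n \<longrightarrow> t \<in> topspace (cube_top n) \<longrightarrow> point X c t \<in> U \<longrightarrow>
        (\<exists>T. openin (cube_top n) T \<and> t \<in> T \<and> (\<forall>t'\<in>T. point X c t' \<in> U \<longrightarrow> \<phi> (c, t') = \<phi> (c, t))))"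

lemma finite_gap:
  assumes "finite (D :: real set)" shows "\<exists>\<epsilon>>0. \<forall>x\<in>D. \<forall>y\<in>D. \<bar>x - y\<bar> < 2 * \<epsilon> \<longrightarrow> x = y"
proof -
  define G where "G = insert 1 ((\<lambda>(x, y). \<bar>x - y\<bar>) ` {(x, y) \<in> D \<times> D. x \<noteq> y})"
  have fin: "finite {(x, y) \<in> D \<times> D. x \<noteq> y}"
    by (rule finite_subset[of _ "D \<times> D"]) (use assms in auto)
  then have G: "finite G" "G \<noteq> {}" "\<And>z. z \<in> G \<Longrightarrow> z > 0" by (auto simp: G_def)
  then have "Min G > 0" by simp
  moreover have "x = y" if "x \<in> D" "y \<in> D" "\<bar>x - y\<bar> < 2 * (Min G / 2)" for x y
  proof (rule ccontr)
    assume "x \<noteq> y"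
    then have "\<bar>x - y\<bar> \<in> G" using that by (force simp: G_def)
    then show False using Min_le[OF G(1)] that(3) by force
  qed
  ultimately show ?thesis by (intro exI[of _ "Min G / 2"]) auto
qed

lemma openin_box:
  "openin (cube_top n) {t \<in> topspace (cube_top n). \<forall>i<n. \<bar>t i - s i\<bar> < \<epsilon>}"
proof -
  have "{t \<in> topspace (cube_top n). \<forall>i<n. \<bar>t i - s i\<bar> < \<epsilon>} = (\<Pi>\<^sub>E i\<in>{..<n}. {0..1} \<inter> ball (s i) \<epsilon>)"
    by (rule Set.set_eqI) (simp add: cube_top_def PiE_iff dist_real_def abs_minus_commute, blast)
  moreover have "openin (top_of_set {0..1}) ({0..1} \<inter> ball (s i) \<epsilon>)" for i
    by (intro openin_open_Int) simp
  ultimately show ?thesis unfolding cube_top_def by (simp add: openin_PiE)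
qed

text \<open>
  The point is interior to a cube \<open>a\<close>. Near it, all cubes contain \<open>a\<close> as a face, and a section is
  defined by giving \<open>a\<close> the value 0 and transporting. Each coordinate of the point in a cube is
  one of the finitely many numbers in \<open>D\<close>; with \<open>\<epsilon>\<close> at most half of the gaps between them, a point
  near \<open>p\<close> determines the face \<open>f\<close> that is equal to \<open>a\<close> uniquely, and it is compatible with
  passing to faces.
\<close>

lemma ex_section:
  assumes "p \<in> topspace R"
  shows "\<exists>U \<phi>. local_section U \<phi> \<and> p \<in> U"
proof -
  obtain k a s where a: "a \<in> cubes X k" and s: "interior_point k s" and p: "p = point X a s"
    using assms ex_interior_point unfolding topspace_realization by blast
  have s': "s \<in> topspace (cube_top k)" using s by (simp add: interior_point_def)
  define D where "D = {0, 1} \<union> s ` {..<k} \<union> (\<lambda>j. 1 - s j) ` {..<k}"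
  have "finite D" by (simp add: D_def)
  then obtain \<epsilon> where \<epsilon>: "\<epsilon> > 0" "\<And>x y. x \<in> D \<Longrightarrow> y \<in> D \<Longrightarrow> \<bar>x - y\<bar> < 2 * \<epsilon> \<Longrightarrow> x = y"
    using finite_gap by metis
  have placeD: "place f s i \<in> D" if "f \<in> faces k n" "i < n" for f n i
    using facesD(1)[OF that(1)] facesD(2)[OF that] that(2) by (cases "f ! i") (auto simp: place_nth D_def)
  define near where "near n c t f \<longleftrightarrow> f \<in> faces k n \<and> face X c f = a \<and> (\<forall>i<n. \<bar>t i - place f s i\<bar> < \<epsilon>)" for n c t f
  have near_unique: "f = f'" if "c \<in> cubes X n" "near n c t f" "near n c t f'" for c n t f f'
  proof -
    have f: "f \<in> faces k n" "face X c f = a" "f' \<in> faces k n" "face X c f' = a"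
      using that by (auto simp: near_def)
    have "place f s i = place f' s i" if i: "i < n" for i
    proof (rule \<epsilon>(2)[OF placeD placeD])
      have "\<bar>t i - place f s i\<bar> < \<epsilon>" "\<bar>t i - place f' s i\<bar> < \<epsilon>"
        using \<open>near n c t f\<close> \<open>near n c t f'\<close> i by (auto simp: near_def)
      then show "\<bar>place f s i - place f' s i\<bar> < 2 * \<epsilon>" by linarith
    qed (use f i in auto)
    moreover have "place f s i = place f' s i" if "\<not> i < n" for i
      using facesD(1)[OF f(1)] facesD(1)[OF f(3)] that by (simp add: place_def)
    ultimately have "place f s = place f' s" by blast
    then show ?thesis using face_unique[OF a s that(1)] f by blast
  qed
  have near_face: "near n c (place g t) (face_comp g h)"
    if "c \<in> cubes X n" "g \<in> faces m n" "near m (face X c g) t h" for n m c g t h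
  proof -
    have h: "h \<in> faces k m" "face X (face X c g) h = a" "\<And>j. j < m \<Longrightarrow> \<bar>t j - place h s j\<bar> < \<epsilon>"
      using that(3) by (auto simp: near_def)
    have "\<bar>place g t i - place g (place h s) i\<bar> < \<epsilon>" if i: "i < n" for i
      using facesD(1)[OF \<open>g \<in> faces m n\<close>] facesD(2)[OF \<open>g \<in> faces m n\<close> i] h(3) i \<epsilon>(1)
      by (cases "g ! i") (auto simp: place_nth abs_minus_commute)
    then show ?thesis
      using face_comp_faces[OF that(2) h(1)] face_face[OF that(1,2) h(1)] h(2) place_face_comp[OF that(2) h(1)]
      by (simp add: near_def)
  qed
  have near_face_conv: "\<exists>h. near m (face X c g) t h \<and> face_comp g h = f"
    if "c \<in> cubes X n" "g \<in> faces m n" "t \<in> topspace (cube_top m)" "near n c (place g t) f" for n m c g t f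
  proof -
    note g = \<open>g \<in> faces m n\<close>
    have f: "f \<in> faces k n" "face X c f = a" "\<And>i. i < n \<Longrightarrow> \<bar>place g t i - place f s i\<bar> < \<epsilon>"
      using that(4) by (auto simp: near_def)
    have "place f s i = of_bool b" if i: "i < n" "g ! i = Fixed b" for i b
    proof -
      have g: "place g t i = of_bool b" using i facesD(1)[OF \<open>g \<in> faces m n\<close>] by (simp add: place_nth)
      have "of_bool b = place f s i"
        by (rule \<epsilon>(2)[OF _ placeD[OF f(1) i(1)]]) (use f(3)[OF i(1)] g \<epsilon>(1) in \<open>auto simp: D_def\<close>)
      then show ?thesis by simp
    qed
    then obtain t' where t': "t' \<in> topspace (cube_top m)" "place g t' = place f s"
      using place_surj[OF g place_in_cube[OF f(1) s']] by blast
    obtain h where h: "h \<in> faces k m" "face_comp g h = f" "place h s = t'"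
      using factor_face[OF f(1) g s t'(1)] t'(2) by auto
    have "\<bar>t j - place h s j\<bar> < \<epsilon>" if j: "j < m" for j
    proof -
      obtain i b where i: "i < n" "g ! i = Coord j b" using facesD(3)[OF \<open>g \<in> faces m n\<close> j] by blast
      have "\<bar>place g t i - place g t' i\<bar> < \<epsilon>" using f(3)[OF i(1)] t'(2) by simp
      then show ?thesis
        using i h(3) facesD(1)[OF \<open>g \<in> faces m n\<close>] by (auto simp: place_nth abs_minus_commute split: if_splits)
    qed
    moreover have "face X (face X c g) h = a" using face_face[OF that(1,2) h(1)] h(2) f(2) by simp
    ultimately show ?thesis using h by (auto simp: near_def)
  qed
  define P where "P q \<longleftrightarrow> (\<exists>n f. fst q \<in> cubes X n \<and> near n (fst q) (snd q) f)" for q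
  have P_iff: "P (c, t) \<longleftrightarrow> (\<exists>f. near n c t f)" if "c \<in> cubes X n" for c n t
  proof
    assume "P (c, t)"
    then obtain n' f where "c \<in> cubes X n'" "near n' c t f" unfolding P_def fst_conv snd_conv by blast
    then show "\<exists>f. near n c t f" using cube_dim[OF that] by blast
  next
    assume "\<exists>f. near n c t f"
    then show "P (c, t)" unfolding P_def fst_conv snd_conv using that by blast
  qed
  have inv: "P q \<longleftrightarrow> P q'" if "glue X q q'" for q q'
  proof -
    obtain m n c g t where c: "c \<in> cubes X n" "g \<in> faces m n" "t \<in> topspace (cube_top m)"
      "q = (face X c g, t)" "q' = (c, place g t)"
      using \<open>glue X q q'\<close> unfolding glue_def by blast
    show ?thesis
      unfolding c(4,5) P_iff[OF c(1)] P_iff[OF face_closed[OF c(1,2)]]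
      using near_face[OF c(1,2)] near_face_conv[OF c(1-3)] by blast
  qed
  define U where "U = point_set P"
  define \<phi> where "\<phi> q = - transport lam (fst q) (THE f. \<exists>n. fst q \<in> cubes X n \<and> near n (fst q) (snd q) f)" for q
  have \<phi>: "\<phi> (c, t) = - transport lam c f" if "c \<in> cubes X n" "near n c t f" for c n t f
  proof -
    have "(THE f. \<exists>n. c \<in> cubes X n \<and> near n c t f) = f"
    proof (rule the_equality)
      show "\<exists>n. c \<in> cubes X n \<and> near n c t f" using that by blast
      fix f' assume "\<exists>n. c \<in> cubes X n \<and> near n c t f'"
      then obtain n' where "c \<in> cubes X n'" "near n' c t f'" by blast
      then show "f' = f" using near_unique[OF that(1)] that cube_dim[OF that(1)] by blast
    qed
    then show ?thesis by (simp add: \<phi>_def)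
  qed
  have box: "\<exists>T. openin (cube_top n) T \<and> t \<in> T \<and> (\<forall>t'\<in>T. near n c t' f)"
    if "c \<in> cubes X n" "t \<in> topspace (cube_top n)" "near n c t f" for n c t f
    using that openin_box[of n "place f s" \<epsilon>]
    by (intro exI[of _ "{t \<in> topspace (cube_top n). \<forall>i<n. \<bar>t i - place f s i\<bar> < \<epsilon>}"]) (auto simp: near_def)
  have "openin R U"
    unfolding U_def
  proof (rule openin_point_set[OF inv])
    fix n c assume c: "c \<in> cubes X n"
    show "openin (cube_top n) {t \<in> topspace (cube_top n). P (c, t)}"
    proof (subst openin_subopen, intro ballI)
      fix t assume "t \<in> {t \<in> topspace (cube_top n). P (c, t)}"
      then obtain f where t: "t \<in> topspace (cube_top n)" "near n c t f" using P_iff[OF c] by blast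
      obtain T where T: "openin (cube_top n) T" "t \<in> T" "\<forall>t'\<in>T. near n c t' f" using box[OF c t] by blast
      then show "\<exists>T. openin (cube_top n) T \<and> t \<in> T \<and> T \<subseteq> {t \<in> topspace (cube_top n). P (c, t)}"
        using P_iff[OF c] openin_subset[OF T(1)] by blast
    qed
  qed
  moreover have "compatible U \<phi>"
    unfolding compatible_def
  proof (intro allI impI)
    fix m n c g t
    assume c: "c \<in> cubes X n" "g \<in> faces m n" "t \<in> topspace (cube_top m)" and "point X c (place g t) \<in> U"
    then obtain f where f: "near n c (place g t) f"
      using point_set[of P, OF inv c(1) place_in_cube[OF c(2,3)]] P_iff[OF c(1)] by (auto simp: U_def)
    obtain h where h: "near m (face X c g) t h" "face_comp g h = f" using near_face_conv[OF c f] by blast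
    have "\<phi> (face X c g, t) = - transport lam (face X c g) h" by (rule \<phi>[OF face_closed[OF c(1,2)] h(1)])
    moreover have "\<phi> (c, place g t) = - transport lam c f" by (rule \<phi>[OF c(1) f])
    moreover have "transport lam c f = transport lam c g + transport lam (face X c g) h"
      using transport_comp[OF c(1,2)] h by (auto simp: near_def)
    ultimately show "\<phi> (face X c g, t) = \<phi> (c, place g t) + transport lam c g"
      by (simp add: minus_add add.assoc)
  qed
  moreover have "\<exists>T. openin (cube_top n) T \<and> t \<in> T \<and> (\<forall>t'\<in>T. point X c t' \<in> U \<longrightarrow> \<phi> (c, t') = \<phi> (c, t))"
    if c: "c \<in> cubes X n" "t \<in> topspace (cube_top n)" "point X c t \<in> U" for n c t
  proof -
    obtain f where f: "near n c t f" using point_set[of P, OF inv c(1,2)] c(3) P_iff[OF c(1)] by (auto simp: U_def)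
    obtain T where T: "openin (cube_top n) T" "t \<in> T" "\<forall>t'\<in>T. near n c t' f" using box[OF c(1,2) f] by blast
    then show ?thesis using \<phi>[OF c(1)] f by (intro exI[of _ T]) (simp add: \<phi>[OF c(1) f])
  qed
  moreover have "p \<in> U"
  proof -
    have "near k a s (id_face k)"
      using id_face_faces face_id[OF a] place_id[OF s'] \<epsilon>(1) by (simp add: near_def)
    then show ?thesis using point_set[of P, OF inv a s'] P_iff[OF a] by (auto simp: U_def p)
  qed
  ultimately show ?thesis unfolding local_section_def by blast
qed

lemma local_section_open: "local_section U \<phi> \<Longrightarrow> openin R U"
  by (simp add: local_section_def)

lemma local_section_compatible:
  assumes "local_section U \<phi>" "c \<in> cubes X n" "g \<in> faces m n" "t \<in> topspace (cube_top m)" "point X c (place g t) \<in> U"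
  shows "\<phi> (face X c g, t) = \<phi> (c, place g t) + transport lam c g"
  using assms unfolding local_section_def compatible_def by (elim conjE) simp

lemma local_section_locally_constant:
  assumes "local_section U \<phi>" "c \<in> cubes X n" "t \<in> topspace (cube_top n)" "point X c t \<in> U"
  shows "\<exists>T. openin (cube_top n) T \<and> t \<in> T \<and> (\<forall>t'\<in>T. point X c t' \<in> U \<longrightarrow> \<phi> (c, t') = \<phi> (c, t))"
  using assms unfolding local_section_def by (elim conjE) simp

definition over :: "('a \<times> (nat \<Rightarrow> real)) set \<Rightarrow> ('a \<times> (nat \<Rightarrow> real)) set" where
  "over p = {(c, t) | c t n. c \<in> cubes X n \<and> t \<in> topspace (cube_top n) \<and> point X c t = p}"

lemma overI: "c \<in> cubes X n \<Longrightarrow> t \<in> topspace (cube_top n) \<Longrightarrow> point X c t = p \<Longrightarrow> (c, t) \<in> over p"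
  by (auto simp: over_def)

lemma overE:
  assumes "q \<in> over p"
  obtains c t n where "q = (c, t)" "c \<in> cubes X n" "t \<in> topspace (cube_top n)" "point X c t = p"
  using assms by (auto simp: over_def)

lemma ex_over:
  assumes "p \<in> topspace R" shows "\<exists>q. q \<in> over p"
proof -
  obtain c t n where "c \<in> cubes X n" "t \<in> topspace (cube_top n)" "p = point X c t"
    using assms unfolding topspace_realization by blast
  then show ?thesis using overI by blast
qed

text \<open>
  The difference of two sections is independent of the representative, since the transports
  cancel, and locally constant.
\<close>

lemma section_difference:
  assumes U: "local_section U \<phi>" and V: "local_section V \<psi>"
    and q: "q \<in> over p" "p \<in> U \<inter> V"
  shows "\<exists>Q. openin R Q \<and> p \<in> Q \<and> Q \<subseteq> U \<inter> V \<and>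
    (\<forall>p'\<in>Q. \<forall>q'\<in>over p'. \<psi> q' + - \<phi> q' = \<psi> q + - \<phi> q)"
proof -
  define \<kappa> where "\<kappa> = \<psi> q + - \<phi> q"
  define P where "P q \<longleftrightarrow> point X (fst q) (snd q) \<in> U \<inter> V \<and> \<psi> q + - \<phi> q = \<kappa>" for q
  have inv: "P q \<longleftrightarrow> P q'" if "glue X q q'" for q q'
  proof -
    obtain m n c g t where c: "c \<in> cubes X n" "g \<in> faces m n" "t \<in> topspace (cube_top m)"
      and q: "q = (face X c g, t)" "q' = (c, place g t)"
      using \<open>glue X q q'\<close> unfolding glue_def by blast
    have "point X (face X c g) t = point X c (place g t)" by (rule point_face[OF c])
    moreover have "\<psi> (face X c g, t) = \<psi> (c, place g t) + transport lam c g"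
      "\<phi> (face X c g, t) = \<phi> (c, place g t) + transport lam c g" if "point X c (place g t) \<in> U \<inter> V"
      using local_section_compatible[OF U c] local_section_compatible[OF V c] that by simp_all
    moreover have "x + a + - (y + a) = x + - y" for x y a :: 'w
      by (simp add: minus_add add.assoc del: add_uminus_conv_diff)
    ultimately show ?thesis by (auto simp: P_def q simp del: add_uminus_conv_diff)
  qed
  have op: "openin R (point_set P)"
  proof (rule openin_point_set[OF inv])
    fix m b assume b: "b \<in> cubes X m"
    show "openin (cube_top m) {u \<in> topspace (cube_top m). P (b, u)}"
    proof (subst openin_subopen, intro ballI)
      fix u assume "u \<in> {u \<in> topspace (cube_top m). P (b, u)}"
      then have u: "u \<in> topspace (cube_top m)" "point X b u \<in> U" "point X b u \<in> V" "\<psi> (b, u) + - \<phi> (b, u) = \<kappa>"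
        by (auto simp: P_def)
      obtain T where T: "openin (cube_top m) T" "u \<in> T" "\<forall>t'\<in>T. point X b t' \<in> U \<longrightarrow> \<phi> (b, t') = \<phi> (b, u)"
        using local_section_locally_constant[OF U b u(1,2)] by blast
      obtain T' where T': "openin (cube_top m) T'" "u \<in> T'" "\<forall>t'\<in>T'. point X b t' \<in> V \<longrightarrow> \<psi> (b, t') = \<psi> (b, u)"
        using local_section_locally_constant[OF V b u(1,3)] by blast
      define S where "S W = {t \<in> topspace (cube_top m). point X b t \<in> W}" for W
      have S: "openin (cube_top m) (S W)" if "openin R W" for W
        using that b unfolding openin_realization S_def by blast
      have "openin (cube_top m) (T \<inter> T' \<inter> S U \<inter> S V)"
        by (intro openin_Int T(1) T'(1) S local_section_open[OF U] local_section_open[OF V])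
      moreover have "T \<inter> T' \<inter> S U \<inter> S V \<subseteq> {u \<in> topspace (cube_top m). P (b, u)}"
      proof
        fix u' assume u': "u' \<in> T \<inter> T' \<inter> S U \<inter> S V"
        then have "\<phi> (b, u') = \<phi> (b, u)" "\<psi> (b, u') = \<psi> (b, u)" using T(3) T'(3) by (simp_all add: S_def)
        then show "u' \<in> {u \<in> topspace (cube_top m). P (b, u)}" using u(4) u' by (simp add: P_def S_def)
      qed
      moreover have "u \<in> T \<inter> T' \<inter> S U \<inter> S V" using T(2) T'(2) u by (simp add: S_def)
      ultimately show "\<exists>T. openin (cube_top m) T \<and> u \<in> T \<and> T \<subseteq> {u \<in> topspace (cube_top m). P (b, u)}" by blast
    qed
  qed
  have P_iff: "P q' \<longleftrightarrow> p' \<in> point_set P" if "q' \<in> over p'" for q' p'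
  proof -
    obtain c t n where "q' = (c, t)" "c \<in> cubes X n" "t \<in> topspace (cube_top n)" "point X c t = p'"
      by (rule overE[OF \<open>q' \<in> over p'\<close>])
    then show ?thesis using point_set[of P, OF inv] by blast
  qed
  moreover have "p \<in> point_set P"
  proof -
    obtain c t n where "q = (c, t)" "point X c t = p" by (rule overE[OF q(1)])
    then have "P q" using q(2) by (simp add: P_def \<kappa>_def)
    then show ?thesis using P_iff[OF q(1)] by blast
  qed
  moreover have "point_set P \<subseteq> U \<inter> V" unfolding point_set_def P_def by auto
  moreover have "\<psi> q' + - \<phi> q' = \<kappa>" if "p' \<in> point_set P" "q' \<in> over p'" for p' q'
    using P_iff[OF that(2)] that(1) by (simp add: P_def)
  ultimately show ?thesis unfolding \<kappa>_def[symmetric] using op by (intro exI[of _ "point_set P"] conjI ballI)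
qed

section \<open>Lifts\<close>

text \<open>
  Lifts of maps \<open>h\<close> to the covering space whose local sections are the local sections above. A
  point of this space over \<open>p\<close> is a compatible family of values on the representatives of \<open>p\<close>.
\<close>

definition lift_at :: "('z::topological_space \<Rightarrow> ('a \<times> (nat \<Rightarrow> real)) set) \<Rightarrow> 'z set \<Rightarrow> ('z \<Rightarrow> 'a \<times> (nat \<Rightarrow> real) \<Rightarrow> 'w) \<Rightarrow> 'z \<Rightarrow> bool" where
  "lift_at h S \<psi> z \<longleftrightarrow> (\<exists>V U \<phi>. openin (top_of_set S) V \<and> z \<in> V \<and> local_section U \<phi> \<and> h ` V \<subseteq> U \<and>
     (\<forall>z'\<in>V. \<forall>q\<in>over (h z'). \<psi> z' q = \<phi> q))"

definition lift :: "('z::topological_space \<Rightarrow> ('a \<times> (nat \<Rightarrow> real)) set) \<Rightarrow> 'z set \<Rightarrow> ('z \<Rightarrow> 'a \<times> (nat \<Rightarrow> real) \<Rightarrow> 'w) \<Rightarrow> bool" where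
  "lift h S \<psi> \<longleftrightarrow> (\<forall>z\<in>S. lift_at h S \<psi> z)"

lemma lift_atI:
  assumes "openin (top_of_set S) V" "z \<in> V" "local_section U \<phi>" "h ` V \<subseteq> U"
    "\<And>z' q. z' \<in> V \<Longrightarrow> q \<in> over (h z') \<Longrightarrow> \<psi> z' q = \<phi> q"
  shows "lift_at h S \<psi> z"
  unfolding lift_at_def using assms by (intro exI[of _ V] exI[of _ U] exI[of _ \<phi>]) simp

lemma lift_atE:
  assumes "lift_at h S \<psi> z"
  obtains V U \<phi> where "openin (top_of_set S) V" "z \<in> V" "local_section U \<phi>" "h ` V \<subseteq> U"
    "\<And>z' q. z' \<in> V \<Longrightarrow> q \<in> over (h z') \<Longrightarrow> \<psi> z' q = \<phi> q"
  using assms unfolding lift_at_def by (elim exE conjE) simp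

lemma liftE:
  assumes "lift h S \<psi>" "z \<in> S"
  obtains V U \<phi> where "openin (top_of_set S) V" "z \<in> V" "local_section U \<phi>" "h ` V \<subseteq> U"
    "\<And>z' q. z' \<in> V \<Longrightarrow> q \<in> over (h z') \<Longrightarrow> \<psi> z' q = \<phi> q"
proof -
  have "lift_at h S \<psi> z" using assms by (simp add: lift_def)
  then show thesis by (rule lift_atE) (rule that)
qed

lemma lift_face:
  assumes "lift h S \<psi>" "z \<in> S" "c \<in> cubes X n" "g \<in> faces m n" "t \<in> topspace (cube_top m)" "point X c (place g t) = h z"
  shows "\<psi> z (face X c g, t) = \<psi> z (c, place g t) + transport lam c g"
proof -
  obtain V U \<phi> where V: "z \<in> V" "local_section U \<phi>" "h ` V \<subseteq> U"
    and \<psi>: "\<And>z' q. z' \<in> V \<Longrightarrow> q \<in> over (h z') \<Longrightarrow> \<psi> z' q = \<phi> q"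
    by (rule liftE[OF assms(1,2)]) (rule that)
  have "point X (face X c g) t = h z" using point_face[OF assms(3-5)] assms(6) by simp
  then have "\<psi> z (face X c g, t) = \<phi> (face X c g, t)"
    using \<psi>[OF V(1)] overI[OF face_closed[OF assms(3,4)] assms(5)] by simp
  moreover have "\<psi> z (c, place g t) = \<phi> (c, place g t)"
    using \<psi>[OF V(1) overI[OF assms(3) place_in_cube[OF assms(4,5)] assms(6)]] .
  moreover have "point X c (place g t) \<in> U" using assms(6) V by auto
  ultimately show ?thesis using local_section_compatible[OF V(2) assms(3-5)] by simp
qed

lemma lift_subset:
  assumes \<psi>: "lift h S \<psi>" and T: "T \<subseteq> S" shows "lift h T \<psi>"
  unfolding lift_def
proof
  fix z assume z: "z \<in> T"
  then have zS: "z \<in> S" using T by blast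
  obtain V U \<phi> where V: "openin (top_of_set S) V" "z \<in> V" "local_section U \<phi>" "h ` V \<subseteq> U"
    and *: "\<And>z' q. z' \<in> V \<Longrightarrow> q \<in> over (h z') \<Longrightarrow> \<psi> z' q = \<phi> q" by (rule liftE[OF \<psi> zS]) (rule that)
  obtain O1 where "open O1" "V = S \<inter> O1" using V(1) by (auto simp: openin_open)
  then have "openin (top_of_set T) (T \<inter> V)"
    using T by (auto simp: openin_open intro!: exI[of _ O1])
  then show "lift_at h T \<psi> z"
    by (rule lift_atI[where U = U and \<phi> = \<phi>]) (use z V * in auto)
qed

lemma lift_compose:
  assumes \<psi>: "lift h S \<psi>" and g: "continuous_on T g" "g ` T \<subseteq> S"
  shows "lift (h \<circ> g) T (\<psi> \<circ> g)"
  unfolding lift_def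
proof
  fix z assume z: "z \<in> T"
  then have zS: "g z \<in> S" using g(2) by blast
  obtain V U \<phi> where V: "openin (top_of_set S) V" "g z \<in> V" "local_section U \<phi>" "h ` V \<subseteq> U"
    and *: "\<And>z' q. z' \<in> V \<Longrightarrow> q \<in> over (h z') \<Longrightarrow> \<psi> z' q = \<phi> q" by (rule liftE[OF \<psi> zS]) (rule that)
  have "openin (top_of_set T) (T \<inter> g -` V)"
    using g V(1) continuous_on_open_gen[of g T S] by blast
  then show "lift_at (h \<circ> g) T (\<psi> \<circ> g) z"
    by (rule lift_atI[where U = U and \<phi> = \<phi>]) (use V z * in auto)
qed

lemma lift_shift:
  assumes \<psi>: "lift h S \<psi>" shows "lift h S (\<lambda>z r. \<kappa> + \<psi> z r)"
  unfolding lift_def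
proof
  fix z assume z: "z \<in> S"
  obtain V U \<phi> where V: "openin (top_of_set S) V" "z \<in> V" "local_section U \<phi>" "h ` V \<subseteq> U"
    and *: "\<And>z' q. z' \<in> V \<Longrightarrow> q \<in> over (h z') \<Longrightarrow> \<psi> z' q = \<phi> q" by (rule liftE[OF \<psi> z]) (rule that)
  have "compatible U (\<lambda>r. \<kappa> + \<phi> r)"
    using local_section_compatible[OF V(3)] unfolding compatible_def by (simp add: add.assoc)
  moreover have "\<exists>T. openin (cube_top n) T \<and> t \<in> T \<and> (\<forall>t'\<in>T. point X c t' \<in> U \<longrightarrow> \<kappa> + \<phi> (c, t') = \<kappa> + \<phi> (c, t))"
    if "c \<in> cubes X n" "t \<in> topspace (cube_top n)" "point X c t \<in> U" for n c t
    using local_section_locally_constant[OF V(3) that] by auto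
  ultimately have "local_section U (\<lambda>r. \<kappa> + \<phi> r)"
    using local_section_open[OF V(3)] unfolding local_section_def by blast
  then show "lift_at h S (\<lambda>z r. \<kappa> + \<psi> z r) z"
    by (rule lift_atI[OF V(1,2)]) (use V * in auto)
qed

lemma continuous_point_in:
  "continuous_map (top_of_set S) R h \<Longrightarrow> z \<in> S \<Longrightarrow> h z \<in> topspace R"
  by (auto simp: continuous_map)

lemma continuous_preimage:
  "continuous_map (top_of_set S) R h \<Longrightarrow> openin R Q \<Longrightarrow> openin (top_of_set S) {z \<in> S. h z \<in> Q}"
  by (simp add: continuous_map)

text \<open>The difference of two lifts is locally constant, by \<open>section_difference\<close>.\<close>

lemma lift_difference:
  assumes \<phi>: "lift h S \<phi>" and \<psi>: "lift h S \<psi>" and S: "connected S" and h: "continuous_map (top_of_set S) R h"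
    and z: "z \<in> S" "q \<in> over (h z)" and z': "z' \<in> S" "q' \<in> over (h z')"
  shows "\<psi> z q + - \<phi> z q = \<psi> z' q' + - \<phi> z' q'"
proof -
  define \<delta> where "\<delta> z q = \<psi> z q + - \<phi> z q" for z q
  have loc: "\<exists>T. openin (top_of_set S) T \<and> z \<in> T \<and> (\<forall>z'\<in>T. \<forall>q'\<in>over (h z'). \<delta> z' q' = \<delta> z q)"
    if z: "z \<in> S" "q \<in> over (h z)" for z q
  proof -
    obtain V U f where V: "openin (top_of_set S) V" "z \<in> V" "local_section U f" "h ` V \<subseteq> U"
      and f: "\<And>z' q. z' \<in> V \<Longrightarrow> q \<in> over (h z') \<Longrightarrow> \<phi> z' q = f q" by (rule liftE[OF \<phi> z(1)]) (rule that)
    obtain V' U' g where V': "openin (top_of_set S) V'" "z \<in> V'" "local_section U' g" "h ` V' \<subseteq> U'"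
      and g: "\<And>z' q. z' \<in> V' \<Longrightarrow> q \<in> over (h z') \<Longrightarrow> \<psi> z' q = g q" by (rule liftE[OF \<psi> z(1)]) (rule that)
    have "h z \<in> U \<inter> U'" using V V' by auto
    then obtain Q where Q: "openin R Q" "h z \<in> Q"
      "\<forall>p'\<in>Q. \<forall>q'\<in>over p'. g q' + - f q' = g q + - f q"
      using section_difference[OF V(3) V'(3) z(2)] by blast
    define T where "T = V \<inter> V' \<inter> {z \<in> S. h z \<in> Q}"
    have "openin (top_of_set S) T"
      unfolding T_def by (intro openin_Int V(1) V'(1) continuous_preimage[OF h Q(1)])
    moreover have "z \<in> T" using z V V' Q(2) by (simp add: T_def)
    moreover have "\<delta> z' q' = \<delta> z q" if "z' \<in> T" "q' \<in> over (h z')" for z' q'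
    proof -
      have z': "z' \<in> V" "z' \<in> V'" "h z' \<in> Q" using that by (auto simp: T_def)
      show ?thesis
        unfolding \<delta>_def f[OF z'(1) that(2)] g[OF z'(2) that(2)] f[OF V(2) z(2)] g[OF V'(2) z(2)]
        using Q(3) z'(3) that(2) by blast
    qed
    ultimately show ?thesis by blast
  qed
  define rep where "rep z = (SOME q. q \<in> over (h z))" for z
  have rep: "rep z \<in> over (h z)" if "z \<in> S" for z
    unfolding rep_def by (rule someI_ex) (rule ex_over[OF continuous_point_in[OF h that]])
  have "(\<lambda>z. \<delta> z (rep z)) constant_on S"
  proof (rule locally_constant_imp_constant[OF S])
    fix z assume z: "z \<in> S"
    obtain T where T: "openin (top_of_set S) T" "z \<in> T" "\<forall>z'\<in>T. \<forall>q'\<in>over (h z'). \<delta> z' q' = \<delta> z (rep z)"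
      using loc[OF z rep[OF z]] by blast
    have "\<delta> z' (rep z') = \<delta> z (rep z)" if "z' \<in> T" for z'
      using rep[of z'] T(3) openin_imp_subset[OF T(1)] that by blast
    then show "\<exists>T. openin (top_of_set S) T \<and> z \<in> T \<and> (\<forall>x\<in>T. \<delta> x (rep x) = \<delta> z (rep z))" using T(1,2) by blast
  qed
  then obtain \<kappa> where \<kappa>: "\<And>z. z \<in> S \<Longrightarrow> \<delta> z (rep z) = \<kappa>" unfolding constant_on_def by blast
  have "\<delta> z q = \<kappa>" if z: "z \<in> S" "q \<in> over (h z)" for z q
  proof -
    obtain T where T: "z \<in> T" "\<forall>z'\<in>T. \<forall>q'\<in>over (h z'). \<delta> z' q' = \<delta> z q" using loc[OF z] by blast
    then have "\<delta> z (rep z) = \<delta> z q" using rep[OF z(1)] by blast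
    then show ?thesis using \<kappa>[OF z(1)] by simp
  qed
  then have "\<delta> z q = \<delta> z' q'" using z z' by simp
  then show ?thesis by (simp add: \<delta>_def)
qed

lemma lift_increment:
  assumes \<phi>: "lift h S \<phi>" and \<psi>: "lift h S \<psi>" and S: "connected S" and h: "continuous_map (top_of_set S) R h"
    and z: "z \<in> S" "q \<in> over (h z)" and z': "z' \<in> S" "q' \<in> over (h z')"
  shows "- \<phi> z q + \<phi> z' q' = - \<psi> z q + \<psi> z' q'"
proof -
  define a b a' b' where ab: "a = \<phi> z q" "b = \<psi> z q" "a' = \<phi> z' q'" "b' = \<psi> z' q'"
  have "b + - a = b' + - a'" using lift_difference[OF \<phi> \<psi> S h z z'] by (simp only: ab)
  then have "- b + (b + - a) + a' = - b + (b' + - a') + a'" by simp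
  then have "- a + a' = - b + b'" by (simp add: add.assoc del: add_uminus_conv_diff)
  then show ?thesis by (simp only: ab)
qed

lemma lift_local:
  assumes h: "continuous_map (top_of_set S) R h" and z: "z \<in> S"
  shows "\<exists>V. openin (top_of_set S) V \<and> z \<in> V \<and> (\<forall>T\<subseteq>V. \<exists>\<psi>. lift h T \<psi>)"
proof -
  obtain U \<phi> where U: "local_section U \<phi>" "h z \<in> U" using ex_section[OF continuous_point_in[OF h z]] by blast
  define V where "V = {z \<in> S. h z \<in> U}"
  have "openin (top_of_set S) V" unfolding V_def by (rule continuous_preimage[OF h local_section_open[OF U(1)]])
  moreover have "lift h T (\<lambda>_. \<phi>)" if "T \<subseteq> V" for T
    unfolding lift_def
  proof
    fix z assume "z \<in> T"
    show "lift_at h T (\<lambda>_. \<phi>) z"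
      by (rule lift_atI[where V = T, OF _ \<open>z \<in> T\<close> U(1)]) (use \<open>T \<subseteq> V\<close> in \<open>auto simp: V_def\<close>)
  qed
  ultimately show ?thesis using z U(2) by (intro exI[of _ V]) (auto simp: V_def)
qed

lemma lift_at_extend:
  assumes "lift h A \<psi>" "z \<in> A" "z \<notin> B" "closed B" "\<And>z. z \<in> A - B \<Longrightarrow> \<omega> z = \<psi> z"
  shows "lift_at h (A \<union> B) \<omega> z"
proof -
  obtain V U f where V: "openin (top_of_set A) V" "z \<in> V" "local_section U f" "h ` V \<subseteq> U"
    and f: "\<And>z' q. z' \<in> V \<Longrightarrow> q \<in> over (h z') \<Longrightarrow> \<psi> z' q = f q" by (rule liftE[OF assms(1,2)]) (rule that)
  obtain O1 where O1: "open O1" "V = A \<inter> O1" using V(1) by (auto simp: openin_open)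
  then have "V - B = (A \<union> B) \<inter> (O1 - B)" by blast
  then have "openin (top_of_set (A \<union> B)) (V - B)"
    using open_Diff[OF O1(1) assms(4)] by (auto simp: openin_open)
  then show ?thesis
    by (rule lift_atI[where U = U and \<phi> = f]) (use V assms(3,5) f O1 in auto)
qed

text \<open>
  The second lift is shifted such that it agrees with the first one at a point of the connected
  intersection, hence on all of it.
\<close>

lemma lift_paste:
  assumes cl: "closed A" "closed B" and con: "connected (A \<inter> B)" "A \<inter> B \<noteq> {}"
    and h: "continuous_map (top_of_set (A \<union> B)) R h" and A: "lift h A \<phi>" and B: "lift h B \<psi>"
  shows "\<exists>\<omega>. lift h (A \<union> B) \<omega>"
proof -
  obtain z0 where z0: "z0 \<in> A \<inter> B" using con by blast
  have hAB: "h z \<in> topspace R" if "z \<in> A \<union> B" for z using continuous_point_in[OF h that] .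
  obtain q0 where q0: "q0 \<in> over (h z0)" using ex_over hAB z0 by blast
  define \<psi>' where "\<psi>' z r = (\<phi> z0 q0 + - \<psi> z0 q0) + \<psi> z r" for z r
  have B': "lift h B \<psi>'" unfolding \<psi>'_def by (rule lift_shift[OF B])
  have hc: "continuous_map (top_of_set (A \<inter> B)) R h"
    using continuous_map_from_subtopology_mono[OF h, of "A \<inter> B"] by blast
  have eq: "\<psi>' z q = \<phi> z q" if "z \<in> A \<inter> B" "q \<in> over (h z)" for z q
  proof -
    have "\<psi>' z q + - \<phi> z q = \<psi>' z0 q0 + - \<phi> z0 q0"
      by (rule lift_difference[OF lift_subset[OF A] lift_subset[OF B'] con(1) hc that z0 q0]) auto
    also have "\<dots> = 0" by (simp add: \<psi>'_def add.assoc del: add_uminus_conv_diff)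
    finally show ?thesis by simp
  qed
  define \<omega> where "\<omega> z = (if z \<in> A then \<phi> z else \<psi>' z)" for z
  have eqB: "\<omega> z q = \<psi>' z q" if "z \<in> B" "q \<in> over (h z)" for z q
    using eq that by (simp add: \<omega>_def)
  have "lift_at h (A \<union> B) \<omega> z" if z: "z \<in> A \<union> B" for z
  proof -
    consider "z \<in> A" "z \<notin> B" | "z \<in> B" "z \<notin> A" | "z \<in> A" "z \<in> B" using z by blast
    then show ?thesis
    proof cases
      case 1
      show ?thesis by (rule lift_at_extend[OF A 1 cl(2)]) (simp add: \<omega>_def)
    next
      case 2
      have "lift_at h (B \<union> A) \<omega> z" by (rule lift_at_extend[OF B' 2 cl(1)]) (simp add: \<omega>_def)
      then show ?thesis by (simp add: Un_commute)
    next
      case 3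
      obtain V U f where V: "openin (top_of_set A) V" "z \<in> V" "local_section U f" "h ` V \<subseteq> U"
        and f: "\<And>z' q. z' \<in> V \<Longrightarrow> q \<in> over (h z') \<Longrightarrow> \<phi> z' q = f q" by (rule liftE[OF A 3(1)]) (rule that)
      obtain V' U' g where V': "openin (top_of_set B) V'" "z \<in> V'" "local_section U' g" "h ` V' \<subseteq> U'"
        and g: "\<And>z' q. z' \<in> V' \<Longrightarrow> q \<in> over (h z') \<Longrightarrow> \<psi>' z' q = g q" by (rule liftE[OF B' 3(2)]) (rule that)
      obtain q where q: "q \<in> over (h z)" using ex_over hAB z by blast
      have "h z \<in> U \<inter> U'" using V V' by auto
      then obtain Q where Q: "openin R Q" "h z \<in> Q" "Q \<subseteq> U \<inter> U'"
        "\<forall>p'\<in>Q. \<forall>q'\<in>over p'. g q' + - f q' = g q + - f q"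
        using section_difference[OF V(3) V'(3) q] by blast
      have "g q = f q" using f[OF V(2) q] g[OF V'(2) q] eq[OF _ q] 3 by simp
      then have gf: "g q' = f q'" if "p' \<in> Q" "q' \<in> over p'" for p' q'
        using Q(4) that by simp
      obtain O1 where O1: "open O1" "V = A \<inter> O1" using V(1) by (auto simp: openin_open)
      obtain O2 where O2: "open O2" "V' = B \<inter> O2" using V'(1) by (auto simp: openin_open)
      define T where "T = (A \<union> B) \<inter> (O1 \<inter> O2) \<inter> {z \<in> A \<union> B. h z \<in> Q}"
      have "openin (top_of_set (A \<union> B)) T"
        unfolding T_def using O1(1) O2(1) by (intro openin_Int openin_open_Int open_Int continuous_preimage[OF h Q(1)])
      moreover have "z \<in> T" using 3 V(2) V'(2) O1 O2 Q(2) by (auto simp: T_def)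
      moreover have "h ` T \<subseteq> U" using Q(3) by (auto simp: T_def)
      moreover have "\<omega> z' q' = f q'" if "z' \<in> T" "q' \<in> over (h z')" for z' q'
      proof (cases "z' \<in> A")
        case True
        then show ?thesis using f[OF _ that(2)] that(1) O1 by (auto simp: \<omega>_def T_def)
      next
        case False
        then have "\<omega> z' q' = g q'" using g[OF _ that(2)] that(1) O2 by (auto simp: \<omega>_def T_def)
        then show ?thesis using gf[OF _ that(2)] that(1) by (auto simp: T_def)
      qed
      ultimately show ?thesis by (rule lift_atI[OF _ _ V(3)])
    qed
  qed
  then show ?thesis unfolding lift_def by blast
qed

end

context labelled_complex
begin

section \<open>Lifting paths and homotopies\<close>

lemma lift_section:
  assumes "local_section U \<phi>" "h ` T \<subseteq> U" shows "lift h T (\<lambda>_. \<phi>)"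
  unfolding lift_def
proof
  fix z assume z: "z \<in> T"
  show "lift_at h T (\<lambda>_. \<phi>) z"
    by (rule lift_atI[where V = T, OF _ z assms]) auto
qed

lemma lift_cong:
  assumes \<psi>: "lift h S \<psi>" and "\<And>z. z \<in> S \<Longrightarrow> h z = h' z" shows "lift h' S \<psi>"
  unfolding lift_def
proof
  fix z assume z: "z \<in> S"
  obtain V U \<phi> where V: "openin (top_of_set S) V" "z \<in> V" "local_section U \<phi>" "h ` V \<subseteq> U"
    and *: "\<And>z' q. z' \<in> V \<Longrightarrow> q \<in> over (h z') \<Longrightarrow> \<psi> z' q = \<phi> q" by (rule liftE[OF \<psi> z]) (rule that)
  have eq: "h z = h' z" if "z \<in> V" for z using assms(2) openin_imp_subset[OF V(1)] that by blast
  show "lift_at h' S \<psi> z"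
    by (rule lift_atI[OF V(1-3)]) (use V(4) * eq in auto)
qed

text \<open>
  Small rectangles can be lifted. Pasting along common sides gives first lifts over thin strips
  and then over the square; both steps are Bolzano's bisection argument.
\<close>

lemma lift_square:
  assumes h: "continuous_map (top_of_set ({0..1} \<times> {0..1})) R h"
  shows "\<exists>\<psi>. lift h ({0..1::real} \<times> {0..1::real}) \<psi>"
proof -
  let ?sq = "{0..1::real} \<times> {0..1::real}"
  have hs: "continuous_map (top_of_set S) R h" if "S \<subseteq> ?sq" for S
    using continuous_map_from_subtopology_mono[OF h that] .
  have loc: "\<exists>e>0. \<forall>a b c d. 0 \<le> a \<longrightarrow> a \<le> x \<longrightarrow> x \<le> b \<longrightarrow> b \<le> 1 \<longrightarrow> b - a < e \<longrightarrow>
      0 \<le> c \<longrightarrow> c \<le> y \<longrightarrow> y \<le> d \<longrightarrow> d \<le> 1 \<longrightarrow> d - c < e \<longrightarrow> (\<exists>\<psi>. lift h ({a..b} \<times> {c..d}) \<psi>)"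
    if xy: "x \<in> {0..1}" "y \<in> {0..1}" for x y
  proof -
    obtain V where V: "openin (top_of_set ?sq) V" "(x, y) \<in> V" "\<forall>T\<subseteq>V. \<exists>\<psi>. lift h T \<psi>"
      using lift_local[OF h, of "(x, y)"] xy by blast
    obtain W where W: "open W" "V = ?sq \<inter> W" using V(1) by (auto simp: openin_open)
    obtain A B where AB: "open A" "open B" "x \<in> A" "y \<in> B" "A \<times> B \<subseteq> W"
      using open_prod_elim[OF W(1), of "(x, y)"] V(2) W(2) by (metis IntD2 mem_Sigma_iff)
    obtain e1 where e1: "e1 > 0" "ball x e1 \<subseteq> A" using AB(1,3) by (rule openE)
    obtain e2 where e2: "e2 > 0" "ball y e2 \<subseteq> B" using AB(2,4) by (rule openE)
    have "\<exists>\<psi>. lift h ({a..b} \<times> {c..d}) \<psi>"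
      if "0 \<le> a" "a \<le> x" "x \<le> b" "b \<le> 1" "b - a < min e1 e2" "0 \<le> c" "c \<le> y" "y \<le> d" "d \<le> 1" "d - c < min e1 e2" for a b c d
    proof -
      have "{a..b} \<subseteq> A" using that e1(2) by (force simp: dist_real_def)
      moreover have "{c..d} \<subseteq> B" using that e2(2) by (force simp: dist_real_def)
      ultimately have "{a..b} \<times> {c..d} \<subseteq> V" using W(2) AB(5) that by auto
      then show ?thesis using V(3) by blast
    qed
    then show ?thesis using e1(1) e2(1) by (intro exI[of _ "min e1 e2"]) auto
  qed
  have strip: "\<exists>e>0. \<forall>a b. 0 \<le> a \<longrightarrow> a \<le> x \<longrightarrow> x \<le> b \<longrightarrow> b \<le> 1 \<longrightarrow> b - a < e \<longrightarrow> (\<exists>\<psi>. lift h ({a..b} \<times> {0..1}) \<psi>)"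
    if x: "x \<in> {0..1}" for x
  proof -
    define P where "P c d \<longleftrightarrow> (0 \<le> c \<longrightarrow> d \<le> 1 \<longrightarrow> (\<exists>e>0. \<forall>a b. 0 \<le> a \<longrightarrow> a \<le> x \<longrightarrow> x \<le> b \<longrightarrow> b \<le> 1 \<longrightarrow> b - a < e \<longrightarrow>
      (\<exists>\<psi>. lift h ({a..b} \<times> {c..d}) \<psi>)))" for c d :: real
    have "P 0 1"
    proof (rule Bolzano)
      fix c d d' assume P: "P c d" "P d d'" and le: "c \<le> d" "d \<le> d'"
      show "P c d'"
        unfolding P_def
      proof (intro impI)
        assume c: "0 \<le> c" "d' \<le> 1"
        have d: "0 \<le> d" "d \<le> 1" using c le by auto
        obtain e where e: "e > 0" "\<forall>a b. 0 \<le> a \<longrightarrow> a \<le> x \<longrightarrow> x \<le> b \<longrightarrow> b \<le> 1 \<longrightarrow> b - a < e \<longrightarrow> (\<exists>\<psi>. lift h ({a..b} \<times> {c..d}) \<psi>)"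
          using mp[OF mp[OF P(1)[unfolded P_def] c(1)] d(2)] by (elim exE conjE) (rule that)
        obtain e' where e': "e' > 0" "\<forall>a b. 0 \<le> a \<longrightarrow> a \<le> x \<longrightarrow> x \<le> b \<longrightarrow> b \<le> 1 \<longrightarrow> b - a < e' \<longrightarrow> (\<exists>\<psi>. lift h ({a..b} \<times> {d..d'}) \<psi>)"
          using mp[OF mp[OF P(2)[unfolded P_def] d(1)] c(2)] by (elim exE conjE) (rule that)
        have "\<exists>\<psi>. lift h ({a..b} \<times> {c..d'}) \<psi>" if a: "0 \<le> a" "a \<le> x" "x \<le> b" "b \<le> 1" "b - a < min e e'" for a b
        proof -
          obtain \<psi> where \<psi>: "lift h ({a..b} \<times> {c..d}) \<psi>" using e(2)[rule_format, of a b] a by auto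
          obtain \<psi>' where \<psi>': "lift h ({a..b} \<times> {d..d'}) \<psi>'" using e'(2)[rule_format, of a b] a by auto
          have i: "{a..b} \<times> {c..d} \<inter> {a..b} \<times> {d..d'} = {a..b} \<times> {d..d}" using le by auto
          have u: "{a..b} \<times> {c..d} \<union> {a..b} \<times> {d..d'} = {a..b} \<times> {c..d'}" using le by auto
          have "\<exists>\<omega>. lift h ({a..b} \<times> {c..d} \<union> {a..b} \<times> {d..d'}) \<omega>"
            by (rule lift_paste[OF _ _ _ _ _ \<psi> \<psi>'])
              (use a c in \<open>auto simp: i u closed_Times connected_Times intro!: hs\<close>)
          then show ?thesis unfolding u .
        qed
        then show "\<exists>e>0. \<forall>a b. 0 \<le> a \<longrightarrow> a \<le> x \<longrightarrow> x \<le> b \<longrightarrow> b \<le> 1 \<longrightarrow> b - a < e \<longrightarrow> (\<exists>\<psi>. lift h ({a..b} \<times> {c..d'}) \<psi>)"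
          using e(1) e'(1) by (intro exI[of _ "min e e'"]) auto
      qed
    next
      fix y :: real assume y: "0 \<le> y" "y \<le> 1"
      obtain e where e: "e > 0" "\<forall>a b c d. 0 \<le> a \<longrightarrow> a \<le> x \<longrightarrow> x \<le> b \<longrightarrow> b \<le> 1 \<longrightarrow> b - a < e \<longrightarrow>
          0 \<le> c \<longrightarrow> c \<le> y \<longrightarrow> y \<le> d \<longrightarrow> d \<le> 1 \<longrightarrow> d - c < e \<longrightarrow> (\<exists>\<psi>. lift h ({a..b} \<times> {c..d}) \<psi>)"
        using loc[OF x, of y] y by auto
      have "P c d" if "c \<le> y" "y \<le> d" "d - c < e" for c d
        unfolding P_def using e that by blast
      then show "\<exists>e>0. \<forall>c d. c \<le> y \<and> y \<le> d \<and> d - c < e \<longrightarrow> P c d" using e(1) by blast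
    qed simp
    then show ?thesis unfolding P_def by simp
  qed
  define P where "P a b \<longleftrightarrow> (0 \<le> a \<longrightarrow> b \<le> 1 \<longrightarrow> (\<exists>\<psi>. lift h ({a..b} \<times> {0..1}) \<psi>))" for a b :: real
  have "P 0 1"
  proof (rule Bolzano)
    fix a b b' assume P: "P a b" "P b b'" and le: "a \<le> b" "b \<le> b'"
    show "P a b'"
      unfolding P_def
    proof (intro impI)
      assume a: "0 \<le> a" "b' \<le> 1"
      obtain \<psi> where \<psi>: "lift h ({a..b} \<times> {0..1}) \<psi>" using P(1) a le unfolding P_def by (metis order.trans)
      obtain \<psi>' where \<psi>': "lift h ({b..b'} \<times> {0..1}) \<psi>'" using P(2) a le unfolding P_def by (metis order.trans)
      have i: "{a..b} \<times> {0..1::real} \<inter> {b..b'} \<times> {0..1} = {b..b} \<times> {0..1}" using le by auto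
      have u: "{a..b} \<times> {0..1::real} \<union> {b..b'} \<times> {0..1} = {a..b'} \<times> {0..1}" using le by auto
      have "\<exists>\<omega>. lift h ({a..b} \<times> {0..1} \<union> {b..b'} \<times> {0..1}) \<omega>"
        by (rule lift_paste[OF _ _ _ _ _ \<psi> \<psi>'])
          (use a in \<open>auto simp: i u closed_Times connected_Times intro!: hs\<close>)
      then show "\<exists>\<psi>. lift h ({a..b'} \<times> {0..1}) \<psi>" unfolding u .
    qed
  next
    fix x :: real assume "0 \<le> x" "x \<le> 1"
    then obtain e where e: "e > 0" "\<forall>a b. 0 \<le> a \<longrightarrow> a \<le> x \<longrightarrow> x \<le> b \<longrightarrow> b \<le> 1 \<longrightarrow> b - a < e \<longrightarrow> (\<exists>\<psi>. lift h ({a..b} \<times> {0..1}) \<psi>)"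
      using strip[of x] by auto
    have "P a b" if "a \<le> x" "x \<le> b" "b - a < e" for a b
      unfolding P_def using e that by blast
    then show "\<exists>e>0. \<forall>a b. a \<le> x \<and> x \<le> b \<and> b - a < e \<longrightarrow> P a b" using e(1) by blast
  qed simp
  then show ?thesis unfolding P_def by simp
qed

lemma ex_path_lift:
  assumes "pathin R \<gamma>" shows "\<exists>\<psi>. lift \<gamma> {0..1} \<psi>"
proof -
  have "continuous_map (top_of_set ({0..1} \<times> {0..1})) R (\<gamma> \<circ> fst)"
    by (rule continuous_map_compose[OF _ assms[unfolded pathin_def]])
      (auto simp: continuous_map_in_subtopology continuous_on_fst)
  then obtain \<psi> where "lift (\<gamma> \<circ> fst) ({0..1} \<times> {0..1::real}) \<psi>" using lift_square by blast
  then have "lift (\<gamma> \<circ> fst \<circ> (\<lambda>x. (x, 0::real))) {0..1} (\<psi> \<circ> (\<lambda>x. (x, 0)))"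
    by (rule lift_compose) (auto intro!: continuous_intros)
  then show ?thesis by (auto simp: comp_def)
qed

text \<open>The difference of a potential between the end points of a path.\<close>

definition increment where
  "increment \<gamma> q q' = (let \<psi> = SOME \<psi>. lift \<gamma> {0..1::real} \<psi> in - \<psi> 0 q + \<psi> 1 q')"

lemma increment_eq:
  assumes "pathin R \<gamma>" "lift \<gamma> {0..1} \<psi>" "q \<in> over (\<gamma> 0)" "q' \<in> over (\<gamma> 1)"
  shows "increment \<gamma> q q' = - \<psi> 0 q + \<psi> 1 q'"
proof -
  have "lift \<gamma> {0..1} (SOME \<psi>. lift \<gamma> {0..1::real} \<psi>)" by (rule someI[where P = "lift \<gamma> {0..1}", OF assms(2)])
  then show ?thesis
    unfolding increment_def Let_def
    by (rule lift_increment[OF _ assms(2)]) (use assms in \<open>auto simp: pathin_def\<close>)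
qed

text \<open>
  Lift a homotopy from the loop to a constant path. On the other three sides \<open>B\<close> of the square the
  homotopy is constant, and so is the lift.
\<close>

lemma increment_loop:
  assumes sc: "simply_connected_space R" and \<gamma>: "pathin R \<gamma>" "\<gamma> 0 = \<gamma> 1" and q: "q \<in> over (\<gamma> 0)"
  shows "increment \<gamma> q q = 0"
proof -
  let ?sq = "{0..1::real} \<times> {0..1::real}"
  have "homotopic_with (\<lambda>h. h 0 = \<gamma> 0 \<and> h 1 = \<gamma> 0) (top_of_set {0..1}) R \<gamma> (\<lambda>_. \<gamma> 0)"
    using sc \<gamma> unfolding simply_connected_space_def by blast
  then obtain h where h: "continuous_map (prod_topology (top_of_set {0..1}) (top_of_set {0..1})) R h"
    and h0: "\<And>x. h (0::real, x) = \<gamma> x" and h1: "\<And>x. h (1, x) = \<gamma> 0"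
    and hs: "\<And>t. t \<in> {0..1} \<Longrightarrow> h (t, 0) = \<gamma> 0 \<and> h (t, 1) = \<gamma> 0"
    unfolding homotopic_with_def by blast
  have hsq: "continuous_map (top_of_set ?sq) R h"
    using h by (simp add: subtopology_Times[symmetric] euclidean_product_topology[symmetric])
  then obtain \<Psi> where \<Psi>: "lift h ?sq \<Psi>" using lift_square by blast
  have "lift (h \<circ> Pair 0) {0..1} (\<Psi> \<circ> Pair 0)"
    by (rule lift_compose[OF \<Psi>]) (auto intro!: continuous_intros)
  then have "lift \<gamma> {0..1} (\<Psi> \<circ> Pair 0)" by (rule lift_cong) (simp add: h0)
  then have inc: "increment \<gamma> q q = - \<Psi> (0, 0) q + \<Psi> (0, 1) q"
    using increment_eq[OF \<gamma>(1) _ q] q \<gamma>(2) by simp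
  define B where "B = {0..1} \<times> {0} \<union> ({1} \<times> {0..1} \<union> {0..1} \<times> {1::real} :: (real \<times> real) set)"
  have B: "B \<subseteq> ?sq" by (auto simp: B_def)
  have "(1, 1) \<in> {1::real} \<times> {0..1::real} \<inter> {0..1::real} \<times> {1::real}" "(1, 0) \<in> {0..1::real} \<times> {0::real} \<inter> ({1::real} \<times> {0..1::real} \<union> {0..1::real} \<times> {1::real})"
    by simp_all
  then have ne: "{1::real} \<times> {0..1::real} \<inter> {0..1::real} \<times> {1::real} \<noteq> {}" "{0..1::real} \<times> {0::real} \<inter> ({1::real} \<times> {0..1::real} \<union> {0..1::real} \<times> {1::real}) \<noteq> {}"
    by blast+
  have "connected B"
    unfolding B_def by (intro connected_Un ne) (simp_all add: connected_Times)
  have hB: "h z = \<gamma> 0" if "z \<in> B" for z using that h1 hs by (auto simp: B_def)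
  have "\<gamma> 0 \<in> topspace R" using \<gamma>(1) by (auto simp: pathin_def continuous_map)
  then obtain U \<phi> where U: "local_section U \<phi>" "\<gamma> 0 \<in> U" using ex_section by blast
  have "lift h B (\<lambda>_. \<phi>)" by (rule lift_section[OF U(1)]) (use hB U(2) in auto)
  then have "- \<Psi> (0, 0) q + \<Psi> (0, 1) q = - \<phi> q + \<phi> q"
    by (rule lift_increment[OF lift_subset[OF \<Psi> B] _ \<open>connected B\<close> continuous_map_from_subtopology_mono[OF hsq B]])
      (use q hs in \<open>auto simp: B_def\<close>)
  then show ?thesis using inc by simp
qed

lemma increment_subpath:
  assumes \<gamma>: "pathin R \<gamma>" and \<psi>: "lift \<gamma> {0..1} \<psi>" and \<alpha>: "pathin R \<alpha>"
    and g: "continuous_on {0..1} g" "g ` {0..1} \<subseteq> {0..1}" "\<And>x. x \<in> {0..1} \<Longrightarrow> \<gamma> (g x) = \<alpha> x"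
    and q: "q \<in> over (\<alpha> 0)" "q' \<in> over (\<alpha> 1)"
  shows "increment \<alpha> q q' = - \<psi> (g 0) q + \<psi> (g 1) q'"
proof -
  have "lift (\<gamma> \<circ> g) {0..1} (\<psi> \<circ> g)" by (rule lift_compose[OF \<psi> g(1,2)])
  then have "lift \<alpha> {0..1} (\<psi> \<circ> g)" by (rule lift_cong) (simp add: g)
  then show ?thesis using increment_eq[OF \<alpha> _ q] by simp
qed

definition join_path :: "(real \<Rightarrow> 'p) \<Rightarrow> (real \<Rightarrow> 'p) \<Rightarrow> real \<Rightarrow> 'p" where
  "join_path \<alpha> \<beta> x = (if x \<le> 1/2 then \<alpha> (2 * x) else \<beta> (2 * x - 1))"

lemma pathin_join:
  assumes "pathin T \<alpha>" "pathin T \<beta>" "\<alpha> 1 = \<beta> 0" shows "pathin T (join_path \<alpha> \<beta>)"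
  unfolding pathin_def join_path_def
proof (rule continuous_map_cases_le)
  let ?I = "\<lambda>P. subtopology (top_of_set {0..1::real}) {x \<in> topspace (top_of_set {0..1}). P x}"
  have "continuous_map (?I (\<lambda>x. x \<le> 1/2)) (top_of_set {0..1}) (\<lambda>x. 2 * x)"
    "continuous_map (?I (\<lambda>x. 1/2 \<le> x)) (top_of_set {0..1}) (\<lambda>x. 2 * x - 1)"
    by (auto simp: continuous_map_in_subtopology subtopology_subtopology intro!: continuous_intros)
  then show "continuous_map (?I (\<lambda>x. x \<le> 1/2)) T (\<lambda>x. \<alpha> (2 * x))" "continuous_map (?I (\<lambda>x. 1/2 \<le> x)) T (\<lambda>x. \<beta> (2 * x - 1))"
    using continuous_map_compose[OF _ assms(1)[unfolded pathin_def]] continuous_map_compose[OF _ assms(2)[unfolded pathin_def]]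
    unfolding comp_def by blast+
next
  fix x :: real assume "x = 1/2"
  then have "2 * x = 1" "2 * x - 1 = 0" by simp_all
  then show "\<alpha> (2 * x) = \<beta> (2 * x - 1)" using assms(3) by (simp only:)
qed (auto intro!: continuous_intros)

lemma increment_join:
  assumes \<alpha>: "pathin R \<alpha>" and \<beta>: "pathin R \<beta>" and eq: "\<alpha> 1 = \<beta> 0"
    and q: "q \<in> over (\<alpha> 0)" "q' \<in> over (\<beta> 0)" "q'' \<in> over (\<beta> 1)"
  shows "increment (join_path \<alpha> \<beta>) q q'' = increment \<alpha> q q' + increment \<beta> q' q''"
proof -
  have j: "pathin R (join_path \<alpha> \<beta>)" by (rule pathin_join[OF \<alpha> \<beta> eq])
  then obtain \<psi> where \<psi>: "lift (join_path \<alpha> \<beta>) {0..1} \<psi>" using ex_path_lift by blast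
  have "increment \<alpha> q q' = - \<psi> (0/2) q + \<psi> (1/2) q'"
    by (rule increment_subpath[OF j \<psi> \<alpha>, of "\<lambda>x. x/2"])
      (use q eq in \<open>auto simp: join_path_def intro!: continuous_intros\<close>)
  moreover have "increment \<beta> q' q'' = - \<psi> ((0 + 1)/2) q' + \<psi> ((1 + 1)/2) q''"
    by (rule increment_subpath[OF j \<psi> \<beta>, of "\<lambda>x. (x + 1)/2"])
      (use q eq in \<open>auto simp: join_path_def add_divide_distrib intro!: continuous_intros\<close>)
  moreover have "increment (join_path \<alpha> \<beta>) q q'' = - \<psi> 0 q + \<psi> 1 q''"
    by (rule increment_eq[OF j \<psi>]) (use q in \<open>auto simp: join_path_def\<close>)
  ultimately show ?thesis by (simp add: add.assoc del: add_uminus_conv_diff)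
qed

lemma increment_unique:
  assumes sc: "simply_connected_space R" and \<alpha>: "pathin R \<alpha>" and \<beta>: "pathin R \<beta>"
    and eq: "\<alpha> 0 = \<beta> 0" "\<alpha> 1 = \<beta> 1" and q: "q \<in> over (\<beta> 0)" "q' \<in> over (\<beta> 1)"
  shows "increment \<alpha> q q' = increment \<beta> q q'"
proof -
  have r: "pathin R (\<beta> \<circ> (\<lambda>x. 1 - x))"
    unfolding pathin_def
    by (rule continuous_map_compose[OF _ \<beta>[unfolded pathin_def]])
      (auto simp: continuous_map_in_subtopology intro!: continuous_intros)
  obtain \<psi> where \<psi>: "lift \<beta> {0..1} \<psi>" using ex_path_lift[OF \<beta>] by blast
  have "increment (\<beta> \<circ> (\<lambda>x. 1 - x)) q' q = - \<psi> (1 - 0) q' + \<psi> (1 - 1) q"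
    by (rule increment_subpath[OF \<beta> \<psi> r, of "\<lambda>x. 1 - x"]) (use q in \<open>auto intro!: continuous_intros\<close>)
  moreover have "increment \<beta> q q' = - \<psi> 0 q + \<psi> 1 q'" by (rule increment_eq[OF \<beta> \<psi> q])
  moreover have "increment \<alpha> q q' + increment (\<beta> \<circ> (\<lambda>x. 1 - x)) q' q = 0"
  proof -
    have "increment (join_path \<alpha> (\<beta> \<circ> (\<lambda>x. 1 - x))) q q = increment \<alpha> q q' + increment (\<beta> \<circ> (\<lambda>x. 1 - x)) q' q"
      by (rule increment_join[OF \<alpha> r]) (use eq q in auto)
    moreover have "increment (join_path \<alpha> (\<beta> \<circ> (\<lambda>x. 1 - x))) q q = 0"
      by (rule increment_loop[OF sc pathin_join[OF \<alpha> r]]) (use eq q in \<open>auto simp: join_path_def\<close>)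
    ultimately show ?thesis by simp
  qed
  moreover have "a = - x + y" if "a + (- y + x) = 0" for a x y :: 'w
    using eq_neg_iff_add_eq_0[THEN iffD2, OF that] by (simp add: minus_add)
  ultimately show ?thesis by simp
qed

section \<open>Potentials\<close>

abbreviation "origin \<equiv> (\<lambda>_. undefined) :: nat \<Rightarrow> real"

lemma origin: "origin \<in> topspace (cube_top 0)"
  by (simp add: in_cube)

text \<open>The straight path in a cube from its corner to its vertex \<open>f\<close>.\<close>

definition line :: "coord list \<Rightarrow> real \<Rightarrow> nat \<Rightarrow> real" where
  "line f r = (\<lambda>i\<in>{..<length f}. if bit (f ! i) then r else 0)"

text \<open>
  Along a path in a single cube the lift is constant when it is evaluated at the representatives
  in this cube; passing to the end points as vertices adds the transports.
\<close>

lemma increment_line: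
  assumes c: "c \<in> cubes X n" and f: "f \<in> faces 0 n"
  shows "pathin R (\<lambda>r. point X c (line f r))"
    "point X c (line f 0) = point X (corner X n c) origin"
    "point X c (line f 1) = point X (face X c f) origin"
    "increment (\<lambda>r. point X c (line f r)) (corner X n c, origin) (face X c f, origin) = transport lam c f"
proof -
  let ?z = "replicate n (Fixed False)"
  let ?\<gamma> = "\<lambda>r. point X c (line f r)"
  have z: "?z \<in> faces 0 n" by (rule zeros_faces)
  have l: "continuous_map (top_of_set {0..1}) (cube_top n) (line f)"
    unfolding cube_top_def
    by (subst continuous_map_componentwise)
      (use facesD(1)[OF f] in \<open>auto simp: line_def continuous_map_in_subtopology intro!: continuous_intros\<close>)
  have l_in: "line f r \<in> topspace (cube_top n)" if "r \<in> {0..1}" for r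
    using l that by (auto simp: continuous_map)
  show p: "pathin R ?\<gamma>"
    unfolding pathin_def using continuous_map_compose[OF l continuous_point[OF c]] by (simp add: comp_def)
  have l0: "line f 0 = place ?z origin" and l1: "line f 1 = place f origin"
  proof -
    have "\<exists>b. f ! i = Fixed b" if "i < n" for i using facesD(2)[OF f that] by (cases "f ! i") auto
    then show "line f 0 = place ?z origin" "line f 1 = place f origin"
      using facesD(1)[OF f] by (force simp: line_def place_def fun_eq_iff)+
  qed
  have e0: "?\<gamma> 0 = point X (corner X n c) origin" and e1: "?\<gamma> 1 = point X (face X c f) origin"
    using point_face[OF c z origin] point_face[OF c f origin] l0 l1 by (simp_all add: corner_def)
  then show "?\<gamma> 0 = point X (corner X n c) origin" "?\<gamma> 1 = point X (face X c f) origin" by simp_all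
  obtain \<psi> where \<psi>: "lift ?\<gamma> {0..1} \<psi>" using ex_path_lift[OF p] by blast
  have "(\<lambda>r. \<psi> r (c, line f r)) constant_on {0..1}"
  proof (rule locally_constant_imp_constant)
    fix r :: real assume r: "r \<in> {0..1}"
    obtain V U \<phi> where V: "openin (top_of_set {0..1}) V" "r \<in> V" "local_section U \<phi>" "?\<gamma> ` V \<subseteq> U"
      and *: "\<And>z' q. z' \<in> V \<Longrightarrow> q \<in> over (?\<gamma> z') \<Longrightarrow> \<psi> z' q = \<phi> q" by (rule liftE[OF \<psi> r]) (rule that)
    have \<psi>\<phi>: "\<psi> s (c, line f s) = \<phi> (c, line f s)" if "s \<in> V" for s
      using openin_imp_subset[OF V(1)] that by (intro * overI[OF c l_in]) auto
    have "point X c (line f r) \<in> U" using V by auto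
    then obtain T where T: "openin (cube_top n) T" "line f r \<in> T"
      "\<forall>t'\<in>T. point X c t' \<in> U \<longrightarrow> \<phi> (c, t') = \<phi> (c, line f r)"
      using local_section_locally_constant[OF V(3) c l_in[OF r]] by blast
    define W where "W = V \<inter> {s \<in> {0..1}. line f s \<in> T}"
    have "openin (top_of_set {0..1}) W"
      unfolding W_def using l T(1) V(1) by (intro openin_Int) (auto simp: continuous_map)
    moreover have "r \<in> W" using V(2) T(2) r by (simp add: W_def)
    moreover have "\<psi> s (c, line f s) = \<psi> r (c, line f r)" if "s \<in> W" for s
    proof -
      have "s \<in> V" "line f s \<in> T" using that by (auto simp: W_def)
      then show ?thesis using \<psi>\<phi>[of s] \<psi>\<phi>[OF V(2)] T(3) V(4) by auto
    qed
    ultimately show "\<exists>T. openin (top_of_set {0..1}) T \<and> r \<in> T \<and> (\<forall>x\<in>T. \<psi> x (c, line f x) = \<psi> r (c, line f r))"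
      using \<open>r \<in> W\<close> by blast
  qed simp
  then have "\<psi> 0 (c, line f 0) = \<psi> 1 (c, line f 1)" by (auto simp: constant_on_def)
  moreover have "\<psi> 0 (corner X n c, origin) = \<psi> 0 (c, line f 0) + transport lam c ?z"
    unfolding corner_def l0 by (rule lift_face[OF \<psi> _ c z origin]) (simp_all add: l0)
  moreover have "transport lam c ?z = 0"
  proof -
    have "transport lam c ?z = sum_list (map (\<lambda>_. 0) [0..<n])"
      unfolding transport_def length_replicate by (intro arg_cong[where f = sum_list] map_cong) simp_all
    then show ?thesis by simp
  qed
  moreover have "\<psi> 1 (face X c f, origin) = \<psi> 1 (c, line f 1) + transport lam c f"
    unfolding l1 by (rule lift_face[OF \<psi> _ c f origin]) (simp_all add: l1)
  moreover have "increment ?\<gamma> (corner X n c, origin) (face X c f, origin)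
      = - \<psi> 0 (corner X n c, origin) + \<psi> 1 (face X c f, origin)"
    using e0 e1 c face_closed[OF c z] face_closed[OF c f]
    by (intro increment_eq[OF p \<psi>] overI[OF _ origin]) (auto simp: corner_def)
  ultimately show "increment ?\<gamma> (corner X n c, origin) (face X c f, origin) = transport lam c f"
    by (simp add: add.assoc[symmetric])
qed

text \<open>
  The potential of a vertex is the increment along any path from a base vertex, independent of the
  path by \<open>increment_loop\<close>.
\<close>

theorem ex_potential:
  assumes sc: "simply_connected_space R"
  shows "\<exists>F. \<forall>n. \<forall>c\<in>cubes X n. \<forall>f\<in>faces 0 n. F (face X c f) = F (corner X n c) + transport lam c f"
proof (cases "cubes X 0 = {}")
  case True
  then show ?thesis using face_closed by blast
next
  case False
  then obtain v0 where v0: "v0 \<in> cubes X 0" by blast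
  have pc: "path_connected_space R" using sc by (simp add: simply_connected_space_def)
  have top: "point X v origin \<in> topspace R" if "v \<in> cubes X 0" for v
    by (rule point_in_topspace[OF that origin])
  have "\<exists>\<gamma>. pathin R \<gamma> \<and> \<gamma> 0 = point X v0 origin \<and> \<gamma> 1 = point X v origin" if "v \<in> cubes X 0" for v
    using pc top[OF v0] top[OF that] unfolding path_connected_space_def by blast
  then obtain \<gamma> where \<gamma>: "\<And>v. v \<in> cubes X 0 \<Longrightarrow> pathin R (\<gamma> v)"
    "\<And>v. v \<in> cubes X 0 \<Longrightarrow> \<gamma> v 0 = point X v0 origin" "\<And>v. v \<in> cubes X 0 \<Longrightarrow> \<gamma> v 1 = point X v origin"
    by metis
  have o: "(v, origin) \<in> over (point X v origin)" if "v \<in> cubes X 0" for v by (rule overI[OF that origin refl])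
  define F where "F v = increment (\<gamma> v) (v0, origin) (v, origin)" for v
  have "F (face X c f) = F (corner X n c) + transport lam c f" if c: "c \<in> cubes X n" and f: "f \<in> faces 0 n" for n c f
  proof -
    let ?v = "corner X n c" and ?v' = "face X c f" and ?l = "\<lambda>r. point X c (line f r)"
    note l = increment_line[OF c f]
    have v: "?v \<in> cubes X 0" "?v' \<in> cubes X 0"
      using face_closed[OF c zeros_faces] face_closed[OF c f] by (simp_all add: corner_def)
    have "F ?v + transport lam c f = increment (join_path (\<gamma> ?v) ?l) (v0, origin) (?v', origin)"
      unfolding F_def l(4)[symmetric]
      by (rule increment_join[symmetric]) (use \<gamma>[OF v(1)] l o[OF v0] o[OF v(1)] o[OF v(2)] in auto)
    also have "\<dots> = F ?v'"
      unfolding F_def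
      by (rule increment_unique[OF sc pathin_join[OF \<gamma>(1)[OF v(1)] l(1)] \<gamma>(1)[OF v(2)]])
        (use \<gamma>[OF v(1)] \<gamma>[OF v(2)] l o[OF v0] o[OF v(2)] in \<open>auto simp: join_path_def\<close>)
    finally show ?thesis by simp
  qed
  then show ?thesis by blast
qed

end

section \<open>Graphs with commuting letters on their edges\<close>

text \<open>
  A graph like the one-skeleton of a cube complex: at each vertex there is at most one edge for
  every letter, and edges with commuting letters span a square. The Coxeter group acts on its
  vertices by moving along edges.
\<close>

definition letter_graph :: "('x \<Rightarrow> 'v letter \<Rightarrow> 'x \<Rightarrow> bool) \<Rightarrow> bool" where
  "letter_graph T \<longleftrightarrow> (\<forall>x a y. T x a y \<longrightarrow> T y a x) \<and> (\<forall>x a y y'. T x a y \<longrightarrow> T x a y' \<longrightarrow> y = y') \<and>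
     (\<forall>x a b y y'. T x a y \<longrightarrow> T x b y' \<longrightarrow> comm a b \<longrightarrow> (\<exists>z. T y b z \<and> T y' a z))"

lemma letter_graphD:
  assumes "letter_graph T"
  shows "T x a y \<Longrightarrow> T y a x" "T x a y \<Longrightarrow> T x a y' \<Longrightarrow> y = y'"
    "T x a y \<Longrightarrow> T x b y' \<Longrightarrow> comm a b \<Longrightarrow> \<exists>z. T y b z \<and> T y' a z"
  using assms unfolding letter_graph_def by blast+

definition mv :: "('x \<Rightarrow> 'v letter \<Rightarrow> 'x \<Rightarrow> bool) \<Rightarrow> 'v letter \<Rightarrow> 'x \<Rightarrow> 'x" where
  "mv T a x = (if \<exists>y. T x a y then THE y. T x a y else x)"

lemma mv_step:
  assumes "letter_graph T" "T x a y" shows "mv T a x = y"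
proof -
  have "(THE y. T x a y) = y" using assms letter_graphD(2)[OF assms(1)] by blast
  then show ?thesis using assms(2) by (auto simp: mv_def)
qed

lemma mv_fix: "\<nexists>y. T x a y \<Longrightarrow> mv T a x = x"
  by (simp add: mv_def)

lemma mv_cases:
  assumes "letter_graph T" obtains "T x a (mv T a x)" | "\<nexists>y. T x a y" "mv T a x = x"
  using mv_step[OF assms, of x a] mv_fix[of T x a] by blast

lemma commuting_mv:
  assumes T: "letter_graph T" shows "commuting_involutions (mv T)"
  unfolding commuting_involutions_def
proof (intro conjI allI impI)
  fix c d x
  show "mv T c (mv T c x) = x"
  proof (rule mv_cases[OF T, of x c])
    assume "T x c (mv T c x)"
    then show ?thesis using mv_step[OF T] letter_graphD(1)[OF T] by blast
  qed simp
  assume cd: "comm c d"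
  have one: "mv T c (mv T d x) = mv T d (mv T c x)"
    if c: "T x c y" and d: "\<nexists>y. T x d y" and cd: "comm c d" for c d y
  proof -
    have "\<nexists>z. T y d z"
    proof
      assume "\<exists>z. T y d z"
      then show False
        using letter_graphD(3)[OF T letter_graphD(1)[OF T c] _ cd] d by blast
    qed
    then show ?thesis using c d by (simp add: mv_fix mv_step[OF T c])
  qed
  show "mv T c (mv T d x) = mv T d (mv T c x)"
  proof (cases "\<exists>y. T x c y")
    case True
    then obtain y where y: "T x c y" by blast
    show ?thesis
    proof (cases "\<exists>y. T x d y")
      case True
      then obtain y' where y': "T x d y'" by blast
      obtain z where "T y d z" "T y' c z" using letter_graphD(3)[OF T y y' cd] by blast
      then show ?thesis using y y' by (simp add: mv_step[OF T])
    qed (use one[OF y _ cd] in blast)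
  next
    case False
    show ?thesis
    proof (cases "\<exists>y. T x d y")
      case True
      then show ?thesis using one[OF _ False comm_sym[OF cd]] by metis
    qed (use False in \<open>simp add: mv_fix\<close>)
  qed
qed

lemma act_map:
  assumes f: "commuting_involutions f" and g: "commuting_involutions g"
    and i: "\<And>a p. p \<in> P \<Longrightarrow> f a p \<in> P \<and> g a (i p) = i (f a p)" and p: "p \<in> P"
  shows "act g (i p) x = i (act f p x)" "act f p x \<in> P"
proof -
  obtain u where u: "x = word u" using ex_word by blast
  have "fold g u (i p) = i (fold f u p) \<and> fold f u p \<in> P"
    using p i by (induction u arbitrary: p) auto
  then show "act g (i p) x = i (act f p x)" "act f p x \<in> P" by (simp_all add: u act_word[OF f] act_word[OF g])
qed

abbreviation reach where "reach T \<equiv> (\<lambda>x y. \<exists>a. T x a y)\<^sup>*\<^sup>*"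

lemma reach_act:
  assumes T: "letter_graph T" and w: "\<And>x a y. T x a y \<Longrightarrow> w y = w x + gen a" and r: "reach T x y"
  shows "y = act (mv T) x (- w x + w y)"
  using r
proof (induction rule: rtranclp_induct)
  case base
  then show ?case using commuting_mv[OF T] by (simp add: act_0)
next
  case (step y z)
  then obtain a where a: "T y a z" by blast
  have "- w x + w z = (- w x + w y) + gen a" using w[OF a] by (simp add: add.assoc)
  then have "act (mv T) x (- w x + w z) = mv T a y"
    using step.IH commuting_mv[OF T] by (simp add: act_plus act_gen)
  then show ?case using mv_step[OF T a] by simp
qed

section \<open>Pieces and chains\<close>

primrec (in monoid) pprod :: "(nat \<Rightarrow> 'a) \<Rightarrow> nat \<Rightarrow> 'a" where
  "pprod s 0 = \<one>"
| "pprod s (Suc j) = pprod s j \<otimes> s j"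

lemma (in monoid) pprod_cong: "(\<And>i. i < j \<Longrightarrow> s i = s' i) \<Longrightarrow> pprod s j = pprod s' j"
  by (induction j) auto

text \<open>
  A free action of a group on the vertices of a letter graph, with an equivariant map \<open>w\<close> to the
  Coxeter group that is compatible with the letters.
\<close>

locale racg_action = group G for G (structure) +
  fixes H :: "'a set" and X0 :: "'x set" and \<rho> :: "'a \<Rightarrow> 'x \<Rightarrow> 'x"
    and S :: "'x \<Rightarrow> 'v letter \<Rightarrow> 'x \<Rightarrow> bool" and w :: "'x \<Rightarrow> 'v racg" and \<theta> :: "'a \<Rightarrow> 'v racg"
  assumes H: "subgroup H G"
    and closed: "\<And>h x. h \<in> H \<Longrightarrow> x \<in> X0 \<Longrightarrow> \<rho> h x \<in> X0"
    and mult: "\<And>h k x. h \<in> H \<Longrightarrow> k \<in> H \<Longrightarrow> x \<in> X0 \<Longrightarrow> \<rho> (h \<otimes> k) x = \<rho> h (\<rho> k x)"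
    and one: "\<And>x. x \<in> X0 \<Longrightarrow> \<rho> \<one> x = x"
    and graph: "letter_graph S"
    and S_X0: "\<And>x a y. S x a y \<Longrightarrow> x \<in> X0"
    and S_w: "\<And>x a y. S x a y \<Longrightarrow> w y = w x + gen a"
    and S_inv: "\<And>h x a y. h \<in> H \<Longrightarrow> S x a y \<Longrightarrow> S (\<rho> h x) a (\<rho> h y)"
    and w_inv: "\<And>h x. h \<in> H \<Longrightarrow> x \<in> X0 \<Longrightarrow> w (\<rho> h x) = \<theta> h + w x"
    and free: "\<And>h x. h \<in> H \<Longrightarrow> x \<in> X0 \<Longrightarrow> \<rho> h x = x \<Longrightarrow> h = \<one>"
begin

lemma H_simps: "h \<in> H \<Longrightarrow> h \<in> carrier G" "h \<in> H \<Longrightarrow> k \<in> H \<Longrightarrow> h \<otimes> k \<in> H" "h \<in> H \<Longrightarrow> inv h \<in> H" "\<one> \<in> H"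
  using H by (auto simp: subgroup_def)

lemma inv_action: "h \<in> H \<Longrightarrow> x \<in> X0 \<Longrightarrow> \<rho> (inv h) (\<rho> h x) = x"
  using mult[of "inv h" h x] one H_simps by simp

lemma S_X0': "S x a y \<Longrightarrow> y \<in> X0"
  using S_X0 letter_graphD(1)[OF graph] by blast

text \<open>
  The connected subgraphs that serve as sides of polygons: a vertex set \<open>Z\<close>, the edges \<open>T\<close>, and a
  set \<open>K\<close> of automorphisms.
\<close>

definition piece :: "'v letter set \<Rightarrow> 'x set \<Rightarrow> ('x \<Rightarrow> 'v letter \<Rightarrow> 'x \<Rightarrow> bool) \<Rightarrow> 'a set \<Rightarrow> bool" where
  "piece C Z T K \<longleftrightarrow> letter_graph T \<and> (\<forall>x a y. T x a y \<longrightarrow> S x a y \<and> x \<in> Z \<and> a \<in> C) \<and> Z \<subseteq> X0 \<and>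
     (\<forall>x\<in>Z. \<forall>y\<in>Z. reach T x y) \<and> K \<subseteq> H \<and> (\<forall>k\<in>K. \<forall>x a y. T x a y \<longrightarrow> T (\<rho> k x) a (\<rho> k y))"

lemma pieceD:
  assumes "piece C Z T K"
  shows "letter_graph T" "T x a y \<Longrightarrow> S x a y" "T x a y \<Longrightarrow> x \<in> Z" "T x a y \<Longrightarrow> y \<in> Z" "T x a y \<Longrightarrow> a \<in> C"
    "x \<in> Z \<Longrightarrow> x \<in> X0" "x \<in> Z \<Longrightarrow> y \<in> Z \<Longrightarrow> reach T x y" "k \<in> K \<Longrightarrow> k \<in> H"
    "k \<in> K \<Longrightarrow> T x a y \<Longrightarrow> T (\<rho> k x) a (\<rho> k y)" "T x a y \<Longrightarrow> w y = w x + gen a"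
proof -
  show T: "letter_graph T" using assms unfolding piece_def by simp
  show "T x a y \<Longrightarrow> S x a y" "T x a y \<Longrightarrow> x \<in> Z" "T x a y \<Longrightarrow> a \<in> C"
    "x \<in> Z \<Longrightarrow> x \<in> X0" "x \<in> Z \<Longrightarrow> y \<in> Z \<Longrightarrow> reach T x y" "k \<in> K \<Longrightarrow> k \<in> H"
    "k \<in> K \<Longrightarrow> T x a y \<Longrightarrow> T (\<rho> k x) a (\<rho> k y)"
    using assms unfolding piece_def by blast+
  show "T x a y \<Longrightarrow> y \<in> Z" using assms letter_graphD(1)[OF T, of x a y] unfolding piece_def by blast
  show "T x a y \<Longrightarrow> w y = w x + gen a" using assms S_w unfolding piece_def by blast
qed

text \<open>
  The elements of \<open>M\<close> act on the vertices of the piece, but only within orbits of \<open>K\<close>. This makes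
  the image of the piece in the quotient by \<open>M\<close> well defined: by \<open>good_cong\<close>, vertices with equal
  image have the same directions.
\<close>

definition good :: "'v racg set \<Rightarrow> 'x set \<Rightarrow> ('x \<Rightarrow> 'v letter \<Rightarrow> 'x \<Rightarrow> bool) \<Rightarrow> 'a set \<Rightarrow> bool" where
  "good M Z T K \<longleftrightarrow> (\<forall>m\<in>M. \<forall>z\<in>Z. \<exists>k\<in>K. act (mv T) z m = \<rho> k z)"

lemma good_mono: "good M Z T K \<Longrightarrow> N \<subseteq> M \<Longrightarrow> good N Z T K"
  by (auto simp: good_def)

lemma good_cong:
  assumes M: "fin_normal M" and p: "piece C Z T K" and g: "good M Z T K"
    and z: "z \<in> Z" "z' \<in> Z" "cong M (w z') (w z)"
  shows "\<exists>k\<in>K. z' = \<rho> k z"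
proof -
  obtain m where m: "m \<in> M" "w z' = m + w z" using z(3) unfolding cong_iff by blast
  have "z' = act (mv T) z (- w z + m + w z)"
    using reach_act[where T = T and w = w, OF pieceD(1)[OF p] pieceD(10)[OF p] pieceD(7)[OF p z(1,2)]] m(2)
    by (simp add: add.assoc)
  moreover have "- w z + m + w z \<in> M" by (rule fin_normalD(5)[OF M m(1)])
  ultimately show ?thesis using g z(1) unfolding good_def by metis
qed

definition piece_rel :: "'v racg set \<Rightarrow> 'x set \<Rightarrow> ('x \<Rightarrow> 'v letter \<Rightarrow> 'x \<Rightarrow> bool) \<Rightarrow> 'v racg \<Rightarrow> 'v letter set" where
  "piece_rel M Z T x = {a. \<exists>m\<in>M. \<exists>z\<in>Z. \<exists>y. x = m + w z \<and> T z a y}"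

context
  fixes M :: "'v racg set" and C Z T K
  assumes M: "fin_normal M" and p: "piece C Z T K" and g: "good M Z T K"
begin

lemma piece_rel_at:
  assumes m: "m \<in> M" and z: "z \<in> Z" shows "a \<in> piece_rel M Z T (m + w z) \<longleftrightarrow> (\<exists>y. T z a y)"
proof
  assume "a \<in> piece_rel M Z T (m + w z)"
  then obtain m' z' y where z': "m' \<in> M" "z' \<in> Z" "m + w z = m' + w z'" "T z' a y"
    unfolding piece_rel_def by blast
  have "cong M (w z) (m + w z)" using cong_mem[OF M m] cong_sym[OF M] by blast
  moreover have "cong M (m + w z) (w z')" unfolding z'(3) by (rule cong_mem[OF M z'(1)])
  ultimately have "cong M (w z) (w z')" using cong_trans[OF M] by blast
  then obtain k where "k \<in> K" "z = \<rho> k z'" using good_cong[OF M p g z'(2) z] by blast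
  then show "\<exists>y. T z a y" using pieceD(9)[OF p _ z'(4)] by blast
next
  assume "\<exists>y. T z a y"
  then show "a \<in> piece_rel M Z T (m + w z)" using m z unfolding piece_rel_def by blast
qed

lemma piece_rel_rels: "piece_rel M Z T \<in> rels M C"
proof -
  have out: "\<exists>m\<in>M. \<exists>z\<in>Z. x = m + w z" if "a \<in> piece_rel M Z T x" for a x
    using that unfolding piece_rel_def by blast
  have "convex_rel (piece_rel M Z T)"
    unfolding convex_rel_def
  proof (intro conjI allI ballI impI)
    fix x c assume "c \<in> piece_rel M Z T x"
    then obtain m z where x: "m \<in> M" "z \<in> Z" "x = m + w z" and c: "c \<in> piece_rel M Z T (m + w z)" using out by blast
    then obtain y where y: "T z c y" using piece_rel_at by blast
    have xc: "x + gen c = m + w y" using pieceD(10)[OF p y] x(3) by (simp add: add.assoc)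
    show "c \<in> piece_rel M Z T (x + gen c)"
      unfolding xc piece_rel_at[OF x(1) pieceD(4)[OF p y]] using letter_graphD(1)[OF pieceD(1)[OF p] y] by blast
    fix d assume "d \<in> piece_rel M Z T x" "comm c d"
    then obtain y' where "T z d y'" using piece_rel_at[OF x(1,2)] x(3) by blast
    then show "d \<in> piece_rel M Z T (x + gen c)"
      unfolding xc piece_rel_at[OF x(1) pieceD(4)[OF p y]]
      using letter_graphD(3)[OF pieceD(1)[OF p] y _ \<open>comm c d\<close>] by blast
  qed
  moreover have "inv_rel M (piece_rel M Z T)"
    unfolding inv_rel_def
  proof (intro ballI allI)
    have sub: "piece_rel M Z T x \<subseteq> piece_rel M Z T (m + x)" if m: "m \<in> M" for m x
    proof
      fix a assume "a \<in> piece_rel M Z T x"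
      then obtain m' z y where "m' \<in> M" "z \<in> Z" "x = m' + w z" "T z a y" unfolding piece_rel_def by blast
      then show "a \<in> piece_rel M Z T (m + x)"
        unfolding piece_rel_def using fin_normalD(2)[OF M m, of m'] by (simp flip: add.assoc) blast
    qed
    fix m x assume m: "m \<in> M"
    show "piece_rel M Z T (m + x) = piece_rel M Z T x"
      using sub[OF m, of x] sub[OF fin_normalD(3)[OF M m], of "m + x"] by simp
  qed
  moreover have "supp (piece_rel M Z T) \<subseteq> C"
    unfolding supp_def piece_rel_def using pieceD(5)[OF p] by blast
  ultimately show ?thesis by (simp add: rels_def)
qed

lemma reach_rel: "reach T z z' \<Longrightarrow> z \<in> Z \<Longrightarrow> rel (piece_rel M Z T) (w z) (w z')"
proof (induction rule: rtranclp_induct)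
  case (step y y')
  then obtain a where a: "T y a y'" by blast
  have "a \<in> piece_rel M Z T (0 + w y)"
    using piece_rel_at[OF fin_normalD(1)[OF M] pieceD(3)[OF p a]] a by blast
  then show ?case using step pieceD(10)[OF p a] by (auto intro: rel_step)
qed (rule rel_refl)

text \<open>
  The directions at \<open>m + w z\<close> are the letters at \<open>z\<close>, so walks are lifted to the piece step by
  step.
\<close>

lemma rel_reach:
  assumes "rel (piece_rel M Z T) x x'" "x = m + w z" "m \<in> M" "z \<in> Z"
  shows "\<exists>z'\<in>Z. x' = m + w z' \<and> reach T z z'"
  using assms
proof (induction rule: rel.induct)
  case (rel_step x y c)
  then obtain z' where z': "z' \<in> Z" "y = m + w z'" "reach T z z'" by blast
  then obtain y' where y': "T z' c y'" using rel_step piece_rel_at[of m z' c] by blast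
  have "reach T z y'"
    using z'(3) y' rtranclp.rtrancl_into_rtrancl[of "\<lambda>x y. \<exists>a. T x a y" z z' y'] by blast
  moreover have "y + gen c = m + w y'" using z'(2) pieceD(10)[OF p y'] by (simp add: add.assoc)
  ultimately show ?case using pieceD(4)[OF p y'] by blast
qed blast

end

text \<open>
  Consecutive vertices of the chain lie in a common piece, and \<open>\<eta>\<close> maps the first vertex to the
  last one. Its image in the Coxeter group is a polygon that closes up modulo \<open>N\<close>, with trivial
  closing side. After the application of \<open>polygons_close\<close>, the new vertices are again images of
  vertices of \<open>X0\<close>: by \<open>good_cong\<close>, the next vertex of the new chain is obtained by applying some
  \<open>\<sigma> \<in> K j\<close> before the element \<open>\<kappa>\<close> reached so far. The new chain is an edge path whose image is
  closed. Hence it is closed, since moving along it is the action of a trivial word, and freeness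
  shows that the accumulated group element is trivial.
\<close>

theorem chains_close:
  assumes C: "finite C" and M: "fin_normal M"
  shows "\<exists>N. fin_normal N \<and> (\<forall>Z T K v \<eta>. (\<forall>j<r. piece C (Z j) (T j) (K j) \<and> good M (Z j) (T j) (K j) \<and> v j \<in> Z j \<and> v (Suc j) \<in> Z j) \<longrightarrow>
     v 0 \<in> X0 \<longrightarrow> \<eta> \<in> H \<longrightarrow> v r = \<rho> \<eta> (v 0) \<longrightarrow> \<theta> \<eta> \<in> N \<longrightarrow>
     (\<exists>s. (\<forall>j<r. s j \<in> K j) \<and> pprod s r \<otimes> \<eta> = \<one>))"
proof -
  obtain N where N: "fin_normal N" "closes C r (r * card C) M N" using polygons_close[OF C M] by blast
  have "\<exists>s. (\<forall>j<r. s j \<in> K j) \<and> pprod s r \<otimes> \<eta> = \<one>"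
    if *: "\<And>j. j < r \<Longrightarrow> piece C (Z j) (T j) (K j) \<and> good M (Z j) (T j) (K j) \<and> v j \<in> Z j \<and> v (Suc j) \<in> Z j"
      and v0: "v 0 \<in> X0" and \<eta>: "\<eta> \<in> H" "v r = \<rho> \<eta> (v 0)" "\<theta> \<eta> \<in> N" for Z T K v \<eta>
  proof -
    define E where "E j = piece_rel M (Z j) (T j)" for j
    have E: "E j \<in> rels M C" if "j < r" for j unfolding E_def using piece_rel_rels[OF M] *[OF that] by blast
    have sides: "rel (E j) (w (v j)) (w (v (Suc j)))" if "j < r" for j
      unfolding E_def using reach_rel[OF M] pieceD(7) *[OF that] by blast
    have "(\<Sum>j<r. card (supp (E j))) \<le> (\<Sum>j<r. card C)"
      by (rule sum_mono) (use relsD(3)[OF E] card_mono[OF C] in auto)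
    then have le: "(\<Sum>j<r. card (supp (E j))) \<le> r * card C" by simp
    have F: "(\<lambda>_. {}) \<in> closing_rels M C"
      by (auto simp: closing_rels_def rels_def convex_rel_def inv_rel_def supp_def)
    have empty: "x = y" if "rel (\<lambda>_. {}) x y" for x y :: "'v racg" using that by (induction rule: rel.induct) auto
    have last: "rel (\<lambda>_. {}) (w (v r)) (\<theta> \<eta> + w (v 0))" using w_inv[OF \<eta>(1) v0] \<eta>(2) by (simp add: rel_refl)
    obtain y where y: "y 0 = w (v 0)" "\<And>j. j \<le> r \<Longrightarrow> cong M (y j) (w (v j))"
      "\<And>j. j < r \<Longrightarrow> rel (E j) (y j) (y (Suc j))" "rel (\<lambda>_. {}) (y r) (w (v 0))"
      by (rule closesD[OF N(2), where E = E and x = "\<lambda>j. w (v j)" and F = "\<lambda>_. {}" and \<nu> = "\<theta> \<eta>", OF E le F sides \<eta>(3) last]) (assumption | rule that; assumption)+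
    have vX: "v j \<in> X0" if "j \<le> r" for j
    proof (cases j)
      case (Suc i)
      then show ?thesis using *[of i] pieceD(6) that by (metis Suc_le_lessD)
    qed (use v0 in simp)
    have "\<exists>s. (\<forall>i<j. s i \<in> K i) \<and> pprod s j \<in> H \<and> y j = w (\<rho> (pprod s j) (v j)) \<and> reach S (v 0) (\<rho> (pprod s j) (v j))"
      if "j \<le> r" for j
      using that
    proof (induction j)
      case 0
      then show ?case using y(1) one[OF v0] H_simps(4) by simp
    next
      case (Suc j)
      then have j: "j < r" "j \<le> r" by auto
      then obtain s where s: "\<forall>i<j. s i \<in> K i" "pprod s j \<in> H" "y j = w (\<rho> (pprod s j) (v j))"
        "reach S (v 0) (\<rho> (pprod s j) (v j))" using Suc.IH by blast
      define \<kappa> where "\<kappa> = pprod s j"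
      have \<kappa>: "\<kappa> \<in> H" using s(2) by (simp add: \<kappa>_def)
      have p: "piece C (Z j) (T j) (K j)" and g: "good M (Z j) (T j) (K j)" and vj: "v j \<in> Z j" "v (Suc j) \<in> Z j"
        using *[OF j(1)] by auto
      have yj: "y j = \<theta> \<kappa> + w (v j)" using s(3) w_inv[OF \<kappa> vX[OF j(2)]] by (simp add: \<kappa>_def)
      have "cong M (\<theta> \<kappa> + w (v j)) (0 + w (v j))" using y(2)[OF j(2)] yj by simp
      then have \<theta>M: "\<theta> \<kappa> \<in> M" unfolding cong_add_right by (simp add: cong_def)
      obtain z where z: "z \<in> Z j" "y (Suc j) = \<theta> \<kappa> + w z" "reach (T j) (v j) z"
        using rel_reach[OF M p g y(3)[OF j(1), unfolded E_def] yj \<theta>M vj(1)] by blast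
      have "cong M (w z) (w (v (Suc j)))"
        using cong_trans[OF M cong_sym[OF M cong_mem[OF M \<theta>M]]] y(2)[OF Suc.prems] z(2) by metis
      then obtain \<sigma> where \<sigma>: "\<sigma> \<in> K j" "z = \<rho> \<sigma> (v (Suc j))" using good_cong[OF M p g vj(2) z(1)] by blast
      define s' where "s' = s(j := \<sigma>)"
      have \<sigma>H: "\<sigma> \<in> H" by (rule pieceD(8)[OF p \<sigma>(1)])
      have "pprod s' j = \<kappa>" unfolding \<kappa>_def by (rule pprod_cong) (simp add: s'_def)
      then have ps: "pprod s' (Suc j) = \<kappa> \<otimes> \<sigma>" by (simp add: s'_def)
      have zz: "\<rho> (\<kappa> \<otimes> \<sigma>) (v (Suc j)) = \<rho> \<kappa> z" using mult[OF \<kappa> \<sigma>H vX[OF Suc.prems]] \<sigma>(2) by simp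
      have "reach S (\<rho> \<kappa> (v j)) (\<rho> \<kappa> z)"
        using z(3)
      proof (induction rule: rtranclp_induct)
        case (step y z)
        then obtain a where "T j y a z" by blast
        then have "S (\<rho> \<kappa> y) a (\<rho> \<kappa> z)" using S_inv[OF \<kappa> pieceD(2)[OF p]] by blast
        then show ?case
          using step.IH rtranclp.rtrancl_into_rtrancl[of "\<lambda>x y. \<exists>a. S x a y" "\<rho> \<kappa> (v j)" "\<rho> \<kappa> y" "\<rho> \<kappa> z"] by blast
      qed simp
      then have "reach S (v 0) (\<rho> (pprod s' (Suc j)) (v (Suc j)))"
        unfolding ps zz using rtranclp_trans[OF s(4)[folded \<kappa>_def]] by blast
      moreover have "y (Suc j) = w (\<rho> (pprod s' (Suc j)) (v (Suc j)))"
        unfolding ps zz using z(2) w_inv[OF \<kappa> pieceD(6)[OF p z(1)]] by simp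
      moreover have "\<forall>i<Suc j. s' i \<in> K i" using s(1) \<sigma>(1) by (auto simp: s'_def less_Suc_eq)
      ultimately show ?case using H_simps(2)[OF \<kappa> \<sigma>H] ps by (intro exI[of _ s']) simp
    qed
    from this[of r] obtain s where s: "\<forall>i<r. s i \<in> K i" "pprod s r \<in> H" "y r = w (\<rho> (pprod s r) (v r))"
        "reach S (v 0) (\<rho> (pprod s r) (v r))" by blast
    have "\<rho> (pprod s r) (v r) = act (mv S) (v 0) (- w (v 0) + w (\<rho> (pprod s r) (v r)))"
      by (rule reach_act[OF graph S_w s(4)])
    also have "- w (v 0) + w (\<rho> (pprod s r) (v r)) = 0" using empty[OF y(4)] s(3) by simp
    also have "act (mv S) (v 0) 0 = v 0" by (rule act_0[OF commuting_mv[OF graph]])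
    finally have "\<rho> (pprod s r \<otimes> \<eta>) (v 0) = v 0" using mult[OF s(2) \<eta>(1) v0] \<eta>(2) by simp
    then have "pprod s r \<otimes> \<eta> = \<one>" using free[OF H_simps(2)[OF s(2) \<eta>(1)] v0] by blast
    then show ?thesis using s(1) by blast
  qed
  then show ?thesis using N(1) by (intro exI[of _ N]) blast
qed

section \<open>Good subgroups for pieces\<close>

text \<open>
  The Coxeter group acts on the finitely many orbits of \<open>K\<close> on \<open>Z\<close>. All points outside of \<open>Z\<close> are
  fixed and put in one class.
\<close>

lemma ex_good:
  assumes p: "piece C Z T K" and K: "subgroup K G" and KZ: "\<And>k z. k \<in> K \<Longrightarrow> z \<in> Z \<Longrightarrow> \<rho> k z \<in> Z"
    and fin: "finite R" "\<And>z. z \<in> Z \<Longrightarrow> \<exists>r\<in>R. \<exists>k\<in>K. z = \<rho> k r" "R \<subseteq> Z"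
  shows "\<exists>M. fin_normal M \<and> good M Z T K"
proof -
  note KH = pieceD(8)[OF p] and ZX = pieceD(6)[OF p]
  have Ks: "k \<in> K \<Longrightarrow> inv k \<in> K" "k \<in> K \<Longrightarrow> l \<in> K \<Longrightarrow> k \<otimes> l \<in> K" "\<one> \<in> K" for k l
    using K by (auto simp: subgroup_def)
  define eqv where "eqv x y \<longleftrightarrow> (x \<in> Z \<and> y \<in> Z \<and> (\<exists>k\<in>K. x = \<rho> k y)) \<or> (x \<notin> Z \<and> y \<notin> Z)" for x y
  have mvZ: "mv T c x \<in> Z \<longleftrightarrow> x \<in> Z" for c x
    by (rule mv_cases[OF pieceD(1)[OF p], of x c]) (use pieceD(3,4)[OF p] in auto)
  have mvk: "mv T c (\<rho> k x) = \<rho> k (mv T c x)" if k: "k \<in> K" and x: "x \<in> Z" for c k x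
  proof (cases "\<exists>y. T x c y")
    case True
    then obtain y where y: "T x c y" by blast
    show ?thesis using mv_step[OF pieceD(1)[OF p] y] mv_step[OF pieceD(1)[OF p] pieceD(9)[OF p k y]] by simp
  next
    case False
    have "\<nexists>y. T (\<rho> k x) c y"
    proof
      assume "\<exists>y. T (\<rho> k x) c y"
      then obtain y where "T (\<rho> k x) c y" by blast
      from pieceD(9)[OF p Ks(1)[OF k] this] show False using False inv_action[OF KH[OF k] ZX[OF x]] by simp
    qed
    then show ?thesis using False by (simp add: mv_fix)
  qed
  define o1 where "o1 = (SOME x. x \<notin> Z)"
  have "fin_normal {m. \<forall>x. eqv (act (mv T) x m) x}"
  proof (rule fin_normal_kernel[OF commuting_mv[OF pieceD(1)[OF p]]])
    show "eqv x x" for x using Ks(3) one ZX unfolding eqv_def by force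
    show "eqv y x" if "eqv x y" for x y
      using \<open>eqv x y\<close> unfolding eqv_def
    proof (elim disjE conjE bexE)
      fix k assume "x \<in> Z" "y \<in> Z" "k \<in> K" "x = \<rho> k y"
      then show "(y \<in> Z \<and> x \<in> Z \<and> (\<exists>k\<in>K. y = \<rho> k x)) \<or> (y \<notin> Z \<and> x \<notin> Z)"
        using inv_action[OF KH ZX, of k y] Ks(1) by metis
    qed blast
    show "eqv x z" if "eqv x y" "eqv y z" for x y z
      using that unfolding eqv_def
    proof (elim disjE conjE bexE)
      fix k l assume "x \<in> Z" "y \<in> Z" "k \<in> K" "x = \<rho> k y" "z \<in> Z" "l \<in> K" "y = \<rho> l z"
      then show "(x \<in> Z \<and> z \<in> Z \<and> (\<exists>k\<in>K. x = \<rho> k z)) \<or> (x \<notin> Z \<and> z \<notin> Z)"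
        using mult[OF KH KH ZX, of k l z] Ks(2) by metis
    qed blast+
    show "eqv (mv T c x) (mv T c y)" if "eqv x y" for c x y
      using that mvk[of _ y c] unfolding eqv_def mvZ by metis
    show "finite (insert o1 R)" using fin(1) by simp
    show "\<exists>r\<in>insert o1 R. eqv x r" for x
    proof (cases "x \<in> Z")
      case True
      then show ?thesis using fin(2)[OF True] fin(3) unfolding eqv_def by blast
    next
      case False
      then have "o1 \<notin> Z" unfolding o1_def by (rule someI)
      then show ?thesis using False unfolding eqv_def by blast
    qed
  qed
  moreover have "good {m. \<forall>x. eqv (act (mv T) x m) x} Z T K"
    unfolding good_def eqv_def by blast
  ultimately show ?thesis by blast
qed

text \<open>
  Translates of a piece need the same \<open>M\<close>. Thus finitely many conditions on \<open>M\<close> suffice for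
  infinitely many pieces.
\<close>

lemma good_translate:
  assumes p: "piece C Z T K" and g: "good M Z T K" and h: "h \<in> H" and T': "letter_graph T'"
    and tr: "\<And>x a y. x \<in> Z \<Longrightarrow> T' (\<rho> h x) a y \<longleftrightarrow> (\<exists>y'. y = \<rho> h y' \<and> T x a y')"
    and K': "\<And>k. k \<in> K \<Longrightarrow> h \<otimes> k \<otimes> inv h \<in> K'"
  shows "good M (\<rho> h ` Z) T' K'"
  unfolding good_def
proof (intro ballI)
  fix m z assume m: "m \<in> M" and "z \<in> \<rho> h ` Z"
  then obtain x where x: "x \<in> Z" "z = \<rho> h x" by blast
  have i: "mv T a x \<in> Z \<and> mv T' a (\<rho> h x) = \<rho> h (mv T a x)" if x: "x \<in> Z" for a x
  proof (rule mv_cases[OF pieceD(1)[OF p], of x a])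
    assume "T x a (mv T a x)"
    then show ?thesis using pieceD(4)[OF p] mv_step[OF T'] tr[OF x] by blast
  next
    assume "\<nexists>y. T x a y" "mv T a x = x"
    then show ?thesis using x mv_fix[of T' "\<rho> h x" a] tr[OF x, of a] by auto
  qed
  obtain k where k: "k \<in> K" "act (mv T) x m = \<rho> k x" using g m x(1) unfolding good_def by blast
  have "act (mv T') z m = \<rho> h (\<rho> k x)"
    unfolding x(2) k(2)[symmetric] by (rule act_map(1)[OF commuting_mv[OF pieceD(1)[OF p]] commuting_mv[OF T'] i x(1)])
  also have "\<dots> = \<rho> (h \<otimes> k \<otimes> inv h) z"
  proof -
    have "k \<in> H" "x \<in> X0" using pieceD(8)[OF p k(1)] pieceD(6)[OF p x(1)] by auto
    then show ?thesis using h x(2) mult inv_action closed H_simps by simp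
  qed
  finally show "\<exists>k\<in>K'. act (mv T') z m = \<rho> k z" using K'[OF k(1)] by blast
qed

text \<open>A single edge, as a piece with trivial stabilizer.\<close>

definition edge_graph :: "'x \<Rightarrow> 'v letter \<Rightarrow> 'x \<Rightarrow> 'x \<Rightarrow> 'v letter \<Rightarrow> 'x \<Rightarrow> bool" where
  "edge_graph v c v' x a y \<longleftrightarrow> a = c \<and> (x = v \<and> y = v' \<or> x = v' \<and> y = v)"

lemma letter_graph_edge: "letter_graph (edge_graph v c v')"
  unfolding letter_graph_def edge_graph_def by (auto simp: comm_irrefl)

lemma piece_edge:
  assumes "S v c v'" "c \<in> C" shows "piece C {v, v'} (edge_graph v c v') {\<one>}"
proof -
  have X: "v \<in> X0" "v' \<in> X0" using assms S_X0 S_X0' by blast+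
  have r: "reach (edge_graph v c v') v v'" "reach (edge_graph v c v') v' v"
    by (auto simp: edge_graph_def intro!: r_into_rtranclp)
  show ?thesis
    unfolding piece_def
    using letter_graph_edge X r assms letter_graphD(1)[OF graph assms(1)] one H_simps(4)
    by (auto simp: edge_graph_def)
qed

text \<open>
  An edge with letter \<open>c\<close> is respected by the words in which \<open>c\<close> occurs an even number of times,
  whatever the edge is.
\<close>

lemma ex_good_edges:
  assumes C: "finite C"
  shows "\<exists>M. fin_normal M \<and> (\<forall>v v'. \<forall>c\<in>C. S v c v' \<longrightarrow> good M {v, v'} (edge_graph v c v') {\<one>})"
proof -
  define f where "f c a p = (if a = c then \<not> p else p)" for c a :: "'v letter" and p :: bool
  have f: "commuting_involutions (f c)" for c by (simp add: commuting_involutions_def f_def)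
  define M where "M = (\<Inter>c\<in>C. {x. \<forall>p. act (f c) p x = p})"
  have "fin_normal M"
    unfolding M_def by (intro fin_normal_INT[OF C] fin_normal_kernel[OF f, where R = UNIV]) auto
  moreover have "good M {v, v'} (edge_graph v c v') {\<one>}" if c: "c \<in> C" and e: "S v c v'" for v c v'
    unfolding good_def
  proof (intro ballI)
    have X: "v \<in> X0" "v' \<in> X0" using S_X0[OF e] S_X0'[OF e] .
    fix m z assume m: "m \<in> M" and z: "z \<in> {v, v'}"
    define i where "i p = (if p then v else v')" for p
    have "z = i True \<or> z = i False" using z by (auto simp: i_def)
    then obtain p where p: "z = i p" by blast
    have "mv (edge_graph v c v') a (i p) = i (f c a p)" for a p
    proof (cases "a = c")
      case True
      then show ?thesis by (intro mv_step[OF letter_graph_edge]) (auto simp: edge_graph_def i_def f_def)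
    next
      case False
      then have "\<nexists>y. edge_graph v c v' (i p) a y" by (simp add: edge_graph_def)
      then show ?thesis using False by (simp add: mv_fix f_def)
    qed
    then have "act (mv (edge_graph v c v')) (i p) m = i (act (f c) p m)"
      by (intro act_map(1)[OF f commuting_mv[OF letter_graph_edge], where P = UNIV]) auto
    also have "act (f c) p m = p" using m c by (simp add: M_def)
    finally show "\<exists>k\<in>{\<one>}. act (mv (edge_graph v c v')) z m = \<rho> k z" using p one X by (auto simp: i_def)
  qed
  ultimately show ?thesis by blast
qed

end

section \<open>Links and faces\<close>

lemma length_vars: "f \<in> faces m n \<Longrightarrow> length (vars f) = m"
  using distinct_card[of "vars f"] by (auto simp: faces_def)

lemma coord_pos_eq: "f \<in> faces m n \<Longrightarrow> i < n \<Longrightarrow> f ! i = Coord j b \<Longrightarrow> coord_pos f j = i"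
  unfolding coord_pos_def using facesD(1,4) by (intro the_equality) blast+

lemma salvetti_face:
  assumes "f \<in> faces m n" "i < n" "f ! i = Coord j b"
  shows "face (salvetti V E) xs f ! j = (fst (xs ! i), snd (xs ! i) \<noteq> b)"
proof -
  have "j < m" using facesD(2)[OF assms] .
  then show ?thesis
    by (simp add: salvetti_def length_vars[OF assms(1)] coord_pos_eq[OF assms] assms(3) split_beta Let_def)
qed

lemma axis_faces: "i < n \<Longrightarrow> (replicate n (Fixed b))[i := Coord 0 c] \<in> faces (Suc 0) n"
  unfolding faces_iff by (auto simp: nth_list_update split: if_splits)

context cube_complex
begin

lemma link_edge:
  assumes "e \<in> cubes X 1" shows "{e} \<in> link X (src X e)"
proof -
  have "axis_edge X 1 e 0 = e" using face_id[OF assms] by (simp add: axis_edge_def id_face_def)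
  moreover have "{..<1::nat} = {0}" by auto
  ultimately have "axis_edge X 1 e ` {..<1} = {e}" by simp
  then show ?thesis
    unfolding link_def using assms by (intro CollectI exI[of _ 1] exI[of _ e]) (simp add: corner_def)
qed

lemma axis_edge:
  assumes "c \<in> cubes X n" "i < n"
  shows "axis_edge X n c i \<in> cubes X 1" "src X (axis_edge X n c i) = corner X n c"
proof -
  show "axis_edge X n c i \<in> cubes X 1"
    using face_closed[OF assms(1) axis_faces[OF assms(2)]] by (simp add: axis_edge_def)
  have "face_comp ((replicate n (Fixed False))[i := Coord 0 False]) [Fixed False] = replicate n (Fixed False)"
    by (rule nth_equalityI) (use assms(2) in \<open>auto simp: nth_list_update\<close>)
  then show "src X (axis_edge X n c i) = corner X n c"
    using face_face[OF assms(1) axis_faces[OF assms(2)] edge_faces(1)] by (simp add: axis_edge_def corner_def)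
qed

lemma corner_face_comp:
  assumes "c \<in> cubes X n" "f \<in> faces m n"
  shows "corner X m (face X c f) = face X c (face_comp f (replicate m (Fixed False)))"
  unfolding corner_def by (rule face_face[OF assms zeros_faces])

lemma potential_unique:
  fixes F :: "'a \<Rightarrow> 'w::group_add"
  assumes F: "\<And>e. e \<in> cubes X 1 \<Longrightarrow> F (tgt X e) = F (src X e) + l e" "\<And>e. e \<in> cubes X 1 \<Longrightarrow> F' (tgt X e) = F' (src X e) + l e"
    and x: "x \<in> cubes X 0" "y \<in> cubes X 0"
  shows "F x + - F' x = F y + - F' y"
  using edge_connected[OF x]
proof (induction rule: rtrancl_induct)
  case (step y z)
  then obtain e where e: "e \<in> cubes X 1" "y = src X e" "z = tgt X e" unfolding edge_rel_def by blast
  have "F z + - F' z = F y + - F' y"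
    unfolding e(2,3) F(1)[OF e(1)] F(2)[OF e(1)] by (simp add: minus_add add.assoc del: add_uminus_conv_diff)
  then show ?case using step.IH by simp
qed simp

end

section \<open>Free actions with special quotient\<close>

locale special_action = group G for G :: "('g, 'm) monoid_scheme" (structure) +
  fixes X :: "('a, 'b) cube_complex_scheme" and \<rho> :: "'g \<Rightarrow> 'a \<Rightarrow> 'a" and H :: "'g set"
    and V :: "'v set" and E :: "'v set set" and \<phi> :: "'a set \<Rightarrow> ('v \<times> bool) list"
  assumes CAT0: "CAT0_cube_complex X" and action: "cubical_action G X \<rho>" and H: "subgroup H G"
    and free: "free_action (G\<lparr>carrier := H\<rparr>) X \<rho>" and graph: "simplicial_graph V E"
    and local_iso: "local_isometry \<phi> (quotient_complex (G\<lparr>carrier := H\<rparr>) X \<rho>) (salvetti V E)"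
begin

abbreviation "Q \<equiv> quotient_complex (G\<lparr>carrier := H\<rparr>) X \<rho>"
abbreviation "Sal \<equiv> salvetti V E"

lemma npc: "non_positively_curved X" and sc: "simply_connected_space (realization X)"
  using CAT0 by (simp_all add: CAT0_cube_complex_def)

sublocale cube_complex X
  using npc by (simp add: non_positively_curved_def)

sublocale acts: group_action G "\<Union>n. cubes X n" \<rho>
  using action by (simp add: cubical_action_def)

lemma comb: "g \<in> carrier G \<Longrightarrow> combinatorial_map (\<rho> g) X X"
  using action by (simp add: cubical_action_def)

lemma act_cube: "g \<in> carrier G \<Longrightarrow> c \<in> cubes X n \<Longrightarrow> \<rho> g c \<in> cubes X n"
  using comb unfolding combinatorial_map_def by blast

lemma act_face: "g \<in> carrier G \<Longrightarrow> c \<in> cubes X n \<Longrightarrow> f \<in> faces m n \<Longrightarrow> \<rho> g (face X c f) = face X (\<rho> g c) f"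
  using comb unfolding combinatorial_map_def by blast

lemma act_mult: "g \<in> carrier G \<Longrightarrow> h \<in> carrier G \<Longrightarrow> c \<in> cubes X n \<Longrightarrow> \<rho> (g \<otimes> h) c = \<rho> g (\<rho> h c)"
  using acts.composition_rule[of c g h] by blast

lemma act_one: "c \<in> cubes X n \<Longrightarrow> \<rho> \<one> c = c"
  using acts.id_eq_one by (metis UN_I UNIV_I restrict_apply')

lemma act_inv: "g \<in> carrier G \<Longrightarrow> c \<in> cubes X n \<Longrightarrow> \<rho> (inv g) (\<rho> g c) = c" "g \<in> carrier G \<Longrightarrow> c \<in> cubes X n \<Longrightarrow> \<rho> g (\<rho> (inv g) c) = c"
  using act_mult[of "inv g" g c n] act_mult[of g "inv g" c n] act_one by auto

lemma H_carrier: "h \<in> H \<Longrightarrow> h \<in> carrier G" "h \<in> H \<Longrightarrow> k \<in> H \<Longrightarrow> h \<otimes> k \<in> H" "h \<in> H \<Longrightarrow> inv h \<in> H" "\<one> \<in> H"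
  using H by (auto simp: subgroup_def)

lemma act_edge:
  assumes "g \<in> carrier G" "e \<in> cubes X 1"
  shows "\<rho> g e \<in> cubes X 1" "src X (\<rho> g e) = \<rho> g (src X e)" "tgt X (\<rho> g e) = \<rho> g (tgt X e)"
    "rev_edge X (\<rho> g e) = \<rho> g (rev_edge X e)"
  using act_cube[OF assms] act_face[OF assms, of "[Fixed False]" 0] act_face[OF assms, of "[Fixed True]" 0]
    act_face[OF assms, of "[Coord 0 True]" 1] edge_faces by simp_all

lemma act_corner: "g \<in> carrier G \<Longrightarrow> c \<in> cubes X n \<Longrightarrow> corner X n (\<rho> g c) = \<rho> g (corner X n c)"
  unfolding corner_def using act_face zeros_faces by metis

lemma act_axis_edge: "g \<in> carrier G \<Longrightarrow> c \<in> cubes X n \<Longrightarrow> i < n \<Longrightarrow> axis_edge X n (\<rho> g c) i = \<rho> g (axis_edge X n c i)"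
  unfolding axis_edge_def using act_face axis_faces by metis

text \<open>
  The action on points is given by the action on representatives, as automorphisms preserve
  gluing.
\<close>

lemma point_map_point:
  assumes g: "g \<in> carrier G" and c: "c \<in> cubes X n" and t: "t \<in> topspace (cube_top n)"
  shows "point_map (\<rho> g) (point X c t) = point X (\<rho> g c) t"
proof -
  have glue: "glue X (\<rho> g c, t) (\<rho> g c', t')" if "glue X (c, t) (c', t')" "g \<in> carrier G" for g c t c' t'
  proof -
    obtain m n f where *: "c' \<in> cubes X n" "f \<in> faces m n" "t \<in> topspace (cube_top m)" "c = face X c' f" "t' = place f t"
      using \<open>glue X (c, t) (c', t')\<close> unfolding glue_def by blast
    then show ?thesis
      unfolding glue_def using act_face[OF \<open>g \<in> carrier G\<close> *(1,2)] act_cube[OF \<open>g \<in> carrier G\<close> *(1)]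
      by (intro exI[of _ m] exI[of _ n] exI[of _ "\<rho> g c'"] exI[of _ f] exI[of _ t]) simp
  qed
  have eqv: "equivclp (glue X) (\<rho> g c, t) (\<rho> g (fst q), snd q)"
    if "equivclp (glue X) (c, t) q" "g \<in> carrier G" for g c t q
    using that(1)
  proof (induction rule: equivclp_induct)
    case (step q r)
    have "glue X (\<rho> g (fst q), snd q) (\<rho> g (fst r), snd r) \<or> glue X (\<rho> g (fst r), snd r) (\<rho> g (fst q), snd q)"
      using step(2) glue[OF _ \<open>g \<in> carrier G\<close>, of "fst q" "snd q" "fst r" "snd r"]
        glue[OF _ \<open>g \<in> carrier G\<close>, of "fst r" "snd r" "fst q" "snd q"] by auto
    then show ?case using step(3) equivclp_into_equivclp by metis
  qed simp
  have in_cubes: "\<exists>m. fst q \<in> cubes X m" if "equivclp (glue X) (c, t) q" "c \<in> cubes X n" for c n t q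
    using that(1)
  proof (induction rule: equivclp_induct)
    case (step q r)
    then show ?case using face_closed unfolding glue_def by fastforce
  qed (use \<open>c \<in> cubes X n\<close> in auto)
  show ?thesis
  proof
    show "point_map (\<rho> g) (point X c t) \<subseteq> point X (\<rho> g c) t"
      unfolding point_map_def point_def using eqv[OF _ g] by force
    show "point X (\<rho> g c) t \<subseteq> point_map (\<rho> g) (point X c t)"
    proof
      fix q assume "q \<in> point X (\<rho> g c) t"
      then have q: "equivclp (glue X) (\<rho> g c, t) q" by (simp add: point_def)
      obtain m where m: "fst q \<in> cubes X m" using in_cubes[OF q act_cube[OF g c]] by blast
      have "equivclp (glue X) (c, t) (\<rho> (inv g) (fst q), snd q)"
        using eqv[OF q, of "inv g"] act_inv[OF g c] g by simp
      moreover have "q = (\<rho> g (\<rho> (inv g) (fst q)), snd q)" using act_inv(2)[OF g m] by simp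
      ultimately show "q \<in> point_map (\<rho> g) (point X c t)"
        unfolding point_map_def point_def by (intro image_eqI[where x = "(\<rho> (inv g) (fst q), snd q)"]) auto
    qed
  qed
qed

lemma free_vertex:
  assumes "h \<in> H" "x \<in> cubes X 0" "\<rho> h x = x" shows "h = \<one>"
proof -
  let ?t = "\<lambda>_. undefined :: real"
  have t: "?t \<in> topspace (cube_top 0)" by (simp add: in_cube)
  have "\<forall>h\<in>H. \<forall>p\<in>topspace (realization X). point_map (\<rho> h) p = p \<longrightarrow> h = \<one>"
    using free unfolding free_action_def by (simp del: ball_simps)
  moreover have "point_map (\<rho> h) (point X x ?t) = point X x ?t"
    using point_map_point[OF H_carrier(1)[OF assms(1)] assms(2) t] assms(3) by simp
  ultimately show ?thesis using point_in_topspace[OF assms(2) t] assms(1) by blast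
qed

subsection \<open>The quotient and its labels\<close>

abbreviation "orb \<equiv> orbit (G\<lparr>carrier := H\<rparr>) \<rho>"

lemma orb_eq: "orb c = {\<rho> h c | h. h \<in> H}"
  by (simp add: orbit_def)

lemma orb_mem: "c \<in> cubes X n \<Longrightarrow> c \<in> orb c"
  unfolding orb_eq using act_one H_carrier(4) by force

lemma orb_act:
  assumes "h \<in> H" "c \<in> cubes X n" shows "orb (\<rho> h c) = orb c"
proof -
  have "\<exists>k\<in>H. \<rho> l c = \<rho> k (\<rho> h c)" if "l \<in> H" for l
    using act_mult[of "l \<otimes> inv h" h c n] H_carrier assms that by (intro bexI[of _ "l \<otimes> inv h"]) (auto simp: m_assoc)
  moreover have "\<rho> k (\<rho> h c) = \<rho> (k \<otimes> h) c" if "k \<in> H" for k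
    using act_mult[of k h c n] H_carrier assms that by simp
  ultimately show ?thesis unfolding orb_eq using H_carrier(2)[OF _ assms(1)] by blast
qed

lemma Q_cubes: "q \<in> cubes Q n \<longleftrightarrow> (\<exists>c\<in>cubes X n. q = orb c)"
  by (auto simp: quotient_complex_def)

lemma Q_face:
  assumes "c \<in> cubes X n" "f \<in> faces m n" shows "face Q (orb c) f = orb (face X c f)"
proof -
  have "(\<lambda>c. face X c f) ` {\<rho> h c | h. h \<in> H} = (\<lambda>h. face X (\<rho> h c) f) ` H" by auto
  also have "\<dots> = (\<lambda>h. \<rho> h (face X c f)) ` H" by (rule image_cong) (simp_all add: act_face[OF H_carrier(1) assms])
  finally show ?thesis unfolding quotient_complex_def orb_eq by auto
qed

lemma iso: "non_positively_curved Q" "cube_complex Q" "combinatorial_map \<phi> Q Sal"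
  "v \<in> cubes Q 0 \<Longrightarrow> inj_on \<phi> (\<Union>(link Q v))" "v \<in> cubes Q 0 \<Longrightarrow> full_subcomplex ((`) \<phi> ` link Q v) (link Sal (\<phi> v))"
  using local_iso unfolding local_isometry_def non_positively_curved_def by blast+

definition labs :: "'a \<Rightarrow> ('v \<times> bool) list" where "labs c = \<phi> (orb c)"

definition lab :: "'a \<Rightarrow> nat \<Rightarrow> 'v \<times> bool" where "lab c i = labs c ! i"

lemma labs_cube: "c \<in> cubes X n \<Longrightarrow> labs c \<in> cubes Sal n"
  using iso(3) Q_cubes unfolding labs_def combinatorial_map_def by blast

lemma length_labs: "c \<in> cubes X n \<Longrightarrow> length (labs c) = n"
  using labs_cube[of c n] by (simp add: salvetti_def)

lemma labs_face:
  assumes "c \<in> cubes X n" "f \<in> faces m n" shows "labs (face X c f) = face Sal (labs c) f"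
proof -
  have "orb c \<in> cubes Q n" using assms Q_cubes by blast
  then have "\<phi> (face Q (orb c) f) = face Sal (\<phi> (orb c)) f"
    using iso(3) assms(2) unfolding combinatorial_map_def by blast
  then show ?thesis using Q_face[OF assms] by (simp add: labs_def)
qed

lemma lab_face:
  assumes "c \<in> cubes X n" "f \<in> faces m n" "i < n" "f ! i = Coord j b"
  shows "lab (face X c f) j = (fst (lab c i), snd (lab c i) \<noteq> b)"
  unfolding lab_def labs_face[OF assms(1,2)] by (rule salvetti_face[OF assms(2-4)])

lemma lab_act: "h \<in> H \<Longrightarrow> c \<in> cubes X n \<Longrightarrow> lab (\<rho> h c) i = lab c i"
  by (simp add: lab_def labs_def orb_act)

lemma lab_adjacent:
  assumes "c \<in> cubes X n" "i < n" "j < n" "i \<noteq> j"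
  shows "fst (lab c i) \<noteq> fst (lab c j)" "{fst (lab c i), fst (lab c j)} \<in> E"
proof -
  have l: "length (labs c) = n" "distinct (map fst (labs c))"
    "\<forall>u\<in>fst ` set (labs c). \<forall>v\<in>fst ` set (labs c). u \<noteq> v \<longrightarrow> {u, v} \<in> E"
    using labs_cube[OF assms(1)] by (auto simp: salvetti_def)
  show 1: "fst (lab c i) \<noteq> fst (lab c j)"
    using l(1,2) assms nth_eq_iff_index_eq[OF l(2), of i j] by (simp add: lab_def)
  show "{fst (lab c i), fst (lab c j)} \<in> E"
    using l(1,3) assms 1 by (auto simp: lab_def)
qed

lemma lab_V: "e \<in> cubes X 1 \<Longrightarrow> fst (lab e 0) \<in> V"
  using labs_cube[of e 1] by (auto simp: salvetti_def lab_def)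

lemma labs_edge: "e \<in> cubes X 1 \<Longrightarrow> labs e = [lab e 0]"
  using length_labs[of e 1] by (cases "labs e") (auto simp: lab_def)

lemma lab_axis_edge:
  assumes "c \<in> cubes X n" "i < n" shows "lab (axis_edge X n c i) 0 = lab c i"
proof -
  have "lab (axis_edge X n c i) 0 = (fst (lab c i), snd (lab c i) \<noteq> False)"
    unfolding axis_edge_def by (rule lab_face[OF assms(1) axis_faces[OF assms(2)] assms(2)]) (use assms(2) in simp)
  then show ?thesis by simp
qed

lemma orb_edge_link:
  assumes "e \<in> cubes X 1" shows "{orb e} \<in> link Q (orb (src X e))"
proof -
  have "orb e \<in> cubes Q 1" using assms Q_cubes by blast
  from cube_complex.link_edge[OF iso(2) this] show ?thesis using Q_face[OF assms, of "[Fixed False]" 0] edge_faces by simp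
qed

text \<open>
  The map to the Salvetti complex is injective on links, so the edges have the same image in the
  quotient, and an element that maps one to the other fixes their common origin.
\<close>

lemma edge_unique:
  assumes e: "e \<in> cubes X 1" "e' \<in> cubes X 1" "src X e = src X e'" "lab e 0 = lab e' 0"
  shows "e = e'"
proof -
  have "orb (src X e) \<in> cubes Q 0" using edge_ends(1)[OF e(1)] Q_cubes by blast
  moreover have "\<phi> (orb e) = \<phi> (orb e')"
    using labs_edge[OF e(1)] labs_edge[OF e(2)] e(4) by (simp add: labs_def)
  ultimately have "orb e = orb e'"
    using inj_onD[OF iso(4), of "orb (src X e)" "orb e" "orb e'"] orb_edge_link[OF e(1)] orb_edge_link[OF e(2)] e(3)
    by (simp; blast)
  then obtain h where h: "h \<in> H" "e' = \<rho> h e" using orb_mem[OF e(2)] unfolding orb_eq by blast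
  then have "\<rho> h (src X e) = src X e" using act_edge(2)[OF H_carrier(1)[OF h(1)] e(1)] e(3) by simp
  then have "h = \<one>" using free_vertex[OF h(1) edge_ends(1)[OF e(1)]] by blast
  then show ?thesis using h(2) act_one[OF e(1)] by simp
qed

text \<open>
  The labels span a square in the Salvetti complex. As the image of the link is a full subcomplex,
  the quotient has a cube with these labels at the image of \<open>x\<close>, and it lifts to a cube at \<open>x\<close>.
  The labels of its axes are distinct, hence it is a square, and its axes are the given edges by
  \<open>edge_unique\<close>.
\<close>

lemma ex_square:
  assumes e: "e1 \<in> cubes X 1" "e2 \<in> cubes X 1" "src X e1 = x" "src X e2 = x"
    and adj: "{fst (lab e1 0), fst (lab e2 0)} \<in> E"
  shows "\<exists>c\<in>cubes X 2. \<exists>i j. i < 2 \<and> j < 2 \<and> i \<noteq> j \<and> corner X 2 c = x \<and> axis_edge X 2 c i = e1 \<and> axis_edge X 2 c j = e2"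
proof -
  define a1 a2 where a: "a1 = lab e1 0" "a2 = lab e2 0"
  have ne: "fst a1 \<noteq> fst a2" using adj graph unfolding simplicial_graph_def a by force
  define xs where "xs = [a1, a2]"
  have xs: "xs \<in> cubes Sal 2"
    using ne adj lab_V[OF e(1)] lab_V[OF e(2)] by (auto simp: salvetti_def xs_def a insert_commute)
  have axis: "axis_edge Sal 2 xs i = [xs ! i]" if "i < 2" for i
  proof (rule nth_equalityI)
    let ?f = "(replicate 2 (Fixed False))[i := Coord 0 False]"
    have f: "?f \<in> faces 1 2" using axis_faces[OF that] by simp
    show l: "length (axis_edge Sal 2 xs i) = length [xs ! i]"
      by (simp add: axis_edge_def salvetti_def length_vars[OF f])
    fix k assume "k < length (axis_edge Sal 2 xs i)"
    then have "k = 0" using l by simp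
    moreover have "axis_edge Sal 2 xs i ! 0 = (fst (xs ! i), snd (xs ! i) \<noteq> False)"
      unfolding axis_edge_def by (rule salvetti_face[OF f that]) (use that in simp)
    ultimately show "axis_edge Sal 2 xs i ! k = [xs ! i] ! k" by simp
  qed
  have x: "x \<in> cubes X 0" using edge_ends(1)[OF e(1)] e(3) by simp
  have "{..<2::nat} = {0, 1}" by auto
  then have "axis_edge Sal 2 xs ` {..<2} = {[a1], [a2]}" using axis[of 0] axis[of 1] by (simp add: xs_def)
  moreover have "corner Sal 2 xs = labs x"
    using length_labs[OF x] length_vars[OF zeros_faces[of 2 False]] by (simp add: corner_def salvetti_def)
  ultimately have \<sigma>: "{[a1], [a2]} \<in> link Sal (labs x)"
    unfolding link_def using xs by (intro CollectI exI[of _ 2] exI[of _ xs]) auto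
  have ox: "orb x \<in> cubes Q 0" using x Q_cubes by blast
  have a_orb: "[a1] = \<phi> (orb e1)" "[a2] = \<phi> (orb e2)"
    using labs_edge[OF e(1)] labs_edge[OF e(2)] by (simp_all add: a labs_def)
  have l: "{orb e1} \<in> link Q (orb x)" "{orb e2} \<in> link Q (orb x)"
    using orb_edge_link[OF e(1)] orb_edge_link[OF e(2)] e(3,4) by simp_all
  have "[a1] \<in> \<Union> ((`) \<phi> ` link Q (orb x))" "[a2] \<in> \<Union> ((`) \<phi> ` link Q (orb x))"
    by (rule UnionI[OF imageI[OF l(1)]], simp add: a_orb) (rule UnionI[OF imageI[OF l(2)]], simp add: a_orb)
  then have "{[a1], [a2]} \<subseteq> \<Union> ((`) \<phi> ` link Q (orb x))" by blast
  then have "{[a1], [a2]} \<in> (`) \<phi> ` link Q (orb x)"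
    using iso(5)[OF ox] \<sigma> unfolding full_subcomplex_def labs_def by blast
  then obtain \<tau> where \<tau>: "\<tau> \<in> link Q (orb x)" "\<phi> ` \<tau> = {[a1], [a2]}" by blast
  then obtain n q where q: "q \<in> cubes Q n" "corner Q n q = orb x" "\<tau> = axis_edge Q n q ` {..<n}"
    unfolding link_def by blast
  obtain c' where c': "c' \<in> cubes X n" "q = orb c'" using q(1) Q_cubes by blast
  have "orb (corner X n c') = orb x" using q(2) Q_face[OF c'(1) zeros_faces] c'(2) by (simp add: corner_def)
  then obtain h where h: "h \<in> H" "x = \<rho> h (corner X n c')" using orb_mem[OF x] unfolding orb_eq by blast
  define c where "c = \<rho> h c'"
  have c: "c \<in> cubes X n" "orb c = q" "corner X n c = x"
    using act_cube[OF H_carrier(1)[OF h(1)] c'(1)] orb_act[OF h(1) c'(1)] c'(2) h act_corner[OF H_carrier(1)[OF h(1)] c'(1)]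
    by (simp_all add: c_def)
  have "\<phi> (axis_edge Q n q i) = [lab c i]" if "i < n" for i
  proof -
    have "axis_edge Q n q i = orb (axis_edge X n c i)"
      unfolding axis_edge_def c(2)[symmetric] by (rule Q_face[OF c(1) axis_faces[OF that]])
    then show ?thesis
      using labs_edge[OF axis_edge(1)[OF c(1) that]] lab_axis_edge[OF c(1) that] by (simp add: labs_def)
  qed
  note ax = this
  have im: "(\<lambda>i. [lab c i]) ` {..<n} = {[a1], [a2]}"
  proof -
    have "(\<lambda>i. [lab c i]) ` {..<n} = (\<lambda>i. \<phi> (axis_edge Q n q i)) ` {..<n}" by (rule image_cong) (simp_all add: ax)
    then show ?thesis using \<tau>(2) unfolding q(3) image_image by simp
  qed
  have "inj_on (\<lambda>i. [lab c i]) {..<n}" by (rule inj_onI) (use lab_adjacent(1)[OF c(1)] in force)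
  then have "n = card {[a1], [a2]}" using card_image im by fastforce
  also have "\<dots> = 2"
  proof -
    have "[a1] \<noteq> [a2]" using ne by auto
    then show ?thesis by (simp only: card_2_iff) blast
  qed
  finally have n: "n = 2" .
  have "[a1] \<in> (\<lambda>i. [lab c i]) ` {..<n}" "[a2] \<in> (\<lambda>i. [lab c i]) ` {..<n}" using im by auto
  then obtain i j where ij: "i < 2" "j < 2" "lab c i = a1" "lab c j = a2" using n by auto
  have c2: "c \<in> cubes X 2" "corner X 2 c = x" using c n by auto
  have "axis_edge X 2 c i = e1"
    by (rule edge_unique) (use axis_edge[OF c2(1) ij(1)] lab_axis_edge[OF c2(1) ij(1)] ij e c2 in \<open>simp_all add: a\<close>)
  moreover have "axis_edge X 2 c j = e2"
    by (rule edge_unique) (use axis_edge[OF c2(1) ij(2)] lab_axis_edge[OF c2(1) ij(2)] ij e c2 in \<open>simp_all add: a\<close>)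
  moreover have "i \<noteq> j" using ij ne by auto
  ultimately show ?thesis using c2 ij by blast
qed

subsection \<open>Heights and letters\<close>

text \<open>
  The increments of a potential for this labelling count the edges with label \<open>v\<close>, with signs.
\<close>

definition sgn_lab :: "'v \<Rightarrow> 'a \<Rightarrow> nat \<Rightarrow> int" where
  "sgn_lab v c i = (if fst (lab c i) = v then if snd (lab c i) then 1 else - 1 else 0)"

lemma labelling_sgn: "labelling X (sgn_lab v)"
  unfolding labelling_def by (auto simp: sgn_lab_def lab_face)

lemma ex_potential_of:
  fixes lam :: "'a \<Rightarrow> nat \<Rightarrow> 'w::group_add"
  assumes "labelling X lam"
  shows "\<exists>F. \<forall>n. \<forall>c\<in>cubes X n. \<forall>f\<in>faces 0 n. F (face X c f) = F (corner X n c) + transport lam c f"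
  by (rule labelled_complex.ex_potential[OF labelled_complex.intro sc])
    (use assms in \<open>auto intro: labelled_complex_axioms.intro cube_complex_axioms\<close>)

lemma potential_edge:
  assumes F: "\<forall>n. \<forall>c\<in>cubes X n. \<forall>f\<in>faces 0 n. F (face X c f) = F (corner X n c) + transport lam c f"
    and e: "e \<in> cubes X 1"
  shows "F (tgt X e) = F (src X e) + lam e 0"
proof -
  have "[Fixed True] \<in> faces 0 1" using edge_faces(1) by simp
  then have "F (tgt X e) = F (corner X 1 e) + transport lam e [Fixed True]" using F e by blast
  then show ?thesis by (simp add: corner_def transport_def)
qed

definition ht :: "'v \<Rightarrow> 'a \<Rightarrow> int" where
  "ht v = (SOME F. \<forall>n. \<forall>c\<in>cubes X n. \<forall>f\<in>faces 0 n. F (face X c f) = F (corner X n c) + transport (sgn_lab v) c f)"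

lemma ht: "\<forall>n. \<forall>c\<in>cubes X n. \<forall>f\<in>faces 0 n. ht v (face X c f) = ht v (corner X n c) + transport (sgn_lab v) c f"
  unfolding ht_def by (rule someI_ex[OF ex_potential_of[OF labelling_sgn]])

lemma ht_edge: "e \<in> cubes X 1 \<Longrightarrow> ht v (tgt X e) = ht v (src X e) + sgn_lab v e 0"
  using potential_edge[OF ht] .

text \<open>
  Only the edges parallel to axis \<open>i\<close> change the height of its label, as the labels of a cube are
  distinct.
\<close>

lemma ht_axis:
  assumes c: "c \<in> cubes X n" and f: "f \<in> faces m n" and i: "i < n" "f ! i = Coord j b"
  shows "ht (fst (lab c i)) (corner X m (face X c f)) =
    ht (fst (lab c i)) (corner X n c) + (if b then if snd (lab c i) then 1 else - 1 else 0)"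
proof -
  define g where "g = face_comp f (replicate m (Fixed False))"
  have g: "g \<in> faces 0 n" unfolding g_def by (rule face_comp_faces[OF f zeros_faces])
  have "j < m" using facesD(2)[OF f i] .
  then have gi: "bit (g ! i) = b" using i facesD(1)[OF f] by (simp add: g_def)
  let ?l = "sgn_lab (fst (lab c i))"
  have "ht (fst (lab c i)) (corner X m (face X c f)) = ht (fst (lab c i)) (corner X n c) + transport ?l c g"
    unfolding corner_face_comp[OF c f] g_def[symmetric] using ht c g by blast
  moreover have "transport ?l c g = (\<Sum>k\<in>{0..<n}. if bit (g ! k) then ?l c k else 0)"
    unfolding transport_def facesD(1)[OF g] by (simp add: interv_sum_list_conv_sum_set_nat)
  moreover have "\<dots> = (\<Sum>k\<in>{0..<n}. if k = i then (if b then ?l c i else 0) else 0)"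
    by (rule sum.cong) (use lab_adjacent(1)[OF c _ i(1)] gi in \<open>auto simp: sgn_lab_def\<close>)
  moreover have "\<dots> = (if b then ?l c i else 0)" using i(1) by simp
  ultimately show ?thesis by (simp add: sgn_lab_def)
qed

text \<open>
  The parity of the lower end point of the axis, with respect to the height of its label. The
  corner is the lower end point iff the axis is traversed along the orientation, so that the
  letter does not change when the axis is reversed.
\<close>

definition letter :: "'a \<Rightarrow> nat \<Rightarrow> 'v letter" where
  "letter c i = (let (v, d) = lab c i in
     Letter v (even (ht v (corner X (length (labs c)) c) - (if d then 0 else 1))) {u. {u, v} \<in> E})"

lemma letter_eq:
  assumes "c \<in> cubes X n"
  shows "letter c i = Letter (fst (lab c i))
    (even (ht (fst (lab c i)) (corner X n c) - (if snd (lab c i) then 0 else 1))) {u. {u, fst (lab c i)} \<in> E}"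
  using length_labs[OF assms] by (simp add: letter_def split_beta Let_def)

lemma vertex_letter [simp]: "vertex (letter c i) = fst (lab c i)"
  by (simp add: letter_def split_beta Let_def)

lemma letter_face:
  assumes "c \<in> cubes X n" "f \<in> faces m n" "i < n" "f ! i = Coord j b"
  shows "letter (face X c f) j = letter c i"
  unfolding letter_eq[OF face_closed[OF assms(1,2)]] letter_eq[OF assms(1)] lab_face[OF assms]
  using ht_axis[OF assms] by auto

lemma letter_comm:
  assumes "c \<in> cubes X n" "i < n" "j < n" "i \<noteq> j" shows "comm (letter c i) (letter c j)"
  using lab_adjacent[OF assms] by (simp add: comm_def letter_eq[OF assms(1)] insert_commute)

lemma comm_letter: "comm (letter c i) (letter c' j) \<Longrightarrow> {fst (lab c i), fst (lab c' j)} \<in> E"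
  by (simp add: comm_def letter_def split_beta Let_def insert_commute)

lemma letter_edge:
  assumes "e \<in> cubes X 1"
  shows "letter e 0 = Letter (fst (lab e 0))
    (even (ht (fst (lab e 0)) (src X e) - (if snd (lab e 0) then 0 else 1))) {u. {u, fst (lab e 0)} \<in> E}"
  using letter_eq[OF assms] by (simp add: corner_def)

lemma letter_rev: "e \<in> cubes X 1 \<Longrightarrow> letter (rev_edge X e) 0 = letter e 0"
  using letter_face[of e 1 "[Coord 0 True]" 1 0 0 True] edge_faces by simp

text \<open>The parity of the height at the common origin and the letter determine the direction.\<close>

lemma letter_unique:
  assumes e: "e \<in> cubes X 1" "e' \<in> cubes X 1" "src X e = src X e'" "letter e 0 = letter e' 0"
  shows "e = e'"
proof (rule edge_unique[OF e(1-3)])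
  have "fst (lab e 0) = fst (lab e' 0)" using e(4) vertex_letter by metis
  moreover have "snd (lab e 0) = snd (lab e' 0)"
    using e(4) calculation unfolding letter_edge[OF e(1)] letter_edge[OF e(2)] e(3) by (auto split: if_splits)
  ultimately show "lab e 0 = lab e' 0" by (rule prod_eqI)
qed

subsection \<open>The letter graph of a set of edges\<close>

definition steps :: "'a set \<Rightarrow> 'a \<Rightarrow> 'v letter \<Rightarrow> 'a \<Rightarrow> bool" where
  "steps D x a y \<longleftrightarrow> (\<exists>e\<in>D. src X e = x \<and> tgt X e = y \<and> letter e 0 = a)"

text \<open>
  Sets of edges that are closed under reversal and under completion of squares. These are the sets
  whose edges form a letter graph: the edges of convex subcomplexes, and the edges with labels in
  a given set.
\<close>

definition square_closed :: "'a set \<Rightarrow> bool" where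
  "square_closed D \<longleftrightarrow> D \<subseteq> cubes X 1 \<and> (\<forall>e\<in>D. rev_edge X e \<in> D) \<and>
     (\<forall>c\<in>cubes X 2. (\<forall>i<2. axis_edge X 2 c i \<in> D) \<longrightarrow> (\<forall>i<2. face X c ((replicate 2 (Fixed True))[i := Coord 0 False]) \<in> D))"

lemma opposite_edge:
  assumes c: "c \<in> cubes X 2" and ij: "i < 2" "j < 2" "i \<noteq> j"
  defines "o1 \<equiv> face X c ((replicate 2 (Fixed True))[i := Coord 0 False])"
  shows "src X o1 = tgt X (axis_edge X 2 c j)" "tgt X o1 = face X c (replicate 2 (Fixed True))"
    "letter o1 0 = letter (axis_edge X 2 c i) 0" "lab o1 0 = lab (axis_edge X 2 c i) 0" "o1 \<in> cubes X 1"
proof -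
  have ij': "i = 0 \<and> j = 1 \<or> i = 1 \<and> j = 0" using ij by auto
  have fi: "(replicate 2 (Fixed b))[k := Coord 0 False] \<in> faces (Suc 0) 2" if "k < 2" for b k
    by (rule axis_faces[OF that])
  note ff = face_face[OF c fi edge_faces(1)]
  show "src X o1 = tgt X (axis_edge X 2 c j)" "tgt X o1 = face X c (replicate 2 (Fixed True))"
    using ij' ff[OF ij(1)] ff[OF ij(2)] by (auto simp: o1_def axis_edge_def face_comp_def numeral_2_eq_2)
  have "letter o1 0 = letter c i" unfolding o1_def by (rule letter_face[OF c fi[OF ij(1)] ij(1)]) (use ij in simp)
  moreover have "letter (axis_edge X 2 c i) 0 = letter c i"
    unfolding axis_edge_def by (rule letter_face[OF c fi[OF ij(1)] ij(1)]) (use ij in simp)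
  ultimately show "letter o1 0 = letter (axis_edge X 2 c i) 0" by simp
  have "lab o1 0 = (fst (lab c i), snd (lab c i) \<noteq> False)"
    unfolding o1_def by (rule lab_face[OF c fi[OF ij(1)] ij(1)]) (use ij in simp)
  then show "lab o1 0 = lab (axis_edge X 2 c i) 0" using lab_axis_edge[OF c ij(1)] by simp
  show "o1 \<in> cubes X 1" unfolding o1_def using face_closed[OF c fi[OF ij(1)]] by simp
qed

lemma letter_graph_steps:
  assumes D: "square_closed D" shows "letter_graph (steps D)"
  unfolding letter_graph_def
proof (intro conjI allI impI)
  have D1: "e \<in> cubes X 1" if "e \<in> D" for e using D that unfolding square_closed_def by blast
  show "steps D y a x" if "steps D x a y" for x a y
  proof -
    obtain e where e: "e \<in> D" "src X e = x" "tgt X e = y" "letter e 0 = a"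
      using \<open>steps D x a y\<close> unfolding steps_def by blast
    have "rev_edge X e \<in> D" using D e(1) unfolding square_closed_def by blast
    then show ?thesis unfolding steps_def using rev_edge[OF D1[OF e(1)]] letter_rev[OF D1[OF e(1)]] e by blast
  qed
  show "y = y'" if "steps D x a y" "steps D x a y'" for x a y y'
    using that letter_unique D1 unfolding steps_def by metis
  fix x a b y y' assume "steps D x a y" "steps D x b y'" "comm a b"
  then obtain e e' where e: "e \<in> D" "src X e = x" "tgt X e = y" "letter e 0 = a"
    and e': "e' \<in> D" "src X e' = x" "tgt X e' = y'" "letter e' 0 = b"
    unfolding steps_def by blast
  have "{fst (lab e 0), fst (lab e' 0)} \<in> E" using comm_letter \<open>comm a b\<close> e(4) e'(4) by blast
  then obtain c i j where c: "c \<in> cubes X 2" "i < 2" "j < 2" "i \<noteq> j" "axis_edge X 2 c i = e" "axis_edge X 2 c j = e'"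
    using ex_square[OF D1[OF e(1)] D1[OF e'(1)] e(2) e'(2)] by blast
  have "axis_edge X 2 c k \<in> D" if "k < 2" for k
  proof -
    have "k = i \<or> k = j" using that c(2-4) by auto
    then show ?thesis using c e(1) e'(1) by blast
  qed
  then have o1: "face X c ((replicate 2 (Fixed True))[k := Coord 0 False]) \<in> D" if "k < 2" for k
    using D c(1) that unfolding square_closed_def by blast
  show "\<exists>z. steps D y b z \<and> steps D y' a z"
    using o1[OF c(2)] o1[OF c(3)] opposite_edge[OF c(1) c(2,3,4)] opposite_edge[OF c(1) c(3,2) c(4)[symmetric]] c(5,6) e e'
    unfolding steps_def by blast
qed

definition labelled_by :: "'v set \<Rightarrow> 'a set" where
  "labelled_by V0 = {e \<in> cubes X 1. fst (lab e 0) \<in> V0}"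

lemma lab_rev: "e \<in> cubes X 1 \<Longrightarrow> fst (lab (rev_edge X e) 0) = fst (lab e 0)"
  using lab_face[of e 1 "[Coord 0 True]" 1 0 0 True] edge_faces by simp

lemma square_closed_labelled: "square_closed (labelled_by V0)"
  unfolding square_closed_def
proof (intro conjI ballI allI impI)
  show "labelled_by V0 \<subseteq> cubes X 1" by (auto simp: labelled_by_def)
  show "rev_edge X e \<in> labelled_by V0" if "e \<in> labelled_by V0" for e
    using that rev_edge(1) lab_rev by (simp add: labelled_by_def)
  fix c and i :: nat assume c: "c \<in> cubes X 2" "\<forall>i<2. axis_edge X 2 c i \<in> labelled_by V0" and i: "i < 2"
  have "1 - i < 2" "i \<noteq> 1 - i" using i by arith+
  then show "face X c ((replicate 2 (Fixed True))[i := Coord 0 False]) \<in> labelled_by V0"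
    using opposite_edge(4,5)[OF c(1) i] c(2) i by (simp add: labelled_by_def)
qed

text \<open>
  If the axes of a square at a vertex lie in \<open>Y\<close>, then \<open>Y\<close> has a cube with these axes, since the
  link of \<open>Y\<close> is full. The link of \<open>X\<close> being simplicial, this cube is the square up to a
  permutation of the coordinates.
\<close>

lemma square_closed_convex:
  assumes Y: "convex_subcomplex Y X" and a: "a \<in> carrier G"
  shows "square_closed (\<rho> a ` cubes Y 1)"
proof -
  have sub: "cube_complex Y" "\<And>n. cubes Y n \<subseteq> cubes X n"
    "\<And>m n c f. c \<in> cubes Y n \<Longrightarrow> f \<in> faces m n \<Longrightarrow> face Y c f = face X c f"
    using Y unfolding convex_subcomplex_def subcomplex_def by blast+
  have full: "full_subcomplex (link Y v) (link X v)" if "v \<in> cubes Y 0" for v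
    using Y that unfolding convex_subcomplex_def local_isometry_def by simp
  have Yface: "face X c f \<in> cubes Y m" if "c \<in> cubes Y n" "f \<in> faces m n" for c f m n
    using cube_complex.face_closed[OF sub(1) that] sub(3)[OF that] by simp
  have Y2: "c \<in> cubes Y 2" if c: "c \<in> cubes X 2" and ax: "\<And>i. i < 2 \<Longrightarrow> axis_edge X 2 c i \<in> cubes Y 1" for c
  proof -
    let ?v = "corner X 2 c"
    have v: "?v \<in> cubes Y 0"
      using Yface[OF ax[of 0], of "[Fixed False]" 0] edge_faces axis_edge(2)[OF c, of 0] by simp
    have "{axis_edge X 2 c i} \<in> link Y ?v" if "i < 2" for i
      using cube_complex.link_edge[OF sub(1) ax[OF that]] sub(3)[OF ax[OF that], of "[Fixed False]" 0] edge_faces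
        axis_edge(2)[OF c that] by simp
    then have "axis_edge X 2 c ` {..<2} \<subseteq> \<Union>(link Y ?v)" by blast
    moreover have "axis_edge X 2 c ` {..<2} \<in> link X ?v"
      unfolding link_def using c by (intro CollectI exI[of _ 2] exI[of _ c]) simp
    ultimately have "axis_edge X 2 c ` {..<2} \<in> link Y ?v" using full[OF v] unfolding full_subcomplex_def by blast
    then obtain n c' where c': "c' \<in> cubes Y n" "corner Y n c' = ?v" "axis_edge X 2 c ` {..<2} = axis_edge Y n c' ` {..<n}" "n \<ge> 1"
      unfolding link_def by blast
    have c'X: "c' \<in> cubes X n" using c'(1) sub(2) by blast
    have cor: "corner X n c' = ?v" using c'(2) sub(3)[OF c'(1) zeros_faces] by (simp add: corner_def)
    have "axis_edge Y n c' ` {..<n} = axis_edge X n c' ` {..<n}"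
      by (rule image_cong) (use sub(3)[OF c'(1) axis_faces] in \<open>simp_all add: axis_edge_def\<close>)
    then have im: "axis_edge X n c' ` {..<n} = axis_edge X 2 c ` {..<2}" using c'(3) by simp
    have sl: "simplicial_link X ?v" using npc corner_vertex[OF c] unfolding non_positively_curved_def by blast
    have "inj_on (axis_edge X n c') {..<n}" "inj_on (axis_edge X 2 c) {..<2}"
      using sl c'X cor c unfolding simplicial_link_def by blast+
    then have n: "n = 2" using im card_image by (metis card_lessThan)
    obtain \<sigma> where \<sigma>: "\<sigma> permutes {..<2}" "c = face X c' (map (\<lambda>i. Coord (\<sigma> i) False) [0..<2])"
      using sl c'X cor c im n unfolding simplicial_link_def by (metis one_le_numeral)
    have "map (\<lambda>i. Coord (\<sigma> i) False) [0..<2] \<in> faces 2 2"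
      unfolding faces_iff
    proof (intro conjI allI impI)
      fix j :: nat assume "j < 2"
      then obtain i where "i < 2" "\<sigma> i = j" using permutes_image[OF \<sigma>(1)] by (metis imageE lessThan_iff)
      then have "map (\<lambda>i. Coord (\<sigma> i) False) [0..<2] ! i = Coord j False" by simp
      then show "\<exists>i<2. \<exists>b. map (\<lambda>i. Coord (\<sigma> i) False) [0..<2] ! i = Coord j b" using \<open>i < 2\<close> by blast
    next
      fix i j :: nat and b assume "i < 2" "map (\<lambda>i. Coord (\<sigma> i) False) [0..<2] ! i = Coord j b"
      then show "j < 2" using permutes_in_image[OF \<sigma>(1), of i] by auto
    next
      fix i i' j :: nat and b b'
      assume "i < 2" "i' < 2" "map (\<lambda>i. Coord (\<sigma> i) False) [0..<2] ! i = Coord j b" "map (\<lambda>i. Coord (\<sigma> i) False) [0..<2] ! i' = Coord j b'"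
      then show "i = i'" using permutes_inj[OF \<sigma>(1)] by (auto simp: inj_def)
    qed simp
    then show ?thesis using Yface c'(1) n \<sigma>(2) by metis
  qed
  show ?thesis
    unfolding square_closed_def
  proof (intro conjI ballI allI impI)
    show "\<rho> a ` cubes Y 1 \<subseteq> cubes X 1" using act_cube[OF a] sub(2) by blast
    show "rev_edge X e \<in> \<rho> a ` cubes Y 1" if "e \<in> \<rho> a ` cubes Y 1" for e
    proof -
      obtain e' where e': "e' \<in> cubes Y 1" "e = \<rho> a e'" using \<open>e \<in> \<rho> a ` cubes Y 1\<close> by blast
      then have "e' \<in> cubes X 1" using sub(2) by blast
      then show ?thesis using act_edge(4)[OF a] e' Yface[OF e'(1), of "[Coord 0 True]" 1] edge_faces by simp
    qed
    fix c and i :: nat assume c: "c \<in> cubes X 2" "\<forall>i<2. axis_edge X 2 c i \<in> \<rho> a ` cubes Y 1" and i: "i < 2"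
    define c' where "c' = \<rho> (inv a) c"
    have c': "c' \<in> cubes X 2" "c = \<rho> a c'" using act_cube[of "inv a"] act_inv(2)[OF a c(1)] a c(1) by (simp_all add: c'_def)
    have "axis_edge X 2 c' k \<in> cubes Y 1" if k: "k < 2" for k
    proof -
      obtain e where e: "e \<in> cubes Y 1" "axis_edge X 2 c k = \<rho> a e" using c(2) k by blast
      have "e \<in> cubes X 1" using e(1) sub(2) by blast
      moreover have "axis_edge X 2 c' k = \<rho> (inv a) (axis_edge X 2 c k)"
        unfolding c'_def by (rule act_axis_edge[OF _ c(1) k]) (use a in simp)
      ultimately show ?thesis using act_inv(1)[OF a] e by simp
    qed
    then have "c' \<in> cubes Y 2" using Y2[OF c'(1)] by blast
    moreover have f: "(replicate 2 (Fixed True))[i := Coord 0 False] \<in> faces (Suc 0) 2" by (rule axis_faces[OF i])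
    ultimately have "face X c' ((replicate 2 (Fixed True))[i := Coord 0 False]) \<in> cubes Y 1" using Yface by fastforce
    then show "face X c ((replicate 2 (Fixed True))[i := Coord 0 False]) \<in> \<rho> a ` cubes Y 1"
      unfolding c'(2) act_face[OF a c'(1) f, symmetric] by blast
  qed
qed

end

section \<open>Subgroups of finite index\<close>

lemma finite_representatives:
  assumes "finite (f ` L)"
  shows "\<exists>R\<subseteq>L. finite R \<and> (\<forall>g\<in>L. \<exists>r\<in>R. f g = f r)"
proof (intro exI conjI ballI)
  let ?s = "\<lambda>v. SOME g. g \<in> L \<and> f g = v"
  have s: "?s (f g) \<in> L \<and> f (?s (f g)) = f g" if "g \<in> L" for g
    by (rule someI[where P = "\<lambda>x. x \<in> L \<and> f x = f g" and x = g]) (use that in simp)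
  show "?s ` f ` L \<subseteq> L" using s by blast
  show "finite (?s ` f ` L)" using assms by simp
  show "\<exists>r\<in>?s ` f ` L. f g = f r" if "g \<in> L" for g
    by (rule bexI[of _ "?s (f g)"]) (use s[OF that] that in simp_all)
qed

context group
begin

definition fin_index :: "'a set \<Rightarrow> bool" where
  "fin_index K \<longleftrightarrow> subgroup K G \<and> (\<exists>R\<subseteq>carrier G. finite R \<and> (\<forall>g\<in>carrier G. \<exists>r\<in>R. g \<otimes> inv r \<in> K))"

lemma subgroup_simps:
  assumes "subgroup K G"
  shows "h \<in> K \<Longrightarrow> h \<in> carrier G" "h \<in> K \<Longrightarrow> k \<in> K \<Longrightarrow> h \<otimes> k \<in> K" "h \<in> K \<Longrightarrow> inv h \<in> K" "\<one> \<in> K"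
  using assms by (auto simp: subgroup_def)

lemma inv_cancel: "a \<in> carrier G \<Longrightarrow> b \<in> carrier G \<Longrightarrow> inv a \<otimes> (a \<otimes> b) = b" "a \<in> carrier G \<Longrightarrow> b \<in> carrier G \<Longrightarrow> a \<otimes> (inv a \<otimes> b) = b"
  by (simp_all flip: m_assoc)

lemma fin_indexI:
  assumes K: "subgroup K G" and fin: "finite (f ` carrier G)"
    and f: "\<And>g g'. g \<in> carrier G \<Longrightarrow> g' \<in> carrier G \<Longrightarrow> f g = f g' \<Longrightarrow> g \<otimes> inv g' \<in> K"
  shows "fin_index K"
proof -
  obtain R where R: "R \<subseteq> carrier G" "finite R" "\<And>g. g \<in> carrier G \<Longrightarrow> \<exists>r\<in>R. f g = f r"
    using finite_representatives[OF fin] by blast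
  have "\<exists>r\<in>R. g \<otimes> inv r \<in> K" if "g \<in> carrier G" for g using R(3)[OF that] f[OF that] R(1) by blast
  then show ?thesis using K R(1,2) unfolding fin_index_def by blast
qed

lemma fin_index_rep:
  assumes "fin_index K"
  obtains rep where "finite (rep ` carrier G)" "\<And>g. g \<in> carrier G \<Longrightarrow> rep g \<in> carrier G \<and> g \<otimes> inv (rep g) \<in> K"
proof -
  obtain R where R: "R \<subseteq> carrier G" "finite R" "\<forall>g\<in>carrier G. \<exists>r\<in>R. g \<otimes> inv r \<in> K"
    using assms unfolding fin_index_def by blast
  obtain rep where rep: "\<And>g. g \<in> carrier G \<Longrightarrow> rep g \<in> R \<and> g \<otimes> inv (rep g) \<in> K" using bchoice[OF R(3)[unfolded Bex_def]] by blast
  have "rep ` carrier G \<subseteq> R" using rep by blast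
  then have "finite (rep ` carrier G)" using R(2) finite_subset by blast
  then show thesis using that rep R(1) by blast
qed

lemma same_rep:
  assumes K: "subgroup K G" and g: "g \<in> carrier G" "g' \<in> carrier G" "r \<in> carrier G" "g \<otimes> inv r \<in> K" "g' \<otimes> inv r \<in> K"
  shows "g \<otimes> inv g' \<in> K" "(g \<otimes> inv r) \<otimes> inv (g' \<otimes> inv r) = g \<otimes> inv g'"
proof -
  show *: "(g \<otimes> inv r) \<otimes> inv (g' \<otimes> inv r) = g \<otimes> inv g'"
    using g(1-3) by (simp add: inv_mult_group m_assoc[symmetric]) (simp add: m_assoc)
  show "g \<otimes> inv g' \<in> K" unfolding *[symmetric] using subgroup_simps[OF K] g(4,5) by blast
qed

lemma fin_index_subgroup:
  assumes H: "fin_index H" and L: "L \<subseteq> carrier G"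
  shows "\<exists>R\<subseteq>L. finite R \<and> (\<forall>l\<in>L. \<exists>r\<in>R. l \<otimes> inv r \<in> H)"
proof -
  obtain rep where rep: "finite (rep ` carrier G)" "\<And>g. g \<in> carrier G \<Longrightarrow> rep g \<in> carrier G \<and> g \<otimes> inv (rep g) \<in> H"
    using fin_index_rep[OF H] by blast
  have "finite (rep ` L)" using rep(1) L by (meson finite_subset image_mono)
  then obtain R where R: "R \<subseteq> L" "finite R" "\<And>l. l \<in> L \<Longrightarrow> \<exists>r\<in>R. rep l = rep r" using finite_representatives by metis
  have "\<exists>r\<in>R. l \<otimes> inv r \<in> H" if l: "l \<in> L" for l
  proof -
    obtain r where r: "r \<in> R" "rep l = rep r" using R(3)[OF l] by blast
    have "l \<in> carrier G" "r \<in> carrier G" using l r(1) R(1) L by auto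
    then have "l \<otimes> inv r \<in> H" using same_rep(1)[of H l r "rep r"] rep(2)[of l] rep(2)[of r] r(2) H by (simp add: fin_index_def)
    then show ?thesis using r(1) by blast
  qed
  then show ?thesis using R by blast
qed

lemma fin_index_rcosets:
  assumes "subgroup H G" "finite (rcosets H)" shows "fin_index H"
proof (rule fin_indexI[OF assms(1)])
  have "(\<lambda>g. H #> g) ` carrier G = rcosets H" unfolding RCOSETS_def by blast
  then show "finite ((\<lambda>g. H #> g) ` carrier G)" using assms(2) by simp
  fix g g' assume g: "g \<in> carrier G" "g' \<in> carrier G" "H #> g = H #> g'"
  then obtain h where "h \<in> H" "g = h \<otimes> g'" using rcos_self[OF g(1) assms(1)] unfolding r_coset_def by blast
  then show "g \<otimes> inv g' \<in> H" using g(2) subgroup_simps(1)[OF assms(1)] by (simp add: m_assoc)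
qed

text \<open>
  The passage from \<open>H\<close> to a subgroup that is the stabilizer of finitely many data on \<open>H\<close>, in terms
  of invariants \<open>q\<close> of the elements.
\<close>

lemma fin_index_refine:
  assumes H: "fin_index H" and K: "subgroup K G" and q: "finite (q ` H)"
    and qK: "\<And>h h'. h \<in> H \<Longrightarrow> h' \<in> H \<Longrightarrow> q h = q h' \<Longrightarrow> h \<otimes> inv h' \<in> K"
  shows "fin_index K"
proof -
  obtain rep where rep: "finite (rep ` carrier G)" "\<And>g. g \<in> carrier G \<Longrightarrow> rep g \<in> carrier G \<and> g \<otimes> inv (rep g) \<in> H"
    using fin_index_rep[OF H] by blast
  define f where "f g = (rep g, q (g \<otimes> inv (rep g)))" for g
  show ?thesis
  proof (rule fin_indexI[OF K])
    have "f ` carrier G \<subseteq> rep ` carrier G \<times> q ` H" using rep(2) by (auto simp: f_def)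
    then show "finite (f ` carrier G)" using rep(1) q by (meson finite_SigmaI finite_subset)
    fix g g' assume g: "g \<in> carrier G" "g' \<in> carrier G" "f g = f g'"
    then have r: "rep g' = rep g" "q (g \<otimes> inv (rep g)) = q (g' \<otimes> inv (rep g))" by (auto simp: f_def)
    have "(g \<otimes> inv (rep g)) \<otimes> inv (g' \<otimes> inv (rep g)) \<in> K"
      using qK[OF _ _ r(2)] rep(2)[OF g(1)] rep(2)[OF g(2)] r(1) by simp
    moreover have "(g \<otimes> inv (rep g)) \<otimes> inv (g' \<otimes> inv (rep g)) = g \<otimes> inv g'"
      by (rule same_rep(2)[of H]) (use rep(2)[OF g(1)] rep(2)[OF g(2)] r(1) g H in \<open>simp_all add: fin_index_def\<close>)
    ultimately show "g \<otimes> inv g' \<in> K" by simp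
  qed
qed

text \<open>Conjugates by elements in the same coset of \<open>K\<close> impose the same condition.\<close>

lemma fin_index_core:
  assumes K: "fin_index K"
  shows "\<exists>N\<subseteq>K. N \<lhd> G \<and> fin_index N"
proof -
  obtain rep where rep: "finite (rep ` carrier G)" "\<And>g. g \<in> carrier G \<Longrightarrow> rep g \<in> carrier G \<and> g \<otimes> inv (rep g) \<in> K"
    using fin_index_rep[OF K] by blast
  have Ks: "subgroup K G" using K by (simp add: fin_index_def)
  note Kc = subgroup_simps[OF Ks]
  define N where "N = {x \<in> carrier G. \<forall>g\<in>carrier G. g \<otimes> x \<otimes> inv g \<in> K}"
  have mult: "g \<otimes> (x \<otimes> y) \<otimes> inv g = (g \<otimes> x \<otimes> inv g) \<otimes> (g \<otimes> y \<otimes> inv g)"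
    if "g \<in> carrier G" "x \<in> carrier G" "y \<in> carrier G" for g x y
    using that by (simp add: m_assoc inv_solve_left' flip: m_assoc[of "inv g" g])
  have inv: "g \<otimes> inv x \<otimes> inv g = inv (g \<otimes> x \<otimes> inv g)" if "g \<in> carrier G" "x \<in> carrier G" for g x
    using that by (simp add: inv_mult_group m_assoc)
  have N: "subgroup N G"
    by (rule subgroupI) (use Kc mult inv in \<open>auto simp: N_def\<close>)
  have "N \<lhd> G"
  proof (rule normal_invI[OF N])
    fix x h assume x: "x \<in> carrier G" "h \<in> N"
    have "g \<otimes> (x \<otimes> h \<otimes> inv x) \<otimes> inv g \<in> K" if g: "g \<in> carrier G" for g
    proof -
      have "(g \<otimes> x) \<otimes> h \<otimes> inv (g \<otimes> x) \<in> K" using x g by (simp add: N_def)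
      then show ?thesis using x g by (simp add: N_def inv_mult_group m_assoc)
    qed
    then show "x \<otimes> h \<otimes> inv x \<in> N" using x by (simp add: N_def)
  qed
  moreover have "fin_index N"
  proof (rule fin_indexI[OF N])
    let ?R = "rep ` carrier G"
    define f where "f x = restrict (\<lambda>r. rep (r \<otimes> x)) ?R" for x
    have R: "?R \<subseteq> carrier G" using rep(2) by blast
    have "f ` carrier G \<subseteq> PiE ?R (\<lambda>_. ?R)"
      using R unfolding f_def by auto
    then show "finite (f ` carrier G)" using finite_PiE[OF rep(1), of "\<lambda>_. ?R"] rep(1) finite_subset by blast
    fix x y assume x: "x \<in> carrier G" "y \<in> carrier G" "f x = f y"
    have r: "r \<otimes> (x \<otimes> inv y) \<otimes> inv r \<in> K" if "r \<in> ?R" for r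
    proof -
      have rG: "r \<in> carrier G" using that R by blast
      have eq: "rep (r \<otimes> x) = rep (r \<otimes> y)" using fun_cong[OF x(3), of r] that by (simp add: f_def)
      have "(r \<otimes> x) \<otimes> inv (r \<otimes> y) \<in> K"
        by (rule same_rep(1)[OF Ks, where r = "rep (r \<otimes> y)"]) (use rep(2)[of "r \<otimes> x"] rep(2)[of "r \<otimes> y"] eq rG x in auto)
      then show ?thesis using rG x by (simp add: inv_mult_group m_assoc)
    qed
    have "g \<otimes> (x \<otimes> inv y) \<otimes> inv g \<in> K" if g: "g \<in> carrier G" for g
    proof -
      let ?r = "rep g" and ?k = "g \<otimes> inv (rep g)" and ?z = "x \<otimes> inv y"
      have rG: "?r \<in> carrier G" "?k \<in> K" using rep(2)[OF g] by auto
      have "?r \<otimes> ?z \<otimes> inv ?r \<in> K" by (rule r) (use g in simp)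
      then have "?k \<otimes> (?r \<otimes> ?z \<otimes> inv ?r) \<otimes> inv ?k \<in> K" using Kc(2)[OF Kc(2)[OF rG(2)] Kc(3)[OF rG(2)]] by simp
      moreover have "?k \<otimes> (?r \<otimes> ?z \<otimes> inv ?r) \<otimes> inv ?k = (?k \<otimes> ?r) \<otimes> ?z \<otimes> inv (?k \<otimes> ?r)"
        using rG(1) g x by (simp add: inv_mult_group m_assoc inv_cancel)
      moreover have "?k \<otimes> ?r = g" using rG(1) g by (simp add: m_assoc)
      ultimately show ?thesis by simp
    qed
    then show "x \<otimes> inv y \<in> N" using x by (simp add: N_def)
  qed
  moreover have "N \<subseteq> K"
  proof
    fix x assume "x \<in> N"
    then have x: "x \<in> carrier G" and "\<forall>g\<in>carrier G. g \<otimes> x \<otimes> inv g \<in> K" by (simp_all add: N_def)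
    from bspec[OF this(2) one_closed] show "x \<in> K" using x by simp
  qed
  ultimately show ?thesis by blast
qed

text \<open>
  Pass to the normal core and number the cosets to get a group on a set of natural numbers.
\<close>

lemma separableI:
  assumes S: "S \<subseteq> carrier G"
    and sep: "\<And>g. g \<in> carrier G - S \<Longrightarrow> \<exists>N. fin_index N \<and> (\<forall>\<nu>\<in>N. \<forall>s\<in>S. g \<noteq> s \<otimes> \<nu>)"
  shows "separable G S"
  unfolding separable_def
proof (intro conjI S ballI)
  fix g assume g: "g \<in> carrier G - S"
  obtain N0 where N0: "fin_index N0" "\<forall>\<nu>\<in>N0. \<forall>s\<in>S. g \<noteq> s \<otimes> \<nu>" using sep[OF g] by blast
  obtain N where N: "N \<subseteq> N0" "N \<lhd> G" "fin_index N" using fin_index_core[OF N0(1)] by blast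
  have Ns: "subgroup N G" using N(3) by (simp add: fin_index_def)
  obtain rep where rep: "finite (rep ` carrier G)" "\<And>g. g \<in> carrier G \<Longrightarrow> rep g \<in> carrier G \<and> g \<otimes> inv (rep g) \<in> N"
    using fin_index_rep[OF N(3)] by blast
  have same: "N #> a = N #> b \<longleftrightarrow> a \<otimes> inv b \<in> N" if ab: "a \<in> carrier G" "b \<in> carrier G" for a b
  proof
    assume "N #> a = N #> b"
    then obtain \<nu> where "\<nu> \<in> N" "a = \<nu> \<otimes> b" using rcos_self[OF ab(1) Ns] unfolding r_coset_def by blast
    then show "a \<otimes> inv b \<in> N" using ab(2) subgroup_simps(1)[OF Ns] by (simp add: m_assoc)
  next
    assume *: "a \<otimes> inv b \<in> N"
    have "a = (a \<otimes> inv b) \<otimes> b" using ab by (simp add: m_assoc)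
    then have "a \<in> N #> b" using * unfolding r_coset_def by blast
    then show "N #> a = N #> b" using repr_independence[OF _ ab(2) Ns] by simp
  qed
  have "(\<lambda>a. N #> a) ` carrier G \<subseteq> (\<lambda>a. N #> a) ` rep ` carrier G"
  proof
    fix c assume "c \<in> (\<lambda>a. N #> a) ` carrier G"
    then obtain a where a: "a \<in> carrier G" "c = N #> a" by blast
    then have "c = N #> rep a" using same[of a "rep a"] rep(2)[OF a(1)] by simp
    then show "c \<in> (\<lambda>a. N #> a) ` rep ` carrier G" using a(1) by blast
  qed
  then have fin: "finite ((\<lambda>a. N #> a) ` carrier G)" using rep(1) finite_subset by blast
  then obtain c :: "'a set \<Rightarrow> nat" where c: "inj_on c ((\<lambda>a. N #> a) ` carrier G)" 
    using finite_imp_inj_to_nat_seg[OF fin] by (elim exE conjE) (rule that)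
  define f where "f a = c (N #> a)" for a
  have wm: "weak_group_morphism f N G"
  proof (rule weak_group_morphismsI[OF N(2)])
    fix a b assume ab: "a \<in> carrier G" "b \<in> carrier G"
    have "f a = f b \<longleftrightarrow> N #> a = N #> b" unfolding f_def using inj_on_eq_iff[OF c] ab by blast
    then show "f a = f b \<longleftrightarrow> a \<otimes> inv b \<in> N" using same[OF ab] by simp
  qed
  have "f g \<notin> f ` S"
  proof
    assume "f g \<in> f ` S"
    then obtain s where s: "s \<in> S" "f g = f s" by blast
    have sG: "s \<in> carrier G" "g \<in> carrier G" using s(1) S g by auto
    then have "g \<otimes> inv s \<in> N" using weak_group_morphism.inj_mod_subgroup[OF wm] s(2) by blast
    then have "inv s \<otimes> (g \<otimes> inv s) \<otimes> inv (inv s) \<in> N" using normal_invE(2)[OF N(2), of "inv s"] sG by blast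
    then have "inv s \<otimes> g \<in> N0" using N(1) sG by (auto simp: m_assoc)
    moreover have "g = s \<otimes> (inv s \<otimes> g)" using sG by (simp flip: m_assoc)
    ultimately show False using N0(2) s(1) by blast
  qed
  moreover have "finite (f ` carrier G)" unfolding f_def using finite_imageI[OF fin, of c] by (simp add: image_image)
  ultimately show "\<exists>(F :: nat monoid) \<phi>. group F \<and> finite (carrier F) \<and> \<phi> \<in> hom G F \<and> \<phi> g \<notin> \<phi> ` S"
    using image_group_is_group[OF wm] weak_group_morphism_is_hom[OF wm]
    by (intro exI[of _ "image_group f G"] exI[of _ f]) (simp add: image_group_carrier)
qed

lemma foldr_pprod:
  assumes "\<And>i. i \<in> {1..n} \<Longrightarrow> k i \<in> carrier G" "a \<in> carrier G"
  shows "pprod (\<lambda>i. k (Suc i)) n \<in> carrier G \<and> foldr (\<otimes>) (map k [1..<Suc n]) a = pprod (\<lambda>i. k (Suc i)) n \<otimes> a"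
  using assms
proof (induction n arbitrary: a)
  case (Suc n)
  have k: "k (Suc n) \<in> carrier G" using Suc.prems(1) by simp
  have "[1..<Suc (Suc n)] = [1..<Suc n] @ [Suc n]" by simp
  then show ?case using Suc.IH[of "k (Suc n) \<otimes> a"] Suc.prems k by (simp add: m_assoc)
qed simp

end

section \<open>Chains of pieces\<close>

context racg_action
begin

text \<open>
  Chains of pieces from \<open>v\<close> to the last argument, with the number of pieces and the product of
  their stabilizers. The number of pieces is fixed in advance in \<open>chain_closes\<close>, while the pieces
  may vary.
\<close>

inductive chain :: "'v letter set \<Rightarrow> 'v racg set \<Rightarrow> 'x \<Rightarrow> nat \<Rightarrow> 'a set \<Rightarrow> 'x \<Rightarrow> bool" for C M v where
  chain_start: "chain C M v 0 {\<one>} v"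
| chain_step: "chain C M v r A u \<Longrightarrow> piece C Z T K \<Longrightarrow> good M Z T K \<Longrightarrow> u \<in> Z \<Longrightarrow> u' \<in> Z \<Longrightarrow>
    chain C M v (Suc r) (A <#> K) u'"

lemma chain_carrier: "chain C M v r A u \<Longrightarrow> A \<subseteq> carrier G"
proof (induction rule: chain.induct)
  case (chain_step r A u Z T K u')
  have "K \<subseteq> carrier G" using pieceD(8)[OF chain_step.hyps(2)] H_simps(1) by blast
  then show ?case using set_mult_closed[OF chain_step.IH] by blast
qed simp

lemma chain_sides:
  "chain C M v r A u \<Longrightarrow> \<exists>Z T K x. (\<forall>j<r. piece C (Z j) (T j) (K j) \<and> good M (Z j) (T j) (K j) \<and> x j \<in> Z j \<and> x (Suc j) \<in> Z j) \<and>
     x 0 = v \<and> x r = u \<and> (\<forall>s. (\<forall>j<r. s j \<in> K j) \<longrightarrow> pprod s r \<in> A)"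
proof (induction rule: chain.induct)
  case chain_start
  show ?case by (intro exI[of _ "\<lambda>_. v"] exI) simp
next
  case (chain_step r A u Z' T' K' u')
  then obtain Z T K x where *: "\<forall>j<r. piece C (Z j) (T j) (K j) \<and> good M (Z j) (T j) (K j) \<and> x j \<in> Z j \<and> x (Suc j) \<in> Z j"
    "x 0 = v" "x r = u" "\<forall>s. (\<forall>j<r. s j \<in> K j) \<longrightarrow> pprod s r \<in> A" by blast
  let ?Z = "Z(r := Z')" and ?T = "T(r := T')" and ?K = "K(r := K')" and ?x = "x(Suc r := u')"
  have "\<forall>j<Suc r. piece C (?Z j) (?T j) (?K j) \<and> good M (?Z j) (?T j) (?K j) \<and> ?x j \<in> ?Z j \<and> ?x (Suc j) \<in> ?Z j"
    using *(1,3) chain_step.hyps by (auto simp: less_Suc_eq)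
  moreover have "pprod s (Suc r) \<in> A <#> K'" if s: "\<forall>j<Suc r. s j \<in> ?K j" for s
  proof -
    have "s j \<in> K j" if "j < r" for j
      using s[rule_format, of j] that by simp
    then have "pprod s r \<in> A" using *(4) by blast
    moreover have "s r \<in> K'" using s[rule_format, of r] by simp
    ultimately show ?thesis unfolding set_mult_def by auto
  qed
  moreover have "?x 0 = v" "?x (Suc r) = u'" using *(2) by simp_all
  ultimately show ?case by blast
qed

theorem chain_closes:
  assumes "finite C" "fin_normal M"
  shows "\<exists>N. fin_normal N \<and> (\<forall>v A \<eta>. v \<in> X0 \<longrightarrow> \<eta> \<in> H \<longrightarrow> \<theta> \<eta> \<in> N \<longrightarrow> chain C M v r A (\<rho> \<eta> v) \<longrightarrow> (\<exists>s\<in>A. s \<otimes> \<eta> = \<one>))"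
proof -
  obtain N where N: "fin_normal N" "\<And>Z T K v \<eta>. (\<forall>j<r. piece C (Z j) (T j) (K j) \<and> good M (Z j) (T j) (K j) \<and> v j \<in> Z j \<and> v (Suc j) \<in> Z j) \<Longrightarrow>
     v 0 \<in> X0 \<Longrightarrow> \<eta> \<in> H \<Longrightarrow> v r = \<rho> \<eta> (v 0) \<Longrightarrow> \<theta> \<eta> \<in> N \<Longrightarrow> \<exists>s. (\<forall>j<r. s j \<in> K j) \<and> pprod s r \<otimes> \<eta> = \<one>"
    using chains_close[OF assms, of r] by (elim exE conjE) blast
  have "\<exists>s\<in>A. s \<otimes> \<eta> = \<one>" if v: "v \<in> X0" "\<eta> \<in> H" "\<theta> \<eta> \<in> N" and ch: "chain C M v r A (\<rho> \<eta> v)" for v A \<eta>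
  proof -
    obtain Z T K x where *: "\<forall>j<r. piece C (Z j) (T j) (K j) \<and> good M (Z j) (T j) (K j) \<and> x j \<in> Z j \<and> x (Suc j) \<in> Z j"
      "x 0 = v" "x r = \<rho> \<eta> v" "\<forall>s. (\<forall>j<r. s j \<in> K j) \<longrightarrow> pprod s r \<in> A" using chain_sides[OF ch] by blast
    obtain s where "\<forall>j<r. s j \<in> K j" "pprod s r \<otimes> \<eta> = \<one>"
      using N(2)[OF *(1) _ v(2) _ v(3)] *(2,3) v(1) by auto
    then show ?thesis using *(4) by blast
  qed
  then show ?thesis using N(1) by blast
qed

lemma chain_edge:
  assumes ch: "chain C M v r A x" and e: "S x c y \<or> S y c x" and c: "c \<in> C"
    and M: "\<And>v v'. S v c v' \<Longrightarrow> good M {v, v'} (edge_graph v c v') {\<one>}"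
  shows "chain C M v (Suc r) A y"
proof -
  have "S x c y" using e letter_graphD(1)[OF graph] by blast
  then have "chain C M v (Suc r) (A <#> {\<one>}) y"
    using chain_step[OF ch piece_edge[OF _ c] M] by blast
  moreover have "A <#> {\<one>} = A" using chain_carrier[OF ch] unfolding set_mult_def by force
  ultimately show ?thesis by simp
qed

end

section \<open>The map to the Coxeter group\<close>

context special_action
begin

text \<open>
  Only labels in \<open>V0\<close> are recorded, so that finitely many letters occur; other edges are
  collapsed.
\<close>

definition wlab :: "'v set \<Rightarrow> 'a \<Rightarrow> nat \<Rightarrow> 'v racg" where
  "wlab V0 c i = (if fst (lab c i) \<in> V0 then gen (letter c i) else 0)"

lemma labelling_wlab: "labelling X (wlab V0)"
  unfolding labelling_def
proof (intro conjI allI impI)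
  fix m n c f i j b assume *: "c \<in> cubes X n" "f \<in> faces m n" "i < n" "f ! i = Coord j b"
  show "wlab V0 (face X c f) j = (if b then - wlab V0 c i else wlab V0 c i)"
    using lab_face[OF *] letter_face[OF *] by (simp add: wlab_def)
next
  fix n c i j assume *: "c \<in> cubes X n" "i < n" "j < n"
  show "wlab V0 c i + wlab V0 c j = wlab V0 c j + wlab V0 c i"
    using gen_comm[OF letter_comm[OF *]] by (cases "i = j") (auto simp: wlab_def)
qed

definition wt :: "'v set \<Rightarrow> 'a \<Rightarrow> 'v racg" where
  "wt V0 = (SOME F. \<forall>n. \<forall>c\<in>cubes X n. \<forall>f\<in>faces 0 n. F (face X c f) = F (corner X n c) + transport (wlab V0) c f)"

lemma wt_edge: "e \<in> cubes X 1 \<Longrightarrow> wt V0 (tgt X e) = wt V0 (src X e) + wlab V0 e 0"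
proof (rule potential_edge)
  show "\<forall>n. \<forall>c\<in>cubes X n. \<forall>f\<in>faces 0 n. wt V0 (face X c f) = wt V0 (corner X n c) + transport (wlab V0) c f"
    unfolding wt_def by (rule someI_ex[OF ex_potential_of[OF labelling_wlab]])
qed

lemma ht_act:
  assumes h: "h \<in> H" and x: "x \<in> cubes X 0" "y \<in> cubes X 0"
  shows "ht v (\<rho> h x) - ht v x = ht v (\<rho> h y) - ht v y"
proof -
  have "ht v (\<rho> h x) + - ht v x = ht v (\<rho> h y) + - ht v y"
  proof (rule potential_unique[OF _ _ x, where l = "\<lambda>e. sgn_lab v e 0"])
    fix e assume e: "e \<in> cubes X 1"
    show "ht v (\<rho> h (tgt X e)) = ht v (\<rho> h (src X e)) + sgn_lab v e 0"
      using ht_edge[OF act_edge(1)[OF H_carrier(1)[OF h] e], of v] act_edge(2,3)[OF H_carrier(1)[OF h] e] lab_act[OF h e]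
      by (simp add: sgn_lab_def)
    show "ht v (tgt X e) = ht v (src X e) + sgn_lab v e 0" by (rule ht_edge[OF e])
  qed
  then show ?thesis by simp
qed

text \<open>
  The elements that change all heights of labels in \<open>V0\<close> by even numbers, and hence preserve
  letters. The height change does not depend on the vertex \<open>x0\<close>, by \<open>ht_act\<close>.
\<close>

definition even_sub :: "'v set \<Rightarrow> 'a \<Rightarrow> 'g set" where
  "even_sub V0 x0 = {h \<in> H. \<forall>v\<in>V0. even (ht v (\<rho> h x0) - ht v x0)}"

text \<open>By \<open>wt_act\<close>, this is the homomorphism with respect to which \<open>wt V0\<close> is equivariant.\<close>

definition shift_wt :: "'v set \<Rightarrow> 'a \<Rightarrow> 'g \<Rightarrow> 'v racg" where
  "shift_wt V0 x0 h = wt V0 (\<rho> h x0) + - wt V0 x0"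

definition letters :: "'v set \<Rightarrow> 'v letter set" where
  "letters V0 = {Letter v b {u. {u, v} \<in> E} | v b. v \<in> V0}"

text \<open>
  The stabilizer of the translate by \<open>a\<close> of the subcomplex, as far as it preserves letters.
\<close>

definition conj_sub :: "'v set \<Rightarrow> 'a \<Rightarrow> 'g set \<Rightarrow> 'g \<Rightarrow> 'g set" where
  "conj_sub V0 x0 K a = {a \<otimes> k \<otimes> inv a | k. k \<in> K} \<inter> even_sub V0 x0"

definition ends :: "'a set \<Rightarrow> ('a \<times> 'a) set" where
  "ends D = {(src X e, tgt X e) | e. e \<in> D}"

context
  fixes V0 :: "'v set" and x0 :: 'a
  assumes V0: "finite V0" and x0: "x0 \<in> cubes X 0"
begin

abbreviation "H0 \<equiv> even_sub V0 x0"

lemma H0: "h \<in> H0 \<Longrightarrow> h \<in> H" "h \<in> H0 \<Longrightarrow> h \<in> carrier G"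
  by (simp_all add: even_sub_def H_carrier)

lemma height_mult:
  assumes "h \<in> H" "k \<in> H"
  shows "ht v (\<rho> (h \<otimes> k) x0) - ht v x0 = (ht v (\<rho> h x0) - ht v x0) + (ht v (\<rho> k x0) - ht v x0)"
  using ht_act[OF assms(1) act_cube[OF H_carrier(1)[OF assms(2)] x0] x0, of v]
    act_mult[OF H_carrier(1)[OF assms(1)] H_carrier(1)[OF assms(2)] x0] by simp

lemma height_inv:
  assumes "h \<in> H" shows "ht v (\<rho> (inv h) x0) - ht v x0 = - (ht v (\<rho> h x0) - ht v x0)"
  using height_mult[OF assms H_carrier(3)[OF assms], of v] act_one[OF x0] H_carrier(1)[OF assms] by simp

lemma subgroup_H0: "subgroup H0 G"
proof (rule subgroupI)
  show "H0 \<subseteq> carrier G" using H0(2) by blast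
  have "\<one> \<in> H0" using H_carrier(4) act_one[OF x0] by (simp add: even_sub_def)
  then show "H0 \<noteq> {}" by blast
  show "inv h \<in> H0" if h: "h \<in> H0" for h
    unfolding even_sub_def
  proof (intro CollectI conjI ballI H_carrier(3)[OF H0(1)[OF h]])
    fix v assume v: "v \<in> V0"
    show "even (ht v (\<rho> (inv h) x0) - ht v x0)"
      unfolding height_inv[OF H0(1)[OF h]] using h v by (simp only: even_sub_def dvd_minus_iff) blast
  qed
  show "h \<otimes> k \<in> H0" if h: "h \<in> H0" and k: "k \<in> H0" for h k
    unfolding even_sub_def
  proof (intro CollectI conjI ballI H_carrier(2)[OF H0(1)[OF h] H0(1)[OF k]])
    fix v assume v: "v \<in> V0"
    show "even (ht v (\<rho> (h \<otimes> k) x0) - ht v x0)"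
      unfolding height_mult[OF H0(1)[OF h] H0(1)[OF k]] by (rule dvd_add) (use h k v in \<open>(simp only: even_sub_def, blast)+\<close>)
  qed
qed

lemma fin_index_H0:
  assumes "fin_index H" shows "fin_index H0"
proof (rule fin_index_refine[OF assms subgroup_H0])
  let ?q = "\<lambda>h. restrict (\<lambda>v. even (ht v (\<rho> h x0) - ht v x0)) V0"
  show "finite (?q ` H)" by (rule finite_subset[OF _ finite_PiE[OF V0, of "\<lambda>_. UNIV :: bool set"]]) auto
  fix h h' assume h: "h \<in> H" "h' \<in> H" "?q h = ?q h'"
  show "h \<otimes> inv h' \<in> H0"
    unfolding even_sub_def
  proof (intro CollectI conjI ballI H_carrier(2)[OF h(1) H_carrier(3)[OF h(2)]])
    fix v assume v: "v \<in> V0"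
    have "even (ht v (\<rho> h x0) - ht v x0) = even (ht v (\<rho> h' x0) - ht v x0)"
      using fun_cong[OF h(3), of v] v by (simp only: restrict_apply if_True)
    then show "even (ht v (\<rho> (h \<otimes> inv h') x0) - ht v x0)"
      unfolding height_mult[OF h(1) H_carrier(3)[OF h(2)]] height_inv[OF h(2)] by presburger
  qed
qed

lemma letter_act:
  assumes h: "h \<in> H0" and e: "e \<in> cubes X 1" "fst (lab e 0) \<in> V0"
  shows "letter (\<rho> h e) 0 = letter e 0"
proof -
  have hG: "h \<in> H" "h \<in> carrier G" using H0[OF h] by auto
  let ?v = "fst (lab e 0)"
  have "even (ht ?v (\<rho> h x0) - ht ?v x0)" using h e(2) by (simp only: even_sub_def) blast
  then have "even (ht ?v (\<rho> h (src X e)) - d) = even (ht ?v (src X e) - d)" for d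
    unfolding ht_act[OF hG(1) x0 edge_ends(1)[OF e(1)], of ?v] by presburger
  then show ?thesis
    unfolding letter_edge[OF e(1)] letter_edge[OF act_edge(1)[OF hG(2) e(1)]] lab_act[OF hG(1) e(1)] act_edge(2)[OF hG(2) e(1)]
    by simp
qed

lemma wt_act:
  assumes h: "h \<in> H0" and x: "x \<in> cubes X 0"
  shows "wt V0 (\<rho> h x) = shift_wt V0 x0 h + wt V0 x"
proof -
  have hG: "h \<in> H" "h \<in> carrier G" using H0[OF h] by auto
  have "wt V0 (\<rho> h x) + - wt V0 x = wt V0 (\<rho> h x0) + - wt V0 x0"
  proof (rule potential_unique[OF _ _ x x0, where l = "\<lambda>e. wlab V0 e 0"])
    fix e assume e: "e \<in> cubes X 1"
    have "wlab V0 (\<rho> h e) 0 = wlab V0 e 0" using lab_act[OF hG(1) e] letter_act[OF h e] by (simp add: wlab_def)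
    then show "wt V0 (\<rho> h (tgt X e)) = wt V0 (\<rho> h (src X e)) + wlab V0 e 0"
      using wt_edge[OF act_edge(1)[OF hG(2) e], of V0] act_edge(2,3)[OF hG(2) e] by simp
    show "wt V0 (tgt X e) = wt V0 (src X e) + wlab V0 e 0" by (rule wt_edge[OF e])
  qed
  then have "wt V0 (\<rho> h x) + - wt V0 x + wt V0 x = shift_wt V0 x0 h + wt V0 x" by (simp add: shift_wt_def)
  then show ?thesis by (simp add: add.assoc del: add_uminus_conv_diff)
qed

lemma labelled: "e \<in> labelled_by V0 \<Longrightarrow> e \<in> cubes X 1" "e \<in> labelled_by V0 \<Longrightarrow> fst (lab e 0) \<in> V0"
  by (simp_all add: labelled_by_def)

lemma steps_act:
  assumes h: "h \<in> H0" and D: "D \<subseteq> labelled_by V0" and "steps D x a y"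
  shows "steps (\<rho> h ` D) (\<rho> h x) a (\<rho> h y)"
proof -
  obtain e where e: "e \<in> D" "src X e = x" "tgt X e = y" "letter e 0 = a" using assms(3) unfolding steps_def by blast
  have l: "e \<in> cubes X 1" "fst (lab e 0) \<in> V0" using e(1) D labelled by blast+
  show ?thesis
    unfolding steps_def using act_edge(2,3)[OF H0(2)[OF h] l(1)] letter_act[OF h l] e
    by (intro bexI[of _ "\<rho> h e"]) auto
qed

lemma act_labelled: "h \<in> H0 \<Longrightarrow> \<rho> h ` labelled_by V0 \<subseteq> labelled_by V0"
  using act_edge(1)[OF H0(2)] lab_act[OF H0(1)] by (auto simp: labelled_by_def)

lemma steps_mono: "steps D x a y \<Longrightarrow> D \<subseteq> D' \<Longrightarrow> steps D' x a y"
  unfolding steps_def by blast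

lemma racg_action: "racg_action G H0 (cubes X 0) \<rho> (steps (labelled_by V0)) (wt V0) (shift_wt V0 x0)"
proof (intro racg_action.intro racg_action_axioms.intro)
  show "group G" by (rule is_group)
  show "subgroup H0 G" by (rule subgroup_H0)
  show "\<rho> h x \<in> cubes X 0" if "h \<in> H0" "x \<in> cubes X 0" for h x using act_cube[OF H0(2)] that by blast
  show "\<rho> (h \<otimes> k) x = \<rho> h (\<rho> k x)" if "h \<in> H0" "k \<in> H0" "x \<in> cubes X 0" for h k x
    using act_mult[OF H0(2) H0(2)] that by blast
  show "\<rho> \<one> x = x" if "x \<in> cubes X 0" for x by (rule act_one[OF that])
  show "letter_graph (steps (labelled_by V0))" by (rule letter_graph_steps[OF square_closed_labelled])
  show "x \<in> cubes X 0" if "steps (labelled_by V0) x a y" for x a y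
    using that edge_ends(1) labelled(1) unfolding steps_def by blast
  show "wt V0 y = wt V0 x + gen a" if "steps (labelled_by V0) x a y" for x a y
    using that wt_edge labelled unfolding steps_def by (auto simp: wlab_def)
  show "steps (labelled_by V0) (\<rho> h x) a (\<rho> h y)" if "h \<in> H0" "steps (labelled_by V0) x a y" for h x a y
    by (rule steps_mono[OF steps_act[OF that(1) order.refl that(2)] act_labelled[OF that(1)]])
  show "wt V0 (\<rho> h x) = shift_wt V0 x0 h + wt V0 x" if "h \<in> H0" "x \<in> cubes X 0" for h x by (rule wt_act[OF that])
  show "h = \<one>" if "h \<in> H0" "x \<in> cubes X 0" "\<rho> h x = x" for h x
    using free_vertex[OF H0(1)] that by blast
qed

interpretation A: racg_action G H0 "cubes X 0" \<rho> "steps (labelled_by V0)" "wt V0" "shift_wt V0 x0"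
  by (rule racg_action)

lemma finite_letters: "finite (letters V0)"
proof -
  have "letters V0 = (\<lambda>(v, b). Letter v b {u. {u, v} \<in> E}) ` (V0 \<times> UNIV)" unfolding letters_def by auto
  then show ?thesis using V0 by simp
qed

lemma letter_letters: "e \<in> labelled_by V0 \<Longrightarrow> letter e 0 \<in> (letters V0)"
  unfolding letters_def letter_edge[OF labelled(1)] using labelled(2) by blast

lemma shift_wt_mult:
  assumes "h \<in> H0" "k \<in> H0" shows "shift_wt V0 x0 (h \<otimes> k) = shift_wt V0 x0 h + shift_wt V0 x0 k"
proof -
  have "shift_wt V0 x0 (h \<otimes> k) + wt V0 x0 = shift_wt V0 x0 h + shift_wt V0 x0 k + wt V0 x0"
    using wt_act[OF A.H_simps(2)[OF assms] x0] wt_act[OF assms(1) act_cube[OF H0(2)[OF assms(2)] x0]] wt_act[OF assms(2) x0]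
      act_mult[OF H0(2)[OF assms(1)] H0(2)[OF assms(2)] x0] by (simp add: add.assoc)
  then show ?thesis by (rule add_right_imp_eq)
qed

text \<open>The quotient by \<open>N\<close> is finite, and \<open>shift_wt\<close> is a homomorphism on \<open>even_sub\<close>.\<close>

lemma fin_index_shift:
  assumes H: "fin_index H" and N: "fin_normal N"
  shows "fin_index {h \<in> H0. shift_wt V0 x0 h \<in> N}"
proof -
  have one: "shift_wt V0 x0 \<one> = 0" using act_one[OF x0] by (simp add: shift_wt_def)
  have inv: "shift_wt V0 x0 (inv h) = - shift_wt V0 x0 h" if "h \<in> H0" for h
    using shift_wt_mult[OF that A.H_simps(3)[OF that]] one H0(2)[OF that] by (simp add: minus_unique)
  obtain rep where rep: "finite (range rep)" "\<And>x. cong N x (rep x)" using fin_normal_reps[OF N] by blast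
  show ?thesis
  proof (rule fin_index_refine[OF fin_index_H0[OF H], where q = "\<lambda>h. rep (shift_wt V0 x0 h)"])
    show "subgroup {h \<in> H0. shift_wt V0 x0 h \<in> N} G"
    proof (rule subgroupI)
      show "{h \<in> H0. shift_wt V0 x0 h \<in> N} \<noteq> {}" using one A.H_simps(4) fin_normalD(1)[OF N] by auto
    qed (use inv shift_wt_mult A.H_simps fin_normalD(2,3)[OF N] H0(2) in auto)
    show "finite ((\<lambda>h. rep (shift_wt V0 x0 h)) ` H0)" by (rule finite_subset[OF _ rep(1)]) blast
    fix h h' assume h: "h \<in> H0" "h' \<in> H0" "rep (shift_wt V0 x0 h) = rep (shift_wt V0 x0 h')"
    have "cong N (rep (shift_wt V0 x0 h)) (shift_wt V0 x0 h')"
      using cong_sym[OF N rep(2)[of "shift_wt V0 x0 h'"]] h(3) by simp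
    then have "cong N (shift_wt V0 x0 h) (shift_wt V0 x0 h')" by (rule cong_trans[OF N rep(2)])
    then show "h \<otimes> inv h' \<in> {h \<in> H0. shift_wt V0 x0 h \<in> N}"
      using shift_wt_mult[OF h(1) A.H_simps(3)[OF h(2)]] inv[OF h(2)] A.H_simps(2)[OF h(1) A.H_simps(3)[OF h(2)]]
      by (simp add: cong_def)
  qed
qed

subsection \<open>Translates of convex subcomplexes are pieces\<close>

context
  fixes Y :: "'a cube_complex" and K :: "'g set"
  assumes Y: "convex_subcomplex Y X" and K: "subgroup K G"
    and KY: "\<And>k n. k \<in> K \<Longrightarrow> \<rho> k ` cubes Y n = cubes Y n"
    and Y_lab: "\<And>a. a \<in> carrier G \<Longrightarrow> \<rho> a ` cubes Y 1 \<subseteq> labelled_by V0"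
begin

lemma Y_sub: "cube_complex Y" "c \<in> cubes Y n \<Longrightarrow> c \<in> cubes X n"
    "c \<in> cubes Y n \<Longrightarrow> f \<in> faces m n \<Longrightarrow> face Y c f = face X c f"
  using Y unfolding convex_subcomplex_def subcomplex_def by blast+

lemma Y_ends:
  assumes "e \<in> cubes Y 1"
  shows "src Y e = src X e" "tgt Y e = tgt X e" "src X e \<in> cubes Y 0" "tgt X e \<in> cubes Y 0"
proof -
  show 1: "src Y e = src X e" "tgt Y e = tgt X e"
    using Y_sub(3)[OF assms, of "[Fixed False]" 0] Y_sub(3)[OF assms, of "[Fixed True]" 0] edge_faces(1) by simp_all
  show "src X e \<in> cubes Y 0" "tgt X e \<in> cubes Y 0" using cube_complex.edge_ends[OF Y_sub(1) assms] 1 by simp_all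
qed

lemma Kc: "k \<in> K \<Longrightarrow> k \<in> carrier G"
  using subgroup_simps(1)[OF K] .

lemma conj_mem:
  assumes a: "a \<in> carrier G" and h: "h \<in> conj_sub V0 x0 K a"
  obtains k where "k \<in> K" "h = a \<otimes> k \<otimes> inv a" "h \<in> H0"
    "\<And>n c. c \<in> cubes X n \<Longrightarrow> \<rho> h (\<rho> a c) = \<rho> a (\<rho> k c)"
proof -
  obtain k where k: "k \<in> K" "h = a \<otimes> k \<otimes> inv a" "h \<in> H0" using h unfolding conj_sub_def by blast
  have "\<rho> h (\<rho> a c) = \<rho> a (\<rho> k c)" if c: "c \<in> cubes X n" for n c
  proof -
    have "h \<otimes> a = a \<otimes> k" using k a Kc[OF k(1)] by (simp add: m_assoc)
    then show ?thesis using act_mult[OF H0(2)[OF k(3)] a c] act_mult[OF a Kc[OF k(1)] c] by simp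
  qed
  then show thesis using that k by blast
qed

lemma piece_translate:
  assumes a: "a \<in> carrier G"
  shows "A.piece (letters V0) (\<rho> a ` cubes Y 0) (steps (\<rho> a ` cubes Y 1)) (conj_sub V0 x0 K a)"
  unfolding A.piece_def
proof (intro conjI allI ballI impI)
  note lab = Y_lab[OF a]
  show "letter_graph (steps (\<rho> a ` cubes Y 1))" by (rule letter_graph_steps[OF square_closed_convex[OF Y a]])
  fix x c y assume st: "steps (\<rho> a ` cubes Y 1) x c y"
  show "steps (labelled_by V0) x c y" by (rule steps_mono[OF st lab])
  obtain e where e: "e \<in> cubes Y 1" "x = src X (\<rho> a e)" "y = tgt X (\<rho> a e)" "c = letter (\<rho> a e) 0"
    using st unfolding steps_def by blast
  show "x \<in> \<rho> a ` cubes Y 0" using act_edge(2)[OF a Y_sub(2)[OF e(1)]] e(2) Y_ends(3)[OF e(1)] by simp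
  show "c \<in> (letters V0)" using letter_letters lab e(1,4) by blast
next
  show "\<rho> a ` cubes Y 0 \<subseteq> cubes X 0" using act_cube[OF a] Y_sub(2) by blast
  show "conj_sub V0 x0 K a \<subseteq> H0" unfolding conj_sub_def by blast
next
  fix x y assume "x \<in> \<rho> a ` cubes Y 0" "y \<in> \<rho> a ` cubes Y 0"
  then obtain x' y' where x: "x' \<in> cubes Y 0" "x = \<rho> a x'" and y: "y' \<in> cubes Y 0" "y = \<rho> a y'" by blast
  have "(x', y') \<in> (edge_rel Y)\<^sup>*" by (rule cube_complex.edge_connected[OF Y_sub(1) x(1) y(1)])
  then show "reach (steps (\<rho> a ` cubes Y 1)) x y"
    unfolding x(2) y(2)
  proof (induction rule: rtrancl_induct)
    case (step y z)
    then obtain e where e: "e \<in> cubes Y 1" "y = src X e" "z = tgt X e" unfolding edge_rel_def using Y_ends by auto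
    have "steps (\<rho> a ` cubes Y 1) (\<rho> a y) (letter (\<rho> a e) 0) (\<rho> a z)"
      unfolding steps_def using act_edge(2,3)[OF a Y_sub(2)[OF e(1)]] e by (intro bexI[of _ "\<rho> a e"]) auto
    then show ?case
      using step.IH rtranclp.rtrancl_into_rtrancl[of "\<lambda>x y. \<exists>c. steps (\<rho> a ` cubes Y 1) x c y"] by blast
  qed simp
next
  fix h x c y assume h: "h \<in> conj_sub V0 x0 K a" and st: "steps (\<rho> a ` cubes Y 1) x c y"
  obtain k where k: "k \<in> K" "h \<in> H0" "\<And>n c. c \<in> cubes X n \<Longrightarrow> \<rho> h (\<rho> a c) = \<rho> a (\<rho> k c)"
    by (rule conj_mem[OF a h]) (rule that)
  have "\<rho> h ` \<rho> a ` cubes Y 1 \<subseteq> \<rho> a ` cubes Y 1"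
  proof
    fix e assume "e \<in> \<rho> h ` \<rho> a ` cubes Y 1"
    then obtain e' where e': "e' \<in> cubes Y 1" "e = \<rho> h (\<rho> a e')" by blast
    have "\<rho> k e' \<in> cubes Y 1" using KY[OF k(1)] e'(1) by blast
    then show "e \<in> \<rho> a ` cubes Y 1" using k(3)[OF Y_sub(2)[OF e'(1)]] e'(2) by blast
  qed
  then show "steps (\<rho> a ` cubes Y 1) (\<rho> h x) c (\<rho> h y)"
    using steps_mono[OF steps_act[OF k(2) Y_lab[OF a] st]] by blast
qed

text \<open>
  For a single translate, \<open>K\<close> acts with finitely many orbits of vertices, and so does its subgroup
  of finite index. All translates are translates, by elements that preserve letters, of finitely
  many.
\<close>

lemma ex_good_translates:
  assumes H: "fin_index H" and co: "cocompact_action (G\<lparr>carrier := K\<rparr>) Y \<rho>"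
  shows "\<exists>M. fin_normal M \<and> (\<forall>a\<in>carrier G. A.good M (\<rho> a ` cubes Y 0) (steps (\<rho> a ` cubes Y 1)) (conj_sub V0 x0 K a))"
proof -
  have comb: "combinatorial_map (\<rho> k) Y Y" if "k \<in> K" for k
    unfolding combinatorial_map_def
  proof (intro conjI allI ballI)
    show "\<rho> k c \<in> cubes Y n" if "c \<in> cubes Y n" for n c using KY[OF \<open>k \<in> K\<close>] that by blast
    then show "\<rho> k (face Y c f) = face Y (\<rho> k c) f" if "c \<in> cubes Y n" "f \<in> faces m n" for m n c f
      using that Y_sub(2,3) act_face[OF Kc[OF \<open>k \<in> K\<close>]] by metis
  qed
  obtain S0 where S0: "finite S0" "S0 \<subseteq> cubes Y 0" "\<And>c. c \<in> cubes Y 0 \<Longrightarrow> \<exists>k\<in>K. \<exists>s\<in>S0. c = \<rho> k s"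
    using cocompact_finite_cells[OF Y_sub(1), of "G\<lparr>carrier := K\<rparr>" \<rho> 0] KY comb co by auto
  have one: "\<exists>M. fin_normal M \<and> A.good M (\<rho> a ` cubes Y 0) (steps (\<rho> a ` cubes Y 1)) (conj_sub V0 x0 K a)"
    if a: "a \<in> carrier G" for a
  proof -
    define L where "L = {a \<otimes> k \<otimes> inv a | k. k \<in> K}"
    have L: "L \<subseteq> carrier G" unfolding L_def using a Kc by blast
    have LL: "l \<otimes> inv l' \<in> L" if l: "l \<in> L" "l' \<in> L" for l l'
    proof -
      obtain k k' where k: "k \<in> K" "l = a \<otimes> k \<otimes> inv a" "k' \<in> K" "l' = a \<otimes> k' \<otimes> inv a" using l unfolding L_def by blast
      have "l \<otimes> inv l' = a \<otimes> (k \<otimes> inv k') \<otimes> inv a"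
        using k a Kc by (simp add: inv_mult_group m_assoc inv_cancel)
      then show ?thesis unfolding L_def using subgroup_simps(2,3)[OF K] k by blast
    qed
    have "\<one> \<in> L"
    proof -
      have "a \<otimes> \<one> \<otimes> inv a = \<one>" using a by simp
      then show ?thesis unfolding L_def using subgroup_simps(4)[OF K] by (metis (mono_tags, lifting) mem_Collect_eq)
    qed
    then have "inv l \<in> L" if "l \<in> L" for l using LL[OF _ that] L that by force
    moreover have "l \<otimes> l' \<in> L" if "l \<in> L" "l' \<in> L" for l l'
      using LL[OF that(1) calculation[OF that(2)]] L that by force
    ultimately have sL: "subgroup L G" using L \<open>\<one> \<in> L\<close> by (intro subgroupI) auto
    have cs: "conj_sub V0 x0 K a = L \<inter> H0" by (simp add: conj_sub_def L_def)
    have sub: "subgroup (conj_sub V0 x0 K a) G" unfolding cs by (rule subgroups_Inter_pair[OF sL subgroup_H0])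
    obtain R where R: "R \<subseteq> L" "finite R" "\<forall>l\<in>L. \<exists>r\<in>R. l \<otimes> inv r \<in> H0"
      using fin_index_subgroup[OF fin_index_H0[OF H] L] by blast
    define R' where "R' = (\<lambda>(r, s). \<rho> r (\<rho> a s)) ` (R \<times> S0)"
    have Linv: "\<exists>k\<in>K. \<forall>n. \<forall>c\<in>cubes X n. \<rho> l (\<rho> a c) = \<rho> a (\<rho> k c)" if l: "l \<in> L" for l
    proof -
      obtain k where k: "k \<in> K" "l = a \<otimes> k \<otimes> inv a" using l unfolding L_def by blast
      have "l \<otimes> a = a \<otimes> k" using k a Kc[OF k(1)] by (simp add: m_assoc)
      moreover have "l \<in> carrier G" using L l by blast
      ultimately have "\<rho> l (\<rho> a c) = \<rho> a (\<rho> k c)" if "c \<in> cubes X n" for n c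
        using act_mult[OF _ a that, of l] act_mult[OF a Kc[OF k(1)] that] by simp
      then show ?thesis using k(1) by blast
    qed
    have LZ: "\<rho> l z \<in> \<rho> a ` cubes Y 0" if l: "l \<in> L" and z: "z \<in> \<rho> a ` cubes Y 0" for l z
    proof -
      obtain y where y: "y \<in> cubes Y 0" "z = \<rho> a y" using z by blast
      obtain k where k: "k \<in> K" "\<forall>n. \<forall>c\<in>cubes X n. \<rho> l (\<rho> a c) = \<rho> a (\<rho> k c)" using Linv[OF l] by blast
      have "\<rho> k y \<in> cubes Y 0" using KY[OF k(1)] y(1) by blast
      then show ?thesis using k(2) Y_sub(2)[OF y(1)] y(2) by blast
    qed
    show ?thesis
    proof (rule A.ex_good[OF piece_translate[OF a] sub, of R'])
      show "\<rho> k z \<in> \<rho> a ` cubes Y 0" if "k \<in> conj_sub V0 x0 K a" "z \<in> \<rho> a ` cubes Y 0" for k z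
        using LZ that unfolding cs by blast
      show "finite R'" unfolding R'_def using R(2) S0(1) by blast
      show "R' \<subseteq> \<rho> a ` cubes Y 0" 
      proof
        fix z assume "z \<in> R'"
        then obtain r s where "r \<in> R" "s \<in> S0" "z = \<rho> r (\<rho> a s)" unfolding R'_def by auto
        then show "z \<in> \<rho> a ` cubes Y 0" using LZ[of r "\<rho> a s"] R(1) S0(2) by blast
      qed
      fix z assume "z \<in> \<rho> a ` cubes Y 0"
      then obtain y where y: "y \<in> cubes Y 0" "z = \<rho> a y" by blast
      obtain k s where ks: "k \<in> K" "s \<in> S0" "y = \<rho> k s" using S0(3)[OF y(1)] by blast
      have s: "s \<in> cubes X 0" using ks(2) S0(2) Y_sub(2) by blast
      define l where "l = a \<otimes> k \<otimes> inv a"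
      have l: "l \<in> L" unfolding l_def L_def using ks(1) by blast
      have "l \<otimes> a = a \<otimes> k" using a Kc[OF ks(1)] by (simp add: l_def m_assoc)
      moreover have lG: "l \<in> carrier G" using L l by blast
      ultimately have z: "z = \<rho> l (\<rho> a s)"
        using act_mult[OF _ a s, of l] act_mult[OF a Kc[OF ks(1)] s] y(2) ks(3) by simp
      obtain r where r: "r \<in> R" "l \<otimes> inv r \<in> H0" using R(3) l by blast
      have rG: "r \<in> carrier G" using r(1) R(1) L by blast
      have "l \<otimes> inv r \<in> conj_sub V0 x0 K a" unfolding cs using LL[OF l] r R(1) by blast
      moreover have "z = \<rho> (l \<otimes> inv r) (\<rho> r (\<rho> a s))"
      proof -
        have "(l \<otimes> inv r) \<otimes> r = l" using lG rG by (simp add: m_assoc)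
        then show ?thesis using act_mult[OF H0(2)[OF r(2)] rG act_cube[OF a s]] z by simp
      qed
      moreover have "\<rho> r (\<rho> a s) \<in> R'" unfolding R'_def using r(1) ks(2) by (intro image_eqI[where x = "(r, s)"]) auto
      ultimately show "\<exists>r\<in>R'. \<exists>k\<in>conj_sub V0 x0 K a. z = \<rho> k r" by blast
    qed
  qed
  obtain R where R: "R \<subseteq> carrier G" "finite R" "\<forall>g\<in>carrier G. \<exists>r\<in>R. g \<otimes> inv r \<in> H0"
    using fin_index_H0[OF H] unfolding fin_index_def by blast
  obtain Ms where Ms: "\<And>a. a \<in> carrier G \<Longrightarrow> fin_normal (Ms a) \<and> A.good (Ms a) (\<rho> a ` cubes Y 0) (steps (\<rho> a ` cubes Y 1)) (conj_sub V0 x0 K a)"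
    using one by metis
  define M where "M = (\<Inter>r\<in>R. Ms r)"
  have "fin_normal M" unfolding M_def by (rule fin_normal_INT[OF R(2)]) (use Ms R(1) in blast)
  moreover have "A.good M (\<rho> a ` cubes Y 0) (steps (\<rho> a ` cubes Y 1)) (conj_sub V0 x0 K a)" if a: "a \<in> carrier G" for a
  proof -
    obtain r where r: "r \<in> R" "a \<otimes> inv r \<in> H0" using R(3) a by blast
    define h where "h = a \<otimes> inv r"
    have h: "h \<in> H0" "r \<in> carrier G" "a = h \<otimes> r" using r R(1) a by (auto simp: h_def m_assoc)
    have ar: "\<rho> a c = \<rho> h (\<rho> r c)" if "c \<in> cubes X n" for c n
      using act_mult[OF H0(2)[OF h(1)] h(2) that] h(3) by simp
    have im: "\<rho> a ` cubes Y n = \<rho> h ` \<rho> r ` cubes Y n" for n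
      unfolding image_image by (rule image_cong) (use ar Y_sub(2) in auto)
    note pr = piece_translate[OF h(2)]
    show ?thesis
      unfolding im[of 0]
    proof (rule A.good_translate[OF pr _ h(1)])
      show "A.good M (\<rho> r ` cubes Y 0) (steps (\<rho> r ` cubes Y 1)) (conj_sub V0 x0 K r)"
        by (rule A.good_mono) (use Ms[OF h(2)] r(1) in \<open>auto simp: M_def\<close>)
      show "letter_graph (steps (\<rho> a ` cubes Y 1))" by (rule letter_graph_steps[OF square_closed_convex[OF Y a]])
      show "h \<otimes> k \<otimes> inv h \<in> conj_sub V0 x0 K a" if k: "k \<in> conj_sub V0 x0 K r" for k
      proof -
        obtain k' where k': "k' \<in> K" "k = r \<otimes> k' \<otimes> inv r" "k \<in> H0" using k unfolding conj_sub_def by blast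
        have "h \<otimes> k \<otimes> inv h = a \<otimes> k' \<otimes> inv a"
          using k' h H0(2)[OF h(1)] Kc by (simp add: inv_mult_group m_assoc)
        moreover have "h \<otimes> k \<otimes> inv h \<in> H0" using A.H_simps(2,3) h(1) k'(3) by blast
        ultimately show ?thesis unfolding conj_sub_def using k'(1) by blast
      qed
      fix x c y assume x: "x \<in> \<rho> r ` cubes Y 0"
      have xX: "x \<in> cubes X 0" using x act_cube[OF h(2)] Y_sub(2) by blast
      show "steps (\<rho> a ` cubes Y 1) (\<rho> h x) c y \<longleftrightarrow> (\<exists>y'. y = \<rho> h y' \<and> steps (\<rho> r ` cubes Y 1) x c y')"
      proof
        assume "steps (\<rho> a ` cubes Y 1) (\<rho> h x) c y"
        then obtain e where e: "e \<in> \<rho> r ` cubes Y 1" "src X (\<rho> h e) = \<rho> h x" "tgt X (\<rho> h e) = y" "letter (\<rho> h e) 0 = c"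
          unfolding im[of 1] steps_def by blast
        have l: "e \<in> labelled_by V0" using e(1) Y_lab[OF h(2)] by blast
        note eX = labelled(1)[OF l]
        note ae = act_edge[OF H0(2)[OF h(1)] eX]
        have "src X e = x"
          using act_inv(1)[OF H0(2)[OF h(1)] edge_ends(1)[OF eX]] act_inv(1)[OF H0(2)[OF h(1)] xX] e(2) ae(2) by metis
        then show "\<exists>y'. y = \<rho> h y' \<and> steps (\<rho> r ` cubes Y 1) x c y'"
          using e ae(3) letter_act[OF h(1) eX labelled(2)[OF l]] unfolding steps_def by auto
      next
        assume "\<exists>y'. y = \<rho> h y' \<and> steps (\<rho> r ` cubes Y 1) x c y'"
        then show "steps (\<rho> a ` cubes Y 1) (\<rho> h x) c y"
          unfolding im[of 1] using steps_act[OF h(1) Y_lab[OF h(2)]] by blast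
      qed
    qed
  qed
  ultimately show ?thesis by blast
qed

end

subsection \<open>Edge paths as chains\<close>

lemma chain_path:
  assumes D: "D \<subseteq> cubes X 1" "\<rho> g ` D \<subseteq> labelled_by V0" and g: "g \<in> carrier G"
    and M: "\<And>c v v'. c \<in> (letters V0) \<Longrightarrow> steps (labelled_by V0) v c v' \<Longrightarrow> A.good M {v, v'} (A.edge_graph v c v') {\<one>}"
  shows "(x, y) \<in> ends D ^^ l \<Longrightarrow> A.chain (letters V0) M v r A (\<rho> g x) \<Longrightarrow> A.chain (letters V0) M v (r + l) A (\<rho> g y)"
    "(x, y) \<in> ends D ^^ l \<Longrightarrow> A.chain (letters V0) M v r A (\<rho> g y) \<Longrightarrow> A.chain (letters V0) M v (r + l) A (\<rho> g x)"
proof -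
  have edge: "\<exists>c\<in>(letters V0). steps (labelled_by V0) (\<rho> g y) c (\<rho> g z)" if yz: "(y, z) \<in> ends D" for y z
  proof -
    obtain e where e: "e \<in> D" "y = src X e" "z = tgt X e" using yz unfolding ends_def by blast
    then have "\<rho> g e \<in> labelled_by V0" "e \<in> cubes X 1" using D by blast+
    then show ?thesis using letter_letters act_edge(2,3)[OF g] e unfolding steps_def by metis
  qed
  show "(x, y) \<in> ends D ^^ l \<Longrightarrow> A.chain (letters V0) M v r A (\<rho> g x) \<Longrightarrow> A.chain (letters V0) M v (r + l) A (\<rho> g y)"
  proof (induction l arbitrary: y)
    case (Suc l)
    then obtain z where z: "(x, z) \<in> ends D ^^ l" "(z, y) \<in> ends D" by auto
    obtain c where c: "c \<in> (letters V0)" "steps (labelled_by V0) (\<rho> g z) c (\<rho> g y)" using edge[OF z(2)] by blast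
    have "A.chain (letters V0) M v (Suc (r + l)) A (\<rho> g y)"
      by (rule A.chain_edge[OF Suc.IH[OF z(1) Suc.prems(2)] _ c(1)]) (use c(2) M[OF c(1)] in blast)+
    then show ?case by simp
  qed simp
  show "(x, y) \<in> ends D ^^ l \<Longrightarrow> A.chain (letters V0) M v r A (\<rho> g y) \<Longrightarrow> A.chain (letters V0) M v (r + l) A (\<rho> g x)"
  proof (induction l arbitrary: x)
    case (Suc l)
    then obtain z where z: "(x, z) \<in> ends D" "(z, y) \<in> ends D ^^ l" using relpow_Suc_D2 by metis
    obtain c where c: "c \<in> (letters V0)" "steps (labelled_by V0) (\<rho> g x) c (\<rho> g z)" using edge[OF z(1)] by blast
    have "A.chain (letters V0) M v (Suc (r + l)) A (\<rho> g x)"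
      by (rule A.chain_edge[OF Suc.IH[OF z(2) Suc.prems(2)] _ c(1)]) (use c(2) M[OF c(1)] in blast)+
    then show ?case by simp
  qed simp
qed

end

end

section \<open>Products of convex-cocompact subgroups\<close>

context special_action
begin

lemma relpow_subset: "(x, y) \<in> (A :: ('x \<times> 'x) set) ^^ l \<Longrightarrow> A \<subseteq> B \<Longrightarrow> (x, y) \<in> B ^^ l"
  by (induction l arbitrary: y) auto

lemma ex_path:
  assumes "x \<in> cubes X 0" "y \<in> cubes X 0"
  shows "\<exists>D l. finite D \<and> D \<subseteq> cubes X 1 \<and> (x, y) \<in> ends D ^^ l"
  using edge_connected[OF assms]
proof (induction rule: rtrancl_induct)
  case base
  show ?case by (intro exI[of _ "{}"] exI[of _ 0]) simp
next
  case (step y z)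
  then obtain D l where D: "finite D" "D \<subseteq> cubes X 1" "(x, y) \<in> ends D ^^ l" by blast
  obtain e where e: "e \<in> cubes X 1" "y = src X e" "z = tgt X e" using step.hyps(2) unfolding edge_rel_def by blast
  have sub: "ends D \<subseteq> ends (insert e D)" and yz: "(y, z) \<in> ends (insert e D)" using e by (auto simp: ends_def)
  have "(x, z) \<in> ends (insert e D) ^^ Suc l" using relpow_subset[OF D(3) sub] yz by auto
  then show ?case using D(1,2) e(1) by (intro exI[of _ "insert e D"] exI[of _ "Suc l"]) simp
qed

text \<open>Elements of \<open>H\<close> preserve labels, and \<open>H\<close> has finite index.\<close>

lemma finite_labels:
  assumes H: "fin_index H" and D: "finite D" "D \<subseteq> cubes X 1"
  shows "\<exists>V0. finite V0 \<and> (\<forall>a\<in>carrier G. \<rho> a ` D \<subseteq> labelled_by V0)"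
proof -
  obtain R where R: "R \<subseteq> carrier G" "finite R" "\<forall>g\<in>carrier G. \<exists>r\<in>R. g \<otimes> inv r \<in> H"
    using H unfolding fin_index_def by blast
  \<comment> \<open>representatives of the cosets of \<open>H\<close> account for all labels\<close>
  define V0 where "V0 = (\<lambda>(r, e). fst (lab (\<rho> r e) 0)) ` (R \<times> D)"
  have "\<rho> a e \<in> labelled_by V0" if a: "a \<in> carrier G" and e: "e \<in> D" for a e
  proof -
    obtain r where r: "r \<in> R" "a \<otimes> inv r \<in> H" using R(3) a by blast
    have eX: "e \<in> cubes X 1" and rG: "r \<in> carrier G" using e D(2) r(1) R(1) by auto
    have "(a \<otimes> inv r) \<otimes> r = a" using a rG by (simp add: m_assoc)
    then have "\<rho> a e = \<rho> (a \<otimes> inv r) (\<rho> r e)" using act_mult[OF H_carrier(1)[OF r(2)] rG eX] by simp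
    then have "lab (\<rho> a e) 0 = lab (\<rho> r e) 0" using lab_act[OF r(2) act_cube[OF rG eX]] by simp
    moreover have "fst (lab (\<rho> r e) 0) \<in> V0" unfolding V0_def using r(1) e by (intro image_eqI[where x = "(r, e)"]) auto
    ultimately show ?thesis using act_cube[OF a eX] by (simp add: labelled_by_def)
  qed
  moreover have "finite V0" unfolding V0_def using R(2) D(1) by blast
  ultimately show ?thesis by blast
qed

lemma convex_cocompactD:
  assumes "convex_cocompact G X \<rho> K"
  shows "subgroup K G" "\<exists>Y :: 'a cube_complex. convex_subcomplex Y X \<and> (\<exists>y. y \<in> cubes Y 0) \<and>
    (\<forall>k\<in>K. \<forall>n. \<rho> k ` cubes Y n = cubes Y n) \<and> cocompact_action (G\<lparr>carrier := K\<rparr>) Y \<rho>"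
proof -
  show "subgroup K G" using assms unfolding convex_cocompact_def by blast
  obtain Y :: "'a cube_complex" and n where Y: "convex_subcomplex Y X" "cubes Y n \<noteq> {}"
    "\<forall>k\<in>K. \<forall>n. \<rho> k ` cubes Y n = cubes Y n" "cocompact_action (G\<lparr>carrier := K\<rparr>) Y \<rho>"
    using assms unfolding convex_cocompact_def by blast
  have "cube_complex Y" using Y(1) unfolding convex_subcomplex_def subcomplex_def by blast
  moreover obtain c where "c \<in> cubes Y n" using Y(2) by blast
  ultimately have "\<exists>y. y \<in> cubes Y 0" using cube_complex.corner_vertex[of Y c n] by blast
  then show "\<exists>Y :: 'a cube_complex. convex_subcomplex Y X \<and> (\<exists>y. y \<in> cubes Y 0) \<and>
    (\<forall>k\<in>K. \<forall>n. \<rho> k ` cubes Y n = cubes Y n) \<and> cocompact_action (G\<lparr>carrier := K\<rparr>) Y \<rho>"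
    using Y by blast
qed

text \<open>
  By cocompactness, finitely many edges of \<open>Y\<close> determine the labels on all translates of \<open>Y\<close>.
\<close>

lemma convex_labels:
  assumes H: "fin_index H" and K: "subgroup K G" and Y: "convex_subcomplex (Y :: 'a cube_complex) X"
    and KY: "\<And>k n. k \<in> K \<Longrightarrow> \<rho> k ` cubes Y n = cubes Y n" and co: "cocompact_action (G\<lparr>carrier := K\<rparr>) Y \<rho>"
  shows "\<exists>D. finite D \<and> D \<subseteq> cubes X 1 \<and>
    (\<forall>V0. (\<forall>a\<in>carrier G. \<rho> a ` D \<subseteq> labelled_by V0) \<longrightarrow> (\<forall>a\<in>carrier G. \<rho> a ` cubes Y 1 \<subseteq> labelled_by V0))"
proof -
  note Kc = subgroup_simps(1)[OF K]
  have sub: "cube_complex Y" "\<And>n. cubes Y n \<subseteq> cubes X n"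
    "\<And>m n c f. c \<in> cubes Y n \<Longrightarrow> f \<in> faces m n \<Longrightarrow> face Y c f = face X c f"
    using Y unfolding convex_subcomplex_def subcomplex_def by blast+
  have comb: "combinatorial_map (\<rho> k) Y Y" if k: "k \<in> K" for k
    unfolding combinatorial_map_def
  proof (intro conjI allI ballI)
    fix n c assume c: "c \<in> cubes Y n"
    show k': "\<rho> k c \<in> cubes Y n" using KY[OF k] c by blast
    fix m f assume f: "f \<in> faces m n"
    show "\<rho> k (face Y c f) = face Y (\<rho> k c) f"
      using sub(3)[OF c f] sub(3)[OF k' f] act_face[OF Kc[OF k] subsetD[OF sub(2) c] f] by simp
  qed
  obtain D where D: "finite D" "D \<subseteq> cubes Y 1" "\<And>c. c \<in> cubes Y 1 \<Longrightarrow> \<exists>k\<in>K. \<exists>s\<in>D. c = \<rho> k s"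
    using cocompact_finite_cells[OF sub(1), of "G\<lparr>carrier := K\<rparr>" \<rho> 1] KY comb co by auto
  have "\<rho> a e \<in> labelled_by V0"
    if V0: "\<forall>a\<in>carrier G. \<rho> a ` D \<subseteq> labelled_by V0" and a: "a \<in> carrier G" and e: "e \<in> cubes Y 1" for V0 a e
  proof -
    obtain k s where ks: "k \<in> K" "s \<in> D" "e = \<rho> k s" using D(3)[OF e] by blast
    have "\<rho> a e = \<rho> (a \<otimes> k) s" using act_mult[OF a Kc[OF ks(1)] subsetD[OF sub(2) subsetD[OF D(2) ks(2)]]] ks(3) by simp
    then show ?thesis using V0 a Kc[OF ks(1)] ks(2) by blast
  qed
  then show ?thesis using D(1,2) sub(2) by (intro exI[of _ D]) blast
qed

text \<open>
  With \<open>p i = k 0 \<otimes> \<dots> \<otimes> k (i - 1)\<close>, the chain goes from \<open>p i x0\<close> along a path to \<open>p i (y i)\<close>,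
  through the translate \<open>p i (Y i)\<close> to \<open>p (i + 1) (y i)\<close>, and back to \<open>p (i + 1) x0\<close>. The last
  point \<open>p n x0\<close> is \<open>\<eta> g x0\<close> for the conjugate \<open>\<eta> = g \<otimes> inv \<nu> \<otimes> inv g\<close>, and a path from \<open>x0\<close> to
  \<open>g x0\<close>, moved by \<open>\<eta>\<close> and reversed, leads to \<open>\<eta> x0\<close>. The number of pieces depends only on \<open>g\<close> and
  the paths. A product of elements of the stabilizers of the pieces, which are conjugates of the
  \<open>K i\<close> by the \<open>p i\<close>, times \<open>p n\<close> is again a product of elements of the \<open>K i\<close>; if it is inverse to
  \<open>\<eta>\<close>, then this is \<open>\<eta>\<close> inverse times \<open>p n\<close>, which is \<open>g\<close>.
\<close>

theorem product_closed:
  fixes K :: "nat \<Rightarrow> 'g set"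
  assumes H: "fin_index H" and n: "n \<ge> 1" and cc: "\<And>i. i < n \<Longrightarrow> convex_cocompact G X \<rho> (K i)"
    and g: "g \<in> carrier G"
  shows "\<exists>N. fin_index N \<and> (\<forall>k. (\<forall>i<n. k i \<in> K i) \<longrightarrow> (\<forall>\<nu>\<in>N. g = pprod k n \<otimes> \<nu> \<longrightarrow>
    (\<exists>k'. (\<forall>i<n. k' i \<in> K i) \<and> g = pprod k' n)))"
proof -
  note K = convex_cocompactD(1)[OF cc]
  have "\<forall>i. \<exists>Y :: 'a cube_complex. i < n \<longrightarrow> convex_subcomplex Y X \<and> (\<exists>y. y \<in> cubes Y 0) \<and>
    (\<forall>k\<in>K i. \<forall>n. \<rho> k ` cubes Y n = cubes Y n) \<and> cocompact_action (G\<lparr>carrier := K i\<rparr>) Y \<rho>"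
    using convex_cocompactD(2)[OF cc] by blast
  then obtain Y :: "nat \<Rightarrow> 'a cube_complex" where Y': "\<forall>i. i < n \<longrightarrow> convex_subcomplex (Y i) X \<and> (\<exists>y. y \<in> cubes (Y i) 0) \<and>
    (\<forall>k\<in>K i. \<forall>n. \<rho> k ` cubes (Y i) n = cubes (Y i) n) \<and> cocompact_action (G\<lparr>carrier := K i\<rparr>) (Y i) \<rho>"
    by (rule choice[THEN exE])
  have Y: "convex_subcomplex (Y i) X" "\<And>k n. k \<in> K i \<Longrightarrow> \<rho> k ` cubes (Y i) n = cubes (Y i) n"
    "cocompact_action (G\<lparr>carrier := K i\<rparr>) (Y i) \<rho>" if "i < n" for i using Y' that by blast+
  have "\<forall>i. \<exists>y. i < n \<longrightarrow> y \<in> cubes (Y i) 0" using Y' by blast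
  then obtain y where y: "\<forall>i. i < n \<longrightarrow> y i \<in> cubes (Y i) 0" by (rule choice[THEN exE])
  have yX: "y i \<in> cubes X 0" if "i < n" for i
    using Y(1)[OF that] y that unfolding convex_subcomplex_def subcomplex_def by blast
  define x0 where "x0 = y 0"
  have x0: "x0 \<in> cubes X 0" unfolding x0_def using yX[of 0] n by simp
  have "\<forall>i. \<exists>q. i < n \<longrightarrow> finite (fst q) \<and> fst q \<subseteq> cubes X 1 \<and> (x0, y i) \<in> ends (fst q) ^^ snd q"
  proof (intro allI)
    fix i
    show "\<exists>q. i < n \<longrightarrow> finite (fst q) \<and> fst q \<subseteq> cubes X 1 \<and> (x0, y i) \<in> ends (fst q) ^^ snd q"
    proof (cases "i < n")
      case True
      then obtain D l where "finite D \<and> D \<subseteq> cubes X 1 \<and> (x0, y i) \<in> ends D ^^ l" using ex_path[OF x0 yX] by blast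
      then show ?thesis by (intro exI[of _ "(D, l)"]) simp
    qed simp
  qed
  then obtain q where q: "\<forall>i. i < n \<longrightarrow> finite (fst (q i)) \<and> fst (q i) \<subseteq> cubes X 1 \<and> (x0, y i) \<in> ends (fst (q i)) ^^ snd (q i)"
    by (rule choice[THEN exE])
  define P l where "P i = fst (q i)" and "l i = snd (q i)" for i
  have P: "finite (P i)" "P i \<subseteq> cubes X 1" "(x0, y i) \<in> ends (P i) ^^ l i" if "i < n" for i
    using q that by (simp_all add: P_def l_def)
  obtain P' l' where P': "finite P'" "P' \<subseteq> cubes X 1" "(x0, \<rho> g x0) \<in> ends P' ^^ l'"
    using ex_path[OF x0 act_cube[OF g x0]] by blast
  have "\<forall>i. \<exists>D. i < n \<longrightarrow> finite D \<and> D \<subseteq> cubes X 1 \<and>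
    (\<forall>V0. (\<forall>a\<in>carrier G. \<rho> a ` D \<subseteq> labelled_by V0) \<longrightarrow> (\<forall>a\<in>carrier G. \<rho> a ` cubes (Y i) 1 \<subseteq> labelled_by V0))"
  proof (intro allI)
    fix i
    show "\<exists>D. i < n \<longrightarrow> finite D \<and> D \<subseteq> cubes X 1 \<and>
    (\<forall>V0. (\<forall>a\<in>carrier G. \<rho> a ` D \<subseteq> labelled_by V0) \<longrightarrow> (\<forall>a\<in>carrier G. \<rho> a ` cubes (Y i) 1 \<subseteq> labelled_by V0))"
    proof (cases "i < n")
      case True
      show ?thesis using convex_labels[OF H K[OF True] Y(1)[OF True] Y(2)[OF True] Y(3)[OF True]] by simp
    qed simp
  qed
  then obtain D where D': "\<forall>i. i < n \<longrightarrow> finite (D i) \<and> D i \<subseteq> cubes X 1 \<and>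
    (\<forall>V0. (\<forall>a\<in>carrier G. \<rho> a ` D i \<subseteq> labelled_by V0) \<longrightarrow> (\<forall>a\<in>carrier G. \<rho> a ` cubes (Y i) 1 \<subseteq> labelled_by V0))"
    by (rule choice[THEN exE])
  \<comment> \<open>all edges whose translates occur in the chains, up to the action of the \<open>K i\<close>\<close>
  define DD where "DD = P' \<union> (\<Union>i<n. P i \<union> D i)"
  have DD: "finite DD" "DD \<subseteq> cubes X 1" unfolding DD_def using P P' D' by auto
  obtain V0 where "finite V0 \<and> (\<forall>a\<in>carrier G. \<rho> a ` DD \<subseteq> labelled_by V0)"
    using finite_labels[OF H DD] by (rule exE)
  then have V0: "finite V0" "\<And>a. a \<in> carrier G \<Longrightarrow> \<rho> a ` DD \<subseteq> labelled_by V0" by (elim conjE, simp)+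
  have labP: "\<rho> a ` P i \<subseteq> labelled_by V0" "\<rho> a ` D i \<subseteq> labelled_by V0" if "i < n" "a \<in> carrier G" for a i
    using V0(2)[OF that(2)] that(1) unfolding DD_def by blast+
  have labP': "\<rho> a ` P' \<subseteq> labelled_by V0" if "a \<in> carrier G" for a
    using V0(2)[OF that] unfolding DD_def by blast
  have labY: "\<rho> a ` cubes (Y i) 1 \<subseteq> labelled_by V0" if "i < n" "a \<in> carrier G" for a i
    using D' labP(2) that by blast
  interpret A: racg_action G "even_sub V0 x0" "cubes X 0" \<rho> "steps (labelled_by V0)" "wt V0" "shift_wt V0 x0"
    by (rule racg_action[OF V0(1) x0])
  let ?C = "letters V0"
  have C: "finite ?C" by (rule finite_letters[OF V0(1) x0])
  have "\<forall>i. \<exists>M. i < n \<longrightarrow> fin_normal M \<and> (\<forall>a\<in>carrier G. A.good M (\<rho> a ` cubes (Y i) 0) (steps (\<rho> a ` cubes (Y i) 1)) (conj_sub V0 x0 (K i) a))"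
  proof (intro allI)
    fix i
    show "\<exists>M. i < n \<longrightarrow> fin_normal M \<and> (\<forall>a\<in>carrier G. A.good M (\<rho> a ` cubes (Y i) 0) (steps (\<rho> a ` cubes (Y i) 1)) (conj_sub V0 x0 (K i) a))"
    proof (cases "i < n")
      case True
      have "\<exists>M. fin_normal M \<and> (\<forall>a\<in>carrier G. A.good M (\<rho> a ` cubes (Y i) 0) (steps (\<rho> a ` cubes (Y i) 1)) (conj_sub V0 x0 (K i) a))"
      proof (rule ex_good_translates[OF V0(1) x0 Y(1)[OF True] K[OF True] _ _ H Y(3)[OF True]])
        show "\<rho> k ` cubes (Y i) m = cubes (Y i) m" if "k \<in> K i" for k m by (rule Y(2)[OF True that])
        show "\<rho> a ` cubes (Y i) 1 \<subseteq> labelled_by V0" if "a \<in> carrier G" for a by (rule labY[OF True that])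
      qed
      then show ?thesis by (elim exE) (rule exI, rule impI)
    qed simp
  qed
  then obtain Ms where Ms: "\<forall>i. i < n \<longrightarrow> fin_normal (Ms i) \<and> (\<forall>a\<in>carrier G. A.good (Ms i) (\<rho> a ` cubes (Y i) 0) (steps (\<rho> a ` cubes (Y i) 1)) (conj_sub V0 x0 (K i) a))"
    by (rule choice[THEN exE])
  obtain ME where ME: "fin_normal ME" "\<forall>v v'. \<forall>c\<in>?C. steps (labelled_by V0) v c v' \<longrightarrow> A.good ME {v, v'} (A.edge_graph v c v') {\<one>}"
    using A.ex_good_edges[OF C] by blast
  define M where "M = ME \<inter> (\<Inter>i\<in>{..<n}. Ms i)"
  have M: "fin_normal M" unfolding M_def using Ms by (intro fin_normal_Int ME(1) fin_normal_INT) auto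
  have goodY: "A.good M (\<rho> a ` cubes (Y i) 0) (steps (\<rho> a ` cubes (Y i) 1)) (conj_sub V0 x0 (K i) a)"
    if "i < n" "a \<in> carrier G" for i a
    by (rule A.good_mono[of "Ms i"]) (use Ms that in \<open>auto simp: M_def\<close>)
  have goodE: "A.good M {v, v'} (A.edge_graph v c v') {\<one>}" if "c \<in> ?C" "steps (labelled_by V0) v c v'" for v c v'
    by (rule A.good_mono[of ME]) (use ME(2) that in \<open>auto simp: M_def\<close>)
  define r where "r i = (\<Sum>j<i. l j + 1 + l j)" for i
  obtain N where N: "fin_normal N" "\<forall>v A \<eta>. v \<in> cubes X 0 \<longrightarrow> \<eta> \<in> even_sub V0 x0 \<longrightarrow> shift_wt V0 x0 \<eta> \<in> N \<longrightarrow>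
      A.chain ?C M v (r n + l') A (\<rho> \<eta> v) \<longrightarrow> (\<exists>s\<in>A. s \<otimes> \<eta> = \<one>)"
    using A.chain_closes[OF C M] by blast
  define N1 where "N1 = {h \<in> even_sub V0 x0. shift_wt V0 x0 h \<in> N}"
  have "fin_index N1" unfolding N1_def by (rule fin_index_shift[OF V0(1) x0 H N(1)])
  then obtain N2 where N2: "N2 \<subseteq> N1" "N2 \<lhd> G" "fin_index N2" using fin_index_core by blast
  have "\<exists>k'. (\<forall>i<n. k' i \<in> K i) \<and> g = pprod k' n"
    if k: "\<forall>i<n. k i \<in> K i" and \<nu>: "\<nu> \<in> N2" and eq: "g = pprod k n \<otimes> \<nu>" for k \<nu>
  proof -
    have kG: "k i \<in> carrier G" if "i < n" for i using subgroup_simps(1)[OF K[OF that]] k that by blast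
    have pG: "pprod k i \<in> carrier G" if "i \<le> n" for i using that by (induction i) (use kG in auto)
    have "\<exists>A. A.chain ?C M x0 (r i) A (\<rho> (pprod k i) x0) \<and>
        (\<forall>s\<in>A. \<exists>k'. (\<forall>j<i. k' j \<in> K j) \<and> s \<otimes> pprod k i = pprod k' i)" if "i \<le> n" for i
      using that
    proof (induction i)
      case 0
      have "A.chain ?C M x0 (r 0) {\<one>} (\<rho> (pprod k 0) x0)"
        using A.chain_start act_one[OF x0] by (simp add: r_def)
      then show ?case by (intro exI[of _ "{\<one>}"]) simp
    next
      case (Suc i)
      then have i: "i < n" "i \<le> n" by auto
      obtain A where A: "A.chain ?C M x0 (r i) A (\<rho> (pprod k i) x0)"
        "\<And>s. s \<in> A \<Longrightarrow> \<exists>k'. (\<forall>j<i. k' j \<in> K j) \<and> s \<otimes> pprod k i = pprod k' i"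
        using Suc.IH[OF i(2)] by blast
      let ?p = "pprod k i" and ?p' = "pprod k (Suc i)" and ?K = "conj_sub V0 x0 (K i) (pprod k i)"
      note p = pG[OF i(2)] and p' = pG[OF Suc.prems] and ki = kG[OF i(1)] and Pi = P[OF i(1)]
      have 1: "A.chain ?C M x0 (r i + l i) A (\<rho> ?p (y i))"
        by (rule chain_path(1)[OF V0(1) x0 Pi(2) labP(1)[OF i(1) p] p goodE Pi(3) A(1)])
      have yp: "\<rho> ?p' (y i) = \<rho> ?p (\<rho> (k i) (y i))" using act_mult[OF p ki yX[OF i(1)]] by simp
      have "\<rho> (k i) (y i) \<in> cubes (Y i) 0" using Y(2)[OF i(1)] k i(1) y by blast
      then have yZ: "\<rho> ?p (y i) \<in> \<rho> ?p ` cubes (Y i) 0" "\<rho> ?p' (y i) \<in> \<rho> ?p ` cubes (Y i) 0"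
        using y i(1) unfolding yp by blast+
      have 2: "A.chain ?C M x0 (Suc (r i + l i)) (A <#> ?K) (\<rho> ?p' (y i))"
        by (rule A.chain_step[OF 1 piece_translate[OF V0(1) x0 Y(1)[OF i(1)] K[OF i(1)] Y(2)[OF i(1)] labY[OF i(1)] p] goodY[OF i(1) p] yZ])
      have 3: "A.chain ?C M x0 (Suc (r i + l i) + l i) (A <#> ?K) (\<rho> ?p' x0)"
        by (rule chain_path(2)[OF V0(1) x0 Pi(2) labP(1)[OF i(1) p'] p' goodE Pi(3) 2])
      have "Suc (r i + l i) + l i = r (Suc i)" by (simp add: r_def)
      then have ch: "A.chain ?C M x0 (r (Suc i)) (A <#> ?K) (\<rho> ?p' x0)" using 3 by simp
      have "\<exists>k'. (\<forall>j<Suc i. k' j \<in> K j) \<and> s \<otimes> ?p' = pprod k' (Suc i)" if s: "s \<in> A <#> ?K" for s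
      proof -
        obtain s' \<sigma> where s': "s' \<in> A" "\<sigma> \<in> ?K" "s = s' \<otimes> \<sigma>" using s unfolding set_mult_def by blast
        obtain \<kappa> where \<kappa>: "\<kappa> \<in> K i" "\<sigma> = ?p \<otimes> \<kappa> \<otimes> inv ?p" using s'(2) unfolding conj_sub_def by blast
        obtain k' where k': "\<forall>j<i. k' j \<in> K j" "s' \<otimes> ?p = pprod k' i" using A(2)[OF s'(1)] by blast
        have G: "s' \<in> carrier G" "\<kappa> \<in> carrier G"
          using A.chain_carrier[OF A(1)] s'(1) subgroup_simps(1)[OF K[OF i(1)] \<kappa>(1)] by auto
        define k'' where "k'' = k'(i := \<kappa> \<otimes> k i)"
        have "pprod k'' i = pprod k' i" by (rule pprod_cong) (simp add: k''_def)
        then have "pprod k'' (Suc i) = (s' \<otimes> ?p) \<otimes> (\<kappa> \<otimes> k i)" using k'(2) by (simp add: k''_def)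
        also have "\<dots> = s \<otimes> ?p'" using G p ki by (simp add: s'(3) \<kappa>(2) m_assoc inv_cancel)
        finally have "s \<otimes> ?p' = pprod k'' (Suc i)" ..
        moreover have "\<kappa> \<otimes> k i \<in> K i" using subgroup_simps(2)[OF K[OF i(1)] \<kappa>(1)] k i(1) by blast
        then have "\<forall>j<Suc i. k'' j \<in> K j" using k'(1) by (auto simp: k''_def less_Suc_eq)
        ultimately show ?thesis by blast
      qed
      then show ?case using ch by blast
    qed
    from this[of n] obtain A where A: "A.chain ?C M x0 (r n) A (\<rho> (pprod k n) x0)"
      "\<And>s. s \<in> A \<Longrightarrow> \<exists>k'. (\<forall>j<n. k' j \<in> K j) \<and> s \<otimes> pprod k n = pprod k' n" by blast
    \<comment> \<open>the error term moved to the front, where it acts on the whole chain\<close>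
    define \<eta> where "\<eta> = g \<otimes> inv \<nu> \<otimes> inv g"
    have N2s: "subgroup N2 G" using N2(3) by (simp add: fin_index_def)
    note p = pG[OF order.refl]
    have \<nu>G: "\<nu> \<in> carrier G" "inv \<nu> \<in> N2" using subgroup_simps(1,3)[OF N2s] \<nu> by blast+
    have "\<eta> \<in> N2" unfolding \<eta>_def using normal_invE(2)[OF N2(2) g \<nu>G(2)] .
    then have \<eta>: "\<eta> \<in> even_sub V0 x0" "shift_wt V0 x0 \<eta> \<in> N" using N2(1) unfolding N1_def by blast+
    have \<eta>G: "\<eta> \<in> carrier G" unfolding \<eta>_def using g \<nu>G(1) by simp
    have pe: "pprod k n = \<eta> \<otimes> g"
    proof -
      have "\<eta> \<otimes> g = g \<otimes> inv \<nu>" unfolding \<eta>_def using g \<nu>G(1) by (simp add: m_assoc)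
      also have "\<dots> = pprod k n" unfolding eq using p \<nu>G(1) by (simp add: m_assoc)
      finally show ?thesis ..
    qed
    have "A.chain ?C M x0 (r n) A (\<rho> \<eta> (\<rho> g x0))" using A(1) act_mult[OF \<eta>G g x0] pe by simp
    from chain_path(2)[OF V0(1) x0 P'(2) labP'[OF \<eta>G] \<eta>G goodE P'(3) this]
    have "A.chain ?C M x0 (r n + l') A (\<rho> \<eta> x0)" .
    then obtain s where s: "s \<in> A" "s \<otimes> \<eta> = \<one>" using N(2) x0 \<eta> by blast
    have sG: "s \<in> carrier G" using A.chain_carrier[OF A(1)] s(1) by blast
    have "s \<otimes> pprod k n = (s \<otimes> \<eta>) \<otimes> g" unfolding pe using sG \<eta>G g by (simp add: m_assoc)
    also have "\<dots> = g" using s(2) g by simp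
    finally show ?thesis using A(2)[OF s(1)] by auto
  qed
  then show ?thesis using N2(3) by blast
qed

end

theorem theorem1p1:
  fixes G :: "('g, 'm) monoid_scheme"
    and X :: "('a, 'b) cube_complex_scheme"
    and \<rho> :: "'g \<Rightarrow> 'a \<Rightarrow> 'a"
    and n :: nat
    and K :: "nat \<Rightarrow> 'g set"
  assumes "group G"
    and "CAT0_cube_complex X"
    and "cubical_action G X \<rho>"
    and "virtually_special TYPE('v) G X \<rho>"
    and "n \<ge> 1"
    and "\<And>i. i \<in> {1..n} \<Longrightarrow> convex_cocompact G X \<rho> (K i)"
  shows "separable G
    {foldr (\<otimes>\<^bsub>G\<^esub>) (map k [1..<Suc n]) \<one>\<^bsub>G\<^esub> | k. \<forall>i\<in>{1..n}. k i \<in> K i}"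
proof -
  interpret group G by (rule assms(1))
  obtain H where quot: "subgroup H G" "finite (rcosets\<^bsub>G\<^esub> H)" "free_action (G\<lparr>carrier := H\<rparr>) X \<rho>"
    "special TYPE('v) (quotient_complex (G\<lparr>carrier := H\<rparr>) X \<rho>)"
    using assms(4) unfolding virtually_special_def by blast
  obtain V :: "'v set" and E \<phi> where \<phi>: "simplicial_graph V E"
    "local_isometry \<phi> (quotient_complex (G\<lparr>carrier := H\<rparr>) X \<rho>) (salvetti V E)"
    using quot(4) unfolding special_def by blast
  interpret special_action G X \<rho> H V E \<phi>
    by unfold_locales (use assms(2,3) quot(3) \<phi> quot(1) in \<open>auto simp: subgroup_def\<close>)
  let ?S = "{foldr (\<otimes>\<^bsub>G\<^esub>) (map k [1..<Suc n]) \<one>\<^bsub>G\<^esub> | k. \<forall>i\<in>{1..n}. k i \<in> K i}"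
  have KG: "k i \<in> carrier G" if "\<forall>i\<in>{1..n}. k i \<in> K i" "i \<in> {1..n}" for k i
    using assms(6)[OF that(2)] that unfolding convex_cocompact_def by (blast dest: subgroup_simps(1))
  have fold: "pprod (\<lambda>i. k (Suc i)) n \<in> carrier G \<and> foldr (\<otimes>\<^bsub>G\<^esub>) (map k [1..<Suc n]) \<one>\<^bsub>G\<^esub> = pprod (\<lambda>i. k (Suc i)) n"
    if "\<forall>i\<in>{1..n}. k i \<in> K i" for k
    using foldr_pprod[of n k "\<one>\<^bsub>G\<^esub>"] KG[OF that] by simp
  show ?thesis
  proof (rule separableI)
    show "?S \<subseteq> carrier G" using fold by auto
    fix g assume g: "g \<in> carrier G - ?S"
    have cc: "\<And>i. i < n \<Longrightarrow> convex_cocompact G X \<rho> (K (Suc i))" using assms(6) by simp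
    have gG: "g \<in> carrier G" using g by blast
    have "\<exists>N. fin_index N \<and> (\<forall>k. (\<forall>i<n. k i \<in> K (Suc i)) \<longrightarrow> (\<forall>\<nu>\<in>N. g = pprod k n \<otimes>\<^bsub>G\<^esub> \<nu> \<longrightarrow>
      (\<exists>k'. (\<forall>i<n. k' i \<in> K (Suc i)) \<and> g = pprod k' n)))"
      by (rule product_closed[OF fin_index_rcosets[OF quot(1,2)] assms(5) cc gG])
    then obtain N where N: "fin_index N" "\<And>k \<nu>. \<forall>i<n. k i \<in> K (Suc i) \<Longrightarrow> \<nu> \<in> N \<Longrightarrow> g = pprod k n \<otimes>\<^bsub>G\<^esub> \<nu> \<Longrightarrow>
      \<exists>k'. (\<forall>i<n. k' i \<in> K (Suc i)) \<and> g = pprod k' n"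
      by (elim exE conjE) blast
    have "g \<noteq> s \<otimes>\<^bsub>G\<^esub> \<nu>" if \<nu>: "\<nu> \<in> N" and s: "s \<in> ?S" for \<nu> s
    proof
      assume eq: "g = s \<otimes>\<^bsub>G\<^esub> \<nu>"
      obtain k where k: "\<forall>i\<in>{1..n}. k i \<in> K i" "s = foldr (\<otimes>\<^bsub>G\<^esub>) (map k [1..<Suc n]) \<one>\<^bsub>G\<^esub>" using s by blast
      have "\<forall>i<n. k (Suc i) \<in> K (Suc i)" using k(1) by simp
      moreover have "g = pprod (\<lambda>i. k (Suc i)) n \<otimes>\<^bsub>G\<^esub> \<nu>" using fold[OF k(1)] k(2) eq by simp
      ultimately obtain k' where k': "\<forall>i<n. k' i \<in> K (Suc i)" "g = pprod k' n"
        using N(2)[of "\<lambda>i. k (Suc i)" \<nu>] \<nu> by blast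
      define k'' where "k'' i = k' (i - 1)" for i
      have k'': "\<forall>i\<in>{1..n}. k'' i \<in> K i"
      proof
        fix i assume "i \<in> {1..n}"
        then have "i - 1 < n" "Suc (i - 1) = i" by auto
        then show "k'' i \<in> K i" using k'(1) by (metis k''_def)
      qed
      have "(\<lambda>i. k'' (Suc i)) = k'" by (simp add: k''_def)
      then have "g = foldr (\<otimes>\<^bsub>G\<^esub>) (map k'' [1..<Suc n]) \<one>\<^bsub>G\<^esub>" using fold[OF k''] k'(2) by simp
      then show False using g k'' by blast
    qed
    then show "\<exists>N. fin_index N \<and> (\<forall>\<nu>\<in>N. \<forall>s\<in>?S. g \<noteq> s \<otimes>\<^bsub>G\<^esub> \<nu>)" using N(1) by blast
  qed
qed

end
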